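(* Let $\gamma>0$, $\xi\ge0$, and let $\Lambda^{(1)}$ be the multiplier operator associated with $\lambda^{(1)}_{m,n}=\lambda^{(1)}(\max\{m,n\})$, where $\lambda^{(1)}(t)=t^{-\gamma}(\ln t)^{-\xi}$ for $t>1$ and $\lambda^{(1)}(t)=0$ for $0\le t\le1$. Let $1\le p\le\infty$, $2\le q\le\infty$, and suppose $\gamma>(2d-1)/p$ if $1\le p\le2$ and $\gamma>(2d-1)/2$ if $p\ge2$. Then for all $m\in\mathbb{N}$ $$d_m(\Lambda^{(1)}U_p,L^q)\ll m^{-\gamma/(2d-1)+(1/p-1/2)_+}(\ln m)^{-\xi}\begin{cases}q^{1/2},&2\le q<\infty,\\(\ln m)^{1/2},&q=\infty.\end{cases}$$
   Context: $\mathbb{N}=\{0,1,2,\dots\}$; $d\ge2$ is a fixed integer. $(a)_+=a$ if $a>0$ and $(a)_+=0$ if $a\le0$. The notation $a_m\ll b_m$ means that there is a constant $C>0$, independent of $m$, with $a_m\le Cb_m$; here it is understood for $m\ge2$. $\Omega_d$ is the unit sphere of $\mathbb{C}^d$ with surface measure $\sigma_d$ (the Lebesgue surface measure of $S^{2d-1}\subset\mathbb{R}^{2d}$ under $\mathbb{C}^d\cong\mathbb{R}^{2d}$). $L^p=L^p(\Omega_d)$ is the usual space of complex-valued functions, with closed unit ball $U_p$. $\mathcal{H}_{m,n}$ is the space of restrictions to $\Omega_d$ of polynomials in $z,\bar z$ homogeneous of degree $m$ in $z$ and degree $n$ in $\bar z$ and in the kernel of $4\sum_j\partial^2/\partial z_j\partial\bar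 z_j$. Let $Z_w^{(m,n)}$ be the reproducing kernel of $\mathcal{H}_{m,n}$ at $w\in\Omega_d$, and $(\varphi*\widetilde Z^{(m,n)})(w)=\int_{\Omega_d}\varphi\,\overline{Z_w^{(m,n)}}\,d\sigma_d$ (the orthogonal projection onto $\mathcal{H}_{m,n}$ on $L^2$). The multiplier operator $\Lambda$ associated with $\{\lambda_{m,n}\}$ sends $\varphi$ to the function $\Lambda\varphi$ with formal expansion $\Lambda\varphi\sim\sum_{m,n}\lambda_{m,n}\varphi*\widetilde Z^{(m,n)}$. Kolmogorov width: $d_n(A,X)=\inf_{X_n}\sup_{x\in A}\inf_{y\in X_n}\|x-y\|_X$, $X_n$ ranging over the subspaces of $X$ of dimension $n$. *)

theory Defs
  imports "HOL-Analysis.Analysis" "HOL-Probability.Essential_Supremum"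
begin

text \<open>Lebesgue surface measure on the unit sphere of a Euclidean space, by the polar-coordinates
  formula: the surface measure of a Borel set E is the dimension times the volume of
  the cone of all t x with x in E and t in (0,1]. Here this cone is the preimage of E in the
  punctured ball under the radial projection. For \<open>complex ^ 'd\<close> the Euclidean structure is
  the one of R^(2d), and \<open>DIM(complex ^ 'd)\<close> is 2d.\<close>

definition surface_measure :: "'a::euclidean_space measure" where
  "surface_measure =
     scale_measure (of_nat DIM('a))
       (distr (restrict_space lborel (cball 0 1 - {0}))
              (restrict_space borel (sphere 0 1))
              (\<lambda>x. x /\<^sub>R norm x))"


text \<open>The L^p norm takes the value \<open>\<infinity>\<close> outside L^p. Elements of L^p are represented by functions
  rather than by classes of functions equal almost everywhere.\<close>

definition Lp_norm :: "ennreal \<Rightarrow> 'a measure \<Rightarrow> ('a \<Rightarrow> complex) \<Rightarrow> ennreal" where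
  "Lp_norm p M f =
     (if p = \<infinity> then esssup M (\<lambda>x. ennreal (norm (f x)))
      else let I = (\<integral>\<^sup>+ x. ennreal (norm (f x) powr enn2real p) \<partial>M)
           in if I = \<infinity> then \<infinity> else ennreal (enn2real I powr (1 / enn2real p)))"

definition Lp_space :: "ennreal \<Rightarrow> 'a measure \<Rightarrow> ('a \<Rightarrow> complex) set" where
  "Lp_space p M = {f \<in> borel_measurable M. Lp_norm p M f < \<infinity>}"

definition Lp_ball :: "ennreal \<Rightarrow> 'a measure \<Rightarrow> ('a \<Rightarrow> complex) set" where
  "Lp_ball p M = {f \<in> Lp_space p M. Lp_norm p M f \<le> 1}"


text \<open>The Kolmogorov width is formed in the complex normed space represented by a set S of functions
  with a seminorm N, functions at distance 0 being identified. A subspace of dimension n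
  is thus the span of n members of S that are linearly independent modulo this identification.\<close>

definition subspaces_of_dim ::
  "('a \<Rightarrow> complex) set \<Rightarrow> (('a \<Rightarrow> complex) \<Rightarrow> ennreal) \<Rightarrow> nat \<Rightarrow> ('a \<Rightarrow> complex) set set" where
  "subspaces_of_dim S N n =
     {V. \<exists>b :: nat \<Rightarrow> 'a \<Rightarrow> complex.
           (\<forall>i<n. b i \<in> S) \<and>
           (\<forall>c :: nat \<Rightarrow> complex. N (\<lambda>x. \<Sum>i<n. c i * b i x) = 0 \<longrightarrow> (\<forall>i<n. c i = 0)) \<and>
           V = range (\<lambda>c :: nat \<Rightarrow> complex. \<lambda>x. \<Sum>i<n. c i * b i x)}"

definition kolmogorov_width ::
  "('a \<Rightarrow> complex) set \<Rightarrow> (('a \<Rightarrow> complex) \<Rightarrow> ennreal) \<Rightarrow> nat \<Rightarrow> ('a \<Rightarrow> complex) set \<Rightarrow> ennreal" where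
  "kolmogorov_width S N n A =
     (INF V \<in> subspaces_of_dim S N n. SUP f \<in> A. INF g \<in> V. N (\<lambda>x. f x - g x))"

abbreviation Lp_width :: "nat \<Rightarrow> ('a \<Rightarrow> complex) set \<Rightarrow> ennreal \<Rightarrow> 'a measure \<Rightarrow> ennreal" where
  "Lp_width n A q M \<equiv> kolmogorov_width (Lp_space q M) (Lp_norm q M) n A"


definition bihomogeneous_poly :: "nat \<Rightarrow> nat \<Rightarrow> (complex ^ 'd \<Rightarrow> complex) \<Rightarrow> bool" where
  "bihomogeneous_poly m n P \<longleftrightarrow>
     (\<exists>c :: ('d \<Rightarrow> nat) \<Rightarrow> ('d \<Rightarrow> nat) \<Rightarrow> complex.
        P = (\<lambda>z. \<Sum>\<alpha> | sum \<alpha> UNIV = m. \<Sum>\<beta> | sum \<beta> UNIV = n.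
                   c \<alpha> \<beta> * (\<Prod>j\<in>UNIV. z $ j ^ \<alpha> j) * (\<Prod>j\<in>UNIV. cnj (z $ j) ^ \<beta> j)))"

text \<open>Wirtinger derivatives with respect to \<open>z\<^sub>j = x\<^sub>j + \<i> y\<^sub>j\<close> and its conjugate.\<close>

definition partial_x :: "'d \<Rightarrow> (complex ^ 'd \<Rightarrow> complex) \<Rightarrow> complex ^ 'd \<Rightarrow> complex" where
  "partial_x j f z = vector_derivative (\<lambda>t::real. f (z + axis j (of_real t))) (at 0)"

definition partial_y :: "'d \<Rightarrow> (complex ^ 'd \<Rightarrow> complex) \<Rightarrow> complex ^ 'd \<Rightarrow> complex" where
  "partial_y j f z = vector_derivative (\<lambda>t::real. f (z + axis j (\<i> * of_real t))) (at 0)"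

definition partial_z :: "'d \<Rightarrow> (complex ^ 'd \<Rightarrow> complex) \<Rightarrow> complex ^ 'd \<Rightarrow> complex" where
  "partial_z j f z = (partial_x j f z - \<i> * partial_y j f z) / 2"

definition partial_cnj :: "'d \<Rightarrow> (complex ^ 'd \<Rightarrow> complex) \<Rightarrow> complex ^ 'd \<Rightarrow> complex" where
  "partial_cnj j f z = (partial_x j f z + \<i> * partial_y j f z) / 2"

definition complex_laplacian :: "(complex ^ 'd \<Rightarrow> complex) \<Rightarrow> complex ^ 'd \<Rightarrow> complex" where
  "complex_laplacian f z = 4 * (\<Sum>j\<in>UNIV. partial_z j (partial_cnj j f) z)"

text \<open>Functions on the sphere are extended by 0, which makes the representation of a restriction
  unique.\<close>

definition harmonic_space :: "nat \<Rightarrow> nat \<Rightarrow> (complex ^ 'd \<Rightarrow> complex) set" where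
  "harmonic_space m n =
     {(\<lambda>z. if z \<in> sphere 0 1 then P z else 0) | P.
        bihomogeneous_poly m n P \<and> (\<forall>z. complex_laplacian P z = 0)}"

definition repr_kernel :: "nat \<Rightarrow> nat \<Rightarrow> complex ^ 'd \<Rightarrow> complex ^ 'd \<Rightarrow> complex" where
  "repr_kernel m n w =
     (THE k. k \<in> harmonic_space m n \<and>
        (\<forall>f \<in> harmonic_space m n. f w = (LINT z|surface_measure. f z * cnj (k z))))"

definition harmonic_proj ::
  "nat \<Rightarrow> nat \<Rightarrow> (complex ^ 'd \<Rightarrow> complex) \<Rightarrow> complex ^ 'd \<Rightarrow> complex" where
  "harmonic_proj m n \<phi> w = (LINT z|surface_measure. \<phi> z * cnj (repr_kernel m n w z))"

text \<open>\<open>\<psi>\<close> has the formal expansion given by the multiplier sequence applied to \<open>\<phi>\<close>: it is an integrable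
  function whose component in each \<open>harmonic_space m n\<close> is the prescribed one. This determines
  \<open>\<psi>\<close> up to equality almost everywhere, so the choice below is one of a representative. If no
  integrable function has the expansion, the value of \<open>multiplier_op\<close> is unspecified.\<close>

definition has_multiplier_expansion ::
  "(nat \<Rightarrow> nat \<Rightarrow> complex) \<Rightarrow> (complex ^ 'd \<Rightarrow> complex) \<Rightarrow> (complex ^ 'd \<Rightarrow> complex) \<Rightarrow> bool" where
  "has_multiplier_expansion l \<phi> \<psi> \<longleftrightarrow>
     \<psi> \<in> Lp_space 1 surface_measure \<and>
     (\<forall>m n. \<forall>w \<in> sphere 0 1. harmonic_proj m n \<psi> w = l m n * harmonic_proj m n \<phi> w)"

definition multiplier_op ::
  "(nat \<Rightarrow> nat \<Rightarrow> complex) \<Rightarrow> (complex ^ 'd \<Rightarrow> complex) \<Rightarrow> complex ^ 'd \<Rightarrow> complex" where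
  "multiplier_op l \<phi> = (SOME \<psi>. has_multiplier_expansion l \<phi> \<psi>)"

definition lambda1 :: "real \<Rightarrow> real \<Rightarrow> real \<Rightarrow> real" where
  "lambda1 \<gamma> \<xi> t = (if t > 1 then t powr (-\<gamma>) * ln t powr (-\<xi>) else 0)"

definition Lambda1 ::
  "real \<Rightarrow> real \<Rightarrow> (complex ^ 'd \<Rightarrow> complex) \<Rightarrow> complex ^ 'd \<Rightarrow> complex" where
  "Lambda1 \<gamma> \<xi> = multiplier_op (\<lambda>m n. of_real (lambda1 \<gamma> \<xi> (real (max m n))))"

end

theory Submission imports Defs "HOL-Probability.Probability"
begin

text \<open>Write \<open>D = 2d - 1\<close> and \<open>r = min p 2\<close>. The image of the unit ball under the multiplier is approximated by functions from a
  subspace with a deterministic and a random part. The spherical harmonics of degree (the larger of the two) below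
  \<open>2\<^sup>J\<close>, with \<open>2\<^bsup>J * D\<^esup>\<close> of order \<open>m\<close>, are reproduced exactly. The blocks of degrees between \<open>2\<^sup>j\<close> and \<open>2\<^bsup>j + 1\<^esup>\<close> for
  \<open>j \<ge> J\<close> are approximated simultaneously by the span of \<open>m div 2\<close> random combinations of harmonics. The blocks beyond a multiple of
  \<open>J\<close> are discarded.

  The random part rests on a general fact (\<open>random_subspace_approximation\<close>): in a normed space with coordinates, the span of
  \<open>k\<close> random sign vectors approximates the Euclidean unit ball to within a constant times \<open>R / k\<close>, where \<open>R\<close> is the average norm of the sum of
  the sign vectors. This is a dual form of the low M*-estimate; it follows from
  symmetrization, the lower Khintchine inequality and the Hahn-Banach theorem. For the norm of \<open>L\<^bsup>2h\<^esup>\<close> the quantity \<open>R\<close> is estimated by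
  the upper Khintchine inequality (\<open>khintchine_even_norm\<close>): if the squares of the functions sum to at most \<open>\<kappa>\<close> at every point, then \<open>R\<close> is of
  order \<open>(h * k * \<kappa>)\<^bsup>1/2\<^esup>\<close>. For finite \<open>q\<close> the exponent \<open>2h\<close> is \<open>q\<close> rounded up, which accounts for the factor \<open>q\<^bsup>1/2\<^esup>\<close>. For
  \<open>q = \<infinity>\<close> one takes \<open>h\<close> of order \<open>ln m\<close>, at which the sup norm of the polynomials in question is comparable with the norm of
  \<open>L\<^bsup>2h\<^esup>\<close>.

  Two facts on the sphere enter. The sum of the squares of an orthonormal basis of polynomials of degree at most \<open>N\<close> is constant
  on the sphere, by unitary invariance, and of order \<open>N\<^sup>D\<close> (\<open>kernel_bound\<close>). Hence the coefficients of degree at most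
  \<open>N\<close> of a function in the unit ball of \<open>L\<^sup>p\<close> have Euclidean norm of order \<open>N\<^bsup>D * (1/r - 1/2)\<^esup>\<close> (\<open>coef_square_sum\<close>). With the
  multiplier this gives the exponent \<open>-\<gamma> / D + 1/r - 1/2\<close>, and \<open>\<gamma> > D / r\<close> makes the sums over the blocks geometric.

  The theory of spherical harmonics is derived from the invariance of surface measure under isometries. Differentiated along
  rotations, it yields integration by parts on the sphere and Green's identity, hence the orthogonality of harmonics of different bidegrees
  and the Fischer decomposition of polynomials into harmonics. With the Stone-Weierstrass theorem it follows that an
  integrable function is determined by its coefficients (\<open>completeness\<close>). So the multiplier operator agrees almost
  everywhere with the sum of a uniformly convergent series of harmonics.\<close>

section \<open>Averages over finite sets\<close>

definition avg :: "'w set \<Rightarrow> ('w \<Rightarrow> real) \<Rightarrow> real" where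
  "avg A f = (\<Sum>x\<in>A. f x) / real (card A)"

lemma avg_const: "finite A \<Longrightarrow> A \<noteq> {} \<Longrightarrow> avg A (\<lambda>_. c) = c"
  by (simp add: avg_def)

lemma avg_add: "avg A (\<lambda>x. f x + g x) = avg A f + avg A g"
  by (simp add: avg_def sum.distrib add_divide_distrib)

lemma avg_diff: "avg A (\<lambda>x. f x - g x) = avg A f - avg A g"
  by (simp add: avg_def sum_subtractf diff_divide_distrib)

lemma avg_cmult: "avg A (\<lambda>x. c * f x) = c * avg A f"
  by (simp add: avg_def sum_distrib_left)

lemma avg_cmult_right: "avg A (\<lambda>x. f x * c) = avg A f * c"
  by (simp add: avg_def sum_distrib_right)

lemma avg_divide: "avg A (\<lambda>x. f x / c) = avg A f / c"
  by (simp add: avg_def sum_divide_distrib[symmetric])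

lemma avg_mono: "(\<And>x. x \<in> A \<Longrightarrow> f x \<le> g x) \<Longrightarrow> avg A f \<le> avg A g"
  by (simp add: avg_def divide_right_mono sum_mono)

lemma avg_cong: "(\<And>x. x \<in> A \<Longrightarrow> f x = g x) \<Longrightarrow> avg A f = avg A g"
  by (simp add: avg_def)

lemma avg_nonneg: "(\<And>x. x \<in> A \<Longrightarrow> 0 \<le> f x) \<Longrightarrow> 0 \<le> avg A f"
  by (simp add: avg_def sum_nonneg)

lemma avg_swap: "avg A (\<lambda>x. avg B (\<lambda>y. f x y)) = avg B (\<lambda>y. avg A (\<lambda>x. f x y))"
  unfolding avg_def sum_divide_distrib[symmetric] by (subst sum.swap) (simp add: mult.commute)

lemma avg_bij: "bij_betw h A A \<Longrightarrow> avg A (\<lambda>x. f (h x)) = avg A f"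
  by (simp add: avg_def sum.reindex_bij_betw)

lemma avg_attained_below:
  assumes "finite A" "A \<noteq> {}"
  shows "\<exists>x\<in>A. f x \<le> avg A f"
proof (rule ccontr)
  assume "\<not> ?thesis"
  then have "\<And>x. x \<in> A \<Longrightarrow> avg A f < f x" by force
  then have "(\<Sum>x\<in>A. avg A f) < (\<Sum>x\<in>A. f x)"
    using assms by (intro sum_strict_mono) auto
  then show False
    using assms by (simp add: avg_def)
qed

lemma avg_PiE_insert:
  assumes "finite S" "x \<notin> S"
  shows "avg (PiE (insert x S) T) F = avg (T x) (\<lambda>y. avg (PiE S T) (\<lambda>g. F (g(x := y))))"
proof -
  have inj: "inj_on (\<lambda>(y, g). g(x := y)) (T x \<times> PiE S T)"
    by (rule inj_combinator[OF assms(2)])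
  have "(\<Sum>g\<in>PiE (insert x S) T. F g) = (\<Sum>y\<in>T x. \<Sum>g\<in>PiE S T. F (g(x := y)))"
    unfolding PiE_insert_eq
    by (subst sum.reindex[OF inj]) (simp add: sum.cartesian_product split_beta)
  moreover have "card (PiE (insert x S) T) = card (T x) * card (PiE S T)"
    using assms by (simp add: card_PiE)
  ultimately show ?thesis
    by (simp add: avg_def sum_divide_distrib[symmetric] mult.commute)
qed

text \<open>Independence: a product of exponentials over a product of finite sets averages to the product of the averages.\<close>

lemma avg_PiE_exp:
  assumes "finite S" "\<And>s. s \<in> S \<Longrightarrow> avg (T s) (\<lambda>y. exp (f s y)) \<le> exp (b s)"
  shows "avg (PiE S T) (\<lambda>g. exp (\<Sum>s\<in>S. f s (g s))) \<le> exp (\<Sum>s\<in>S. b s)"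
  using assms
proof (induction S rule: finite_induct)
  case empty
  then show ?case by (simp add: avg_def)
next
  case (insert x S)
  have *: "(\<Sum>s\<in>S. f s ((g(x := y)) s)) = (\<Sum>s\<in>S. f s (g s))" for g y
    using insert by (intro sum.cong) auto
  have "avg (PiE (insert x S) T) (\<lambda>g. exp (\<Sum>s\<in>insert x S. f s (g s)))
     = avg (T x) (\<lambda>y. exp (f x y)) * avg (PiE S T) (\<lambda>g. exp (\<Sum>s\<in>S. f s (g s)))"
    using insert
    by (simp add: avg_PiE_insert * exp_add avg_cmult avg_cmult_right cong del: if_weak_cong del: fun_upd_apply) 
       (simp add: avg_cmult avg_cmult_right)
  also have "\<dots> \<le> exp (b x) * exp (\<Sum>s\<in>S. b s)"
    using insert by (intro mult_mono avg_nonneg) auto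
  finally show ?case
    using insert by (simp add: exp_add)
qed

section \<open>Symmetrization\<close>

lemma bounded_imp_bdd_above_image:
  fixes f :: "'v \<Rightarrow> real"
  shows "(\<And>v. v \<in> K \<Longrightarrow> f v \<le> B) \<Longrightarrow> bdd_above (f ` K)"
  by (auto simp: bdd_above_def)

text \<open>One factor of the symmetrization inequality. The expectation of \<open>\<bar>X w' v\<bar>\<close> over an independent copy
  \<open>w'\<close> is taken out of the supremum. Exchanging \<open>w\<close> and \<open>w'\<close> pairs two points \<open>v\<close> and \<open>u\<close>, for which the triangle
  inequality reduces everything to \<open>\<bar>X w v - X w u\<bar>\<close> and \<open>\<bar>X w' v - X w' u\<bar>\<close>. The symmetry \<open>neg\<close> of the index set
  turns these absolute values into the two suprema on the right. The summand \<open>a v\<close> carries the terms not yet treated.\<close>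

lemma symmetrization_step:
  fixes X :: "'w \<Rightarrow> 'v \<Rightarrow> real"
  assumes W: "finite W" "W \<noteq> {}" and neg: "bij_betw neg W W"
    and X_neg: "\<And>w v. w \<in> W \<Longrightarrow> v \<in> K \<Longrightarrow> X (neg w) v = - X w v"
    and K: "K \<noteq> {}"
    and X_bd: "\<And>w v. w \<in> W \<Longrightarrow> v \<in> K \<Longrightarrow> \<bar>X w v\<bar> \<le> B"
    and a_bd: "\<And>v. v \<in> K \<Longrightarrow> a v \<le> A"
  shows "avg W (\<lambda>w. SUP v\<in>K. a v + (avg W (\<lambda>w'. \<bar>X w' v\<bar>) - \<bar>X w v\<bar>))
         \<le> avg W (\<lambda>w. SUP v\<in>K. a v + 2 * X w v)"
proof -
  define U where "U w = (SUP v\<in>K. a v + 2 * X w v)" for w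
  define G where "G w w' = (SUP v\<in>K. a v + \<bar>X w' v\<bar> - \<bar>X w v\<bar>)" for w w'
  have negW: "neg w \<in> W" if "w \<in> W" for w
    using neg that by (auto simp: bij_betw_def)
  have bdU: "bdd_above ((\<lambda>v. a v + 2 * X w v) ` K)" if "w \<in> W" for w
  proof (rule bounded_imp_bdd_above_image[of _ _ "A + 2 * B"])
    fix v assume v: "v \<in> K"
    show "a v + 2 * X w v \<le> A + 2 * B"
      using X_bd[OF that v] a_bd[OF v] by linarith
  qed
  have bdG: "bdd_above ((\<lambda>v. a v + \<bar>X w' v\<bar> - \<bar>X w v\<bar>) ` K)" if "w \<in> W" "w' \<in> W" for w w'
  proof (rule bounded_imp_bdd_above_image[of _ _ "A + B"])
    fix v assume v: "v \<in> K"
    show "a v + \<bar>X w' v\<bar> - \<bar>X w v\<bar> \<le> A + B"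
      using X_bd[OF that(2) v] a_bd[OF v] by linarith
  qed
  have U_upper: "a v + 2 * X w v \<le> U w" if "w \<in> W" "v \<in> K" for w v
    unfolding U_def using that by (intro cSUP_upper bdU)
  have two_point: "a v + a u + 2 * \<bar>X w v - X w u\<bar> \<le> U w + U (neg w)"
    if "w \<in> W" "v \<in> K" "u \<in> K" for w v u
    using U_upper[OF that(1,2)] U_upper[OF that(1,3)] U_upper[OF negW[OF that(1)] that(2)]
      U_upper[OF negW[OF that(1)] that(3)] X_neg[OF that(1,2)] X_neg[OF that(1,3)]
    by (simp add: abs_if)
  have G_le: "G w w' + G w' w \<le> (U w + U (neg w) + U w' + U (neg w')) / 2" (is "_ \<le> ?R")
    if w: "w \<in> W" "w' \<in> W" for w w'
  proof -
    have "a v + \<bar>X w' v\<bar> - \<bar>X w v\<bar> \<le> ?R - G w' w" if v: "v \<in> K" for v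
    proof -
      have "G w' w \<le> ?R - (a v + \<bar>X w' v\<bar> - \<bar>X w v\<bar>)"
        unfolding G_def
      proof (rule cSUP_least[OF K])
        fix u assume u: "u \<in> K"
        show "a u + \<bar>X w u\<bar> - \<bar>X w' u\<bar> \<le> ?R - (a v + \<bar>X w' v\<bar> - \<bar>X w v\<bar>)"
          using two_point[OF w(1) v u] two_point[OF w(2) v u]
            abs_triangle_ineq2[of "X w u" "X w v"] abs_triangle_ineq2[of "X w' v" "X w' u"]
            abs_minus_commute[of "X w u" "X w v"]
          by (simp add: field_simps)
      qed
      then show ?thesis by linarith
    qed
    then have "G w w' \<le> ?R - G w' w"
      by (subst (1) G_def) (rule cSUP_least[OF K], auto)
    then show ?thesis by linarith
  qed
  have 1: "(SUP v\<in>K. a v + (avg W (\<lambda>w'. \<bar>X w' v\<bar>) - \<bar>X w v\<bar>)) \<le> avg W (G w)" if w: "w \<in> W" for w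
  proof (rule cSUP_least[OF K])
    fix v assume v: "v \<in> K"
    have "a v + (avg W (\<lambda>w'. \<bar>X w' v\<bar>) - \<bar>X w v\<bar>) = avg W (\<lambda>w'. a v + \<bar>X w' v\<bar> - \<bar>X w v\<bar>)"
      using W by (simp add: avg_add avg_diff avg_const)
    also have "\<dots> \<le> avg W (G w)"
      unfolding G_def using v w by (intro avg_mono cSUP_upper bdG)
    finally show "a v + (avg W (\<lambda>w'. \<bar>X w' v\<bar>) - \<bar>X w v\<bar>) \<le> avg W (G w)" .
  qed
  have "2 * avg W (\<lambda>w. avg W (G w)) = avg W (\<lambda>w. avg W (\<lambda>w'. G w w' + G w' w))"
    by (simp add: avg_add avg_swap[of W W "\<lambda>x y. G y x"])
  also have "\<dots> \<le> avg W (\<lambda>w. avg W (\<lambda>w'. (U w + U (neg w) + U w' + U (neg w')) / 2))"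
    by (intro avg_mono G_le)
  also have "\<dots> = 2 * avg W U"
    using W by (simp add: avg_divide avg_add avg_const avg_bij[OF neg])
  finally have 2: "avg W (\<lambda>w. avg W (G w)) \<le> avg W U" by simp
  show ?thesis
    using order_trans[OF avg_mono[OF 1] 2] unfolding U_def .
qed

text \<open>The deviation of \<open>\<bar>X\<bar>\<close> from its mean, uniformly in \<open>v\<close>, costs no more than twice the uniform size of the sum
  of the linear process itself: the one-factor inequality is applied to the factors one at a time.\<close>

lemma symmetrization:
  fixes X :: "'w \<Rightarrow> 'v \<Rightarrow> real"
  assumes W: "finite W" "W \<noteq> {}" and neg: "bij_betw neg W W"
    and X_neg: "\<And>w v. w \<in> W \<Longrightarrow> v \<in> K \<Longrightarrow> X (neg w) v = - X w v"
    and K: "K \<noteq> {}"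
    and X_bd: "\<And>w v. w \<in> W \<Longrightarrow> v \<in> K \<Longrightarrow> \<bar>X w v\<bar> \<le> B"
    and a_bd: "\<And>v. v \<in> K \<Longrightarrow> a v \<le> A"
    and S: "finite S"
  shows "avg (PiE S (\<lambda>_. W)) (\<lambda>g. SUP v\<in>K. a v + (\<Sum>s\<in>S. avg W (\<lambda>w. \<bar>X w v\<bar>) - \<bar>X (g s) v\<bar>))
         \<le> avg (PiE S (\<lambda>_. W)) (\<lambda>g. SUP v\<in>K. a v + 2 * (\<Sum>s\<in>S. X (g s) v))"
  using S a_bd
proof (induction S arbitrary: a A rule: finite_induct)
  case empty
  then show ?case by simp
next
  case (insert x S)
  let ?m = "\<lambda>v. avg W (\<lambda>w. \<bar>X w v\<bar>)"
  have upd: "(\<Sum>s\<in>S. f ((g(x := y)) s)) = (\<Sum>s\<in>S. f (g s))" for f :: "'w \<Rightarrow> real" and g y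
    using insert by (intro sum.cong) auto
  have m_bd: "?m v \<le> B" if "v \<in> K" for v
  proof -
    have "?m v \<le> avg W (\<lambda>_. B)" using X_bd that by (intro avg_mono) auto
    then show ?thesis using W by (simp add: avg_const)
  qed
  have "avg (PiE (insert x S) (\<lambda>_. W)) (\<lambda>g. SUP v\<in>K. a v + (\<Sum>s\<in>insert x S. ?m v - \<bar>X (g s) v\<bar>))
     = avg W (\<lambda>w. avg (PiE S (\<lambda>_. W)) (\<lambda>g. SUP v\<in>K. a v + (?m v - \<bar>X w v\<bar>) + (\<Sum>s\<in>S. ?m v - \<bar>X (g s) v\<bar>)))"
    using insert.hyps
    by (simp add: avg_PiE_insert upd[where f = "\<lambda>w. avg W (\<lambda>w. \<bar>X w v\<bar>) - \<bar>X w v\<bar>" for v] add.assoc del: fun_upd_apply)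
       (simp add: algebra_simps)
  also have "\<dots> \<le> avg W (\<lambda>w. avg (PiE S (\<lambda>_. W)) (\<lambda>g. SUP v\<in>K. a v + (?m v - \<bar>X w v\<bar>) + 2 * (\<Sum>s\<in>S. X (g s) v)))"
  proof (rule avg_mono)
    fix w assume "w \<in> W"
    show "avg (PiE S (\<lambda>_. W)) (\<lambda>g. SUP v\<in>K. a v + (?m v - \<bar>X w v\<bar>) + (\<Sum>s\<in>S. ?m v - \<bar>X (g s) v\<bar>))
       \<le> avg (PiE S (\<lambda>_. W)) (\<lambda>g. SUP v\<in>K. a v + (?m v - \<bar>X w v\<bar>) + 2 * (\<Sum>s\<in>S. X (g s) v))"
    proof (rule insert.IH[of _ "A + B"])
      fix v assume v: "v \<in> K"
      show "a v + (?m v - \<bar>X w v\<bar>) \<le> A + B"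
        using m_bd[OF v] insert.prems[OF v] by linarith
    qed
  qed
  also have "\<dots> = avg (PiE S (\<lambda>_. W)) (\<lambda>g. avg W (\<lambda>w. SUP v\<in>K. (a v + 2 * (\<Sum>s\<in>S. X (g s) v)) + (?m v - \<bar>X w v\<bar>)))"
    by (subst avg_swap) (simp add: algebra_simps)
  also have "\<dots> \<le> avg (PiE S (\<lambda>_. W)) (\<lambda>g. avg W (\<lambda>w. SUP v\<in>K. (a v + 2 * (\<Sum>s\<in>S. X (g s) v)) + 2 * X w v))"
  proof (rule avg_mono)
    fix g assume g: "g \<in> PiE S (\<lambda>_. W)"
    show "avg W (\<lambda>w. SUP v\<in>K. (a v + 2 * (\<Sum>s\<in>S. X (g s) v)) + (?m v - \<bar>X w v\<bar>))
       \<le> avg W (\<lambda>w. SUP v\<in>K. (a v + 2 * (\<Sum>s\<in>S. X (g s) v)) + 2 * X w v)"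
    proof (rule symmetrization_step[where X = X and B = B and A = "A + 2 * (\<Sum>s\<in>S. B)" and neg = neg])
      fix v assume v: "v \<in> K"
      have "(\<Sum>s\<in>S. X (g s) v) \<le> (\<Sum>s\<in>S. B)"
      proof (rule sum_mono)
        fix s assume "s \<in> S"
        then have "g s \<in> W" using g by auto
        then show "X (g s) v \<le> B" using X_bd[of "g s" v] v by linarith
      qed
      then show "a v + 2 * (\<Sum>s\<in>S. X (g s) v) \<le> A + 2 * (\<Sum>s\<in>S. B)"
        using insert.prems[OF v] by linarith
    qed (use W neg X_neg K X_bd in auto)
  qed
  also have "\<dots> = avg W (\<lambda>w. avg (PiE S (\<lambda>_. W)) (\<lambda>g. SUP v\<in>K. a v + 2 * (X w v + (\<Sum>s\<in>S. X (g s) v))))"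
    by (subst avg_swap) (simp add: algebra_simps)
  also have "\<dots> = avg (PiE (insert x S) (\<lambda>_. W)) (\<lambda>g. SUP v\<in>K. a v + 2 * (\<Sum>s\<in>insert x S. X (g s) v))"
    using insert.hyps
    by (simp add: avg_PiE_insert upd[where f = "\<lambda>w. X w v" for v] del: fun_upd_apply)
       simp
  finally show ?case .
qed

section \<open>Random signs\<close>

lemma cosh_real_le_exp_half_square: "cosh x \<le> exp (x\<^sup>2 / 2)" for x :: real
proof -
  have pos: "cosh x \<le> exp (x\<^sup>2 / 2)" if x: "x \<ge> 0" for x :: real
  proof -
    have "0 * cosh 0 - sinh 0 \<le> x * cosh x - sinh x" if "x \<ge> 0" for x :: real
    proof (rule DERIV_nonneg_imp_nondecreasing[OF that])
      fix y :: real assume "0 \<le> y"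
      then show "\<exists>z. ((\<lambda>x. x * cosh x - sinh x) has_real_derivative z) (at y) \<and> 0 \<le> z"
        by (intro exI[of _ "y * sinh y"]) (auto intro!: derivative_eq_intros)
    qed
    then have sinh_le: "sinh y \<le> y * cosh y" if "y \<ge> 0" for y :: real
      using that by force
    have "0\<^sup>2 / 2 - ln (cosh 0) \<le> x\<^sup>2 / 2 - ln (cosh x)"
    proof (rule DERIV_nonneg_imp_nondecreasing[OF x])
      fix y :: real assume y: "0 \<le> y"
      have "sinh y / cosh y \<le> y"
        using sinh_le[OF y] by (simp add: pos_divide_le_eq)
      then show "\<exists>z. ((\<lambda>x. x\<^sup>2 / 2 - ln (cosh x)) has_real_derivative z) (at y) \<and> 0 \<le> z"
        by (intro exI[of _ "y - sinh y / cosh y"]) (auto intro!: derivative_eq_intros)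
    qed
    then have "ln (cosh x) \<le> x\<^sup>2 / 2" by simp
    then have "exp (ln (cosh x)) \<le> exp (x\<^sup>2 / 2)" by (simp only: exp_le_cancel_iff)
    then show ?thesis using cosh_real_pos[of x] by (simp only: exp_ln)
  qed
  show ?thesis
    using pos[of x] pos[of "-x"] by (cases "x \<ge> 0") auto
qed

definition signs :: "'i set \<Rightarrow> ('i \<Rightarrow> real) set" where
  "signs I = PiE I (\<lambda>_. {-1, 1})"

lemma signs_finite: "finite I \<Longrightarrow> finite (signs I)"
  by (simp add: signs_def finite_PiE)

lemma signs_nonempty: "signs I \<noteq> {}"
  by (simp add: signs_def PiE_eq_empty_iff)

lemma avg_pair: "avg {-1, 1::real} f = (f (-1) + f 1) / 2"
  by (simp add: avg_def)

lemma avg_signs_exp: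
  assumes "finite I"
  shows "avg (signs I) (\<lambda>\<epsilon>. exp (t * (\<Sum>i\<in>I. a i * \<epsilon> i))) \<le> exp (t\<^sup>2 * (\<Sum>i\<in>I. (a i)\<^sup>2) / 2)"
proof -
  have "avg (PiE I (\<lambda>_. {-1, 1})) (\<lambda>\<epsilon>. exp (\<Sum>i\<in>I. t * a i * \<epsilon> i)) \<le> exp (\<Sum>i\<in>I. (t * a i)\<^sup>2 / 2)"
  proof (rule avg_PiE_exp[OF assms])
    fix i
    have "avg {- 1, 1} (\<lambda>y. exp (t * a i * y)) = cosh (t * a i)"
      by (simp add: avg_pair cosh_def)
    then show "avg {- 1, 1} (\<lambda>y. exp (t * a i * y)) \<le> exp ((t * a i)\<^sup>2 / 2)"
      using cosh_real_le_exp_half_square by simp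
  qed
  then show ?thesis
    by (simp add: signs_def sum_distrib_left sum_divide_distrib power_mult_distrib mult.assoc)
qed

lemma power_le_fact_exp: 
  fixes x :: real
  assumes "x \<ge> 0" shows "x ^ n \<le> fact n * exp x"
proof -
  have "(\<Sum>k\<in>{n}. x ^ k /\<^sub>R fact k) \<le> (\<Sum>k. x ^ k /\<^sub>R fact k)"
    using assms by (intro sum_le_suminf summable_exp_generic) auto
  then have "x ^ n / fact n \<le> exp x"
    by (simp add: exp_def field_simps)
  then show ?thesis by (simp add: field_simps)
qed

text \<open>A power is dominated by an exponential, \<open>x\<^sup>n \<le> n! e\<^sup>x\<close>; the growth \<open>h\<^sup>h\<close> of the bound is what produces the factor
  \<open>q\<^bsup>1/2\<^esup>\<close> in the width estimate.\<close>

lemma subgaussian_moment: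
  assumes "b > 0" "h \<ge> 1"
    and mgf: "\<And>t. avg W (\<lambda>w. exp (t * Z w)) \<le> exp (t\<^sup>2 * b / 2)"
  shows "avg W (\<lambda>w. Z w ^ (2 * h)) \<le> (12 * real h * b) ^ h"
proof -
  \<comment> \<open>This choice makes the exponent \<open>t\<^sup>2 * b / 2\<close> of the moment generating function equal to \<open>h\<close>.\<close>
  define t where "t = sqrt (2 * real h / b)"
  have t: "t > 0" "t\<^sup>2 = 2 * real h / b"
    using assms by (auto simp: t_def)
  have pw: "Z w ^ (2*h) \<le> (fact (2*h) / t ^ (2*h)) * (exp (t * Z w) + exp ((-t) * Z w))" for w
  proof -
    have "(t * \<bar>Z w\<bar>) ^ (2*h) \<le> fact (2*h) * exp (t * \<bar>Z w\<bar>)"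
      using t by (intro power_le_fact_exp) auto
    also have "\<dots> \<le> fact (2*h) * (exp (t * Z w) + exp ((-t) * Z w))"
      by (intro mult_left_mono) (auto simp: abs_if)
    finally have "t ^ (2*h) * Z w ^ (2*h) \<le> fact (2*h) * (exp (t * Z w) + exp ((-t) * Z w))"
      by (simp only: power_mult_distrib power_mult power2_abs)
    moreover have "t ^ (2*h) > 0" using t by simp
    ultimately show ?thesis
      unfolding times_divide_eq_left by (subst pos_le_divide_eq) (simp_all only: mult.commute)
  qed
  have "avg W (\<lambda>w. Z w ^ (2*h)) \<le> (fact (2*h) / t ^ (2*h)) * (avg W (\<lambda>w. exp (t * Z w)) + avg W (\<lambda>w. exp ((-t) * Z w)))"
    unfolding avg_add[symmetric] avg_cmult[symmetric] by (intro avg_mono pw)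
  also have "\<dots> \<le> (fact (2*h) / t ^ (2*h)) * (exp (t\<^sup>2 * b / 2) + exp ((-t)\<^sup>2 * b / 2))"
    using t by (intro mult_left_mono add_mono mgf) auto
  also have "\<dots> = fact (2*h) / (2 * real h / b) ^ h * (2 * exp (real h))"
    unfolding power_mult using assms(1) t(2) by simp
  also have "\<dots> \<le> real (2*h) ^ (2*h) / (2 * real h / b) ^ h * (2 * exp (real h))"
    using assms fact_le_power[of "2*h", where 'a = real]
    by (intro mult_right_mono divide_right_mono) auto
  also have "\<dots> = 2 * (2 * real h * b * exp 1) ^ h"
    using assms by (simp add: power_mult power_mult_distrib power_divide power2_eq_square exp_of_nat_mult[of h 1, simplified] field_simps)
  also have "\<dots> \<le> 2 ^ h * (2 * real h * b * 3) ^ h"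
    using assms exp_le self_le_power[of "2::real" h]
    by (intro mult_mono power_mono mult_left_mono) auto
  also have "\<dots> = (2 * (2 * real h * b * 3)) ^ h"
    by (rule power_mult_distrib[symmetric])
  also have "\<dots> = (12 * real h * b) ^ h"
    by (simp add: mult_ac)
  finally show ?thesis .
qed

lemma avg_signs_square:
  assumes "finite I"
  shows "avg (signs I) (\<lambda>\<epsilon>. (\<Sum>i\<in>I. v i * \<epsilon> i)\<^sup>2) = (\<Sum>i\<in>I. (v i)\<^sup>2)"
  using assms
proof (induction I rule: finite_induct)
  case empty
  then show ?case by (simp add: signs_def avg_def)
next
  case (insert x I)
  have upd: "(\<Sum>i\<in>I. v i * (if i = x then y else g i)) = (\<Sum>i\<in>I. v i * g i)" for g y
    using insert by (intro sum.cong) auto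
  have "avg (signs (insert x I)) (\<lambda>\<epsilon>. (\<Sum>i\<in>insert x I. v i * \<epsilon> i)\<^sup>2) =
     (avg (signs I) (\<lambda>\<epsilon>. (- v x + (\<Sum>i\<in>I. v i * \<epsilon> i))\<^sup>2) + avg (signs I) (\<lambda>\<epsilon>. (v x + (\<Sum>i\<in>I. v i * \<epsilon> i))\<^sup>2)) / 2"
    unfolding signs_def using insert.hyps
    by (subst avg_PiE_insert) (simp_all add: avg_pair upd)
  also have "\<dots> = avg (signs I) (\<lambda>\<epsilon>. ((- v x + (\<Sum>i\<in>I. v i * \<epsilon> i))\<^sup>2 + (v x + (\<Sum>i\<in>I. v i * \<epsilon> i))\<^sup>2) * (1/2))"
    unfolding avg_cmult_right avg_add by simp
  also have "\<dots> = avg (signs I) (\<lambda>\<epsilon>. (v x)\<^sup>2 + (\<Sum>i\<in>I. v i * \<epsilon> i)\<^sup>2)"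
    by (intro avg_cong) (simp add: power2_eq_square algebra_simps)
  also have "\<dots> = (v x)\<^sup>2 + (\<Sum>i\<in>I. (v i)\<^sup>2)"
    using insert by (simp add: avg_add avg_const signs_finite signs_nonempty)
  finally show ?case using insert by simp
qed

text \<open>The lower Khintchine inequality, by comparison of the second and the fourth moment.\<close>

lemma avg_signs_abs_lower:
  assumes I: "finite I"
  shows "sqrt (\<Sum>i\<in>I. (v i)\<^sup>2) / 34 \<le> avg (signs I) (\<lambda>\<epsilon>. \<bar>\<Sum>i\<in>I. v i * \<epsilon> i\<bar>)"
proof (cases "(\<Sum>i\<in>I. (v i)\<^sup>2) = 0")
  case True
  then show ?thesis by (simp add: avg_nonneg)
next
  case False
  define b where "b = (\<Sum>i\<in>I. (v i)\<^sup>2)"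
  define Z where "Z \<epsilon> = (\<Sum>i\<in>I. v i * \<epsilon> i)" for \<epsilon>
  have b: "b > 0" using False by (simp add: b_def sum_nonneg less_le)
  have m4: "avg (signs I) (\<lambda>\<epsilon>. Z \<epsilon> ^ 4) \<le> 576 * b\<^sup>2"
    using subgaussian_moment[of b 2 "signs I" Z] b avg_signs_exp[OF I, of _ v]
    by (simp add: Z_def b_def power_mult_distrib)
  \<comment> \<open>The polynomial minorant \<open>y \<ge> 2 * (y\<^sup>2 - y\<^sup>4)\<close> for \<open>y \<ge> 0\<close> is used at the scale \<open>s\<close>. At this scale the fourth-moment
    term is at most half of the second-moment term, since \<open>34\<^sup>2 \<ge> 2 * 576\<close>.\<close>
  define s where "s = 34 * sqrt b"
  have s: "s > 0" "s\<^sup>2 = 1156 * b" using b by (auto simp: s_def power_mult_distrib)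
  have pw: "2 * s * ((Z \<epsilon>)\<^sup>2 / s\<^sup>2 - Z \<epsilon> ^ 4 / s ^ 4) \<le> \<bar>Z \<epsilon>\<bar>" for \<epsilon>
  proof -
    define y where "y = \<bar>Z \<epsilon>\<bar> / s"
    have y: "y \<ge> 0" using s by (simp add: y_def)
    have "y - y ^ 3 \<le> 1 / 2"
    proof -
      have "1/2 - y + y^3 = (y + 1) * (y - 1/2)\<^sup>2 + (1/4 - y/4)" 
        by (simp add: power2_eq_square power3_eq_cube field_simps)
      moreover have "1/2 - y + y^3 \<ge> 0" if "y \<ge> 1"
        using that self_le_power[of y 3] by simp
      moreover have "(y + 1) * (y - 1/2)\<^sup>2 \<ge> 0" using y by simp
      ultimately show ?thesis by (cases "y \<ge> 1") simp_all
    qed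
    then have "2 * (y * (y - y ^ 3)) \<le> y"
      using mult_left_mono[of "y - y^3" "1/2" y] y by simp
    then have "s * (2 * (y * (y - y ^ 3))) \<le> s * y"
      using s by (intro mult_left_mono) auto
    moreover have "s * (2 * (y * (y - y ^ 3))) = 2 * s * (y\<^sup>2 - y ^ 4)"
      by (simp add: power2_eq_square power3_eq_cube power4_eq_xxxx algebra_simps)
    moreover have "y\<^sup>2 = (Z \<epsilon>)\<^sup>2 / s\<^sup>2" "y ^ 4 = Z \<epsilon> ^ 4 / s ^ 4" "s * y = \<bar>Z \<epsilon>\<bar>"
      using s(1) by (simp_all add: y_def power_divide)
    ultimately show ?thesis by simp
  qed
  have sq: "avg (signs I) (\<lambda>\<epsilon>. (Z \<epsilon>)\<^sup>2) = b"
    unfolding Z_def b_def by (rule avg_signs_square[OF I])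
  have "2 * s * (b / s\<^sup>2 - 576 * b\<^sup>2 / s ^ 4) \<le> 2 * s * (avg (signs I) (\<lambda>\<epsilon>. (Z \<epsilon>)\<^sup>2) / s\<^sup>2 - avg (signs I) (\<lambda>\<epsilon>. Z \<epsilon> ^ 4) / s ^ 4)"
    using m4 s(1) sq by (intro mult_left_mono diff_mono divide_right_mono) auto
  also have "\<dots> = (2 * s / s\<^sup>2) * avg (signs I) (\<lambda>\<epsilon>. (Z \<epsilon>)\<^sup>2) - (2 * s / s ^ 4) * avg (signs I) (\<lambda>\<epsilon>. Z \<epsilon> ^ 4)"
    by (simp add: right_diff_distrib)
  also have "\<dots> = avg (signs I) (\<lambda>\<epsilon>. (2 * s / s\<^sup>2) * (Z \<epsilon>)\<^sup>2 - (2 * s / s ^ 4) * Z \<epsilon> ^ 4)"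
    unfolding avg_diff avg_cmult ..
  also have "\<dots> = avg (signs I) (\<lambda>\<epsilon>. 2 * s * ((Z \<epsilon>)\<^sup>2 / s\<^sup>2 - Z \<epsilon> ^ 4 / s ^ 4))"
    by (intro avg_cong) (simp add: right_diff_distrib)
  also have "\<dots> \<le> avg (signs I) (\<lambda>\<epsilon>. \<bar>Z \<epsilon>\<bar>)"
    by (intro avg_mono pw)
  finally have "2 * s * (b / s\<^sup>2 - 576 * b\<^sup>2 / s ^ 4) \<le> avg (signs I) (\<lambda>\<epsilon>. \<bar>Z \<epsilon>\<bar>)" .
  moreover have "2 * s * (b / s\<^sup>2 - 576 * b\<^sup>2 / s ^ 4) \<ge> sqrt b / 34"
  proof -
    have "s ^ 4 = (s\<^sup>2)\<^sup>2" by (simp add: power_mult[symmetric])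
    then have s4: "s ^ 4 = 1336336 * b\<^sup>2" by (simp add: s(2) power_mult_distrib)
    have "b / s\<^sup>2 - 576 * b\<^sup>2 / s ^ 4 = 1/1156 - 576 / 1336336"
      unfolding s4 s(2) using b by simp
    then have "2 * s * (b / s\<^sup>2 - 576 * b\<^sup>2 / s ^ 4) = sqrt b * (68 * (1/1156 - 576 / 1336336))"
      unfolding s_def by simp
    moreover have "sqrt b * (1/34) \<le> sqrt b * (68 * (1/1156 - 576 / 1336336))"
      using b by (intro mult_left_mono) auto
    ultimately show ?thesis by linarith
  qed
  ultimately show ?thesis by (simp add: Z_def b_def)
qed

section \<open>Approximation by random subspaces\<close>

text \<open>A functional that is dominated by the seminorm on the span of \<open>x\<close> and the \<open>Y s\<close>, vanishes on the \<open>Y s\<close> and takes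
  the value \<open>D\<close> at \<open>x\<close> extends with the same domination. The coordinates in \<open>I\<close> are added one at a time, so the extension is
  described by its coefficients \<open>v i\<close> on the unit vectors.\<close>

lemma hahn_banach_extension:
  fixes N :: "('i \<Rightarrow> real) \<Rightarrow> real" and Y :: "'s \<Rightarrow> 'i \<Rightarrow> real"
  assumes N_add: "\<And>x y. N (\<lambda>i. x i + y i) \<le> N x + N y"
    and N_scale: "\<And>c x. c > 0 \<Longrightarrow> N (\<lambda>i. c * x i) = c * N x"
    and base: "\<And>t a. t * D \<le> N (\<lambda>i. t * x i + (\<Sum>s\<in>S. a s * Y s i))"
    and I: "finite I"
  shows "\<exists>v. \<forall>t a c. t * D + (\<Sum>i\<in>I. v i * c i)
           \<le> N (\<lambda>i. t * x i + (\<Sum>s\<in>S. a s * Y s i) + (if i \<in> I then c i else 0))"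
  using I
proof (induction I rule: finite_induct)
  case empty
  then show ?case using base by simp
next
  case (insert j I)
  then obtain v where v: "\<And>t a c. t * D + (\<Sum>i\<in>I. v i * c i)
      \<le> N (\<lambda>i. t * x i + (\<Sum>s\<in>S. a s * Y s i) + (if i \<in> I then c i else 0))" by blast
  define L where "L z i = fst z * x i + (\<Sum>s\<in>S. fst (snd z) s * Y s i) + (if i \<in> I then snd (snd z) i else 0)"
    for z :: "real \<times> ('s \<Rightarrow> real) \<times> ('i \<Rightarrow> real)" and i
  define F where "F z = fst z * D + (\<Sum>i\<in>I. v i * snd (snd z) i)"
    for z :: "real \<times> ('s \<Rightarrow> real) \<times> ('i \<Rightarrow> real)"
  define e where "e i = (if i = j then 1 else 0 :: real)" for i
  have v': "F z \<le> N (L z)" for z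
    using v[of "fst z" "snd (snd z)" "fst (snd z)"] unfolding F_def L_def .
  let ?plus = "\<lambda>z z'. (fst z + fst z', (\<lambda>s. fst (snd z) s + fst (snd z') s), (\<lambda>s. snd (snd z) s + snd (snd z') s))"
  have sep: "F z - N (\<lambda>i. L z i - e i) \<le> N (\<lambda>i. L z' i + e i) - F z'" for z z'
  proof -
    have "F z + F z' = F (?plus z z')"
      by (simp add: F_def algebra_simps sum.distrib)
    also have "\<dots> \<le> N (L (?plus z z'))" by (rule v')
    also have "L (?plus z z') = (\<lambda>i. (L z i - e i) + (L z' i + e i))"
      by (rule ext) (simp add: L_def algebra_simps sum.distrib)
    also have "N \<dots> \<le> N (\<lambda>i. L z i - e i) + N (\<lambda>i. L z' i + e i)" by (rule N_add)
    finally show ?thesis by simp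
  qed
  \<comment> \<open>The value on the new unit vector may be any number in the gap left by the two one-sided constraints.\<close>
  define \<alpha> where "\<alpha> = (SUP z. F z - N (\<lambda>i. L z i - e i))"
  have lo: "F z - N (\<lambda>i. L z i - e i) \<le> \<alpha>" for z
    unfolding \<alpha>_def by (rule cSUP_upper) (auto simp: bdd_above_def intro!: sep)
  have hi: "\<alpha> \<le> N (\<lambda>i. L z i + e i) - F z" for z
    unfolding \<alpha>_def by (rule cSUP_least) (auto intro!: sep)
  let ?scale = "\<lambda>r z. (r * fst z, (\<lambda>s. r * fst (snd z) s), (\<lambda>s. r * snd (snd z) s))"
  have F_scale: "F (?scale r z) = r * F z" for r z
    by (simp add: F_def algebra_simps sum_distrib_left)
  have L_scale: "L (?scale r z) i = r * L z i" for r z i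
    by (simp add: L_def algebra_simps sum_distrib_left)
  have ext: "F z + \<alpha> * r \<le> N (\<lambda>i. L z i + r * e i)" for z r
  proof (cases r "0::real" rule: linorder_cases)
    case equal
    then show ?thesis using v'[of z] by simp
  next
    case greater
    have "r * (F (?scale (1/r) z) + \<alpha>) \<le> r * N (\<lambda>i. L (?scale (1/r) z) i + e i)"
      using hi[of "?scale (1/r) z"] greater by (intro mult_left_mono) auto
    also have "\<dots> = N (\<lambda>i. r * (L (?scale (1/r) z) i + e i))"
      using greater by (simp only: N_scale)
    finally show ?thesis using greater
      by (simp only: F_scale L_scale) (simp add: algebra_simps)
  next
    case less
    have "(-r) * (F (?scale (-1/r) z) - \<alpha>) \<le> (-r) * N (\<lambda>i. L (?scale (-1/r) z) i - e i)"
      using lo[of "?scale (-1/r) z"] less by (intro mult_left_mono) auto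
    also have "\<dots> = N (\<lambda>i. (-r) * (L (?scale (-1/r) z) i - e i))"
      using less by (subst N_scale) auto
    finally show ?thesis using less
      by (simp only: F_scale L_scale) (simp add: algebra_simps)
  qed
  show ?case
  proof (intro exI[of _ "v(j := \<alpha>)"] allI)
    fix t a c
    have "(\<Sum>i\<in>insert j I. (v(j := \<alpha>)) i * c i) = \<alpha> * c j + (\<Sum>i\<in>I. (v(j := \<alpha>)) i * c i)"
      using insert.hyps by simp
    also have "(\<Sum>i\<in>I. (v(j := \<alpha>)) i * c i) = (\<Sum>i\<in>I. v i * c i)"
      using insert.hyps by (intro sum.cong) auto
    finally have "t * D + (\<Sum>i\<in>insert j I. (v(j := \<alpha>)) i * c i) = F (t, a, c) + \<alpha> * c j"
      by (simp add: F_def)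
    also have "\<dots> \<le> N (\<lambda>i. L (t, a, c) i + c j * e i)" by (rule ext)
    also have "(\<lambda>i. L (t, a, c) i + c j * e i) = (\<lambda>i. t * x i + (\<Sum>s\<in>S. a s * Y s i) + (if i \<in> insert j I then c i else 0))"
      using insert.hyps by (auto simp: L_def e_def fun_eq_iff)
    finally show "t * D + (\<Sum>i\<in>insert j I. (v(j := \<alpha>)) i * c i)
      \<le> N (\<lambda>i. t * x i + (\<Sum>s\<in>S. a s * Y s i) + (if i \<in> insert j I then c i else 0))" .
  qed
qed

text \<open>The subspace spanned by \<open>card S\<close> random sign vectors approximates every vector \<open>x\<close> in the norm \<open>N\<close> to within
  a multiple of its Euclidean norm. By duality the distance of \<open>x\<close> from the subspace is the largest value at \<open>x\<close> of a
  functional \<open>v\<close> in the dual unit ball \<open>K\<close> that annihilates the sign vectors. By symmetrization and the lower Khintchine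
  inequality some choice of the signs forces all such \<open>v\<close> to have Euclidean norm at most \<open>68 * R / card S\<close>. A positive
  \<open>\<eta>\<close> avoids the question whether the distance is attained.\<close>

theorem random_subspace_approximation:
  fixes N :: "('i \<Rightarrow> real) \<Rightarrow> real"
  assumes I: "finite I" and S: "finite S" "S \<noteq> {}"
    and N_add: "\<And>x y. N (\<lambda>i. x i + y i) \<le> N x + N y"
    and N_scale: "\<And>c x. N (\<lambda>i. c * x i) = \<bar>c\<bar> * N x"
    and N_cong: "\<And>x y. (\<And>i. i \<in> I \<Longrightarrow> x i = y i) \<Longrightarrow> N x = N y"
  defines "R \<equiv> avg (PiE S (\<lambda>_. signs I)) (\<lambda>g. N (\<lambda>i. \<Sum>s\<in>S. g s i))"
  shows "\<exists>g. \<forall>x \<eta>. \<eta> > 0 \<longrightarrow> (\<exists>a. N (\<lambda>i. x i - (\<Sum>s\<in>S. a s * g s i))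
            < 68 / real (card S) * R * sqrt (\<Sum>i\<in>I. (x i)\<^sup>2) + \<eta>)"
proof -
  have N0: "N (\<lambda>_. 0) = 0" using N_scale[of 0 "\<lambda>_. 0"] by simp
  have N_nonneg: "N x \<ge> 0" for x
    using N_add[of x "\<lambda>i. (-1) * x i"] by (simp only: N_scale) (simp add: N0)
  define K where "K = {v. \<forall>c. (\<Sum>i\<in>I. v i * c i) \<le> N c}"
  define X where "X w v = (\<Sum>i\<in>I. v i * w i)" for w v :: "'i \<Rightarrow> real"
  define W where "W = signs I"
  define neg where "neg w = restrict (\<lambda>i. - w i) I" for w :: "'i \<Rightarrow> real"
  have W: "finite W" "W \<noteq> {}" using I by (simp_all add: W_def signs_finite signs_nonempty)
  have neg_bij: "bij_betw neg W W"
    by (rule bij_betwI[where g = neg])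
       (auto simp: W_def signs_def neg_def PiE_def extensional_def restrict_def fun_eq_iff)
  have X_neg: "X (neg w) v = - X w v" for w v
    by (simp add: X_def neg_def sum_negf)
  have K: "K \<noteq> {}" using N_nonneg by (auto simp: K_def intro!: exI[of _ "\<lambda>_. 0"])
  have X_le: "X w v \<le> N w" if "v \<in> K" for w v
    using that by (simp add: K_def X_def)
  have X_bd: "\<bar>X w v\<bar> \<le> (\<Sum>w\<in>W. N w + N (neg w))" if "w \<in> W" "v \<in> K" for w v
  proof -
    have "\<bar>X w v\<bar> \<le> N w + N (neg w)"
      using X_le[OF that(2), of w] X_le[OF that(2), of "neg w"] X_neg[of w v] N_nonneg[of w] N_nonneg[of "neg w"]
      by (simp add: abs_if)
    also have "\<dots> \<le> (\<Sum>w\<in>W. N w + N (neg w))"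
      using W that N_nonneg by (intro member_le_sum) (auto intro: add_nonneg_nonneg)
    finally show ?thesis .
  qed
  let ?P = "PiE S (\<lambda>_. W)"
  have P: "finite ?P" "?P \<noteq> {}" using W S by (auto simp: finite_PiE PiE_eq_empty_iff)
  define m where "m v = avg W (\<lambda>w. \<bar>X w v\<bar>)" for v
  have "avg ?P (\<lambda>g. SUP v\<in>K. 0 + (\<Sum>s\<in>S. m v - \<bar>X (g s) v\<bar>)) \<le> avg ?P (\<lambda>g. SUP v\<in>K. 0 + 2 * (\<Sum>s\<in>S. X (g s) v))"
    unfolding m_def
    by (rule symmetrization[where X = X and W = W and neg = neg and K = K and S = S and A = 0
          and a = "\<lambda>_. 0" and B = "\<Sum>w\<in>W. N w + N (neg w)"])
       (use W neg_bij X_neg K X_bd S in auto)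
  also have "\<dots> \<le> avg ?P (\<lambda>g. 2 * N (\<lambda>i. \<Sum>s\<in>S. g s i))"
  proof (intro avg_mono cSUP_least K)
    fix g v assume v: "v \<in> K"
    have "(\<Sum>s\<in>S. X (g s) v) = X (\<lambda>i. \<Sum>s\<in>S. g s i) v"
      unfolding X_def by (subst sum.swap) (simp add: sum_distrib_left)
    then show "0 + 2 * (\<Sum>s\<in>S. X (g s) v) \<le> 2 * N (\<lambda>i. \<Sum>s\<in>S. g s i)"
      using X_le[OF v] by simp
  qed
  also have "\<dots> = 2 * R" by (simp add: R_def avg_cmult W_def)
  finally have avg_le: "avg ?P (\<lambda>g. SUP v\<in>K. 0 + (\<Sum>s\<in>S. m v - \<bar>X (g s) v\<bar>)) \<le> 2 * R" .
  obtain g where g: "g \<in> ?P" "(SUP v\<in>K. 0 + (\<Sum>s\<in>S. m v - \<bar>X (g s) v\<bar>)) \<le> 2 * R"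
    using avg_attained_below[OF P, of "\<lambda>g. SUP v\<in>K. 0 + (\<Sum>s\<in>S. m v - \<bar>X (g s) v\<bar>)"] avg_le by force
  have m_upper: "m v \<le> (\<Sum>w\<in>W. N w + N (neg w))" if "v \<in> K" for v
  proof -
    have "m v \<le> avg W (\<lambda>_. \<Sum>w\<in>W. N w + N (neg w))"
      unfolding m_def using that by (intro avg_mono X_bd)
    then show ?thesis using W by (simp add: avg_const)
  qed
  have small: "sqrt (\<Sum>i\<in>I. (v i)\<^sup>2) \<le> 68 / real (card S) * R"
    if v: "v \<in> K" and orth: "\<And>s. s \<in> S \<Longrightarrow> X (g s) v = 0" for v
  proof -
    have "(\<Sum>s\<in>S. m v - \<bar>X (g s) v\<bar>) \<le> 2 * R"
    proof (rule order_trans[OF _ g(2)])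
      have "bdd_above ((\<lambda>v. 0 + (\<Sum>s\<in>S. m v - \<bar>X (g s) v\<bar>)) ` K)"
      proof (rule bounded_imp_bdd_above_image)
        fix v assume v: "v \<in> K"
        have "m v - \<bar>X (g s) v\<bar> \<le> (\<Sum>w\<in>W. N w + N (neg w))" for s
          using m_upper[OF v] by linarith
        then show "0 + (\<Sum>s\<in>S. m v - \<bar>X (g s) v\<bar>) \<le> (\<Sum>s\<in>S. \<Sum>w\<in>W. N w + N (neg w))"
          unfolding add_0 by (intro sum_mono)
      qed
      from cSUP_upper[OF v this]
      show "(\<Sum>s\<in>S. m v - \<bar>X (g s) v\<bar>) \<le> (SUP v\<in>K. 0 + (\<Sum>s\<in>S. m v - \<bar>X (g s) v\<bar>))" by simp
    qed
    then have "real (card S) * m v \<le> 2 * R" using orth by simp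
    moreover have "sqrt (\<Sum>i\<in>I. (v i)\<^sup>2) / 34 \<le> m v"
      unfolding m_def X_def W_def by (rule avg_signs_abs_lower[OF I])
    then have "real (card S) * (sqrt (\<Sum>i\<in>I. (v i)\<^sup>2) / 34) \<le> real (card S) * m v"
      by (intro mult_left_mono) auto
    ultimately have "real (card S) * (sqrt (\<Sum>i\<in>I. (v i)\<^sup>2) / 34) \<le> 2 * R" by linarith
    moreover have "card S > 0" using S by (simp add: card_gt_0_iff)
    ultimately show ?thesis by (simp add: field_simps)
  qed
  show ?thesis
  proof (intro exI[of _ g] allI impI, rule ccontr)
    fix x :: "'i \<Rightarrow> real" and \<eta> :: real
    assume \<eta>: "\<eta> > 0"
    define \<rho> where "\<rho> = 68 / real (card S) * R"
    define D where "D = \<rho> * sqrt (\<Sum>i\<in>I. (x i)\<^sup>2) + \<eta>"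
    assume "\<nexists>a. N (\<lambda>i. x i - (\<Sum>s\<in>S. a s * g s i)) < 68 / real (card S) * R * sqrt (\<Sum>i\<in>I. (x i)\<^sup>2) + \<eta>"
    then have far: "D \<le> N (\<lambda>i. x i - (\<Sum>s\<in>S. a s * g s i))" for a
      by (auto simp: D_def \<rho>_def not_less)
    have "R \<ge> 0" unfolding R_def by (intro avg_nonneg N_nonneg)
    then have D: "D > 0" using \<eta> by (simp add: D_def \<rho>_def add_nonneg_pos sum_nonneg)
    have base: "t * D \<le> N (\<lambda>i. t * x i + (\<Sum>s\<in>S. a s * g s i))" for t a
    proof (cases "t = 0")
      case True
      then show ?thesis by (simp add: N_nonneg)
    next
      case False
      have "t * D \<le> \<bar>t\<bar> * D" using D by (intro mult_right_mono) auto
      also have "\<dots> \<le> \<bar>t\<bar> * N (\<lambda>i. x i - (\<Sum>s\<in>S. (- a s / t) * g s i))"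
        by (intro mult_left_mono far) auto
      also have "\<dots> = N (\<lambda>i. t * (x i - (\<Sum>s\<in>S. (- a s / t) * g s i)))"
        by (rule N_scale[symmetric])
      also have "(\<lambda>i. t * (x i - (\<Sum>s\<in>S. (- a s / t) * g s i))) = (\<lambda>i. t * x i + (\<Sum>s\<in>S. a s * g s i))"
        using False by (simp add: fun_eq_iff ring_distribs sum_distrib_left sum_negf)
      finally show ?thesis .
    qed
    have N_scale_pos: "N (\<lambda>i. c * x i) = c * N x" if "c > 0" for c x
      using that N_scale[of c x] by simp
    obtain v where v: "\<And>t a c. t * D + (\<Sum>i\<in>I. v i * c i)
           \<le> N (\<lambda>i. t * x i + (\<Sum>s\<in>S. a s * g s i) + (if i \<in> I then c i else 0))"
      using hahn_banach_extension[where N = N and D = D and x = x and S = S and Y = g and I = I, OF N_add N_scale_pos base I]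
      by blast
    have vK: "v \<in> K"
      unfolding K_def
    proof (intro CollectI allI)
      fix c
      have "(\<Sum>i\<in>I. v i * c i) \<le> N (\<lambda>i. if i \<in> I then c i else 0)"
        using v[of 0 c "\<lambda>_. 0"] by simp
      also have "\<dots> = N c" by (rule N_cong) simp
      finally show "(\<Sum>i\<in>I. v i * c i) \<le> N c" .
    qed
    have orth: "X (g s) v = 0" if s: "s \<in> S" for s
    proof -
      \<comment> \<open>The functional is bounded above on the line through \<open>g s\<close>, along which the seminorm modulo the subspace vanishes.\<close>
      have le0: "r * X (g s) v \<le> 0" for r
      proof -
        have "r * X (g s) v = 0 * D + (\<Sum>i\<in>I. v i * (r * g s i))"
          by (simp add: X_def sum_distrib_left algebra_simps)
        also have "\<dots> \<le> N (\<lambda>i. 0 * x i + (\<Sum>s'\<in>S. (if s' = s then - r else 0) * g s' i) + (if i \<in> I then r * g s i else 0))"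
          by (rule v)
        also have "\<dots> = N (\<lambda>_. 0)"
          using s S by (intro N_cong) (simp add: if_distrib[of "\<lambda>x. x * _"] cong: if_cong)
        finally show ?thesis by (simp add: N0)
      qed
      from le0[of 1] le0[of "-1"] show ?thesis by simp
    qed
    have "1 * D + (\<Sum>i\<in>I. v i * (- x i)) \<le> N (\<lambda>i. 1 * x i + (\<Sum>s\<in>S. 0 * g s i) + (if i \<in> I then - x i else 0))"
      by (rule v)
    also have "\<dots> = N (\<lambda>_. 0)" by (rule N_cong) simp
    finally have "D \<le> (\<Sum>i\<in>I. v i * x i)" by (simp add: N0 sum_negf)
    also have "\<dots> \<le> sqrt ((\<Sum>i\<in>I. (v i)\<^sup>2) * (\<Sum>i\<in>I. (x i)\<^sup>2))"
      by (intro real_le_rsqrt Cauchy_Schwarz_ineq_sum)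
    also have "\<dots> \<le> \<rho> * sqrt (\<Sum>i\<in>I. (x i)\<^sup>2)"
      unfolding real_sqrt_mult \<rho>_def using small[OF vK orth] by (intro mult_right_mono) (auto simp: sum_nonneg)
    finally show False using \<eta> by (simp add: D_def)
  qed
qed

section \<open>Isometries and Lebesgue measure\<close>

lemma nn_integral_lborel_shift:
  fixes f :: "'a::euclidean_space \<Rightarrow> ennreal"
  assumes [measurable]: "f \<in> borel_measurable borel"
  shows "(\<integral>\<^sup>+y. f (c + y) \<partial>lborel) = (\<integral>\<^sup>+y. f y \<partial>lborel)"
proof -
  have "(\<integral>\<^sup>+y. f y \<partial>lborel) = (\<integral>\<^sup>+y. f y \<partial>(distr lborel borel ((+) c)))"
    by (simp add: lborel_distr_plus)
  also have "\<dots> = (\<integral>\<^sup>+y. f (c + y) \<partial>lborel)"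
    by (subst nn_integral_distr) auto
  finally show ?thesis by simp
qed

lemma nn_integral_lborel_reflect:
  fixes f :: "'a::euclidean_space \<Rightarrow> ennreal"
  assumes [measurable]: "f \<in> borel_measurable borel"
  shows "(\<integral>\<^sup>+y. f (c - y) \<partial>lborel) = (\<integral>\<^sup>+y. f y \<partial>lborel)"
proof -
  have "(\<integral>\<^sup>+y. f y \<partial>lborel) = (\<integral>\<^sup>+y. f y \<partial>(density (distr lborel borel (\<lambda>x. c + (-1) *\<^sub>R x)) (\<lambda>_. \<bar>-1::real\<bar> ^ DIM('a))))"
    by (subst lborel_affine[of "-1" c, symmetric]) auto
  also have "\<dots> = (\<integral>\<^sup>+y. f (c - y) \<partial>lborel)"
    by (simp add: nn_integral_density nn_integral_distr density_1)
  finally show ?thesis by simp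
qed

text \<open>Uniqueness of Haar measure, applied to the image of Lebesgue measure under an isometry: both measures
  agree on the unit ball.\<close>

lemma nn_integral_lborel_isometry:
  fixes U :: "'a::euclidean_space \<Rightarrow> 'a" and g :: "'a \<Rightarrow> ennreal"
  assumes U: "linear U" "surj U" "\<And>x. norm (U x) = norm x"
    and [measurable]: "g \<in> borel_measurable borel"
  shows "(\<integral>\<^sup>+x. g (U x) \<partial>lborel) = (\<integral>\<^sup>+x. g x \<partial>lborel)"
proof -
  have [measurable]: "U \<in> borel_measurable borel"
    by (intro borel_measurable_continuous_onI linear_continuous_on linear_conv_bounded_linear[THEN iffD1] U)
  define f where "f = (\<lambda>x::'a. indicator (ball 0 1) x :: ennreal)"
  have [measurable]: "f \<in> borel_measurable borel" unfolding f_def by (intro borel_measurable_indicator) simp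
  have fU: "f (U x) = f x" for x by (simp add: f_def indicator_def U(3))
  have "(\<integral>\<^sup>+x. f (U x) \<partial>lborel) * (\<integral>\<^sup>+y. g y \<partial>lborel) = (\<integral>\<^sup>+x. (\<integral>\<^sup>+y. f (U x) * g (U x + y) \<partial>lborel) \<partial>lborel)"
    by (simp add: nn_integral_multc[symmetric] nn_integral_cmult nn_integral_lborel_shift)
  also have "\<dots> = (\<integral>\<^sup>+y. (\<integral>\<^sup>+x. f (U x) * g (U x + y) \<partial>lborel) \<partial>lborel)"
    by (rule lborel_pair.Fubini') measurable
  also have "\<dots> = (\<integral>\<^sup>+y. (\<integral>\<^sup>+x. f (U x - y) * g (U x) \<partial>lborel) \<partial>lborel)"
  proof (rule nn_integral_cong)
    fix y :: 'a
    obtain v where v: "U v = y" using U(2) by (metis surjD)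
    have "(\<integral>\<^sup>+x. f (U x - y) * g (U x) \<partial>lborel) = (\<integral>\<^sup>+x. f (U (v + x) - y) * g (U (v + x)) \<partial>lborel)"
      by (rule nn_integral_lborel_shift[symmetric]) measurable
    then show "(\<integral>\<^sup>+x. f (U x) * g (U x + y) \<partial>lborel) = (\<integral>\<^sup>+x. f (U x - y) * g (U x) \<partial>lborel)"
      by (simp add: linear_add[OF U(1)] v add.commute)
  qed
  also have "\<dots> = (\<integral>\<^sup>+x. (\<integral>\<^sup>+y. f (U x - y) * g (U x) \<partial>lborel) \<partial>lborel)"
    by (rule lborel_pair.Fubini'[symmetric]) measurable
  also have "\<dots> = (\<integral>\<^sup>+y. f y \<partial>lborel) * (\<integral>\<^sup>+x. g (U x) \<partial>lborel)"
    by (simp add: nn_integral_multc nn_integral_cmult nn_integral_lborel_reflect)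
  finally have eq: "emeasure lborel (ball 0 1 :: 'a set) * (\<integral>\<^sup>+y. g y \<partial>lborel) = emeasure lborel (ball 0 1 :: 'a set) * (\<integral>\<^sup>+x. g (U x) \<partial>lborel)"
    unfolding fU by (simp add: f_def)
  have "emeasure lborel (ball 0 1 :: 'a set) = ennreal (unit_ball_vol (real DIM('a)))"
    by (simp add: emeasure_ball)
  then have "emeasure lborel (ball 0 1 :: 'a set) \<noteq> \<infinity>" "emeasure lborel (ball 0 1 :: 'a set) \<noteq> 0"
    using unit_ball_vol_pos[of "real DIM('a)"] by (simp_all add: ennreal_eq_0_iff not_le)
  then show ?thesis using eq by (simp add: ennreal_mult_cancel_left)
qed

section \<open>Surface measure\<close>

definition cone_over :: "'a::euclidean_space set \<Rightarrow> 'a set" where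
  "cone_over A = {x \<in> cball 0 1 - {0}. x /\<^sub>R norm x \<in> A}"

lemma sets_surface_measure [measurable_cong]:
  "sets (surface_measure :: 'a::euclidean_space measure) = sets (restrict_space borel (sphere 0 1))"
  by (simp add: surface_measure_def)

lemma space_surface_measure [simp]: "space (surface_measure :: 'a::euclidean_space measure) = sphere 0 1"
  by (simp add: surface_measure_def space_restrict_space space_scale_measure)

lemma radial_measurable:
  "(\<lambda>x::'a::euclidean_space. x /\<^sub>R norm x) \<in> restrict_space lborel (cball 0 1 - {0}) \<rightarrow>\<^sub>M restrict_space borel (sphere 0 1)"
  by (intro measurable_restrict_space2 measurable_restrict_space1) (auto simp: space_restrict_space)

lemma emeasure_surface_measure:
  assumes "A \<in> sets (surface_measure :: 'a::euclidean_space measure)"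
  shows "cone_over A \<in> sets borel"
    and "emeasure surface_measure A = of_nat DIM('a) * emeasure lborel (cone_over A)"
proof -
  have A: "A \<in> sets (restrict_space borel (sphere 0 1))" using assms by (simp add: sets_surface_measure)
  have eq: "(\<lambda>x. x /\<^sub>R norm x) -` A \<inter> space (restrict_space lborel (cball 0 1 - {0})) = cone_over A"
    by (auto simp: cone_over_def space_restrict_space)
  have B: "cball 0 1 - {0::'a} \<in> sets lborel" by simp
  have "cone_over A \<in> sets (restrict_space lborel (cball 0 1 - {0}))"
    unfolding eq[symmetric] by (rule measurable_sets[OF radial_measurable A])
  then show "cone_over A \<in> sets borel"
    using B by (simp add: sets_restrict_space_iff)
  then show "emeasure surface_measure A = of_nat DIM('a) * emeasure lborel (cone_over A)"
    unfolding surface_measure_def emeasure_scale_measure emeasure_distr[OF radial_measurable A] eq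
    by (subst emeasure_restrict_space) (auto simp: cone_over_def)
qed

lemma finite_measure_surface_measure: "finite_measure (surface_measure :: 'a::euclidean_space measure)"
proof
  have "emeasure (surface_measure :: 'a measure) (sphere 0 1) = of_nat DIM('a) * emeasure lborel (cone_over (sphere 0 1 :: 'a set))"
    by (rule emeasure_surface_measure) (use sets.top[of "surface_measure :: 'a measure"] in simp)
  also have "\<dots> \<le> of_nat DIM('a) * emeasure lborel (cball 0 1 :: 'a set)"
    by (intro mult_left_mono emeasure_mono) (auto simp: cone_over_def)
  also have "\<dots> < \<infinity>"
    using emeasure_bounded_finite[of "cball 0 1 :: 'a set"] by (simp add: ennreal_mult_less_top of_nat_less_top)
  finally show "emeasure (surface_measure :: 'a measure) (space surface_measure) \<noteq> \<infinity>" by simp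
qed

lemma surface_measure_isometry:
  fixes U :: "'a::euclidean_space \<Rightarrow> 'a"
  assumes U: "linear U" "surj U" "\<And>x. norm (U x) = norm x"
  shows "U \<in> surface_measure \<rightarrow>\<^sub>M surface_measure"
    and "distr surface_measure surface_measure U = surface_measure"
proof -
  have Ub[measurable]: "U \<in> borel_measurable borel"
    by (intro borel_measurable_continuous_onI linear_continuous_on linear_conv_bounded_linear[THEN iffD1] U)
  have "U \<in> restrict_space borel (sphere 0 1) \<rightarrow>\<^sub>M restrict_space borel (sphere 0 1)"
    by (intro measurable_restrict_space2 measurable_restrict_space1) (auto simp: space_restrict_space U)
  then show m: "U \<in> surface_measure \<rightarrow>\<^sub>M surface_measure"
    by (simp cong: measurable_cong_sets add: sets_surface_measure)
  show "distr surface_measure surface_measure U = surface_measure"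
  proof (rule measure_eqI)
    fix A :: "'a set" assume "A \<in> sets (distr surface_measure surface_measure U)"
    then have A: "A \<in> sets surface_measure" by simp
    let ?B = "U -` A \<inter> space surface_measure"
    have B: "?B \<in> sets surface_measure" by (rule measurable_sets[OF m A])
    note [measurable] = emeasure_surface_measure(1)[OF A] emeasure_surface_measure(1)[OF B]
    have ind: "indicator (cone_over ?B) x = (indicator (cone_over A) (U x) :: ennreal)" for x
    proof -
      have "U x = 0 \<longleftrightarrow> x = 0" using U(3)[of x] by (metis norm_eq_zero)
      moreover have "U (x /\<^sub>R norm x) = U x /\<^sub>R norm x" by (rule linear_scale[OF U(1)])
      ultimately show ?thesis by (auto simp: cone_over_def indicator_def U(3))
    qed
    have "emeasure lborel (cone_over ?B) = (\<integral>\<^sup>+x. indicator (cone_over ?B) x \<partial>lborel)"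
      using emeasure_surface_measure(1)[OF B] by (intro nn_integral_indicator[symmetric]) (simp only: sets_lborel)
    also have "\<dots> = (\<integral>\<^sup>+x. indicator (cone_over A) (U x) \<partial>lborel)"
      by (simp only: ind)
    also have "\<dots> = (\<integral>\<^sup>+x. indicator (cone_over A) x \<partial>lborel)"
      by (rule nn_integral_lborel_isometry[OF U]) measurable
    also have "\<dots> = emeasure lborel (cone_over A)"
      using emeasure_surface_measure(1)[OF A] by (intro nn_integral_indicator) (simp only: sets_lborel)
    finally have "emeasure lborel (cone_over ?B) = emeasure lborel (cone_over A)" .
    then show "emeasure (distr surface_measure surface_measure U) A = emeasure surface_measure A"
      by (simp only: emeasure_distr[OF m A] emeasure_surface_measure(2)[OF A] emeasure_surface_measure(2)[OF B])
  qed simp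
qed

text \<open>The cone over the preimage of a set is the preimage of the cone, so the isometry invariance of Lebesgue measure is
  inherited by surface measure.\<close>

lemma integral_surface_measure_isometry:
  fixes U :: "'a::euclidean_space \<Rightarrow> 'a" and f :: "'a \<Rightarrow> complex"
  assumes U: "linear U" "surj U" "\<And>x. norm (U x) = norm x"
    and f: "f \<in> borel_measurable surface_measure"
  shows "(LINT z|surface_measure. f (U z)) = (LINT z|surface_measure. f z)"
proof -
  have "(LINT z|surface_measure. f z) = (LINT z|distr surface_measure surface_measure U. f z)"
    by (simp add: surface_measure_isometry(2)[OF U])
  also have "\<dots> = (LINT z|surface_measure. f (U z))"
    by (rule integral_distr[OF surface_measure_isometry(1)[OF U] f])
  finally show ?thesis by simp
qed

lemma continuous_borel_measurable_surface:
  fixes f :: "'a::euclidean_space \<Rightarrow> 'b::{second_countable_topology, topological_space}"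
  assumes "continuous_on (sphere 0 1) f"
  shows "f \<in> borel_measurable surface_measure"
  using borel_measurable_continuous_on_restrict[OF assms]
  by (simp cong: measurable_cong_sets add: sets_surface_measure)

lemma continuous_integrable_surface:
  fixes f :: "'a::euclidean_space \<Rightarrow> 'b::{second_countable_topology, banach}"
  assumes "continuous_on (sphere 0 1) f"
  shows "integrable surface_measure f"
proof -
  interpret finite_measure "surface_measure :: 'a measure" by (rule finite_measure_surface_measure)
  have "bounded (f ` sphere 0 1)"
    using compact_continuous_image[OF assms] by (simp add: compact_imp_bounded)
  then obtain B where "\<forall>x\<in>sphere 0 1. norm (f x) \<le> B"
    unfolding bounded_iff by blast
  then show ?thesis
    by (intro integrable_const_bound[of _ B] AE_I2 continuous_borel_measurable_surface assms) auto
qed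

lemma continuous_AE_zero_surface:
  fixes f :: "'a::euclidean_space \<Rightarrow> 'b::real_normed_vector"
  assumes f: "continuous_on (sphere 0 1) f" and ae: "AE x in surface_measure. f x = 0" and w: "w \<in> sphere 0 1"
  shows "f w = 0"
proof (rule ccontr)
  assume nz: "f w \<noteq> 0"
  obtain N where N: "N \<in> null_sets surface_measure" "{x \<in> space surface_measure. f x \<noteq> 0} \<subseteq> N"
    using ae unfolding eventually_ae_filter by auto
  have N': "N \<in> sets surface_measure" using N by auto
  have "of_nat DIM('a) * emeasure lborel (cone_over N) = 0"
    using N(1) emeasure_surface_measure(2)[OF N'] by auto
  then have "emeasure lborel (cone_over N) = 0" by simp
  then have null: "cone_over N \<in> null_sets lborel"
    using emeasure_surface_measure(1)[OF N'] by auto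
  let ?g = "\<lambda>x::'a. f (x /\<^sub>R norm x)"
  let ?O = "?g -` (- {0}) \<inter> (ball 0 1 - {0})"
  have "continuous_on (ball 0 1 - {0}) ?g"
  proof (rule continuous_on_compose2[OF f])
    show "continuous_on (ball 0 1 - {0}) (\<lambda>x::'a. x /\<^sub>R norm x)"
      by (auto intro!: continuous_intros)
    show "(\<lambda>x::'a. x /\<^sub>R norm x) ` (ball 0 1 - {0}) \<subseteq> sphere 0 1"
      by (simp add: image_subset_iff)
  qed
  then have O: "open ?O"
    by (subst (1) Int_commute, intro continuous_open_preimage) (auto simp: open_delete)
  have "?O \<subseteq> cone_over N"
    using N(2) by (auto simp: cone_over_def)
  then have "?O \<in> null_sets lborel"
    using null O by (intro null_sets_subset[OF null]) auto
  then have "negligible ?O"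
    by (simp add: negligible_iff_null_sets null_sets_completionI)
  moreover have "?O \<noteq> {}"
  proof -
    have nw: "norm w = 1" using w by simp
    then have "w \<noteq> 0" by auto
    then have "(1/2) *\<^sub>R w \<in> ?O" using nz by (simp add: nw)
    then show ?thesis by blast
  qed
  ultimately show False using open_not_negligible[OF O] by blast
qed

section \<open>Bihomogeneous polynomials\<close>

text \<open>Polynomials of bidegree \<open>(m, n)\<close> in inductive form, so that their differential calculus can be developed by rule
  induction. The zero function has every bidegree.\<close>

inductive bihom :: "nat \<Rightarrow> nat \<Rightarrow> (complex ^ 'd::finite \<Rightarrow> complex) \<Rightarrow> bool" where
  bihom_const: "bihom 0 0 (\<lambda>_. c)"
| bihom_zero: "bihom m n (\<lambda>_. 0)"
| bihom_z: "bihom m n f \<Longrightarrow> bihom (Suc m) n (\<lambda>z. z $ j * f z)"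
| bihom_conj: "bihom m n f \<Longrightarrow> bihom m (Suc n) (\<lambda>z. cnj (z $ j) * f z)"
| bihom_add: "bihom m n f \<Longrightarrow> bihom m n g \<Longrightarrow> bihom m n (\<lambda>z. f z + g z)"

lemma bihom_scale: "bihom m n f \<Longrightarrow> bihom m n (\<lambda>z. c * f z)"
proof (induction rule: bihom.induct)
  case (bihom_const a)
  then show ?case by (rule bihom.bihom_const)
next
  case (bihom_zero m n)
  then show ?case by (simp add: bihom.bihom_zero)
next
  case (bihom_z m n f j)
  from bihom.bihom_z[OF bihom_z.IH, of j] show ?case by (simp add: mult.left_commute)
next
  case (bihom_conj m n f j)
  from bihom.bihom_conj[OF bihom_conj.IH, of j] show ?case by (simp add: mult.left_commute)
next
  case (bihom_add m n f g)
  from bihom.bihom_add[OF bihom_add.IH] show ?case by (simp add: distrib_left)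
qed

lemma bihom_sum: "(\<And>i. i \<in> A \<Longrightarrow> bihom m n (f i)) \<Longrightarrow> bihom m n (\<lambda>z. \<Sum>i\<in>A. f i z)"
  by (induction A rule: infinite_finite_induct) (auto intro: bihom_zero bihom_add)

lemma bihom_diff: "bihom m n f \<Longrightarrow> bihom m n g \<Longrightarrow> bihom m n (\<lambda>z. f z - g z)"
  using bihom_add[of m n f "\<lambda>z. (-1) * g z"] bihom_scale[of m n g "-1"] by simp

lemma bihom_mult:
  assumes "bihom m n f" "bihom m' n' g"
  shows "bihom (m + m') (n + n') (\<lambda>z. f z * g z)"
  using assms(1)
proof (induction rule: bihom.induct)
  case (bihom_const a)
  then show ?case using bihom_scale[OF assms(2)] by simp
next
  case (bihom_zero m n)
  then show ?case by (simp add: bihom.bihom_zero)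
next
  case (bihom_z m n f j)
  from bihom.bihom_z[OF bihom_z.IH, of j] show ?case by (simp add: mult.assoc)
next
  case (bihom_conj m n f j)
  from bihom.bihom_conj[OF bihom_conj.IH, of j] show ?case by (simp add: mult.assoc)
next
  case (bihom_add m n f g)
  from bihom.bihom_add[OF bihom_add.IH] show ?case by (simp add: distrib_right)
qed

lemma bihom_cnj: "bihom m n f \<Longrightarrow> bihom n m (\<lambda>z. cnj (f z))"
proof (induction rule: bihom.induct)
  case (bihom_const a)
  then show ?case by (rule bihom.bihom_const)
next
  case (bihom_zero m n)
  then show ?case by (simp add: bihom.bihom_zero)
next
  case (bihom_z m n f j)
  from bihom.bihom_conj[OF bihom_z.IH, of j] show ?case by simp
next
  case (bihom_conj m n f j)
  from bihom.bihom_z[OF bihom_conj.IH, of j] show ?case by simp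
next
  case (bihom_add m n f g)
  from bihom.bihom_add[OF bihom_add.IH] show ?case by simp
qed

lemma bihom_coord: "bihom 1 0 (\<lambda>z. z $ j)" "bihom 0 1 (\<lambda>z. cnj (z $ j))"
  using bihom_z[OF bihom_const[of 1], of j] bihom_conj[OF bihom_const[of 1], of j] by simp_all

lemma bihom_continuous: "bihom m n f \<Longrightarrow> continuous_on A f"
  by (induction rule: bihom.induct) (auto intro!: continuous_intros)

lemma bihom_homogeneous: "bihom m n f \<Longrightarrow> f (r *\<^sub>R z) = of_real r ^ (m + n) * f z"
  by (induction rule: bihom.induct) (auto simp: scaleR_conv_of_real[where 'a = complex] algebra_simps)

lemma bihom_differentiable: "bihom m n f \<Longrightarrow> f differentiable (at z)"
proof (induction rule: bihom.induct)
  case (bihom_z m n f j)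
  have "(\<lambda>z. z $ j) differentiable (at z)"
    using bounded_linear_vec_nth[of j] by (rule bounded_linear_imp_differentiable)
  then show ?case using bihom_z.IH by (rule differentiable_mult)
next
  case (bihom_conj m n f j)
  have "bounded_linear (\<lambda>z::complex^'a. cnj (z $ j))"
    by (rule bounded_linear_compose[OF bounded_linear_cnj bounded_linear_vec_nth])
  then have "(\<lambda>z. cnj (z $ j)) differentiable (at z)"
    by (rule bounded_linear_imp_differentiable)
  then show ?case using bihom_conj.IH by (rule differentiable_mult)
qed auto

text \<open>The Lipschitz bound on the ball supplies the dominating function when difference quotients are integrated.\<close>

lemma bihom_bounded_lipschitz:
  fixes f :: "complex ^ 'd::finite \<Rightarrow> complex"
  assumes "bihom m n f"
  shows "\<exists>B. B \<ge> 0 \<and> (\<forall>x. norm x \<le> 1 \<longrightarrow> norm (f x) \<le> B) \<and>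
    (\<forall>x y. norm x \<le> 1 \<longrightarrow> norm y \<le> 1 \<longrightarrow> norm (f x - f y) \<le> B * norm (x - y))"
proof -
  have product: "\<exists>B. B \<ge> 0 \<and> (\<forall>x. norm x \<le> 1 \<longrightarrow> norm (g x * f x) \<le> B) \<and>
    (\<forall>x y. norm x \<le> 1 \<longrightarrow> norm y \<le> 1 \<longrightarrow> norm (g x * f x - g y * f y) \<le> B * norm (x - y))"
    if g: "\<And>x. norm x \<le> 1 \<Longrightarrow> norm (g x) \<le> 1" "\<And>x y. norm (g x - g y) \<le> norm (x - y)"
      and f: "\<exists>B. B \<ge> 0 \<and> (\<forall>x. norm x \<le> 1 \<longrightarrow> norm (f x) \<le> B) \<and>
        (\<forall>x y. norm x \<le> 1 \<longrightarrow> norm y \<le> 1 \<longrightarrow> norm (f x - f y) \<le> B * norm (x - y))"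
    for f g :: "complex ^ 'd \<Rightarrow> complex"
  proof -
    obtain B where B: "B \<ge> 0" "\<And>x. norm x \<le> 1 \<Longrightarrow> norm (f x) \<le> B"
      "\<And>x y. norm x \<le> 1 \<Longrightarrow> norm y \<le> 1 \<Longrightarrow> norm (f x - f y) \<le> B * norm (x - y)"
      using f by blast
    have "norm (g x * f x) \<le> 2 * B" if "norm x \<le> 1" for x
      using mult_mono[OF g(1) B(2), OF that that] B(1) by (simp add: norm_mult)
    moreover have "norm (g x * f x - g y * f y) \<le> (2 * B) * norm (x - y)" if xy: "norm x \<le> 1" "norm y \<le> 1" for x y
    proof -
      have "g x * f x - g y * f y = g x * (f x - f y) + (g x - g y) * f y" by (simp add: algebra_simps)
      then have "norm (g x * f x - g y * f y) \<le> norm (g x) * norm (f x - f y) + norm (g x - g y) * norm (f y)"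
        by (metis norm_triangle_ineq norm_mult)
      also have "\<dots> \<le> 1 * (B * norm (x - y)) + norm (x - y) * B"
        using g(1)[OF xy(1)] g(2)[of x y] B(2)[OF xy(2)] B(3)[OF xy]
        by (intro add_mono mult_mono) auto
      finally show ?thesis by (simp add: algebra_simps)
    qed
    ultimately show ?thesis using B(1) by (intro exI[of _ "2 * B"]) auto
  qed
  show ?thesis
    using assms
  proof (induction rule: bihom.induct)
    case (bihom_const c)
    then show ?case by (intro exI[of _ "norm c"]) auto
  next
    case (bihom_zero m n)
    then show ?case by (intro exI[of _ 0]) auto
  next
    case (bihom_z m n f j)
    show ?case
    proof (rule product[OF _ _ bihom_z.IH])
      fix x y :: "complex ^ 'd"
      show "norm (x $ j - y $ j) \<le> norm (x - y)"
        using Finite_Cartesian_Product.norm_nth_le[of "x - y" j] by simp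
      show "norm (x $ j) \<le> 1" if "norm x \<le> 1"
        using Finite_Cartesian_Product.norm_nth_le[of x j] that by simp
    qed
  next
    case (bihom_conj m n f j)
    show ?case
    proof (rule product[OF _ _ bihom_conj.IH])
      fix x y :: "complex ^ 'd"
      show "norm (cnj (x $ j) - cnj (y $ j)) \<le> norm (x - y)"
        using Finite_Cartesian_Product.norm_nth_le[of "x - y" j]
        by (metis complex_cnj_diff complex_mod_cnj vector_minus_component)
      show "norm (cnj (x $ j)) \<le> 1" if "norm x \<le> 1"
        using Finite_Cartesian_Product.norm_nth_le[of x j] that by simp
    qed
  next
    case (bihom_add m n f g)
    then obtain B C where B: "B \<ge> 0" "\<And>x. norm x \<le> 1 \<Longrightarrow> norm (f x) \<le> B"
      "\<And>x y. norm x \<le> 1 \<Longrightarrow> norm y \<le> 1 \<Longrightarrow> norm (f x - f y) \<le> B * norm (x - y)"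
      and C: "C \<ge> 0" "\<And>x. norm x \<le> 1 \<Longrightarrow> norm (g x) \<le> C"
      "\<And>x y. norm x \<le> 1 \<Longrightarrow> norm y \<le> 1 \<Longrightarrow> norm (g x - g y) \<le> C * norm (x - y)"
      by blast
    have "norm (f x + g x - (f y + g y)) \<le> (B + C) * norm (x - y)" if "norm x \<le> 1" "norm y \<le> 1" for x y
      using norm_triangle_ineq[of "f x - f y" "g x - g y"] B(3)[OF that] C(3)[OF that]
      by (simp add: algebra_simps)
    moreover have "norm (f x + g x) \<le> B + C" if "norm x \<le> 1" for x
      using norm_triangle_ineq[of "f x" "g x"] B(2)[OF that] C(2)[OF that] by linarith
    ultimately show ?case using B(1) C(1) by (intro exI[of _ "B + C"]) auto
  qed
qed

section \<open>Wirtinger derivatives\<close>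

text \<open>The derivative of a curve in a coordinate direction is the value of the total derivative at that direction.\<close>

lemma partial_of_derivative:
  assumes "(f has_derivative f') (at z)"
  shows "partial_x j f z = f' (axis j 1)" "partial_y j f z = f' (axis j \<i>)"
    "partial_z j f z = (f' (axis j 1) - \<i> * f' (axis j \<i>)) / 2"
    "partial_cnj j f z = (f' (axis j 1) + \<i> * f' (axis j \<i>)) / 2"
proof -
  have dir: "vector_derivative (\<lambda>t::real. f (z + axis j (c * of_real t))) (at 0) = f' (axis j c)" for c :: complex
  proof -
    have eq: "axis j (c * of_real t) = t *\<^sub>R axis j c" for t
      by (simp add: axis_def vec_eq_iff scaleR_conv_of_real[where 'a = complex] mult.commute)
    have "((\<lambda>t::real. z + t *\<^sub>R axis j c) has_vector_derivative axis j c) (at 0)"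
      by (auto intro!: derivative_eq_intros)
    moreover have "(f has_derivative f') (at (z + 0 *\<^sub>R axis j c))" using assms by simp
    ultimately have "((f \<circ> (\<lambda>t::real. z + t *\<^sub>R axis j c)) has_vector_derivative f' (axis j c)) (at 0)"
      by (intro vector_derivative_diff_chain_within) (auto intro: has_derivative_at_withinI)
    then show ?thesis
      unfolding eq o_def by (rule vector_derivative_at)
  qed
  show x: "partial_x j f z = f' (axis j 1)"
    using dir[of 1] by (simp add: partial_x_def)
  show y: "partial_y j f z = f' (axis j \<i>)"
    using dir[of \<i>] by (simp add: partial_y_def)
  show "partial_z j f z = (f' (axis j 1) - \<i> * f' (axis j \<i>)) / 2"
    "partial_cnj j f z = (f' (axis j 1) + \<i> * f' (axis j \<i>)) / 2"
    by (simp_all add: partial_z_def partial_cnj_def x y)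
qed

lemma derivative_eq_partials:
  assumes f: "(f has_derivative f') (at z)"
  shows "f' v = (\<Sum>j\<in>UNIV. v $ j * partial_z j f z + cnj (v $ j) * partial_cnj j f z)"
proof -
  interpret linear f' using f by (rule has_derivative_linear)
  have "v = (\<Sum>j\<in>UNIV. Re (v $ j) *\<^sub>R axis j 1 + Im (v $ j) *\<^sub>R axis j \<i>)"
  proof (rule vec_eq_iff[THEN iffD2], rule allI)
    fix i
    have "(\<Sum>j\<in>UNIV. Re (v $ j) *\<^sub>R axis j 1 + Im (v $ j) *\<^sub>R axis j \<i>) $ i
      = (\<Sum>j\<in>UNIV. if j = i then v $ i else 0)"
      unfolding sum_component
      by (intro sum.cong refl) (auto simp: axis_def complex_eq_iff)
    then show "v $ i = (\<Sum>j\<in>UNIV. Re (v $ j) *\<^sub>R axis j 1 + Im (v $ j) *\<^sub>R axis j \<i>) $ i"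
      by simp
  qed
  then have "f' v = f' (\<Sum>j\<in>UNIV. Re (v $ j) *\<^sub>R axis j 1 + Im (v $ j) *\<^sub>R axis j \<i>)" by simp
  also have "\<dots> = (\<Sum>j\<in>UNIV. Re (v $ j) *\<^sub>R f' (axis j 1) + Im (v $ j) *\<^sub>R f' (axis j \<i>))"
    by (simp add: sum add scale)
  also have "\<dots> = (\<Sum>j\<in>UNIV. v $ j * partial_z j f z + cnj (v $ j) * partial_cnj j f z)"
    by (intro sum.cong refl)
       (simp add: partial_of_derivative[OF f] complex_eq_iff algebra_simps, simp add: field_simps)
  finally show ?thesis .
qed

lemma partial_mult:
  assumes "f differentiable (at z)" "g differentiable (at z)"
  shows "partial_z j (\<lambda>z. f z * g z) z = partial_z j f z * g z + f z * partial_z j g z"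
    and "partial_cnj j (\<lambda>z. f z * g z) z = partial_cnj j f z * g z + f z * partial_cnj j g z"
proof -
  obtain f' g' where d: "(f has_derivative f') (at z)" "(g has_derivative g') (at z)"
    using assms by (auto simp: differentiable_def)
  show "partial_z j (\<lambda>z. f z * g z) z = partial_z j f z * g z + f z * partial_z j g z"
    "partial_cnj j (\<lambda>z. f z * g z) z = partial_cnj j f z * g z + f z * partial_cnj j g z"
    unfolding partial_of_derivative[OF d(1)] partial_of_derivative[OF d(2)]
      partial_of_derivative[OF has_derivative_mult[OF d]]
    by (simp_all add: field_simps)
qed

lemma partial_add:
  assumes "f differentiable (at z)" "g differentiable (at z)"
  shows "partial_z j (\<lambda>z. f z + g z) z = partial_z j f z + partial_z j g z"
    and "partial_cnj j (\<lambda>z. f z + g z) z = partial_cnj j f z + partial_cnj j g z"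
proof -
  obtain f' g' where d: "(f has_derivative f') (at z)" "(g has_derivative g') (at z)"
    using assms by (auto simp: differentiable_def)
  show "partial_z j (\<lambda>z. f z + g z) z = partial_z j f z + partial_z j g z"
    "partial_cnj j (\<lambda>z. f z + g z) z = partial_cnj j f z + partial_cnj j g z"
    unfolding partial_of_derivative[OF d(1)] partial_of_derivative[OF d(2)]
      partial_of_derivative[OF has_derivative_add[OF d]]
    by (simp_all add: field_simps)
qed

lemma partial_const: "partial_z j (\<lambda>_. c) z = 0" "partial_cnj j (\<lambda>_. c) z = 0"
  by (simp_all add: partial_of_derivative[OF has_derivative_const])

lemma partial_coord:
  "partial_z j (\<lambda>z. z $ l) z = (if l = j then 1 else 0)" "partial_cnj j (\<lambda>z. z $ l) z = 0"
  "partial_z j (\<lambda>z. cnj (z $ l)) z = 0" "partial_cnj j (\<lambda>z. cnj (z $ l)) z = (if l = j then 1 else 0)"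
proof -
  have d: "((\<lambda>z. z $ l) has_derivative (\<lambda>z. z $ l)) (at z)"
    by (rule bounded_linear_imp_has_derivative[OF bounded_linear_vec_nth])
  have d': "((\<lambda>z. cnj (z $ l)) has_derivative (\<lambda>z. cnj (z $ l))) (at z)"
    by (rule bounded_linear_imp_has_derivative)
       (rule bounded_linear_compose[OF bounded_linear_cnj bounded_linear_vec_nth])
  show "partial_z j (\<lambda>z. z $ l) z = (if l = j then 1 else 0)" "partial_cnj j (\<lambda>z. z $ l) z = 0"
    "partial_z j (\<lambda>z. cnj (z $ l)) z = 0" "partial_cnj j (\<lambda>z. cnj (z $ l)) z = (if l = j then 1 else 0)"
    unfolding partial_of_derivative[OF d] partial_of_derivative[OF d'] by (auto simp: axis_def)
qed

lemma partial_of_cnj: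
  assumes "f differentiable (at z)"
  shows "partial_z j (\<lambda>z. cnj (f z)) z = cnj (partial_cnj j f z)"
    and "partial_cnj j (\<lambda>z. cnj (f z)) z = cnj (partial_z j f z)"
proof -
  obtain f' where d: "(f has_derivative f') (at z)"
    using assms by (auto simp: differentiable_def)
  have d': "((\<lambda>z. cnj (f z)) has_derivative (\<lambda>z. cnj (f' z))) (at z)"
    by (rule bounded_linear.has_derivative[OF bounded_linear_cnj d])
  show "partial_z j (\<lambda>z. cnj (f z)) z = cnj (partial_cnj j f z)"
    "partial_cnj j (\<lambda>z. cnj (f z)) z = cnj (partial_z j f z)"
    unfolding partial_of_derivative[OF d] partial_of_derivative[OF d'] by simp_all
qed

lemma coord_differentiable: "(\<lambda>z. z $ j) differentiable (at z)" "(\<lambda>z. cnj (z $ j)) differentiable (at z)"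
  for z :: "complex ^ 'd::finite"
  using bihom_differentiable[OF bihom_coord(1)] bihom_differentiable[OF bihom_coord(2)] by auto

lemma partial_coord_mult:
  assumes "bihom m n f"
  shows "partial_z j (\<lambda>z. z $ l * f z) = (\<lambda>z. (if l = j then 1 else 0) * f z + z $ l * partial_z j f z)"
    "partial_cnj j (\<lambda>z. z $ l * f z) = (\<lambda>z. z $ l * partial_cnj j f z)"
    "partial_z j (\<lambda>z. cnj (z $ l) * f z) = (\<lambda>z. cnj (z $ l) * partial_z j f z)"
    "partial_cnj j (\<lambda>z. cnj (z $ l) * f z) = (\<lambda>z. (if l = j then 1 else 0) * f z + cnj (z $ l) * partial_cnj j f z)"
  using bihom_differentiable[OF assms]
  by (simp_all add: fun_eq_iff partial_mult coord_differentiable partial_coord)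

lemma bihom_partial_z: "bihom m n f \<Longrightarrow> bihom (m - 1) n (partial_z j f) \<and> (m = 0 \<longrightarrow> partial_z j f = (\<lambda>_. 0))"
proof (induction rule: bihom.induct)
  case (bihom_z m n f l)
  have "bihom m n (\<lambda>z. z $ l * partial_z j f z)"
    using bihom_z.IH bihom.bihom_z[of "m - 1" n "partial_z j f" l] by (cases m) (auto intro: bihom_zero)
  then show ?case
    using bihom_z.hyps by (auto simp: partial_coord_mult intro!: bihom_add bihom_zero)
next
  case (bihom_conj m n f l)
  then show ?case by (auto simp: partial_coord_mult intro!: bihom.bihom_conj bihom_zero)
next
  case (bihom_add m n f g)
  have "partial_z j (\<lambda>z. f z + g z) = (\<lambda>z. partial_z j f z + partial_z j g z)"
    using bihom_add.hyps[THEN bihom_differentiable] by (simp add: fun_eq_iff partial_add)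
  then show ?case using bihom_add.IH by (auto intro: bihom.bihom_add)
qed (auto simp: partial_const[abs_def] fun_eq_iff intro: bihom_zero)

lemma bihom_partial_cnj: "bihom m n f \<Longrightarrow> bihom m (n - 1) (partial_cnj j f) \<and> (n = 0 \<longrightarrow> partial_cnj j f = (\<lambda>_. 0))"
proof (induction rule: bihom.induct)
  case (bihom_conj m n f l)
  have "bihom m n (\<lambda>z. cnj (z $ l) * partial_cnj j f z)"
    using bihom_conj.IH bihom.bihom_conj[of m "n - 1" "partial_cnj j f" l] by (cases n) (auto intro: bihom_zero)
  then show ?case
    using bihom_conj.hyps by (auto simp: partial_coord_mult intro!: bihom_add bihom_zero)
next
  case (bihom_z m n f l)
  then show ?case by (auto simp: partial_coord_mult intro!: bihom.bihom_z bihom_zero)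
next
  case (bihom_add m n f g)
  have "partial_cnj j (\<lambda>z. f z + g z) = (\<lambda>z. partial_cnj j f z + partial_cnj j g z)"
    using bihom_add.hyps[THEN bihom_differentiable] by (simp add: fun_eq_iff partial_add)
  then show ?case using bihom_add.IH by (auto intro: bihom.bihom_add)
qed (auto simp: partial_const[abs_def] fun_eq_iff intro: bihom_zero)

lemma euler_z: "bihom m n f \<Longrightarrow> (\<Sum>j\<in>UNIV. z $ j * partial_z j f z) = of_nat m * f z"
proof (induction rule: bihom.induct)
  case (bihom_z m n f l)
  have "(\<Sum>j\<in>UNIV. z $ j * ((if l = j then 1 else 0) * f z + z $ l * partial_z j f z))
    = (\<Sum>j\<in>UNIV. if l = j then z $ l * f z else 0) + z $ l * (\<Sum>j\<in>UNIV. z $ j * partial_z j f z)"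
    unfolding sum_distrib_left sum.distrib[symmetric] by (intro sum.cong) (auto simp: algebra_simps)
  then show ?case
    unfolding partial_coord_mult[OF bihom_z.hyps] bihom_z.IH by (simp add: algebra_simps)
next
  case (bihom_conj m n f l)
  have "(\<Sum>j\<in>UNIV. z $ j * (cnj (z $ l) * partial_z j f z)) = cnj (z $ l) * (\<Sum>j\<in>UNIV. z $ j * partial_z j f z)"
    by (simp add: sum_distrib_left algebra_simps)
  then show ?case
    unfolding partial_coord_mult[OF bihom_conj.hyps] bihom_conj.IH by (simp add: algebra_simps)
next
  case (bihom_add m n f g)
  then show ?case
    using bihom_add.hyps[THEN bihom_differentiable] by (simp add: partial_add algebra_simps sum.distrib)
qed (auto simp: partial_const)

lemma euler_cnj:
  assumes "bihom m n f"
  shows "(\<Sum>j\<in>UNIV. cnj (z $ j) * partial_cnj j f z) = of_nat n * f z"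
proof -
  have "(\<Sum>j\<in>UNIV. z $ j * cnj (partial_cnj j f z)) = of_nat n * cnj (f z)"
    using euler_z[OF bihom_cnj[OF assms], of z] by (simp add: partial_of_cnj bihom_differentiable[OF assms])
  from arg_cong[OF this, of cnj] show ?thesis by simp
qed

lemma partial_commute: "bihom m n f \<Longrightarrow> partial_cnj j (partial_z k f) = partial_z k (partial_cnj j f)"
proof (induction rule: bihom.induct)
  case (bihom_const c)
  then show ?case by (simp add: partial_const[abs_def])
next
  case (bihom_zero m n)
  then show ?case by (simp add: partial_const[abs_def])
next
  case (bihom_z m n f l)
  have d: "bihom (m - 1) n (partial_z k f)" "bihom m (n - 1) (partial_cnj j f)"
    using bihom_z.hyps by (simp_all add: bihom_partial_z[THEN conjunct1] bihom_partial_cnj[THEN conjunct1] del: One_nat_def)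
  show ?case
    using bihom_z bihom_differentiable[OF bihom_z.hyps] bihom_differentiable[OF bihom.bihom_z[OF d(1)]] d
    by (auto simp: partial_coord_mult fun_eq_iff partial_add partial_const)
next
  case (bihom_conj m n f l)
  have d: "bihom (m - 1) n (partial_z k f)" "bihom m (n - 1) (partial_cnj j f)"
    using bihom_conj.hyps by (simp_all add: bihom_partial_z[THEN conjunct1] bihom_partial_cnj[THEN conjunct1] del: One_nat_def)
  show ?case
    using bihom_conj bihom_differentiable[OF bihom_conj.hyps] bihom_differentiable[OF bihom.bihom_conj[OF d(2)]] d
    by (auto simp: partial_coord_mult fun_eq_iff partial_add partial_const)
next
  case (bihom_add m n f g)
  have d: "bihom (m - 1) n (partial_z k f)" "bihom m (n - 1) (partial_cnj j f)"
     "bihom (m - 1) n (partial_z k g)" "bihom m (n - 1) (partial_cnj j g)"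
    using bihom_add.hyps by (simp_all add: bihom_partial_z[THEN conjunct1] bihom_partial_cnj[THEN conjunct1] del: One_nat_def)
  have "partial_z k (\<lambda>z. f z + g z) = (\<lambda>z. partial_z k f z + partial_z k g z)"
    "partial_cnj j (\<lambda>z. f z + g z) = (\<lambda>z. partial_cnj j f z + partial_cnj j g z)"
    using bihom_add.hyps[THEN bihom_differentiable] by (simp_all add: fun_eq_iff partial_add)
  then show ?case
    using bihom_add.IH d[THEN bihom_differentiable] by (simp add: fun_eq_iff partial_add)
qed

section \<open>Integration by parts on the sphere\<close>

lemma bihom_integrable: "bihom m n f \<Longrightarrow> integrable surface_measure f"
  by (intro continuous_integrable_surface bihom_continuous)

lemma isometry_surj:
  fixes U :: "'a::euclidean_space \<Rightarrow> 'a"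
  assumes "linear U" "\<And>x. norm (U x) = norm x"
  shows "surj U"
proof -
  have "inj U"
    using assms by (subst linear_injective_0) (metis norm_eq_zero)+
  then show ?thesis using linear_injective_imp_surjective[OF assms(1)] by simp
qed

lemma norm_square_vec: "(norm z)\<^sup>2 = (\<Sum>i\<in>UNIV. (norm (z $ i))\<^sup>2)"
  by (simp add: norm_vec_def L2_set_def sum_nonneg)

text \<open>The integral of \<open>f (U t z)\<close> does not depend on \<open>t\<close>, so the integral of its derivative at \<open>0\<close> vanishes. This turns
  the invariance of surface measure under a one-parameter family of isometries into an integration by parts rule;
  the sum is the derivative of \<open>f\<close> in the direction of the generator \<open>A\<close>.\<close>

lemma integral_generator_zero:
  fixes U :: "real \<Rightarrow> complex ^ 'd::finite \<Rightarrow> complex ^ 'd"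
  assumes f: "bihom m n f"
    and U: "\<And>t. linear (U t)" "\<And>t x. norm (U t x) = norm x" "\<And>z. U 0 z = z"
    and A: "\<And>z. ((\<lambda>t. U t z) has_vector_derivative A z) (at 0)"
    and A_cont: "continuous_on (sphere 0 1) A"
    and lip: "\<And>t z. norm z = 1 \<Longrightarrow> norm (U t z - z) \<le> C * \<bar>t\<bar>"
  shows "(LINT z|surface_measure. (\<Sum>j\<in>UNIV. A z $ j * partial_z j f z + cnj (A z $ j) * partial_cnj j f z)) = 0"
proof -
  interpret finite_measure "surface_measure :: (complex ^ 'd) measure" by (rule finite_measure_surface_measure)
  define X where "X z = (\<Sum>j\<in>UNIV. A z $ j * partial_z j f z + cnj (A z $ j) * partial_cnj j f z)" for z
  define q where "q k z = of_nat (Suc k) * (f (U (inverse (real (Suc k))) z) - f z)" for k z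
  have fc: "continuous_on B f" for B by (rule bihom_continuous[OF f])
  have Uc: "continuous_on B (U t)" for B t
    by (intro linear_continuous_on linear_conv_bounded_linear[THEN iffD1] U)
  have int0: "(LINT z|surface_measure. q k z) = 0" for k
  proof -
    let ?t = "inverse (real (Suc k))"
    have "(LINT z|surface_measure. f (U ?t z)) = (LINT z|surface_measure. f z)"
      by (intro integral_surface_measure_isometry U isometry_surj continuous_borel_measurable_surface fc)
    moreover have "integrable surface_measure (\<lambda>z. f (U ?t z))"
      by (intro continuous_integrable_surface continuous_on_compose2[OF fc[of UNIV] Uc]) auto
    ultimately show ?thesis
      using bihom_integrable[OF f] unfolding q_def by simp
  qed
  obtain L where L: "L \<ge> 0" "\<And>x y. norm x \<le> 1 \<Longrightarrow> norm y \<le> 1 \<Longrightarrow> norm (f x - f y) \<le> L * norm (x - y)"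
    using bihom_bounded_lipschitz[OF f] by blast
  have "(\<lambda>k. LINT z|surface_measure. q k z) \<longlonglongrightarrow> (LINT z|surface_measure. X z)"
  proof (rule integral_dominated_convergence[where w = "\<lambda>_. L * C"])
    have "continuous_on (sphere 0 1) X"
      unfolding X_def using f A_cont
      by (intro continuous_intros bihom_continuous[OF bihom_partial_z[THEN conjunct1]]
            bihom_continuous[OF bihom_partial_cnj[THEN conjunct1]]) auto
    then show "X \<in> borel_measurable surface_measure" by (rule continuous_borel_measurable_surface)
    show "q k \<in> borel_measurable surface_measure" for k
      unfolding q_def
      by (intro continuous_borel_measurable_surface continuous_intros fc continuous_on_compose2[OF fc[of UNIV] Uc]) auto
    show "integrable surface_measure (\<lambda>_::complex ^ 'd. L * C)" by simp
    show "AE z in surface_measure. (\<lambda>k. q k z) \<longlonglongrightarrow> X z"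
    proof (rule AE_I2)
      fix z :: "complex ^ 'd"
      obtain f' where f': "(f has_derivative f') (at z)"
        using bihom_differentiable[OF f] by (auto simp: differentiable_def)
      have "((f \<circ> (\<lambda>t. U t z)) has_vector_derivative f' (A z)) (at 0)"
        using A[of z] f' U(3)
        by (intro vector_derivative_diff_chain_within) (auto intro: has_derivative_at_withinI)
      then have "(\<lambda>h. norm (f (U h z) - f z - h *\<^sub>R f' (A z)) / norm h) \<midarrow>0\<rightarrow> 0"
        by (simp add: has_vector_derivative_def has_derivative_at U(3))
      then have "(\<lambda>k. norm (f (U (inverse (real (Suc k))) z) - f z - inverse (real (Suc k)) *\<^sub>R f' (A z)) / norm (inverse (real (Suc k)))) \<longlonglongrightarrow> 0"
        by (rule filterlim_compose) (intro filterlim_atI LIMSEQ_inverse_real_of_nat always_eventually, simp)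
      moreover have "norm (f (U (inverse (real (Suc k))) z) - f z - inverse (real (Suc k)) *\<^sub>R f' (A z)) / norm (inverse (real (Suc k)))
          = norm (q k z - f' (A z))" for k
      proof -
        have "q k z - f' (A z) = of_nat (Suc k) * (f (U (inverse (real (Suc k))) z) - f z - inverse (real (Suc k)) *\<^sub>R f' (A z))"
          by (simp add: q_def scaleR_conv_of_real right_diff_distrib del: of_nat_Suc)
        then have "norm (q k z - f' (A z)) = real (Suc k) * norm (f (U (inverse (real (Suc k))) z) - f z - inverse (real (Suc k)) *\<^sub>R f' (A z))"
          by (simp only: norm_mult norm_of_nat)
        then show ?thesis by (simp add: divide_inverse del: of_nat_Suc)
      qed
      ultimately have "(\<lambda>k. norm (q k z - f' (A z))) \<longlonglongrightarrow> 0" by simp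
      then have "(\<lambda>k. q k z) \<longlonglongrightarrow> f' (A z)"
        by (simp add: tendsto_norm_zero_iff LIM_zero_iff)
      then show "(\<lambda>k. q k z) \<longlonglongrightarrow> X z"
        by (simp add: X_def derivative_eq_partials[OF f'])
    qed
    show "AE z in surface_measure. norm (q k z) \<le> L * C" for k
    proof (rule AE_I2)
      fix z :: "complex ^ 'd" assume "z \<in> space surface_measure"
      then have z: "norm z = 1" by simp
      let ?t = "inverse (real (Suc k))"
      have "norm (f (U ?t z) - f z) \<le> L * norm (U ?t z - z)"
        using z U(2) by (intro L(2)) auto
      also have "\<dots> \<le> L * (C * \<bar>?t\<bar>)" by (intro mult_left_mono lip z L(1))
      finally have "real (Suc k) * norm (f (U ?t z) - f z) \<le> real (Suc k) * (L * (C * \<bar>?t\<bar>))"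
        by (intro mult_left_mono) auto
      also have "\<dots> = L * C" by (simp del: of_nat_Suc)
      finally show "norm (q k z) \<le> L * C"
        unfolding q_def norm_mult norm_of_nat .
    qed
  qed
  then show ?thesis
    unfolding int0 X_def using LIMSEQ_unique tendsto_const by blast
qed

text \<open>A rotation in the plane of the coordinates \<open>j\<close> and \<open>l\<close>, with phase \<open>u\<close>.\<close>

definition plane_rotation :: "complex \<Rightarrow> 'd \<Rightarrow> 'd \<Rightarrow> real \<Rightarrow> complex ^ 'd \<Rightarrow> complex ^ 'd" where
  "plane_rotation u j l t z = (\<chi> i. if i = j then of_real (cos t) * z $ j + u * of_real (sin t) * z $ l
     else if i = l then of_real (cos t) * z $ l - cnj u * of_real (sin t) * z $ j else z $ i)"

lemma sum_UNIV_two: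
  fixes F :: "'d::finite \<Rightarrow> 'b::comm_monoid_add"
  assumes "j \<noteq> l"
  shows "sum F UNIV = F j + (F l + sum F (UNIV - {j} - {l}))"
  using assms by (simp add: sum.remove[of UNIV j] sum.remove[of "UNIV - {j}" l])

lemma norm_unit_square: "norm u = 1 \<Longrightarrow> u * cnj u = 1"
  by (simp add: complex_norm_square[symmetric])

lemma plane_rotation_norm:
  assumes "norm u = 1" "j \<noteq> l"
  shows "norm (plane_rotation u j l t z) = norm z"
proof -
  define a b c s where "a = z $ j" and "b = z $ l" and "c = (of_real (cos t) :: complex)" and "s = (of_real (sin t) :: complex)"
  have cs: "c * c + s * s = 1"
    unfolding c_def s_def of_real_mult[symmetric] of_real_add[symmetric]
    using sin_cos_squared_add[of t] by (simp add: power2_eq_square)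
  have uu: "u * cnj u = 1" by (rule norm_unit_square[OF assms(1)])
  have cc: "cnj c = c" "cnj s = s" by (simp_all add: c_def s_def)
  have "complex_of_real ((norm (c * a + u * s * b))\<^sup>2 + (norm (c * b - cnj u * s * a))\<^sup>2) =
     (c * c + s * s * (u * cnj u)) * (a * cnj a + b * cnj b)"
    by (simp add: complex_norm_square cc algebra_simps del: of_real_power)
  also have "\<dots> = complex_of_real ((norm a)\<^sup>2 + (norm b)\<^sup>2)"
    by (simp add: uu cs complex_norm_square del: of_real_power)
  finally have "(norm (c * a + u * s * b))\<^sup>2 + (norm (c * b - cnj u * s * a))\<^sup>2 = (norm a)\<^sup>2 + (norm b)\<^sup>2"
    using of_real_eq_iff by blast
  moreover have "(\<Sum>i\<in>UNIV - {j} - {l}. (norm (plane_rotation u j l t z $ i))\<^sup>2) = (\<Sum>i\<in>UNIV - {j} - {l}. (norm (z $ i))\<^sup>2)"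
    by (intro sum.cong) (auto simp: plane_rotation_def)
  ultimately have "(norm (plane_rotation u j l t z))\<^sup>2 = (norm z)\<^sup>2"
    using assms(2) unfolding norm_square_vec sum_UNIV_two[OF assms(2)]
    by (simp add: plane_rotation_def a_def b_def c_def s_def)
  then show ?thesis by simp
qed

lemma integral_plane_rotation:
  assumes f: "bihom m n f" and u: "norm u = 1" and jl: "j \<noteq> l"
  shows "(LINT z|surface_measure. u * (z $ l * partial_z j f z - cnj (z $ j) * partial_cnj l f z)
     + cnj u * (cnj (z $ l) * partial_cnj j f z - z $ j * partial_z l f z)) = 0"
proof -
  define A where "A z = (\<chi> i. if i = j then u * z $ l else if i = l then - cnj u * z $ j else 0)" for z :: "complex ^ 'a"
  define P where "P z = (\<chi> i. if i = j \<or> i = l then z $ i else 0)" for z :: "complex ^ 'a"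
  have rot: "plane_rotation u j l t z = z + (cos t - 1) *\<^sub>R P z + sin t *\<^sub>R A z" for t z
    using jl by (auto simp: plane_rotation_def A_def P_def vec_eq_iff scaleR_conv_of_real[where 'a = complex] algebra_simps)
  have nP: "norm (P z) \<le> norm z" and nA: "norm (A z) \<le> norm z" for z
  proof -
    have "(norm (P z))\<^sup>2 \<le> (norm z)\<^sup>2"
      unfolding norm_square_vec by (intro sum_mono) (simp add: P_def)
    then show "norm (P z) \<le> norm z" by (rule power2_le_imp_le) simp
    have "(\<Sum>i\<in>UNIV - {j} - {l}. (norm (A z $ i))\<^sup>2) \<le> (\<Sum>i\<in>UNIV - {j} - {l}. (norm (z $ i))\<^sup>2)"
      by (intro sum_mono) (auto simp: A_def)
    then have "(norm (A z))\<^sup>2 \<le> (norm z)\<^sup>2"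
      using jl u unfolding norm_square_vec sum_UNIV_two[OF jl]
      by (simp add: A_def norm_mult)
    then show "norm (A z) \<le> norm z" by (rule power2_le_imp_le) simp
  qed
  have "(LINT z|surface_measure. (\<Sum>i\<in>UNIV. A z $ i * partial_z i f z + cnj (A z $ i) * partial_cnj i f z)) = 0"
  proof (rule integral_generator_zero[OF f, where U = "plane_rotation u j l" and C = 2])
    show "linear (plane_rotation u j l t)" for t
      by (rule linearI) (auto simp: plane_rotation_def vec_eq_iff algebra_simps scaleR_conv_of_real[where 'a = complex])
    show "norm (plane_rotation u j l t x) = norm x" for t x
      by (rule plane_rotation_norm[OF u jl])
    show "plane_rotation u j l 0 z = z" for z
      by (simp add: rot)
    show "((\<lambda>t. plane_rotation u j l t z) has_vector_derivative A z) (at 0)" for z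
      unfolding rot by (auto intro!: derivative_eq_intros)
    show "continuous_on (sphere 0 1) A"
    proof -
      have "continuous_on (sphere 0 1) (\<lambda>x. if i = j then u * x $ l else if i = l then - cnj u * x $ j else 0)" for i
        by (cases "i = j"; cases "i = l") (auto intro!: continuous_intros)
      then show ?thesis unfolding A_def by (intro continuous_on_vec_lambda)
    qed
    fix t :: real and z :: "complex ^ 'a" assume z: "norm z = 1"
    have "\<bar>cos t - 1\<bar> \<le> \<bar>t\<bar>"
    proof -
      have "\<bar>cos t - cos 0\<bar> \<le> 1 * \<bar>t - 0\<bar>"
        using field_differentiable_bound[of UNIV cos "\<lambda>x. - sin x" 1 t 0] by (auto intro!: derivative_eq_intros)
      then show ?thesis by simp
    qed
    have "plane_rotation u j l t z - z = (cos t - 1) *\<^sub>R P z + sin t *\<^sub>R A z"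
      by (simp add: rot)
    then have "norm (plane_rotation u j l t z - z) \<le> \<bar>cos t - 1\<bar> * norm (P z) + \<bar>sin t\<bar> * norm (A z)"
      by (metis norm_triangle_ineq norm_scaleR)
    also have "\<dots> \<le> \<bar>t\<bar> * 1 + \<bar>t\<bar> * 1"
      using nP[of z] nA[of z] z \<open>\<bar>cos t - 1\<bar> \<le> \<bar>t\<bar>\<close> abs_sin_x_le_abs_x[of t] by (intro add_mono mult_mono) auto
    finally show "norm (plane_rotation u j l t z - z) \<le> 2 * \<bar>t\<bar>" by simp
  qed
  moreover have "(\<Sum>i\<in>UNIV. A z $ i * partial_z i f z + cnj (A z $ i) * partial_cnj i f z) =
     u * (z $ l * partial_z j f z - cnj (z $ j) * partial_cnj l f z)
     + cnj u * (cnj (z $ l) * partial_cnj j f z - z $ j * partial_z l f z)" for z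
    unfolding sum_UNIV_two[OF jl] using jl by (simp add: A_def algebra_simps)
  ultimately show ?thesis by simp
qed

lemma bihom_derivative_terms:
  assumes "bihom m n f"
  shows "bihom (m - 1) n (partial_z j f)" "bihom m (n - 1) (partial_cnj j f)"
    "bihom (Suc (m - 1)) n (\<lambda>z. z $ l * partial_z j f z)" "bihom m (Suc (n - 1)) (\<lambda>z. cnj (z $ l) * partial_cnj j f z)"
  using assms by (simp_all add: bihom_partial_z[THEN conjunct1] bihom_partial_cnj[THEN conjunct1] bihom_z bihom_conj del: One_nat_def)

lemma continuous_partials:
  assumes "bihom m n f"
  shows "continuous_on A (partial_z j f)" "continuous_on A (partial_cnj j f)"
  by (rule bihom_continuous[OF bihom_derivative_terms(1)[OF assms]] bihom_continuous[OF bihom_derivative_terms(2)[OF assms]])+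

lemma coord_integrable:
  fixes f :: "complex ^ 'd::finite \<Rightarrow> complex"
  assumes "continuous_on (sphere 0 1) f"
  shows "integrable surface_measure (\<lambda>z. z $ l * f z)" "integrable surface_measure (\<lambda>z. cnj (z $ l) * f z)"
    "integrable surface_measure f"
  using assms by (auto intro!: continuous_integrable_surface continuous_intros)

text \<open>The infinitesimal form of unitary invariance. For \<open>j = l\<close> it comes from the phase rotations of one coordinate, and for
  \<open>j \<noteq> l\<close> from the plane rotations with phases \<open>1\<close> and \<open>\<i>\<close>, which together separate the two complex terms.\<close>

lemma integral_rotation_generator:
  assumes f: "bihom m n f"
  shows "(LINT z|surface_measure. z $ l * partial_z j f z) = (LINT z|surface_measure. cnj (z $ j) * partial_cnj l f z)"
proof (cases "j = l")
  case True
  define U where "U t z = (\<chi> i. if i = l then cis t * z $ i else z $ i)" for t and z :: "complex ^ 'a"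
  define A where "A z = (\<chi> i. if i = l then \<i> * z $ i else 0)" for z :: "complex ^ 'a"
  define P where "P z = (\<chi> i. if i = l then z $ i else 0)" for z :: "complex ^ 'a"
  have rot: "U t z = z + (cos t - 1) *\<^sub>R P z + sin t *\<^sub>R A z" for t z
    by (auto simp: U_def A_def P_def vec_eq_iff scaleR_conv_of_real[where 'a = complex] algebra_simps complex_eq_iff)
  have nP: "norm (P z) \<le> norm z" and nA: "norm (A z) \<le> norm z" for z
  proof -
    have "(norm (P z))\<^sup>2 \<le> (norm z)\<^sup>2" "(norm (A z))\<^sup>2 \<le> (norm z)\<^sup>2"
      unfolding norm_square_vec by (intro sum_mono; simp add: P_def A_def norm_mult)+
    then show "norm (P z) \<le> norm z" "norm (A z) \<le> norm z"
      by (auto intro: power2_le_imp_le)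
  qed
  have "(LINT z|surface_measure. (\<Sum>i\<in>UNIV. A z $ i * partial_z i f z + cnj (A z $ i) * partial_cnj i f z)) = 0"
  proof (rule integral_generator_zero[OF f, where U = U and C = 2])
    show "linear (U t)" for t
      by (rule linearI) (auto simp: U_def vec_eq_iff algebra_simps)
    show "norm (U t x) = norm x" for t x
    proof -
      have "(norm (U t x))\<^sup>2 = (norm x)\<^sup>2"
        unfolding norm_square_vec by (intro sum.cong) (auto simp: U_def norm_mult)
      then show ?thesis by simp
    qed
    show "U 0 z = z" for z
      by (simp add: rot)
    show "((\<lambda>t. U t z) has_vector_derivative A z) (at 0)" for z
      unfolding rot by (auto intro!: derivative_eq_intros)
    show "continuous_on (sphere 0 1) A"
    proof -
      have "continuous_on (sphere 0 1) (\<lambda>x. if i = l then \<i> * x $ i else 0)" for i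
        by (cases "i = l") (auto intro!: continuous_intros)
      then show ?thesis unfolding A_def by (intro continuous_on_vec_lambda)
    qed
    fix t :: real and z :: "complex ^ 'a" assume z: "norm z = 1"
    have "\<bar>cos t - 1\<bar> \<le> \<bar>t\<bar>"
    proof -
      have "\<bar>cos t - cos 0\<bar> \<le> 1 * \<bar>t - 0\<bar>"
        using field_differentiable_bound[of UNIV cos "\<lambda>x. - sin x" 1 t 0] by (auto intro!: derivative_eq_intros)
      then show ?thesis by simp
    qed
    have "U t z - z = (cos t - 1) *\<^sub>R P z + sin t *\<^sub>R A z"
      by (simp add: rot)
    then have "norm (U t z - z) \<le> \<bar>cos t - 1\<bar> * norm (P z) + \<bar>sin t\<bar> * norm (A z)"
      by (metis norm_triangle_ineq norm_scaleR)
    also have "\<dots> \<le> \<bar>t\<bar> * 1 + \<bar>t\<bar> * 1"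
      using nP[of z] nA[of z] z \<open>\<bar>cos t - 1\<bar> \<le> \<bar>t\<bar>\<close> abs_sin_x_le_abs_x[of t] by (intro add_mono mult_mono) auto
    finally show "norm (U t z - z) \<le> 2 * \<bar>t\<bar>" by simp
  qed
  moreover have "(\<Sum>i\<in>UNIV. A z $ i * partial_z i f z + cnj (A z $ i) * partial_cnj i f z) =
     \<i> * (z $ l * partial_z l f z - cnj (z $ l) * partial_cnj l f z)" for z
    by (subst sum.remove[of _ l]) (auto simp: A_def algebra_simps)
  ultimately have "(LINT z|surface_measure. \<i> * (z $ l * partial_z l f z - cnj (z $ l) * partial_cnj l f z)) = 0" by simp
  then show ?thesis
    using True continuous_partials[OF f] by (simp add: coord_integrable)
next
  case False
  define P where "P = (LINT z|surface_measure. z $ l * partial_z j f z - cnj (z $ j) * partial_cnj l f z)"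
  define Q where "Q = (LINT z|surface_measure. cnj (z $ l) * partial_cnj j f z - z $ j * partial_z l f z)"
  have int: "integrable surface_measure (\<lambda>z. z $ l * partial_z j f z - cnj (z $ j) * partial_cnj l f z)"
    "integrable surface_measure (\<lambda>z. cnj (z $ l) * partial_cnj j f z - z $ j * partial_z l f z)"
    using continuous_partials[OF f] by (auto intro!: Bochner_Integration.integrable_diff coord_integrable(1,2))
  have "u * P + cnj u * Q = 0" if "norm u = 1" for u
    using integral_plane_rotation[OF f that False] int unfolding P_def Q_def by simp
  from this[of 1] this[of \<i>] have "P = 0" by (simp add: complex_eq_iff)
  then show ?thesis
    using continuous_partials[OF f] unfolding P_def by (simp add: coord_integrable)
qed

lemma sphere_coord_sum: "z \<in> sphere 0 1 \<Longrightarrow> (\<Sum>l\<in>UNIV. z $ l * cnj (z $ l)) = (1::complex)"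
  for z :: "complex ^ 'd::finite"
proof -
  assume "z \<in> sphere 0 1"
  then have "(\<Sum>l\<in>UNIV. (norm (z $ l))\<^sup>2) = 1" using norm_square_vec[of z] by simp
  then have "complex_of_real (\<Sum>l\<in>UNIV. (norm (z $ l))\<^sup>2) = 1" by simp
  then show ?thesis by (simp add: complex_norm_square del: of_real_power)
qed

text \<open>The diagonal case of the rotation rule, summed over the coordinates, together with Euler's identities gives
  \<open>m * \<integral>f = n * \<integral>f\<close>.\<close>

lemma integral_bihom_unbalanced:
  fixes f :: "complex ^ 'd::finite \<Rightarrow> complex"
  assumes f: "bihom m n f" and "m \<noteq> n"
  shows "(LINT z|surface_measure. f z) = 0"
proof -
  have "of_nat m * (LINT z|surface_measure. f z) = (LINT z|surface_measure. (\<Sum>l\<in>UNIV. z $ l * partial_z l f z))"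
    by (simp add: euler_z[OF f])
  also have "\<dots> = (\<Sum>l\<in>UNIV. LINT z|surface_measure. z $ l * partial_z l f z)"
    using continuous_partials[OF f] by (intro Bochner_Integration.integral_sum) (auto intro: coord_integrable)
  also have "\<dots> = (\<Sum>l\<in>UNIV. LINT z|surface_measure. cnj (z $ l) * partial_cnj l f z)"
    by (simp add: integral_rotation_generator[OF f])
  also have "\<dots> = (LINT z|surface_measure. (\<Sum>l\<in>UNIV. cnj (z $ l) * partial_cnj l f z))"
    using continuous_partials[OF f] by (intro Bochner_Integration.integral_sum[symmetric]) (auto intro: coord_integrable)
  also have "\<dots> = of_nat n * (LINT z|surface_measure. f z)"
    by (simp add: euler_cnj[OF f])
  finally have "(of_nat m - of_nat n) * (LINT z|surface_measure. f z) = 0" by (simp add: algebra_simps)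
  then show ?thesis using assms(2) by simp
qed

text \<open>On the sphere the derivative may be multiplied by \<open>\<Sum>\<^sub>l z\<^sub>l * cnj z\<^sub>l = 1\<close>. The rotation rule then moves it to the
  conjugate coordinates, where Euler's identity evaluates the sum.\<close>

lemma integral_partial_z:
  fixes f :: "complex ^ 'd::finite \<Rightarrow> complex"
  assumes f: "bihom m n f"
  shows "(LINT z|surface_measure. partial_z j f z) = of_nat (CARD('d) + n) * (LINT z|surface_measure. cnj (z $ j) * f z)"
proof -
  have fc: "bihom m (Suc n) (\<lambda>z. cnj (z $ l) * f z)" for l by (rule bihom_conj[OF f])
  have fi: "integrable surface_measure (\<lambda>z. cnj (z $ j) * f z)" by (rule bihom_integrable[OF fc])
  have "(LINT z|surface_measure. partial_z j f z) = (LINT z|surface_measure. (\<Sum>l\<in>UNIV. z $ l * partial_z j (\<lambda>z. cnj (z $ l) * f z) z))"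
  proof (rule Bochner_Integration.integral_cong[OF refl])
    fix z :: "complex ^ 'd" assume "z \<in> space surface_measure"
    then have "(\<Sum>l\<in>UNIV. z $ l * cnj (z $ l)) * partial_z j f z = partial_z j f z"
      by (subst sphere_coord_sum) auto
    then show "partial_z j f z = (\<Sum>l\<in>UNIV. z $ l * partial_z j (\<lambda>z. cnj (z $ l) * f z) z)"
      by (simp add: partial_coord_mult[OF f] sum_distrib_right mult.assoc)
  qed
  also have "\<dots> = (\<Sum>l\<in>UNIV. LINT z|surface_measure. z $ l * partial_z j (\<lambda>z. cnj (z $ l) * f z) z)"
    using continuous_partials[OF fc] by (intro Bochner_Integration.integral_sum) (auto intro: coord_integrable)
  also have "\<dots> = (\<Sum>l\<in>UNIV. LINT z|surface_measure. cnj (z $ j) * partial_cnj l (\<lambda>z. cnj (z $ l) * f z) z)"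
    by (simp add: integral_rotation_generator[OF fc])
  also have "\<dots> = (LINT z|surface_measure. (\<Sum>l\<in>UNIV. cnj (z $ j) * partial_cnj l (\<lambda>z. cnj (z $ l) * f z) z))"
    using continuous_partials[OF fc] by (intro Bochner_Integration.integral_sum[symmetric]) (auto intro: coord_integrable)
  also have "\<dots> = (LINT z|surface_measure. of_nat (CARD('d) + n) * (cnj (z $ j) * f z))"
  proof (rule Bochner_Integration.integral_cong[OF refl])
    fix z :: "complex ^ 'd"
    have "(\<Sum>l\<in>UNIV. cnj (z $ j) * partial_cnj l (\<lambda>z. cnj (z $ l) * f z) z) = cnj (z $ j) * (\<Sum>l\<in>UNIV. f z + cnj (z $ l) * partial_cnj l f z)"
      by (simp add: partial_coord_mult[OF f] sum_distrib_left)
    also have "\<dots> = of_nat (CARD('d) + n) * (cnj (z $ j) * f z)"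
      unfolding sum.distrib euler_cnj[OF f] by (simp add: algebra_simps)
    finally show "(\<Sum>l\<in>UNIV. cnj (z $ j) * partial_cnj l (\<lambda>z. cnj (z $ l) * f z) z) = of_nat (CARD('d) + n) * (cnj (z $ j) * f z)" .
  qed
  also have "\<dots> = of_nat (CARD('d) + n) * (LINT z|surface_measure. cnj (z $ j) * f z)"
    using fi by simp
  finally show ?thesis .
qed

lemma integral_partial_cnj:
  fixes f :: "complex ^ 'd::finite \<Rightarrow> complex"
  assumes f: "bihom m n f"
  shows "(LINT z|surface_measure. partial_cnj j f z) = of_nat (CARD('d) + m) * (LINT z|surface_measure. z $ j * f z)"
proof -
  have "partial_z j (\<lambda>z. cnj (f z)) = (\<lambda>z. cnj (partial_cnj j f z))"
    by (rule ext) (rule partial_of_cnj(1)[OF bihom_differentiable[OF f]])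
  then have "cnj (LINT z|surface_measure. partial_cnj j f z) = of_nat (CARD('d) + m) * (LINT z|surface_measure. cnj (z $ j) * cnj (f z))"
    using integral_partial_z[OF bihom_cnj[OF f], of j] by (simp add: Bochner_Integration.integral_cnj[symmetric] del: Bochner_Integration.integral_cnj)
  also have "\<dots> = cnj (of_nat (CARD('d) + m) * (LINT z|surface_measure. z $ j * f z))"
    by (simp add: Bochner_Integration.integral_cnj[symmetric] del: Bochner_Integration.integral_cnj)
  finally show ?thesis by (simp only: complex_cnj_cancel_iff)
qed

section \<open>Green's identity\<close>

definition wirtinger_laplacian :: "(complex ^ 'd::finite \<Rightarrow> complex) \<Rightarrow> complex ^ 'd \<Rightarrow> complex" where
  "wirtinger_laplacian f z = (\<Sum>j\<in>UNIV. partial_z j (partial_cnj j f) z)"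

lemma complex_laplacian_eq: "complex_laplacian f z = 4 * wirtinger_laplacian f z"
  by (simp add: complex_laplacian_def wirtinger_laplacian_def)

lemma bihom_laplacian: "bihom m n f \<Longrightarrow> bihom (m - 1) (n - 1) (wirtinger_laplacian f)"
  unfolding wirtinger_laplacian_def [abs_def]
  by (intro bihom_sum) (blast intro: bihom_derivative_terms(1,2))

text \<open>Integration by parts of the outer derivative in the Laplacian.\<close>

lemma green_half:
  fixes f g :: "complex ^ 'd::finite \<Rightarrow> complex"
  assumes f: "bihom m n f" and g: "bihom b c g"
  shows "(LINT z|surface_measure. wirtinger_laplacian f z * g z) =
     of_nat (CARD('d) + n + c - 1) * of_nat n * (LINT z|surface_measure. f z * g z)
     - (LINT z|surface_measure. (\<Sum>j\<in>UNIV. partial_cnj j f z * partial_z j g z))"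
proof -
  have fg: "bihom (m + b) (n - 1 + c) (\<lambda>z. partial_cnj j f z * g z)" for j
    by (rule bihom_mult[OF bihom_derivative_terms(2)[OF f] g])
  have i1: "integrable surface_measure (\<lambda>z. partial_z j (partial_cnj j f) z * g z)"
    and i2: "integrable surface_measure (\<lambda>z. partial_cnj j f z * partial_z j g z)" for j
    using continuous_partials[OF f] continuous_partials[OF g] continuous_partials[OF bihom_derivative_terms(2)[OF f]] bihom_continuous[OF g]
    by (auto intro!: continuous_integrable_surface continuous_intros)
  have leib: "partial_z j (\<lambda>z. partial_cnj j f z * g z) z = partial_z j (partial_cnj j f) z * g z + partial_cnj j f z * partial_z j g z" for j z
    by (rule partial_mult(1)[OF bihom_differentiable[OF bihom_derivative_terms(2)[OF f]] bihom_differentiable[OF g]])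
  have "(LINT z|surface_measure. wirtinger_laplacian f z * g z) + (LINT z|surface_measure. (\<Sum>j\<in>UNIV. partial_cnj j f z * partial_z j g z))
     = (\<Sum>j\<in>UNIV. (LINT z|surface_measure. partial_z j (\<lambda>z. partial_cnj j f z * g z) z))"
    using i1 i2 by (simp add: wirtinger_laplacian_def sum_distrib_right leib sum.distrib)
  also have "\<dots> = (\<Sum>j\<in>UNIV. of_nat (CARD('d) + (n - 1 + c)) * (LINT z|surface_measure. cnj (z $ j) * (partial_cnj j f z * g z)))"
    by (simp only: integral_partial_z[OF fg])
  also have "\<dots> = of_nat (CARD('d) + (n - 1 + c)) * (LINT z|surface_measure. (\<Sum>j\<in>UNIV. cnj (z $ j) * (partial_cnj j f z * g z)))"
    using bihom_continuous[OF fg]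
    by (subst Bochner_Integration.integral_sum) (auto simp: sum_distrib_left intro: coord_integrable)
  also have "(\<lambda>z. \<Sum>j\<in>UNIV. cnj (z $ j) * (partial_cnj j f z * g z)) = (\<lambda>z. of_nat n * (f z * g z))"
    by (simp add: fun_eq_iff sum_distrib_right[symmetric] mult.assoc[symmetric] euler_cnj[OF f])
  also have "(LINT z|surface_measure. of_nat n * (f z * g z)) = of_nat n * (LINT z|surface_measure. f z * g z)"
    using bihom_integrable[OF bihom_mult[OF f g]] by simp
  also have "of_nat (CARD('d) + (n - 1 + c)) * (of_nat n * (LINT z|surface_measure. f z * g z))
     = of_nat (CARD('d) + n + c - 1) * of_nat n * (LINT z|surface_measure. f z * g z)"
    by (cases n) (auto simp: algebra_simps)
  finally show ?thesis by (simp add: algebra_simps)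
qed

text \<open>Here the inner derivative is the one that is moved; both halves leave the same gradient term.\<close>

lemma green_half':
  fixes f g :: "complex ^ 'd::finite \<Rightarrow> complex"
  assumes f: "bihom m n f" and g: "bihom b c g"
  shows "(LINT z|surface_measure. f z * wirtinger_laplacian g z) =
     of_nat (CARD('d) + m + b - 1) * of_nat b * (LINT z|surface_measure. f z * g z)
     - (LINT z|surface_measure. (\<Sum>j\<in>UNIV. partial_cnj j f z * partial_z j g z))"
proof -
  have fg: "bihom (m + (b - 1)) (n + c) (\<lambda>z. f z * partial_z j g z)" for j
    by (rule bihom_mult[OF f bihom_derivative_terms(1)[OF g]])
  have i1: "integrable surface_measure (\<lambda>z. f z * partial_cnj j (partial_z j g) z)"
    and i2: "integrable surface_measure (\<lambda>z. partial_cnj j f z * partial_z j g z)" for j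
    using continuous_partials[OF f] continuous_partials[OF g] continuous_partials[OF bihom_derivative_terms(1)[OF g]] bihom_continuous[OF f]
    by (auto intro!: continuous_integrable_surface continuous_intros)
  have leib: "partial_cnj j (\<lambda>z. f z * partial_z j g z) z = partial_cnj j f z * partial_z j g z + f z * partial_cnj j (partial_z j g) z" for j z
    by (rule partial_mult(2)[OF bihom_differentiable[OF f] bihom_differentiable[OF bihom_derivative_terms(1)[OF g]]])
  have "(LINT z|surface_measure. f z * wirtinger_laplacian g z) + (LINT z|surface_measure. (\<Sum>j\<in>UNIV. partial_cnj j f z * partial_z j g z))
     = (\<Sum>j\<in>UNIV. (LINT z|surface_measure. partial_cnj j (\<lambda>z. f z * partial_z j g z) z))"
    using i1 i2 by (simp add: wirtinger_laplacian_def partial_commute[OF g, symmetric] sum_distrib_left leib sum.distrib)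
  also have "\<dots> = (\<Sum>j\<in>UNIV. of_nat (CARD('d) + (m + (b - 1))) * (LINT z|surface_measure. z $ j * (f z * partial_z j g z)))"
    by (simp only: integral_partial_cnj[OF fg])
  also have "\<dots> = of_nat (CARD('d) + (m + (b - 1))) * (LINT z|surface_measure. (\<Sum>j\<in>UNIV. z $ j * (f z * partial_z j g z)))"
    using bihom_continuous[OF fg]
    by (subst Bochner_Integration.integral_sum) (auto simp: sum_distrib_left intro: coord_integrable)
  also have "(\<lambda>z. \<Sum>j\<in>UNIV. z $ j * (f z * partial_z j g z)) = (\<lambda>z. of_nat b * (f z * g z))"
    by (simp add: fun_eq_iff sum_distrib_left[symmetric] mult.left_commute[of _ "f _"] euler_z[OF g])
  also have "(LINT z|surface_measure. of_nat b * (f z * g z)) = of_nat b * (LINT z|surface_measure. f z * g z)"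
    using bihom_integrable[OF bihom_mult[OF f g]] by simp
  also have "of_nat (CARD('d) + (m + (b - 1))) * (of_nat b * (LINT z|surface_measure. f z * g z))
     = of_nat (CARD('d) + m + b - 1) * of_nat b * (LINT z|surface_measure. f z * g z)"
    by (cases b) (auto simp: algebra_simps)
  finally show ?thesis by (simp add: algebra_simps)
qed

text \<open>The gradient terms cancel. The boundary terms of the usual formula appear as multiples of the integral of \<open>f * g\<close> because
  normal derivatives of homogeneous polynomials are multiples of their values. When \<open>f * g\<close> is unbalanced, its integral
  vanishes, so the bidegrees may be assumed to satisfy \<open>m + b = n + c\<close>.\<close>

lemma green_identity:
  fixes f g :: "complex ^ 'd::finite \<Rightarrow> complex"
  assumes f: "bihom m n f" and g: "bihom b c g"
  shows "(LINT z|surface_measure. wirtinger_laplacian f z * g z) - (LINT z|surface_measure. f z * wirtinger_laplacian g z)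
    = of_nat (CARD('d) + m + b - 1) * (of_nat n - of_nat b) * (LINT z|surface_measure. f z * g z)"
proof (cases "m + b = n + c")
  case True
  then have "CARD('d) + n + c - 1 = CARD('d) + m + b - 1" by simp
  then show ?thesis
    unfolding green_half[OF f g] green_half'[OF f g] by (simp only:) (simp add: algebra_simps)
next
  case False
  then have "(LINT z|surface_measure. f z * g z) = 0"
    by (rule integral_bihom_unbalanced[OF bihom_mult[OF f g]])
  then show ?thesis
    unfolding green_half[OF f g] green_half'[OF f g] by simp
qed

section \<open>Orthonormal families of continuous functions on the sphere\<close>

abbreviation sphere_cont :: "('a::euclidean_space \<Rightarrow> complex) \<Rightarrow> bool" where
  "sphere_cont f \<equiv> continuous_on (sphere 0 1) f"

definition ip :: "('a::euclidean_space \<Rightarrow> complex) \<Rightarrow> ('a \<Rightarrow> complex) \<Rightarrow> complex" where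
  "ip f g = (LINT z|surface_measure. f z * cnj (g z))"

lemma ip_integrable: "sphere_cont f \<Longrightarrow> sphere_cont g \<Longrightarrow> integrable surface_measure (\<lambda>z. f z * cnj (g z))"
  by (intro continuous_integrable_surface continuous_intros)

lemma ip_cnj: "cnj (ip f g) = ip g f"
  unfolding ip_def by (simp add: Bochner_Integration.integral_cnj[symmetric] mult.commute del: Bochner_Integration.integral_cnj)

lemma ip_cong: "(\<And>z. z \<in> sphere 0 1 \<Longrightarrow> f z = f' z) \<Longrightarrow> (\<And>z. z \<in> sphere 0 1 \<Longrightarrow> g z = g' z) \<Longrightarrow> ip f g = ip f' g'"
  unfolding ip_def by (intro Bochner_Integration.integral_cong) auto

lemma ip_diff_left: "sphere_cont f \<Longrightarrow> sphere_cont g \<Longrightarrow> sphere_cont h \<Longrightarrow> ip (\<lambda>z. f z - g z) h = ip f h - ip g h"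
  unfolding ip_def by (simp add: left_diff_distrib ip_integrable)

lemma ip_scale_left: "ip (\<lambda>z. c * f z) h = c * ip f h"
  unfolding ip_def by (simp add: mult.assoc)

lemma ip_sum_left:
  assumes "\<And>k. k \<in> A \<Longrightarrow> sphere_cont (f k)" "sphere_cont h"
  shows "ip (\<lambda>z. \<Sum>k\<in>A. f k z) h = (\<Sum>k\<in>A. ip (f k) h)"
  unfolding ip_def sum_distrib_right
  using assms by (intro Bochner_Integration.integral_sum ip_integrable) auto

lemma ip_lincomb_left:
  assumes "\<And>k. k \<in> A \<Longrightarrow> sphere_cont (f k)" "sphere_cont h"
  shows "ip (\<lambda>z. \<Sum>k\<in>A. c k * f k z) h = (\<Sum>k\<in>A. c k * ip (f k) h)"
  using assms by (subst ip_sum_left) (auto simp: ip_scale_left intro!: continuous_intros)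

lemma ip_self: 
  assumes "sphere_cont f" 
  shows "ip f f = of_real (LINT z|surface_measure. (norm (f z))\<^sup>2)" "(LINT z|surface_measure. (norm (f z))\<^sup>2) \<ge> 0"
  unfolding ip_def complex_norm_square[symmetric] by (rule integral_complex_of_real) (simp add: integral_nonneg_AE)

text \<open>A continuous function that vanishes almost everywhere vanishes on the sphere, because caps have positive measure.\<close>

lemma ip_self_zero:
  assumes f: "sphere_cont f" and z: "ip f f = 0" and w: "w \<in> sphere 0 1"
  shows "f w = 0"
proof -
  have i: "integrable surface_measure (\<lambda>z. (norm (f z))\<^sup>2)"
    using f by (intro continuous_integrable_surface continuous_intros)
  have "(LINT z|surface_measure. (norm (f z))\<^sup>2) = 0"
    using z ip_self(1)[OF f] by simp
  then have "AE z in surface_measure. (norm (f z))\<^sup>2 = 0"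
    using i by (subst (asm) integral_nonneg_eq_0_iff_AE) auto
  then have "AE z in surface_measure. f z = 0" by simp
  then show ?thesis by (rule continuous_AE_zero_surface[OF f _ w])
qed

definition orthonormal :: "('a::euclidean_space \<Rightarrow> complex) set \<Rightarrow> bool" where
  "orthonormal U \<longleftrightarrow> finite U \<and> (\<forall>u\<in>U. sphere_cont u) \<and> (\<forall>u\<in>U. \<forall>v\<in>U. ip u v = (if u = v then 1 else 0))"

lemma orthonormal_residual:
  assumes U: "orthonormal U" and f: "sphere_cont f"
  defines "g \<equiv> \<lambda>z. f z - (\<Sum>u\<in>U. ip f u * u z)"
  shows "sphere_cont g" "v \<in> U \<Longrightarrow> ip g v = 0" "ip g g = ip f f - of_real (\<Sum>u\<in>U. (norm (ip f u))\<^sup>2)"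
proof -
  have Uc: "\<And>u. u \<in> U \<Longrightarrow> sphere_cont u" and fin: "finite U" using U by (auto simp: orthonormal_def)
  have sc: "sphere_cont (\<lambda>z. \<Sum>u\<in>U. ip f u * u z)" using Uc by (intro continuous_intros)
  show gc: "sphere_cont g" unfolding g_def by (intro continuous_intros f sc)
  have gh: "ip g h = ip f h - (\<Sum>u\<in>U. ip f u * ip u h)" if "sphere_cont h" for h
    unfolding g_def using that Uc by (simp add: ip_diff_left[OF f sc] ip_lincomb_left)
  show orth: "ip g v = 0" if "v \<in> U" for v
  proof -
    have "(\<Sum>u\<in>U. ip f u * ip u v) = (\<Sum>u\<in>U. if u = v then ip f v else 0)"
      using U that by (intro sum.cong) (auto simp: orthonormal_def)
    then show ?thesis using that fin by (simp add: gh Uc)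
  qed
  have "cnj (ip g g) = cnj (ip f g) - cnj (\<Sum>u\<in>U. ip f u * ip u g)"
    by (simp add: gh[OF gc])
  also have "(\<Sum>u\<in>U. ip f u * ip u g) = 0"
    using orth by (intro sum.neutral) (metis ip_cnj complex_cnj_zero mult_zero_right)
  finally have "ip g g = cnj (ip f g)" by (simp add: ip_cnj)
  also have "\<dots> = ip f f - (\<Sum>u\<in>U. ip f u * ip u f)" by (simp add: ip_cnj gh[OF f])
  also have "(\<Sum>u\<in>U. ip f u * ip u f) = of_real (\<Sum>u\<in>U. (norm (ip f u))\<^sup>2)"
    unfolding of_real_sum by (intro sum.cong refl) (metis complex_norm_square ip_cnj)
  finally show "ip g g = ip f f - of_real (\<Sum>u\<in>U. (norm (ip f u))\<^sup>2)" .
qed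

lemma bessel:
  assumes U: "orthonormal U" and f: "sphere_cont f"
  shows "(\<Sum>u\<in>U. (norm (ip f u))\<^sup>2) \<le> (LINT z|surface_measure. (norm (f z))\<^sup>2)"
proof -
  let ?g = "\<lambda>z. f z - (\<Sum>u\<in>U. ip f u * u z)"
  have "complex_of_real (LINT z|surface_measure. (norm (?g z))\<^sup>2) = of_real ((LINT z|surface_measure. (norm (f z))\<^sup>2) - (\<Sum>u\<in>U. (norm (ip f u))\<^sup>2))"
    using orthonormal_residual(3)[OF U f] ip_self(1)[OF orthonormal_residual(1)[OF U f]] ip_self(1)[OF f] by simp
  then have "(LINT z|surface_measure. (norm (?g z))\<^sup>2) = (LINT z|surface_measure. (norm (f z))\<^sup>2) - (\<Sum>u\<in>U. (norm (ip f u))\<^sup>2)"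
    using of_real_eq_iff by blast
  then show ?thesis using ip_self(2)[OF orthonormal_residual(1)[OF U f]] by simp
qed

lemma orthonormal_insert_residual:
  assumes U: "orthonormal U" and f: "sphere_cont f"
    and w: "w \<in> sphere 0 1" "f w \<noteq> (\<Sum>u\<in>U. ip f u * u w)"
  defines "g \<equiv> \<lambda>z. f z - (\<Sum>u\<in>U. ip f u * u z)"
  shows "\<exists>c. c \<noteq> 0 \<and> (\<lambda>z. c * g z) \<notin> U \<and> orthonormal (insert (\<lambda>z. c * g z) U)"
proof -
  have gc: "sphere_cont g" unfolding g_def by (rule orthonormal_residual(1)[OF U f])
  have orth: "ip g v = 0" if "v \<in> U" for v
    unfolding g_def by (rule orthonormal_residual(2)[OF U f that])
  have "ip g g \<noteq> 0" using ip_self_zero[OF gc _ w(1)] w(2) by (auto simp: g_def)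
  define r where "r = (LINT z|surface_measure. (norm (g z))\<^sup>2)"
  have r: "r > 0" "ip g g = of_real r"
    using ip_self[OF gc] \<open>ip g g \<noteq> 0\<close> by (auto simp: r_def less_le)
  define c where "c = complex_of_real (1 / sqrt r)"
  define v where "v = (\<lambda>z. c * g z)"
  have c: "c \<noteq> 0" using r by (simp add: c_def)
  have vv: "ip v v = 1"
  proof -
    have v: "ip v h = c * ip g h" for h unfolding v_def by (rule ip_scale_left)
    have "ip v v = c * ip g v" by (rule v)
    also have "ip g v = cnj (ip v g)" by (rule ip_cnj[symmetric])
    also have "ip v g = c * ip g g" by (rule v)
    also have "c * cnj (c * ip g g) = c * cnj c * cnj (ip g g)" by simp
    also have "\<dots> = of_real ((1 / sqrt r) * (1 / sqrt r) * r)"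
      by (simp only: c_def r(2) complex_cnj_complex_of_real of_real_mult)
    also have "(1 / sqrt r) * (1 / sqrt r) * r = 1" using r(1) by simp
    finally show ?thesis by simp
  qed
  have vu: "ip v u = 0" "ip u v = 0" if "u \<in> U" for u
  proof -
    show "ip v u = 0" unfolding v_def ip_scale_left using orth[OF that] by simp
    then show "ip u v = 0" by (metis ip_cnj complex_cnj_zero)
  qed
  have "v \<notin> U" using vu(1)[of v] vv by auto
  moreover have "sphere_cont v" unfolding v_def by (intro continuous_intros gc)
  ultimately have "orthonormal (insert v U)"
    using U vv vu unfolding orthonormal_def by auto
  then show ?thesis using c \<open>v \<notin> U\<close> unfolding v_def by blast
qed

lemma gram_schmidt:
  fixes g :: "'k \<Rightarrow> 'a::euclidean_space \<Rightarrow> complex"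
  assumes "finite A" "\<And>k. k \<in> A \<Longrightarrow> sphere_cont (g k)"
  shows "\<exists>U. orthonormal U \<and> card U \<le> card A \<and> (\<forall>k\<in>A. \<forall>z\<in>sphere 0 1. g k z = (\<Sum>u\<in>U. ip (g k) u * u z))"
  using assms
proof (induction A rule: finite_induct)
  case empty
  then show ?case by (intro exI[of _ "{}"]) (auto simp: orthonormal_def)
next
  case (insert a A)
  then obtain U where U: "orthonormal U" "card U \<le> card A"
    "\<And>k z. k \<in> A \<Longrightarrow> z \<in> sphere 0 1 \<Longrightarrow> g k z = (\<Sum>u\<in>U. ip (g k) u * u z)" by blast
  have finU: "finite U" and Uc: "\<And>u. u \<in> U \<Longrightarrow> sphere_cont u" using U(1) by (auto simp: orthonormal_def)
  show ?case
  proof (cases "\<forall>z\<in>sphere 0 1. g a z = (\<Sum>u\<in>U. ip (g a) u * u z)")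
    case True
    then show ?thesis using U insert.hyps by (intro exI[of _ U]) auto
  next
    case False
    then obtain w where w: "w \<in> sphere 0 1" "g a w \<noteq> (\<Sum>u\<in>U. ip (g a) u * u w)" by blast
    have ga: "sphere_cont (g a)" using insert.prems by simp
    obtain c where c: "c \<noteq> 0" "(\<lambda>z. c * (g a z - (\<Sum>u\<in>U. ip (g a) u * u z))) \<notin> U"
      "orthonormal (insert (\<lambda>z. c * (g a z - (\<Sum>u\<in>U. ip (g a) u * u z))) U)"
      using orthonormal_insert_residual[OF U(1) ga w] by blast
    define v where "v = (\<lambda>z. c * (g a z - (\<Sum>u\<in>U. ip (g a) u * u z)))"
    have V: "orthonormal (insert v U)" "v \<notin> U" using c by (simp_all add: v_def)
    have exp_in_V: "f z = (\<Sum>u\<in>insert v U. ip f u * u z)"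
      if f: "\<And>z. z \<in> sphere 0 1 \<Longrightarrow> f z = (\<Sum>u\<in>insert v U. d u * u z)" and z: "z \<in> sphere 0 1" for f d and z :: 'a
    proof -
      have "ip f u = d u" if "u \<in> insert v U" for u
      proof -
        have "ip f u = ip (\<lambda>z. \<Sum>u\<in>insert v U. d u * u z) u" by (intro ip_cong f) auto
        also have "\<dots> = (\<Sum>u'\<in>insert v U. d u' * ip u' u)"
          using V(1) that by (intro ip_lincomb_left) (auto simp: orthonormal_def)
        also have "\<dots> = (\<Sum>u'\<in>insert v U. if u' = u then d u else 0)"
          using V(1) that by (intro sum.cong) (auto simp: orthonormal_def)
        also have "\<dots> = d u" using that finU by simp
        finally show ?thesis .
      qed
      then show ?thesis using f[OF z] by simp
    qed
    have "g k z = (\<Sum>u\<in>insert v U. ip (g k) u * u z)" if k: "k \<in> insert a A" and z: "z \<in> sphere 0 1" for k z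
    proof (cases "k = a")
      case True
      show ?thesis
      proof (rule exp_in_V[OF _ z, where d = "(\<lambda>u. ip (g k) u)(v := 1 / c)"])
        fix z :: 'a assume "z \<in> sphere 0 1"
        have "(\<Sum>u\<in>U. ((\<lambda>u. ip (g k) u)(v := 1 / c)) u * u z) = (\<Sum>u\<in>U. ip (g k) u * u z)"
          using V(2) by (intro sum.cong) auto
        then show "g k z = (\<Sum>u\<in>insert v U. ((\<lambda>u. ip (g k) u)(v := 1 / c)) u * u z)"
          using V(2) finU c(1) True by (simp add: v_def)
      qed
    next
      case False
      then have kA: "k \<in> A" using k by simp
      show ?thesis
      proof (rule exp_in_V[OF _ z, where d = "(\<lambda>u. ip (g k) u)(v := 0)"])
        fix z :: 'a assume z: "z \<in> sphere 0 1"
        have "(\<Sum>u\<in>U. ((\<lambda>u. ip (g k) u)(v := 0)) u * u z) = (\<Sum>u\<in>U. ip (g k) u * u z)"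
          using V(2) by (intro sum.cong) auto
        then show "g k z = (\<Sum>u\<in>insert v U. ((\<lambda>u. ip (g k) u)(v := 0)) u * u z)"
          using V(2) finU U(3)[OF kA z] by simp
      qed
    qed
    then show ?thesis
      using V finU U(2) insert.hyps by (intro exI[of _ "insert v U"]) auto
  qed
qed

text \<open>Let \<open>U\<close> be an orthonormal family obtained from the spanning one. In the sum of \<open>\<bar>ip v u\<bar>\<^sup>2\<close> over all pairs, each
  \<open>v\<close> contributes \<open>1\<close>, and by Bessel's inequality each \<open>u\<close> contributes at most \<open>1\<close>.\<close>

lemma orthonormal_card_le:
  assumes V: "orthonormal V" and A: "finite A" "\<And>k. k \<in> A \<Longrightarrow> sphere_cont (g k)"
    and span: "\<And>v. v \<in> V \<Longrightarrow> \<exists>c. \<forall>z\<in>sphere 0 1. v z = (\<Sum>k\<in>A. c k * g k z)"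
  shows "card V \<le> card A"
proof -
  obtain U where U: "orthonormal U" "card U \<le> card A"
    "\<And>k z. k \<in> A \<Longrightarrow> z \<in> sphere 0 1 \<Longrightarrow> g k z = (\<Sum>u\<in>U. ip (g k) u * u z)" using gram_schmidt[where A = A and g = g] A by blast
  have finU: "finite U" and Uc: "\<And>u. u \<in> U \<Longrightarrow> sphere_cont u" using U(1) by (auto simp: orthonormal_def)
  have finV: "finite V" and Vc: "\<And>u. u \<in> V \<Longrightarrow> sphere_cont u" using V by (auto simp: orthonormal_def)
  have "(\<Sum>u\<in>U. (norm (ip v u))\<^sup>2) = 1" if v: "v \<in> V" for v
  proof -
    obtain c where c: "\<And>z. z \<in> sphere 0 1 \<Longrightarrow> v z = (\<Sum>k\<in>A. c k * g k z)" using span[OF v] by blast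
    define d where "d u = (\<Sum>k\<in>A. c k * ip (g k) u)" for u
    have vexp: "v z = (\<Sum>u\<in>U. d u * u z)" if z: "z \<in> sphere 0 1" for z
    proof -
      have "v z = (\<Sum>k\<in>A. c k * (\<Sum>u\<in>U. ip (g k) u * u z))" using c[OF z] U(3)[OF _ z] by simp
      also have "\<dots> = (\<Sum>u\<in>U. d u * u z)"
        unfolding d_def sum_distrib_left sum_distrib_right by (subst sum.swap) (simp add: mult.assoc)
      finally show ?thesis .
    qed
    have "1 = ip v v" using V v by (auto simp: orthonormal_def)
    also have "\<dots> = ip (\<lambda>z. \<Sum>u\<in>U. d u * u z) v" by (intro ip_cong vexp) auto
    also have "\<dots> = (\<Sum>u\<in>U. d u * ip u v)" using Uc Vc v by (intro ip_lincomb_left) auto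
    also have "\<dots> = (\<Sum>u\<in>U. of_real ((norm (ip v u))\<^sup>2))"
    proof (intro sum.cong refl)
      fix u assume u: "u \<in> U"
      have "ip v u = ip (\<lambda>z. \<Sum>u\<in>U. d u * u z) u" by (intro ip_cong vexp) auto
      also have "\<dots> = (\<Sum>u'\<in>U. d u' * ip u' u)" using Uc u by (intro ip_lincomb_left) auto
      also have "\<dots> = (\<Sum>u'\<in>U. if u' = u then d u else 0)"
        using U(1) u by (intro sum.cong) (auto simp: orthonormal_def)
      also have "\<dots> = d u" using u finU by simp
      finally have "d u = ip v u" by simp
      then show "d u * ip u v = of_real ((norm (ip v u))\<^sup>2)"
        by (metis complex_norm_square ip_cnj)
    qed
    finally have "complex_of_real (\<Sum>u\<in>U. (norm (ip v u))\<^sup>2) = of_real 1" by simp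
    then show ?thesis using of_real_eq_iff by blast
  qed
  then have "real (card V) = (\<Sum>v\<in>V. \<Sum>u\<in>U. (norm (ip v u))\<^sup>2)" by simp
  also have "\<dots> = (\<Sum>u\<in>U. \<Sum>v\<in>V. (norm (ip v u))\<^sup>2)" by (rule sum.swap)
  also have "\<dots> = (\<Sum>u\<in>U. \<Sum>v\<in>V. (norm (ip u v))\<^sup>2)"
    by (intro sum.cong refl) (metis ip_cnj complex_mod_cnj)
  also have "\<dots> \<le> (\<Sum>u\<in>U. LINT z|surface_measure. (norm (u z))\<^sup>2)"
    using Uc by (intro sum_mono bessel[OF V])
  also have "\<dots> = (\<Sum>u\<in>U. 1)"
  proof (intro sum.cong refl)
    fix u assume u: "u \<in> U"
    have "complex_of_real (LINT z|surface_measure. (norm (u z))\<^sup>2) = of_real 1"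
      using ip_self(1)[OF Uc[OF u]] U(1) u by (simp add: orthonormal_def)
    then show "(LINT z|surface_measure. (norm (u z))\<^sup>2) = 1" using of_real_eq_iff by blast
  qed
  finally have "card V \<le> card U" by simp
  then show ?thesis using U(2) by simp
qed

definition function_space :: "(('a::euclidean_space \<Rightarrow> complex) \<Rightarrow> bool) \<Rightarrow> bool" where
  "function_space P \<longleftrightarrow> P (\<lambda>_. 0) \<and> (\<forall>f g. P f \<longrightarrow> P g \<longrightarrow> P (\<lambda>z. f z + g z)) \<and> (\<forall>c f. P f \<longrightarrow> P (\<lambda>z. c * f z))
     \<and> (\<forall>f. P f \<longrightarrow> sphere_cont f)"

lemma function_space_lincomb:
  assumes P: "function_space P" and f: "\<And>k. k \<in> A \<Longrightarrow> P (f k)"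
  shows "P (\<lambda>z. \<Sum>k\<in>A. c k * f k z)"
  using f
proof (induction A rule: infinite_finite_induct)
  case (insert x F)
  have "P (\<lambda>z. c x * f x z)" "P (\<lambda>z. \<Sum>k\<in>F. c k * f k z)"
    using P insert by (auto simp: function_space_def)
  then have "P (\<lambda>z. c x * f x z + (\<Sum>k\<in>F. c k * f k z))"
    using P unfolding function_space_def by blast
  then show ?case using insert.hyps by simp
qed (use P in \<open>auto simp: function_space_def\<close>)

theorem orthonormal_basis_exists:
  assumes P: "function_space P" and A: "finite A" "\<And>k. k \<in> A \<Longrightarrow> sphere_cont (g k)"
    and span: "\<And>f. P f \<Longrightarrow> \<exists>c. \<forall>z\<in>sphere 0 1. f z = (\<Sum>k\<in>A. c k * g k z)"
  shows "\<exists>U. orthonormal U \<and> card U \<le> card A \<and> (\<forall>u\<in>U. P u) \<and> (\<forall>f. P f \<longrightarrow> (\<forall>z\<in>sphere 0 1. f z = (\<Sum>u\<in>U. ip f u * u z)))"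
proof -
  define Q where "Q k \<longleftrightarrow> (\<exists>U. orthonormal U \<and> (\<forall>u\<in>U. P u) \<and> card U = k)" for k
  have Q0: "Q 0" unfolding Q_def by (intro exI[of _ "{}"]) (auto simp: orthonormal_def)
  have Qle: "k \<le> card A" if "Q k" for k
    using that orthonormal_card_le[where A = A and g = g] A span unfolding Q_def by metis
  define k where "k = Greatest Q"
  have k: "Q k" "\<And>k'. Q k' \<Longrightarrow> k' \<le> k"
    unfolding k_def using Q0 Qle by (auto intro: GreatestI_nat Greatest_le_nat)
  then obtain U where U: "orthonormal U" "\<And>u. u \<in> U \<Longrightarrow> P u" "card U = k" unfolding Q_def by blast
  have finU: "finite U" using U(1) by (simp add: orthonormal_def)
  have "f w = (\<Sum>u\<in>U. ip f u * u w)" if f: "P f" and w: "w \<in> sphere 0 1" for f w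
  proof (rule ccontr)
    assume ne: "f w \<noteq> (\<Sum>u\<in>U. ip f u * u w)"
    have fc: "sphere_cont f" using P f by (simp add: function_space_def)
    obtain c where c: "(\<lambda>z. c * (f z - (\<Sum>u\<in>U. ip f u * u z))) \<notin> U"
      "orthonormal (insert (\<lambda>z. c * (f z - (\<Sum>u\<in>U. ip f u * u z))) U)"
      using orthonormal_insert_residual[OF U(1) fc w ne] by blast
    have "P (\<lambda>z. f z + (-1) * (\<Sum>u\<in>U. ip f u * u z))"
      using P f function_space_lincomb[OF P U(2), of U "\<lambda>u. u"] unfolding function_space_def by blast
    then have "P (\<lambda>z. c * (f z - (\<Sum>u\<in>U. ip f u * u z)))"
      using P by (simp add: function_space_def)
    then have "Q (Suc k)"
      unfolding Q_def using c U finU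
      by (intro exI[of _ "insert (\<lambda>z. c * (f z - (\<Sum>u\<in>U. ip f u * u z))) U"]) auto
    then show False using k(2) by fastforce
  qed
  then show ?thesis using U Qle k(1) by blast
qed

section \<open>Harmonic polynomials\<close>

definition zmon :: "('d::finite \<Rightarrow> nat) \<Rightarrow> ('d \<Rightarrow> nat) \<Rightarrow> complex ^ 'd \<Rightarrow> complex" where
  "zmon \<alpha> \<beta> z = (\<Prod>j\<in>UNIV. z $ j ^ \<alpha> j) * (\<Prod>j\<in>UNIV. cnj (z $ j) ^ \<beta> j)"

lemma bihom_zmon: "bihom (sum \<alpha> UNIV) (sum \<beta> UNIV) (zmon \<alpha> \<beta>)"
proof -
  have pow: "bihom k 0 (\<lambda>z::complex^'a. z $ j ^ k)" "bihom 0 k (\<lambda>z::complex^'a. cnj (z $ j) ^ k)" for j k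
  proof (induction k)
    case 0
    { case 1 then show ?case using bihom_const[of 1] by simp }
    { case 2 then show ?case using bihom_const[of 1] by simp }
  next
    case (Suc k)
    { case 1 then show ?case using bihom_z[OF Suc(1)] by simp }
    { case 2 then show ?case using bihom_conj[OF Suc(2)] by simp }
  qed
  have "bihom (sum \<alpha> A) 0 (\<lambda>z. \<Prod>j\<in>A. z $ j ^ \<alpha> j)" "bihom 0 (sum \<beta> A) (\<lambda>z. \<Prod>j\<in>A. cnj (z $ j) ^ \<beta> j)"
    if "finite A" for A :: "'a set"
    using that
  proof (induction A rule: finite_induct)
    case empty
    { case 1 then show ?case using bihom_const[of 1] by simp }
    { case 2 then show ?case using bihom_const[of 1] by simp }
  next
    case (insert x F)
    { case 1 then show ?case using bihom_mult[OF pow(1) insert.IH(1), of "\<alpha> x" x] insert.hyps by simp }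
    { case 2 then show ?case using bihom_mult[OF pow(2) insert.IH(2), of "\<beta> x" x] insert.hyps by simp }
  qed
  from bihom_mult[OF this(1)[OF finite_class.finite_UNIV] this(2)[OF finite_class.finite_UNIV]]
  show ?thesis by (simp add: zmon_def[abs_def])
qed

lemma bihomogeneous_poly_zmon:
  "bihomogeneous_poly m n P \<longleftrightarrow> (\<exists>c. P = (\<lambda>z. \<Sum>\<alpha> | sum \<alpha> UNIV = m. \<Sum>\<beta> | sum \<beta> UNIV = n. c \<alpha> \<beta> * zmon \<alpha> \<beta> z))"
  by (simp add: bihomogeneous_poly_def zmon_def mult.assoc)

lemma finite_multi_index: "finite {\<alpha> :: 'd::finite \<Rightarrow> nat. sum \<alpha> UNIV = m}"
proof (rule finite_subset)
  show "{\<alpha> :: 'd \<Rightarrow> nat. sum \<alpha> UNIV = m} \<subseteq> PiE UNIV (\<lambda>_. {..m})"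
    by (auto simp: member_le_sum)
  show "finite (PiE (UNIV :: 'd set) (\<lambda>_. {..m}))" by (rule finite_PiE) auto
qed

lemma zmon_shift:
  "zmon (\<alpha>(l := Suc (\<alpha> l))) \<beta> z = z $ l * zmon \<alpha> \<beta> z"
  "zmon \<alpha> (\<beta>(l := Suc (\<beta> l))) z = cnj (z $ l) * zmon \<alpha> \<beta> z"
proof -
  have p: "(\<Prod>j\<in>UNIV. f j ^ (\<gamma>(l := Suc (\<gamma> l))) j) = f l * (\<Prod>j\<in>UNIV. f j ^ \<gamma> j)" for f :: "'a \<Rightarrow> complex" and \<gamma>
  proof -
    have "(\<Prod>j\<in>UNIV - {l}. f j ^ (\<gamma>(l := Suc (\<gamma> l))) j) = (\<Prod>j\<in>UNIV - {l}. f j ^ \<gamma> j)"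
      by (intro prod.cong) auto
    then show ?thesis by (simp add: prod.remove[of UNIV l])
  qed
  show "zmon (\<alpha>(l := Suc (\<alpha> l))) \<beta> z = z $ l * zmon \<alpha> \<beta> z"
    "zmon \<alpha> (\<beta>(l := Suc (\<beta> l))) z = cnj (z $ l) * zmon \<alpha> \<beta> z"
    using p[of "\<lambda>j. z $ j" \<alpha>] p[of "\<lambda>j. cnj (z $ j)" \<beta>]
    by (simp_all only: zmon_def mult_ac)
qed

lemma sum_fun_upd_Suc: "sum (\<alpha>(l := Suc (\<alpha> l))) UNIV = Suc (sum \<alpha> (UNIV :: 'd::finite set))"
proof -
  have "sum (\<alpha>(l := Suc (\<alpha> l))) (UNIV - {l}) = sum \<alpha> (UNIV - {l})" by (intro sum.cong) auto
  then show ?thesis by (simp add: sum.remove[of UNIV l])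
qed

lemma multi_index_shift:
  fixes F :: "('d::finite \<Rightarrow> nat) \<Rightarrow> complex"
  shows "(\<Sum>\<alpha> | sum \<alpha> UNIV = m. F (\<alpha>(l := Suc (\<alpha> l)))) = (\<Sum>\<alpha> | sum \<alpha> UNIV = Suc m. if \<alpha> l > 0 then F \<alpha> else 0)"
proof -
  have "(\<Sum>\<alpha> | sum \<alpha> UNIV = Suc m. if \<alpha> l > 0 then F \<alpha> else 0) = (\<Sum>\<alpha> | sum \<alpha> UNIV = Suc m \<and> \<alpha> l > 0. F \<alpha>)"
    using sum.inter_filter[OF finite_multi_index[of "Suc m"], of F "\<lambda>\<alpha>. \<alpha> l > 0"] by simp
  also have "\<dots> = (\<Sum>\<alpha> | sum \<alpha> UNIV = m. F (\<alpha>(l := Suc (\<alpha> l))))"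
  proof (rule sum.reindex_bij_witness[where i = "\<lambda>\<alpha>. \<alpha>(l := Suc (\<alpha> l))" and j = "\<lambda>\<alpha>. \<alpha>(l := \<alpha> l - 1)"])
    fix \<alpha> :: "'d \<Rightarrow> nat" assume a: "\<alpha> \<in> {\<alpha>. sum \<alpha> UNIV = Suc m \<and> \<alpha> l > 0}"
    then show eq: "(\<alpha>(l := \<alpha> l - 1))(l := Suc ((\<alpha>(l := \<alpha> l - 1)) l)) = \<alpha>" by auto
    show "\<alpha>(l := \<alpha> l - 1) \<in> {\<alpha>. sum \<alpha> UNIV = m}"
    proof -
      have "Suc (sum (\<alpha>(l := \<alpha> l - 1)) UNIV) = sum \<alpha> UNIV"
        using sum_fun_upd_Suc[of "\<alpha>(l := \<alpha> l - 1)" l] unfolding eq by (rule sym)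
      then show ?thesis using a by (simp only: mem_Collect_eq)
    qed
    show "F ((\<alpha>(l := \<alpha> l - 1))(l := Suc ((\<alpha>(l := \<alpha> l - 1)) l))) = F \<alpha>" unfolding eq ..
  next
    fix b :: "'d \<Rightarrow> nat" assume b: "b \<in> {\<alpha>. sum \<alpha> UNIV = m}"
    show "(b(l := Suc (b l)))(l := (b(l := Suc (b l))) l - 1) = b" by auto
    show "b(l := Suc (b l)) \<in> {\<alpha>. sum \<alpha> UNIV = Suc m \<and> \<alpha> l > 0}"
      using b by (simp only: mem_Collect_eq sum_fun_upd_Suc fun_upd_same) simp
  qed
  finally show ?thesis by simp
qed

text \<open>Multiplication by a coordinate shifts the exponents of every monomial, which gives the coefficients of the product.\<close>

lemma bihomogeneous_poly_iff_bihom: "bihomogeneous_poly m n P \<longleftrightarrow> bihom m n P"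
proof
  assume "bihomogeneous_poly m n P"
  then obtain c where P: "P = (\<lambda>z. \<Sum>\<alpha> | sum \<alpha> UNIV = m. \<Sum>\<beta> | sum \<beta> UNIV = n. c \<alpha> \<beta> * zmon \<alpha> \<beta> z)"
    unfolding bihomogeneous_poly_zmon by blast
  show "bihom m n P"
    unfolding P using bihom_zmon by (intro bihom_sum bihom_scale) auto
next
  assume "bihom m n P"
  then show "bihomogeneous_poly m n P"
    unfolding bihomogeneous_poly_zmon
  proof (induction rule: bihom.induct)
    case (bihom_const c)
    have "{\<alpha>. sum \<alpha> (UNIV::'a set) = 0} = {\<lambda>_. 0 :: nat}" by auto
    then show ?case by (intro exI[of _ "\<lambda>_ _. c"]) (simp add: zmon_def)
  next
    case (bihom_zero m n)
    then show ?case by (intro exI[of _ "\<lambda>_ _. 0"]) simp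
  next
    case (bihom_z m n f l)
    then obtain c where f: "f = (\<lambda>z. \<Sum>\<alpha> | sum \<alpha> UNIV = m. \<Sum>\<beta> | sum \<beta> UNIV = n. c \<alpha> \<beta> * zmon \<alpha> \<beta> z)" by blast
    show ?case
    proof (intro exI ext)
      fix z
      let ?F = "\<lambda>\<alpha>. \<Sum>\<beta> | sum \<beta> UNIV = n. c (\<alpha>(l := \<alpha> l - 1)) \<beta> * zmon \<alpha> \<beta> z"
      have "z $ l * f z = (\<Sum>\<alpha> | sum \<alpha> UNIV = m. ?F (\<alpha>(l := Suc (\<alpha> l))))"
        by (simp add: f sum_distrib_left zmon_shift mult_ac)
      also have "\<dots> = (\<Sum>\<alpha> | sum \<alpha> UNIV = Suc m. if \<alpha> l > 0 then ?F \<alpha> else 0)"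
        by (rule multi_index_shift)
      also have "\<dots> = (\<Sum>\<alpha> | sum \<alpha> UNIV = Suc m. \<Sum>\<beta> | sum \<beta> UNIV = n. (if \<alpha> l > 0 then c (\<alpha>(l := \<alpha> l - 1)) \<beta> else 0) * zmon \<alpha> \<beta> z)"
        by (intro sum.cong) auto
      finally show "z $ l * f z = (\<Sum>\<alpha> | sum \<alpha> UNIV = Suc m. \<Sum>\<beta> | sum \<beta> UNIV = n. (if \<alpha> l > 0 then c (\<alpha>(l := \<alpha> l - 1)) \<beta> else 0) * zmon \<alpha> \<beta> z)" .
    qed
  next
    case (bihom_conj m n f l)
    then obtain c where f: "f = (\<lambda>z. \<Sum>\<alpha> | sum \<alpha> UNIV = m. \<Sum>\<beta> | sum \<beta> UNIV = n. c \<alpha> \<beta> * zmon \<alpha> \<beta> z)" by blast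
    show ?case
    proof (intro exI ext)
      fix z
      let ?F = "\<lambda>\<alpha> \<beta>. c \<alpha> (\<beta>(l := \<beta> l - 1)) * zmon \<alpha> \<beta> z"
      have "cnj (z $ l) * f z = (\<Sum>\<alpha> | sum \<alpha> UNIV = m. \<Sum>\<beta> | sum \<beta> UNIV = n. ?F \<alpha> (\<beta>(l := Suc (\<beta> l))))"
        by (simp add: f sum_distrib_left zmon_shift mult_ac)
      also have "\<dots> = (\<Sum>\<alpha> | sum \<alpha> UNIV = m. \<Sum>\<beta> | sum \<beta> UNIV = Suc n. if \<beta> l > 0 then ?F \<alpha> \<beta> else 0)"
        by (intro sum.cong refl multi_index_shift)
      also have "\<dots> = (\<Sum>\<alpha> | sum \<alpha> UNIV = m. \<Sum>\<beta> | sum \<beta> UNIV = Suc n. (if \<beta> l > 0 then c \<alpha> (\<beta>(l := \<beta> l - 1)) else 0) * zmon \<alpha> \<beta> z)"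
        by (intro sum.cong) auto
      finally show "cnj (z $ l) * f z = (\<Sum>\<alpha> | sum \<alpha> UNIV = m. \<Sum>\<beta> | sum \<beta> UNIV = Suc n. (if \<beta> l > 0 then c \<alpha> (\<beta>(l := \<beta> l - 1)) else 0) * zmon \<alpha> \<beta> z)" .
    qed
  next
    case (bihom_add m n f g)
    then obtain c d where "f = (\<lambda>z. \<Sum>\<alpha> | sum \<alpha> UNIV = m. \<Sum>\<beta> | sum \<beta> UNIV = n. c \<alpha> \<beta> * zmon \<alpha> \<beta> z)"
      "g = (\<lambda>z. \<Sum>\<alpha> | sum \<alpha> UNIV = m. \<Sum>\<beta> | sum \<beta> UNIV = n. d \<alpha> \<beta> * zmon \<alpha> \<beta> z)" by blast
    then show ?case
      by (intro exI[of _ "\<lambda>\<alpha> \<beta>. c \<alpha> \<beta> + d \<alpha> \<beta>"]) (simp add: fun_eq_iff sum.distrib distrib_right)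
  qed
qed

text \<open>A homogeneous polynomial is determined by its values on the sphere.\<close>

lemma bihom_eq_zero:
  fixes f :: "complex ^ 'd::finite \<Rightarrow> complex"
  assumes f: "bihom m n f" and z: "\<And>z. z \<in> sphere 0 1 \<Longrightarrow> f z = 0"
  shows "f z = 0"
proof -
  have pos: "f z = 0" if "z \<noteq> 0" for z
  proof -
    have "f (norm z *\<^sub>R (z /\<^sub>R norm z)) = of_real (norm z) ^ (m + n) * f (z /\<^sub>R norm z)"
      by (rule bihom_homogeneous[OF f])
    moreover have "f (z /\<^sub>R norm z) = 0" using that by (intro z) simp
    ultimately show ?thesis using that by simp
  qed
  have "f (0 *\<^sub>R axis undefined 1) = of_real 0 ^ (m + n) * f (axis undefined 1)"
    by (rule bihom_homogeneous[OF f])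
  moreover have "f (axis undefined 1) = 0" by (rule pos) (simp add: axis_eq_0_iff)
  ultimately have "f 0 = 0" by simp
  then show ?thesis using pos by (cases "z = 0") auto
qed

definition harmonic_poly :: "nat \<Rightarrow> nat \<Rightarrow> (complex ^ 'd::finite \<Rightarrow> complex) \<Rightarrow> bool" where
  "harmonic_poly m n f \<longleftrightarrow> bihom m n f \<and> (\<forall>z. wirtinger_laplacian f z = 0)"

lemma harmonic_space_eq: "harmonic_space m n = {(\<lambda>z. if z \<in> sphere 0 1 then f z else 0) | f. harmonic_poly m n f}"
  by (simp add: harmonic_space_def harmonic_poly_def bihomogeneous_poly_iff_bihom complex_laplacian_eq)

lemma laplacian_linear:
  assumes f: "bihom m n f" and g: "bihom m n g"
  shows "wirtinger_laplacian (\<lambda>z. f z + g z) z = wirtinger_laplacian f z + wirtinger_laplacian g z"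
    and "wirtinger_laplacian (\<lambda>z. c * f z) z = c * wirtinger_laplacian f z"
proof -
  have 1: "partial_cnj j (\<lambda>z. f z + g z) = (\<lambda>z. partial_cnj j f z + partial_cnj j g z)"
    "partial_cnj j (\<lambda>z. c * f z) = (\<lambda>z. c * partial_cnj j f z)" for j
    using f[THEN bihom_differentiable] g[THEN bihom_differentiable]
    by (simp_all add: fun_eq_iff partial_add partial_mult partial_const)
  have d: "partial_cnj j f differentiable (at z)" "partial_cnj j g differentiable (at z)" for j z
    using bihom_derivative_terms(2)[OF f] bihom_derivative_terms(2)[OF g] by (blast intro: bihom_differentiable)+
  show "wirtinger_laplacian (\<lambda>z. f z + g z) z = wirtinger_laplacian f z + wirtinger_laplacian g z"
    "wirtinger_laplacian (\<lambda>z. c * f z) z = c * wirtinger_laplacian f z"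
    unfolding wirtinger_laplacian_def 1 using d
    by (simp_all add: partial_add partial_mult partial_const sum.distrib sum_distrib_left)
qed

lemma laplacian_cnj:
  assumes f: "bihom m n f"
  shows "wirtinger_laplacian (\<lambda>z. cnj (f z)) z = cnj (wirtinger_laplacian f z)"
proof -
  have 1: "partial_cnj j (\<lambda>z. cnj (f z)) = (\<lambda>z. cnj (partial_z j f z))" for j
    using f[THEN bihom_differentiable] by (simp add: fun_eq_iff partial_of_cnj)
  have d: "partial_z j f differentiable (at z)" for j z
    using bihom_derivative_terms(1)[OF f] by (blast intro: bihom_differentiable)
  show ?thesis
    unfolding wirtinger_laplacian_def 1 using d
    by (simp add: partial_of_cnj partial_commute[OF f])
qed

lemma laplacian_zero: "wirtinger_laplacian (\<lambda>_. 0) z = 0"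
  by (simp add: wirtinger_laplacian_def partial_const[abs_def])

lemma harm_function_space: "function_space (harmonic_poly m n)" "function_space (bihom m n)"
proof -
  show "function_space (harmonic_poly m n)"
    unfolding function_space_def harmonic_poly_def
    by (auto simp: laplacian_linear laplacian_zero intro: bihom_zero bihom_add bihom_scale bihom_continuous)
  show "function_space (bihom m n)"
    unfolding function_space_def by (auto intro: bihom_zero bihom_add bihom_scale bihom_continuous)
qed

text \<open>The product of \<open>f\<close> and \<open>cnj g\<close> has bidegree \<open>(m + n', n + m')\<close>. If it is unbalanced, its integral vanishes. Otherwise
  \<open>n \<noteq> n'\<close>, and Green's identity, whose left side is \<open>0\<close> for harmonic functions, has a non-zero factor on the right.\<close>

lemma harm_orthogonal:
  fixes f g :: "complex ^ 'd::finite \<Rightarrow> complex"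
  assumes f: "harmonic_poly m n f" and g: "harmonic_poly m' n' g" and ne: "(m, n) \<noteq> (m', n')"
  shows "ip f g = 0"
proof (cases "n = n'")
  case True
  have "bihom (m + n') (n + m') (\<lambda>z. f z * cnj (g z))"
    using f g by (intro bihom_mult bihom_cnj) (auto simp: harmonic_poly_def)
  then show ?thesis
    unfolding ip_def by (rule integral_bihom_unbalanced) (use True ne in auto)
next
  case False
  have fb: "bihom m n f" and gb: "bihom m' n' g" using f g by (auto simp: harmonic_poly_def)
  have "of_nat (CARD('d) + m + n' - 1) * (of_nat n - of_nat n') * ip f g = (0::complex)"
    using green_identity[OF fb bihom_cnj[OF gb]] f g
    by (simp add: ip_def laplacian_cnj[OF gb] harmonic_poly_def)
  moreover have "(of_nat n - of_nat n' :: complex) \<noteq> 0" using False by simp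
  moreover have "(of_nat (CARD('d) + m + n' - 1) :: complex) \<noteq> 0 \<or> ip f g = 0"
  proof (cases "CARD('d) + m + n' - 1 = 0")
    case True
    have "CARD('d) > 0" by simp
    then have "m = 0" "n' = 0" using True by linarith+
    then have "m + n' \<noteq> n + m'" using False by auto
    then have "ip f g = 0"
      unfolding ip_def using bihom_mult[OF fb bihom_cnj[OF gb]] by (intro integral_bihom_unbalanced)
    then show ?thesis by simp
  qed (simp only: of_nat_eq_0_iff, simp)
  ultimately show ?thesis by auto
qed

definition radius_square :: "complex ^ 'd::finite \<Rightarrow> complex" where
  "radius_square z = (\<Sum>l\<in>UNIV. z $ l * cnj (z $ l))"

lemma radius_square_sphere: "z \<in> sphere 0 1 \<Longrightarrow> radius_square z = 1"
  unfolding radius_square_def by (rule sphere_coord_sum)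

lemma bihom_radius_square: "bihom m n f \<Longrightarrow> bihom (Suc m) (Suc n) (\<lambda>z. radius_square z * f z)"
proof -
  assume f: "bihom m n f"
  have "bihom 1 1 (radius_square :: complex ^ 'a \<Rightarrow> complex)"
    unfolding radius_square_def [abs_def]
    by (intro bihom_sum) (use bihom_mult[OF bihom_coord(1) bihom_coord(2)] in simp)
  from bihom_mult[OF this f] show ?thesis by simp
qed

text \<open>By Green's identity the square integral of \<open>\<Delta>f\<close> is a combination of the inner products of \<open>f\<close> with \<open>\<Delta>\<Delta>f\<close> and with \<open>\<Delta>f\<close>.
  On the sphere both are restrictions of polynomials of bidegree \<open>(m, n)\<close>.\<close>

lemma orthogonal_imp_harm:
  fixes f :: "complex ^ 'd::finite \<Rightarrow> complex"
  assumes f: "bihom (Suc m) (Suc n) f" and orth: "\<And>g. bihom m n g \<Longrightarrow> ip f g = 0"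
  shows "harmonic_poly (Suc m) (Suc n) f"
proof -
  define g where "g = wirtinger_laplacian f"
  have g: "bihom m n g" using bihom_laplacian[OF f] by (simp add: g_def)
  have "ip f (wirtinger_laplacian g) = 0"
  proof (cases "m = 0 \<or> n = 0")
    case True
    have "partial_cnj j g = (\<lambda>_. 0) \<or> (\<forall>z. partial_z j (partial_cnj j g) z = 0)" for j
      using True bihom_partial_cnj[OF g] bihom_partial_z[OF bihom_derivative_terms(2)[OF g], of j j] by (auto simp: fun_eq_iff)
    then have "partial_z j (partial_cnj j g) z = 0" for j z
      by (metis partial_const(1))
    then have "wirtinger_laplacian g z = 0" for z by (simp add: wirtinger_laplacian_def)
    then show ?thesis by (simp add: ip_def)
  next
    case False
    then have "bihom m n (\<lambda>z. radius_square z * wirtinger_laplacian g z)"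
      using bihom_radius_square[OF bihom_laplacian[OF g]] by simp
    from orth[OF this] show ?thesis
      using ip_cong[of f f "wirtinger_laplacian g" "\<lambda>z. radius_square z * wirtinger_laplacian g z"]
      by (simp add: radius_square_sphere)
  qed
  moreover have "ip f g = 0" by (rule orth[OF g])
  ultimately have "ip g g = 0"
    using green_identity[OF f bihom_cnj[OF g]]
    by (simp add: ip_def laplacian_cnj[OF g] g_def[symmetric])
  then have "g z = 0" if "z \<in> sphere 0 1" for z
    using ip_self_zero[OF bihom_continuous[OF g] _ that] by simp
  then have "g z = 0" for z by (rule bihom_eq_zero[OF g])
  then show ?thesis using f by (simp add: harmonic_poly_def g_def)
qed

lemma harm_of_zero_degree: "bihom m n f \<Longrightarrow> m = 0 \<or> n = 0 \<Longrightarrow> harmonic_poly m n f"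
proof -
  assume f: "bihom m n f" and mn: "m = 0 \<or> n = 0"
  have "partial_cnj j f = (\<lambda>_. 0) \<or> (\<forall>z. partial_z j (partial_cnj j f) z = 0)" for j
    using mn bihom_partial_cnj[OF f] bihom_partial_z[OF bihom_derivative_terms(2)[OF f], of j j] by (auto simp: fun_eq_iff)
  then have "partial_z j (partial_cnj j f) z = 0" for j z
    by (metis partial_const(1))
  then show ?thesis using f by (simp add: harmonic_poly_def wirtinger_laplacian_def)
qed

lemma bihom_span_zmon:
  assumes "bihom m n f"
  shows "\<exists>c. \<forall>z\<in>sphere 0 1. f z = (\<Sum>k\<in>{\<alpha>. sum \<alpha> UNIV = m} \<times> {\<beta>. sum \<beta> UNIV = n}. c k * zmon (fst k) (snd k) z)"
proof -
  obtain c where "f = (\<lambda>z. \<Sum>\<alpha> | sum \<alpha> UNIV = m. \<Sum>\<beta> | sum \<beta> UNIV = n. c \<alpha> \<beta> * zmon \<alpha> \<beta> z)"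
    using assms unfolding bihomogeneous_poly_iff_bihom[symmetric] bihomogeneous_poly_zmon by blast
  then show ?thesis
    by (intro exI[of _ "\<lambda>k. c (fst k) (snd k)"]) (simp add: sum.cartesian_product split_beta)
qed

lemma zmon_continuous: "continuous_on A (zmon \<alpha> \<beta>)"
  by (rule bihom_continuous[OF bihom_zmon])

lemma harm_basis_exists:
  fixes m n :: nat
  assumes "function_space P" "\<And>f :: complex ^ 'd::finite \<Rightarrow> complex. P f \<Longrightarrow> bihom m n f"
  shows "\<exists>U. orthonormal U \<and> (\<forall>u\<in>U. P u) \<and> (\<forall>f. P f \<longrightarrow> (\<forall>z\<in>sphere 0 1. f z = (\<Sum>u\<in>U. ip f u * u z)))"
  using orthonormal_basis_exists[OF assms(1), of "{\<alpha>. sum \<alpha> UNIV = m} \<times> {\<beta>. sum \<beta> UNIV = n}" "\<lambda>k. zmon (fst k) (snd k)"]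
    bihom_span_zmon assms(2) finite_multi_index zmon_continuous by blast

text \<open>On the sphere \<open>\<bar>z\<bar>\<^sup>2 = 1\<close>, so polynomials of bidegree \<open>(m, n)\<close> restrict to functions of bidegree
  \<open>(Suc m, Suc n)\<close>. The residual of \<open>f\<close> after orthogonal projection onto them is harmonic.\<close>

lemma fischer_decomposition:
  fixes f :: "complex ^ 'd::finite \<Rightarrow> complex"
  assumes f: "bihom (Suc m) (Suc n) f"
  shows "\<exists>h g. harmonic_poly (Suc m) (Suc n) h \<and> bihom m n g \<and> (\<forall>z\<in>sphere 0 1. f z = h z + g z)"
proof -
  obtain V :: "(complex ^ 'd \<Rightarrow> complex) set" where V: "orthonormal V" "\<And>v. v \<in> V \<Longrightarrow> bihom m n v"
    "\<And>g z. bihom m n g \<Longrightarrow> z \<in> sphere 0 1 \<Longrightarrow> g z = (\<Sum>u\<in>V. ip g u * u z)"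
    using harm_basis_exists[OF harm_function_space(2)] by blast
  define g where "g z = (\<Sum>v\<in>V. ip f v * v z)" for z
  have g: "bihom m n g" unfolding g_def[abs_def] using V(2) by (intro bihom_sum bihom_scale)
  define h where "h z = f z - radius_square z * g z" for z
  have h: "bihom (Suc m) (Suc n) h" unfolding h_def[abs_def] by (intro bihom_diff f bihom_radius_square g)
  have fc: "sphere_cont f" by (rule bihom_continuous[OF f])
  have hs: "h z = f z - (\<Sum>v\<in>V. ip f v * v z)" if "z \<in> sphere 0 1" for z
    using radius_square_sphere[OF that] by (simp add: h_def g_def)
  have "ip h g' = 0" if g': "bihom m n g'" for g'
  proof -
    have hv: "ip h v = 0" if "v \<in> V" for v
      using orthonormal_residual(2)[OF V(1) fc that] ip_cong[of h _ v v, OF hs] by simp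
    have "ip g' h = ip (\<lambda>z. \<Sum>u\<in>V. ip g' u * u z) h"
      by (intro ip_cong V(3)[OF g']) auto
    also have "\<dots> = (\<Sum>u\<in>V. ip g' u * ip u h)"
      using V(2) h by (intro ip_lincomb_left) (auto intro: bihom_continuous)
    also have "\<dots> = 0"
      using hv by (intro sum.neutral) (metis ip_cnj complex_cnj_zero mult_zero_right)
    finally show ?thesis by (metis ip_cnj complex_cnj_zero)
  qed
  then have "harmonic_poly (Suc m) (Suc n) h" by (intro orthogonal_imp_harm h)
  moreover have "f z = h z + g z" if "z \<in> sphere 0 1" for z
    using radius_square_sphere[OF that] by (simp add: h_def)
  ultimately show ?thesis using g by blast
qed

section \<open>The graded basis and its kernel\<close>

text \<open>An orthonormal basis of the harmonic polynomials of bidegree \<open>(m, n)\<close>. Its elements are polynomials on the whole space.\<close>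

definition hbasis :: "nat \<Rightarrow> nat \<Rightarrow> (complex ^ 'd::finite \<Rightarrow> complex) set" where
  "hbasis m n = (SOME U. orthonormal U \<and> (\<forall>u\<in>U. harmonic_poly m n u) \<and>
     (\<forall>f. harmonic_poly m n f \<longrightarrow> (\<forall>z\<in>sphere 0 1. f z = (\<Sum>u\<in>U. ip f u * u z))))"

lemma hbasis:
  shows "orthonormal (hbasis m n)" "u \<in> hbasis m n \<Longrightarrow> harmonic_poly m n u"
    "harmonic_poly m n f \<Longrightarrow> z \<in> sphere 0 1 \<Longrightarrow> f z = (\<Sum>u\<in>hbasis m n. ip f u * u z)"
proof -
  have "\<exists>U. orthonormal U \<and> (\<forall>u\<in>U. harmonic_poly m n u) \<and>
     (\<forall>f. harmonic_poly m n f \<longrightarrow> (\<forall>z\<in>sphere 0 1. f z = (\<Sum>u\<in>U. ip f u * u z)))"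
    by (rule harm_basis_exists[where P = "harmonic_poly m n" and m = m and n = n, OF harm_function_space(1)]) (simp add: harmonic_poly_def)
  from someI_ex[OF this, folded hbasis_def]
  show "orthonormal (hbasis m n)" "u \<in> hbasis m n \<Longrightarrow> harmonic_poly m n u"
    "harmonic_poly m n f \<Longrightarrow> z \<in> sphere 0 1 \<Longrightarrow> f z = (\<Sum>u\<in>hbasis m n. ip f u * u z)" by blast+
qed

definition graded_basis :: "nat \<Rightarrow> (complex ^ 'd::finite \<Rightarrow> complex) set" where
  "graded_basis N = (\<Union>m\<in>{..N}. \<Union>n\<in>{..N}. hbasis m n)"

lemma hbasis_disjoint:
  assumes u: "u \<in> hbasis m n" "u \<in> hbasis m' n'"
  shows "m = m' \<and> n = n'"
proof (rule ccontr)
  assume "\<not> (m = m' \<and> n = n')"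
  then have "ip u u = 0" by (intro harm_orthogonal[OF hbasis(2)[OF u(1)] hbasis(2)[OF u(2)]]) auto
  moreover have "ip u u = 1" using hbasis(1)[of m n] u(1) by (auto simp: orthonormal_def)
  ultimately show False by simp
qed

lemma orthonormal_graded_basis: "orthonormal (graded_basis N)"
  unfolding orthonormal_def
proof (intro conjI ballI)
  show "finite (graded_basis N)"
    unfolding graded_basis_def using hbasis(1) by (auto simp: orthonormal_def)
  show "sphere_cont u" if "u \<in> graded_basis N" for u :: "complex ^ 'a \<Rightarrow> complex"
    using that hbasis(1) unfolding graded_basis_def orthonormal_def by blast
  fix u v :: "complex ^ 'a \<Rightarrow> complex" assume "u \<in> graded_basis N" "v \<in> graded_basis N"
  then obtain m n m' n' where u: "u \<in> hbasis m n" and v: "v \<in> hbasis m' n'"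
    by (auto simp: graded_basis_def)
  show "ip u v = (if u = v then 1 else 0)"
  proof (cases "(m, n) = (m', n')")
    case True
    then show ?thesis using u v hbasis(1)[of m n] by (auto simp: orthonormal_def)
  next
    case False
    then have "ip u v = 0" by (rule harm_orthogonal[OF hbasis(2)[OF u] hbasis(2)[OF v]])
    moreover have "u \<noteq> v" using hbasis_disjoint[OF u] v False by auto
    ultimately show ?thesis by simp
  qed
qed

lemma orthonormal_coefficients:
  assumes U: "orthonormal U" and f: "\<And>z. z \<in> sphere 0 1 \<Longrightarrow> f z = (\<Sum>u\<in>U. c u * u z)" and u: "u \<in> U"
  shows "ip f u = c u"
proof -
  have "ip f u = ip (\<lambda>z. \<Sum>u\<in>U. c u * u z) u" by (intro ip_cong f) auto
  also have "\<dots> = (\<Sum>u'\<in>U. c u' * ip u' u)"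
    using U u by (intro ip_lincomb_left) (auto simp: orthonormal_def)
  also have "\<dots> = (\<Sum>u'\<in>U. if u' = u then c u else 0)"
    using U u by (intro sum.cong) (auto simp: orthonormal_def)
  also have "\<dots> = c u" using U u by (simp add: orthonormal_def)
  finally show ?thesis .
qed

text \<open>The coefficients of an element of the span of an orthonormal family are its inner products.\<close>

definition in_span :: "nat \<Rightarrow> (complex ^ 'd::finite \<Rightarrow> complex) \<Rightarrow> bool" where
  "in_span N f \<longleftrightarrow> (\<forall>z\<in>sphere 0 1. f z = (\<Sum>u\<in>graded_basis N. ip f u * u z))"

lemma in_spanI:
  assumes f: "\<And>z. z \<in> sphere 0 1 \<Longrightarrow> f z = (\<Sum>u\<in>graded_basis N. c u * u z)"
  shows "in_span N f"
  unfolding in_span_def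
proof
  fix z :: "complex ^ 'a" assume z: "z \<in> sphere 0 1"
  have "ip f u = c u" if "u \<in> graded_basis N" for u
    by (rule orthonormal_coefficients[OF orthonormal_graded_basis f that])
  then show "f z = (\<Sum>u\<in>graded_basis N. ip f u * u z)" using f[OF z] by simp
qed

lemma in_span_add: "in_span N f \<Longrightarrow> in_span N g \<Longrightarrow> in_span N (\<lambda>z. f z + g z)"
  by (rule in_spanI[where c = "\<lambda>u. ip f u + ip g u"]) (simp add: in_span_def sum.distrib distrib_right)

lemma in_span_cong: "in_span N f \<Longrightarrow> (\<And>z. z \<in> sphere 0 1 \<Longrightarrow> g z = f z) \<Longrightarrow> in_span N g"
  by (rule in_spanI[where c = "\<lambda>u. ip f u"]) (simp add: in_span_def)

lemma harm_in_span:
  fixes f :: "complex ^ 'd::finite \<Rightarrow> complex"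
  assumes f: "harmonic_poly m n f" and "m \<le> N" "n \<le> N"
  shows "in_span N f"
proof (rule in_spanI[where c = "\<lambda>u. if u \<in> hbasis m n then ip f u else 0"])
  fix z :: "complex ^ 'd" assume z: "z \<in> sphere 0 1"
  have sub: "hbasis m n \<subseteq> graded_basis N" using assms unfolding graded_basis_def by auto
  have fin: "finite (graded_basis N :: (complex ^ 'd \<Rightarrow> complex) set)" using orthonormal_graded_basis by (auto simp: orthonormal_def)
  have "(\<Sum>u\<in>graded_basis N. (if u \<in> hbasis m n then ip f u else 0) * u z) = (\<Sum>u\<in>hbasis m n. ip f u * u z)"
    by (rule sum.mono_neutral_cong_right[OF fin sub]) auto
  then show "f z = (\<Sum>u\<in>graded_basis N. (if u \<in> hbasis m n then ip f u else 0) * u z)"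
    using hbasis(3)[OF f z] by simp
qed

text \<open>Repeated Fischer decomposition expresses a polynomial on the sphere by harmonic polynomials of smaller bidegrees.\<close>

lemma bihom_in_span:
  fixes f :: "complex ^ 'd::finite \<Rightarrow> complex"
  shows "bihom m n f \<Longrightarrow> m \<le> N \<Longrightarrow> n \<le> N \<Longrightarrow> in_span N f"
proof (induction m arbitrary: n f)
  case 0
  then show ?case using harm_of_zero_degree harm_in_span by blast
next
  case (Suc m)
  show ?case
  proof (cases n)
    case 0
    then show ?thesis using Suc.prems harm_of_zero_degree harm_in_span by blast
  next
    case (Suc n')
    then obtain h g where hg: "harmonic_poly (Suc m) (Suc n') h" "bihom m n' g" "\<And>z. z \<in> sphere 0 1 \<Longrightarrow> f z = h z + g z"
      using fischer_decomposition[of m n' f] Suc.prems by blast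
    have "in_span N h" using Suc Suc.prems by (intro harm_in_span[OF hg(1)]) auto
    moreover have "in_span N g" using Suc Suc.prems by (intro Suc.IH[OF hg(2)]) auto
    ultimately show ?thesis using in_span_add in_span_cong hg(3) by blast
  qed
qed

lemma graded_basis_bihom: "u \<in> graded_basis N \<Longrightarrow> \<exists>m n. m \<le> N \<and> n \<le> N \<and> bihom m n u"
  unfolding graded_basis_def using hbasis(2) by (fastforce simp: harmonic_poly_def)

lemma bihom_compose_linear:
  assumes f: "bihom m n f" and U: "\<And>z j. U z $ j = (\<Sum>l\<in>UNIV. a j l * z $ l)"
  shows "bihom m n (\<lambda>z. f (U z))"
  using f
proof (induction rule: bihom.induct)
  case (bihom_const c)
  then show ?case by (rule bihom.bihom_const)
next
  case (bihom_zero m n)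
  then show ?case by (rule bihom.bihom_zero)
next
  case (bihom_z m n f j)
  have "bihom 1 0 (\<lambda>z. U z $ j)"
    unfolding U by (intro bihom_sum bihom_scale bihom_coord)
  from bihom_mult[OF this bihom_z.IH] show ?case by simp
next
  case (bihom_conj m n f j)
  have "bihom 0 1 (\<lambda>z. cnj (U z $ j))"
    unfolding U cnj_sum complex_cnj_mult by (intro bihom_sum bihom_scale bihom_coord)
  from bihom_mult[OF this bihom_conj.IH] show ?case by simp
next
  case (bihom_add m n f g)
  then show ?case by (intro bihom.bihom_add)
qed

definition cip :: "complex ^ 'd::finite \<Rightarrow> complex ^ 'd \<Rightarrow> complex" where
  "cip z v = (\<Sum>l\<in>UNIV. z $ l * cnj (v $ l))"

lemma cip_self: "cip z z = of_real ((norm z)\<^sup>2)"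
  unfolding cip_def norm_square_vec of_real_sum by (intro sum.cong refl) (metis complex_norm_square)

lemma cip_cnj: "cnj (cip z v) = cip v z"
  by (simp add: cip_def mult.commute)

lemma cip_diff_scale: "cip (x - s *s v) (x - s *s v) = cip x x - cnj s * cip x v - s * cip v x + s * cnj s * cip v v"
  by (simp add: cip_def sum_subtractf sum.distrib sum_distrib_left algebra_simps)

lemma norm_axis_complex: "norm (axis i (1::complex)) = 1"
  by (simp add: norm_eq_sqrt_inner inner_axis_axis)

text \<open>The unitary group acts transitively: a phase makes the Hermitian product of the two points real, and then a
  complex reflection maps one to the other.\<close>

lemma unitary_transitive:
  fixes w w' :: "complex ^ 'd::finite"
  assumes w: "w \<in> sphere 0 1" and w': "w' \<in> sphere 0 1"
  shows "\<exists>U a. (\<forall>z j. U z $ j = (\<Sum>l\<in>UNIV. a j l * z $ l)) \<and> linear U \<and> (\<forall>z. norm (U z) = norm z) \<and> U w = w'"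
proof -
  define c where "c = cip w w'"
  define \<eta> where "\<eta> = (if c = 0 then 1 else cnj c / of_real (norm c))"
  have \<eta>: "norm \<eta> = 1" "\<eta> * c = of_real (norm c)"
    by (auto simp: \<eta>_def norm_divide complex_norm_square[symmetric] power2_eq_square mult.commute)
  define \<rho> where "\<rho> = norm c"
  define v where "v = \<eta> *s w - w'"
  have cip1: "cip (\<eta> *s w) w' = of_real \<rho>"
    using \<eta>(2) by (simp add: \<rho>_def c_def cip_def sum_distrib_left mult.assoc)
  have ww: "cip w w = 1" "cip w' w' = 1" using w w' by (simp_all add: cip_self)
  have etaw: "cip (\<eta> *s w) (\<eta> *s w) = 1"
  proof -
    have "cip (\<eta> *s w) (\<eta> *s w) = (\<eta> * cnj \<eta>) * cip w w"
      by (simp add: cip_def sum_distrib_left mult_ac)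
    then show ?thesis using norm_unit_square[OF \<eta>(1)] ww by simp
  qed
  have cipd: "cip z v = cip z (\<eta> *s w) - cip z w'" "cip v z = cip (\<eta> *s w) z - cip w' z" for z
    by (simp_all add: cip_def v_def sum_subtractf algebra_simps)
  have vv: "cip v v = of_real (2 - 2 * \<rho>)"
  proof -
    have "cip w' (\<eta> *s w) = cnj (cip (\<eta> *s w) w')" by (rule cip_cnj[symmetric])
    also have "\<dots> = of_real \<rho>" by (simp only: cip1 complex_cnj_complex_of_real)
    finally have "cip w' (\<eta> *s w) = of_real \<rho>" .
    moreover have "cip v v = (cip (\<eta> *s w) (\<eta> *s w) - cip w' (\<eta> *s w)) - (cip (\<eta> *s w) w' - cip w' w')"
      using cipd(1)[of v] cipd(2)[of "\<eta> *s w"] cipd(2)[of w'] by simp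
    ultimately show ?thesis by (simp add: etaw ww cip1)
  qed
  have wv: "cip (\<eta> *s w) v = of_real (1 - \<rho>)"
    unfolding cipd(1) etaw cip1 by simp
  define \<kappa> where "\<kappa> = (if v = 0 then 0 else 2 / (norm v)\<^sup>2)"
  define U where "U z = \<eta> *s z - (of_real \<kappa> * cip (\<eta> *s z) v) *s v" for z
  define a where "a j l = (if l = j then \<eta> else 0) - of_real \<kappa> * \<eta> * cnj (v $ l) * v $ j" for j l
  have coords: "U z $ j = (\<Sum>l\<in>UNIV. a j l * z $ l)" for z j
  proof -
    have "(\<Sum>l\<in>UNIV. a j l * z $ l) = (\<Sum>l\<in>UNIV. (if l = j then \<eta> * z $ j else 0) - (of_real \<kappa> * v $ j) * (\<eta> * z $ l * cnj (v $ l)))"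
      by (intro sum.cong) (auto simp: a_def algebra_simps)
    also have "\<dots> = U z $ j"
      by (simp add: sum_subtractf sum_distrib_left[symmetric] U_def cip_def mult_ac)
    finally show ?thesis by simp
  qed
  have lin: "linear U"
    by (rule linearI) (simp_all add: vec_eq_iff coords sum.distrib distrib_left scaleR_conv_of_real[where 'a = complex] sum_distrib_left mult_ac)
  have iso: "norm (U z) = norm z" for z
  proof -
    define x where "x = \<eta> *s z"
    define s where "s = of_real \<kappa> * cip x v"
    have xx: "cip x x = cip z z"
    proof -
      have "cip x x = (\<eta> * cnj \<eta>) * cip z z"
        by (simp add: x_def cip_def sum_distrib_left mult_ac)
      then show ?thesis using norm_unit_square[OF \<eta>(1)] by simp
    qed
    have "U z = x - s *s v" by (simp only: U_def x_def s_def)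
    then have "cip (U z) (U z) = cip x x - cnj s * cip x v - s * cip v x + s * cnj s * cip v v"
      by (simp only: cip_diff_scale)
    also have "cip v x = cnj (cip x v)" by (simp add: cip_cnj)
    also have "cip x x - cnj s * cip x v - s * cnj (cip x v) + s * cnj s * cip v v
       = cip x x - of_real \<kappa> * (2 - of_real \<kappa> * cip v v) * (cip x v * cnj (cip x v))"
      by (simp add: s_def algebra_simps)
    also have "of_real \<kappa> * (2 - of_real \<kappa> * cip v v) = 0"
      by (simp add: \<kappa>_def cip_self)
    finally have "cip (U z) (U z) = cip z z" using xx by simp
    then have "complex_of_real ((norm (U z))\<^sup>2) = of_real ((norm z)\<^sup>2)" by (simp only: cip_self)
    then have "(norm (U z))\<^sup>2 = (norm z)\<^sup>2" using of_real_eq_iff by blast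
    then show ?thesis by simp
  qed
  have "U w = w'"
  proof (cases "v = 0")
    case True
    then show ?thesis by (simp add: U_def \<kappa>_def v_def)
  next
    case False
    then have n: "(norm v)\<^sup>2 = 2 - 2 * \<rho>" "(norm v)\<^sup>2 \<noteq> 0"
      using vv unfolding cip_self by (simp_all only: of_real_eq_iff) auto
    have "of_real \<kappa> * cip (\<eta> *s w) v = (of_real (\<kappa> * (1 - \<rho>)) :: complex)" by (simp add: wv)
    also have "\<kappa> * (1 - \<rho>) = 1" using False n by (simp add: \<kappa>_def field_simps)
    finally show ?thesis by (simp add: U_def v_def)
  qed
  then show ?thesis using coords lin iso by blast
qed

text \<open>The functions \<open>u (U z)\<close> are again an orthonormal family in the span of the basis, and the sum of squares at a point
  is largest for a basis.\<close>

lemma kernel_diag_le: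
  fixes U :: "complex ^ 'd::finite \<Rightarrow> complex ^ 'd"
  assumes coords: "\<And>z j. U z $ j = (\<Sum>l\<in>UNIV. a j l * z $ l)"
    and U: "linear U" "\<And>z. norm (U z) = norm z" and w: "w \<in> sphere 0 1"
  shows "(\<Sum>u\<in>graded_basis N. (norm (u (U w)))\<^sup>2) \<le> (\<Sum>u\<in>graded_basis N. (norm (u w))\<^sup>2)"
proof -
  let ?B = "graded_basis N :: (complex ^ 'd \<Rightarrow> complex) set"
  have B: "finite ?B" "\<And>u. u \<in> ?B \<Longrightarrow> sphere_cont u" "\<And>u v. u \<in> ?B \<Longrightarrow> v \<in> ?B \<Longrightarrow> ip u v = (if u = v then 1 else 0)"
    using orthonormal_graded_basis[of N] by (auto simp: orthonormal_def)
  have surj: "surj U" by (rule isometry_surj[OF U])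
  have Uc: "\<And>u. u \<in> ?B \<Longrightarrow> sphere_cont (\<lambda>z. u (U z))"
  proof -
    fix u assume "u \<in> ?B"
    then show "sphere_cont (\<lambda>z. u (U z))"
      using bihom_compose_linear[OF _ coords] graded_basis_bihom bihom_continuous by metis
  qed
  have ipU: "ip (\<lambda>z. u (U z)) (\<lambda>z. v (U z)) = ip u v" if "u \<in> ?B" "v \<in> ?B" for u v
    unfolding ip_def using B(2) that
    by (intro integral_surface_measure_isometry[OF U(1) surj U(2), where f = "\<lambda>z. u z * cnj (v z)"]
        continuous_borel_measurable_surface continuous_intros) auto
  have inj: "inj_on (\<lambda>u z. u (U z)) ?B"
  proof (rule inj_onI)
    fix u v assume uv: "u \<in> ?B" "v \<in> ?B" "(\<lambda>z. u (U z)) = (\<lambda>z. v (U z))"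
    show "u = v"
    proof
      fix z
      obtain y where "z = U y" using surj by (metis surjD)
      then show "u z = v z" using uv(3) by (metis)
    qed
  qed
  have V: "orthonormal ((\<lambda>u z. u (U z)) ` ?B)"
    unfolding orthonormal_def using B Uc inj by (auto simp: ipU inj_on_eq_iff[OF inj])
  define k where "k z = (\<Sum>v\<in>?B. cnj (v w) * v z)" for z
  have kc: "sphere_cont k" unfolding k_def using B(2) by (intro continuous_intros)
  have repr: "f w = ip f k" if f: "in_span N f" "sphere_cont f" for f
  proof -
    have "cnj (ip f k) = (\<Sum>v\<in>?B. cnj (v w) * ip v f)"
      unfolding ip_cnj k_def using B f by (intro ip_lincomb_left) auto
    also have "\<dots> = cnj (\<Sum>v\<in>?B. ip f v * v w)"
      by (simp add: ip_cnj mult.commute)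
    also have "(\<Sum>v\<in>?B. ip f v * v w) = f w" using f(1) w by (simp add: in_span_def)
    finally show ?thesis by simp
  qed
  have "(\<Sum>u\<in>?B. (norm (u (U w)))\<^sup>2) = (\<Sum>u\<in>?B. (norm (ip k (\<lambda>z. u (U z))))\<^sup>2)"
  proof (intro sum.cong refl)
    fix u assume u: "u \<in> ?B"
    obtain m n where "m \<le> N" "n \<le> N" "bihom m n u" using graded_basis_bihom[OF u] by blast
    then have "in_span N (\<lambda>z. u (U z))"
      using bihom_in_span bihom_compose_linear[OF _ coords] by blast
    then have "u (U w) = ip (\<lambda>z. u (U z)) k" by (rule repr) (rule Uc[OF u])
    then show "(norm (u (U w)))\<^sup>2 = (norm (ip k (\<lambda>z. u (U z))))\<^sup>2"
      by (metis ip_cnj complex_mod_cnj)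
  qed
  also have "\<dots> = (\<Sum>v\<in>(\<lambda>u z. u (U z)) ` ?B. (norm (ip k v))\<^sup>2)"
    by (simp add: sum.reindex[OF inj])
  also have "\<dots> \<le> (LINT z|surface_measure. (norm (k z))\<^sup>2)"
    by (rule bessel[OF V kc])
  also have "\<dots> = (\<Sum>u\<in>?B. (norm (u w))\<^sup>2)"
  proof -
    have "complex_of_real (LINT z|surface_measure. (norm (k z))\<^sup>2) = ip k k" by (rule ip_self(1)[OF kc, symmetric])
    also have "\<dots> = k w"
    proof (rule repr[symmetric, OF _ kc])
      show "in_span N k" by (rule in_spanI[where c = "\<lambda>v. cnj (v w)"]) (simp add: k_def)
    qed
    also have "\<dots> = of_real (\<Sum>u\<in>?B. (norm (u w))\<^sup>2)"
      unfolding k_def of_real_sum by (intro sum.cong refl) (metis complex_norm_square mult.commute)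
    finally show ?thesis using of_real_eq_iff by blast
  qed
  finally show ?thesis .
qed

definition sphere_area :: "'d::finite itself \<Rightarrow> real" where
  "sphere_area _ = measure (surface_measure :: (complex ^ 'd) measure) (sphere 0 1)"

lemma sphere_area_pos: "sphere_area TYPE('d::finite) > 0"
proof (rule ccontr)
  interpret finite_measure "surface_measure :: (complex ^ 'd) measure" by (rule finite_measure_surface_measure)
  assume "\<not> ?thesis"
  then have "measure (surface_measure :: (complex ^ 'd) measure) (space surface_measure) = 0"
    using measure_nonneg[of "surface_measure :: (complex ^ 'd) measure" "sphere 0 1"] by (simp add: sphere_area_def)
  then have "emeasure (surface_measure :: (complex ^ 'd) measure) (space surface_measure) = 0"
    by (simp add: emeasure_eq_measure del: space_surface_measure)
  then have "AE x in (surface_measure :: (complex ^ 'd) measure). (1::complex) = 0"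
    by (intro AE_I[of _ _ "space surface_measure"] sets.top) auto
  then have "(1::complex) = 0"
    by (rule continuous_AE_zero_surface[where w = "axis undefined 1 :: complex ^ 'd" and f = "\<lambda>_. 1", rotated])
       (auto simp: norm_axis_complex)
  then show False by simp
qed

text \<open>By transitivity the diagonal of the reproducing kernel is constant on the sphere. Its integral is the number of basis
  elements.\<close>

lemma kernel_diag_eq:
  fixes w :: "complex ^ 'd::finite"
  assumes w: "w \<in> sphere 0 1"
  shows "(\<Sum>u\<in>graded_basis N. (norm (u w))\<^sup>2) * sphere_area TYPE('d) = real (card (graded_basis N :: (complex ^ 'd \<Rightarrow> complex) set))"
proof -
  interpret finite_measure "surface_measure :: (complex ^ 'd) measure" by (rule finite_measure_surface_measure)
  let ?B = "graded_basis N :: (complex ^ 'd \<Rightarrow> complex) set"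
  let ?K = "\<lambda>w. \<Sum>u\<in>?B. (norm (u w))\<^sup>2"
  have B: "finite ?B" "\<And>u. u \<in> ?B \<Longrightarrow> sphere_cont u" "\<And>u. u \<in> ?B \<Longrightarrow> ip u u = 1"
    using orthonormal_graded_basis[of N] by (auto simp: orthonormal_def)
  have le: "?K z' \<le> ?K z" if z: "z \<in> sphere 0 1" "z' \<in> sphere 0 1" for z z'
  proof -
    obtain U a where U: "\<And>z j. U z $ j = (\<Sum>l\<in>UNIV. a j l * z $ l)" "linear U" "\<And>z. norm (U z) = norm z" "U z = z'"
      using unitary_transitive[OF z] by blast
    from kernel_diag_le[OF U(1-3) z(1)] show ?thesis unfolding U(4) .
  qed
  have "real (card ?B) = (\<Sum>u\<in>?B. LINT z|surface_measure. (norm (u z))\<^sup>2)"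
  proof -
    have "(LINT z|surface_measure. (norm (u z))\<^sup>2) = 1" if "u \<in> ?B" for u
    proof -
      have "complex_of_real (LINT z|surface_measure. (norm (u z))\<^sup>2) = of_real 1"
        using ip_self(1)[OF B(2)[OF that]] B(3)[OF that] by simp
      then show ?thesis using of_real_eq_iff by blast
    qed
    then show ?thesis by simp
  qed
  also have "\<dots> = (LINT z|surface_measure. ?K z)"
    using B(2) by (intro Bochner_Integration.integral_sum[symmetric] continuous_integrable_surface continuous_intros) auto
  also have "\<dots> = (LINT z|(surface_measure :: (complex ^ 'd) measure). ?K w)"
    using le w by (intro Bochner_Integration.integral_cong refl antisym) auto
  also have "\<dots> = ?K w * sphere_area TYPE('d)"
    by (simp add: sphere_area_def)
  finally show ?thesis by simp
qed

lemma zmon_reduce: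
  fixes \<alpha> \<beta> :: "'d::finite \<Rightarrow> nat"
  assumes z: "z \<in> sphere 0 1"
  shows "zmon (\<alpha>(j := Suc (\<alpha> j))) (\<beta>(j := Suc (\<beta> j))) z
     = zmon \<alpha> \<beta> z - (\<Sum>l\<in>UNIV - {j}. zmon (\<alpha>(l := Suc (\<alpha> l))) (\<beta>(l := Suc (\<beta> l))) z)"
proof -
  have sh: "zmon (\<alpha>(l := Suc (\<alpha> l))) (\<beta>(l := Suc (\<beta> l))) z = (z $ l * cnj (z $ l)) * zmon \<alpha> \<beta> z" for l
    by (simp only: zmon_shift mult.assoc mult.left_commute)
  have "zmon \<alpha> \<beta> z = (\<Sum>l\<in>UNIV. z $ l * cnj (z $ l)) * zmon \<alpha> \<beta> z"
    by (simp only: sphere_coord_sum[OF z] mult_1)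
  also have "\<dots> = (\<Sum>l\<in>UNIV. zmon (\<alpha>(l := Suc (\<alpha> l))) (\<beta>(l := Suc (\<beta> l))) z)"
    by (simp only: sh sum_distrib_right)
  finally show ?thesis by (simp add: sum.remove[of UNIV j])
qed

text \<open>Pairs of exponents in which \<open>z\<^sub>j\<close> and its conjugate do not occur together.\<close>

definition reduced_index :: "nat \<Rightarrow> 'd::finite \<Rightarrow> (('d \<Rightarrow> nat) \<times> ('d \<Rightarrow> nat)) set" where
  "reduced_index N j = PiE UNIV (\<lambda>i. if i = j then {0} else {..N}) \<times> PiE UNIV (\<lambda>_. {..N})
     \<union> PiE UNIV (\<lambda>_. {..N}) \<times> PiE UNIV (\<lambda>i. if i = j then {0} else {..N})"

lemma reduced_index_card:
  fixes j :: "'d::finite"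
  shows "finite (reduced_index N j)" "card (reduced_index N j) \<le> 2 * (N + 1) ^ (2 * CARD('d) - 1)"
proof -
  have fin: "finite (PiE (UNIV :: 'd set) (\<lambda>i. if i = j then {0} else {..N}))" "finite (PiE (UNIV :: 'd set) (\<lambda>_. {..N}))"
    by (auto intro!: finite_PiE)
  show "finite (reduced_index N j)" unfolding reduced_index_def using fin by simp
  have c1: "card (PiE (UNIV :: 'd set) (\<lambda>i. if i = j then {0} else {..N})) = (N + 1) ^ (CARD('d) - 1)"
  proof -
    have "(\<Prod>i\<in>UNIV. card (if i = j then {0} else {..N})) = card {0::nat} * (\<Prod>i\<in>UNIV - {j}. card (if i = j then {0} else {..N}))"
      by (subst prod.remove[of _ j]) auto
    also have "(\<Prod>i\<in>UNIV - {j}. card (if i = j then {0} else {..N})) = (\<Prod>i\<in>UNIV - {j}. N + 1)"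
      by (intro prod.cong) auto
    finally show ?thesis by (simp add: card_PiE card_Diff_singleton)
  qed
  have c2: "card (PiE (UNIV :: 'd set) (\<lambda>_. {..N})) = (N + 1) ^ CARD('d)"
    by (simp add: card_PiE)
  have d: "(N + 1) ^ (CARD('d) - 1) * (N + 1) ^ CARD('d) = (N + 1) ^ (2 * CARD('d) - 1)"
  proof -
    have "CARD('d) > 0" by simp
    then have "2 * CARD('d) - 1 = (CARD('d) - 1) + CARD('d)" by linarith
    then show ?thesis by (simp only: power_add)
  qed
  have "card (reduced_index N j) \<le> (N + 1) ^ (CARD('d) - 1) * (N + 1) ^ CARD('d) + (N + 1) ^ CARD('d) * (N + 1) ^ (CARD('d) - 1)"
    unfolding reduced_index_def by (rule order_trans[OF card_Un_le]) (simp only: card_cartesian_product c1 c2)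
  then show "card (reduced_index N j) \<le> 2 * (N + 1) ^ (2 * CARD('d) - 1)"
    using d by (simp only: mult.commute[of "(N + 1) ^ CARD('d)"])
qed

text \<open>The relation \<open>\<bar>z\<^sub>j\<bar>\<^sup>2 = 1 - \<Sum>\<bar>z\<^sub>l\<bar>\<^sup>2\<close>, summed over \<open>l \<noteq> j\<close>, removes one factor \<open>z\<^sub>j * cnj z\<^sub>j\<close> at a time without raising
  the degrees. This saves one of the \<open>2d\<close> exponents and gives dimension growth of order \<open>2d - 1\<close>.\<close>

lemma zmon_reduced_span:
  fixes \<alpha> \<beta> :: "'d::finite \<Rightarrow> nat"
  assumes "sum \<alpha> UNIV \<le> N" "sum \<beta> UNIV \<le> N"
  shows "\<exists>c. \<forall>z\<in>sphere 0 1. zmon \<alpha> \<beta> z = (\<Sum>k\<in>reduced_index N j. c k * zmon (fst k) (snd k) z)"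
  using assms
proof (induction "\<alpha> j" arbitrary: \<alpha> \<beta>)
  case 0
  have le: "\<alpha> i \<le> N" "\<beta> i \<le> N" for i
    using 0(2,3) member_le_sum[of i UNIV \<alpha>] member_le_sum[of i UNIV \<beta>] by auto
  have "(\<alpha>, \<beta>) \<in> reduced_index N j"
    using 0(1) le by (auto simp: reduced_index_def PiE_iff)
  then show ?case
    using reduced_index_card(1)[of N j]
    by (intro exI[of _ "\<lambda>k. if k = (\<alpha>, \<beta>) then 1 else 0"]) (simp add: if_distrib[of "\<lambda>x. x * _"] cong: if_cong)
next
  case (Suc a)
  show ?case
  proof (cases "\<beta> j = 0")
    case True
    have le: "\<alpha> i \<le> N" "\<beta> i \<le> N" for i
      using Suc(3,4) member_le_sum[of i UNIV \<alpha>] member_le_sum[of i UNIV \<beta>] by auto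
    have "(\<alpha>, \<beta>) \<in> reduced_index N j"
      using True le by (auto simp: reduced_index_def PiE_iff)
    then show ?thesis
      using reduced_index_card(1)[of N j]
      by (intro exI[of _ "\<lambda>k. if k = (\<alpha>, \<beta>) then 1 else 0"]) (simp add: if_distrib[of "\<lambda>x. x * _"] cong: if_cong)
  next
    case False
    define \<alpha>' \<beta>' where "\<alpha>' = \<alpha>(j := a)" and "\<beta>' = \<beta>(j := \<beta> j - 1)"
    have eq: "\<alpha> = \<alpha>'(j := Suc (\<alpha>' j))" "\<beta> = \<beta>'(j := Suc (\<beta>' j))"
      using Suc(2) False by (auto simp: \<alpha>'_def \<beta>'_def)
    have "Suc (sum \<alpha>' UNIV) = sum \<alpha> UNIV" "Suc (sum \<beta>' UNIV) = sum \<beta> UNIV"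
      by (subst eq(1), rule sum_fun_upd_Suc[symmetric]) (subst eq(2), rule sum_fun_upd_Suc[symmetric])
    then have s: "Suc (sum \<alpha>' UNIV) \<le> N" "Suc (sum \<beta>' UNIV) \<le> N" using Suc(3,4) by auto
    have a: "a = \<alpha>' j" by (simp add: \<alpha>'_def)
    have "\<exists>c. \<forall>z\<in>sphere 0 1. zmon \<alpha>' \<beta>' z = (\<Sum>k\<in>reduced_index N j. c k * zmon (fst k) (snd k) z)"
      using s by (intro Suc(1)[of \<alpha>' \<beta>', OF a]) auto
    then obtain c0 where c0: "\<And>z. z \<in> sphere 0 1 \<Longrightarrow> zmon \<alpha>' \<beta>' z = (\<Sum>k\<in>reduced_index N j. c0 k * zmon (fst k) (snd k) z)" by blast
    have "\<exists>c. \<forall>z\<in>sphere 0 1. zmon (\<alpha>'(l := Suc (\<alpha>' l))) (\<beta>'(l := Suc (\<beta>' l))) z = (\<Sum>k\<in>reduced_index N j. c k * zmon (fst k) (snd k) z)"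
      if "l \<noteq> j" for l
    proof (rule Suc(1))
      show "a = (\<alpha>'(l := Suc (\<alpha>' l))) j" using that a by simp
      show "sum (\<alpha>'(l := Suc (\<alpha>' l))) UNIV \<le> N" "sum (\<beta>'(l := Suc (\<beta>' l))) UNIV \<le> N"
        unfolding sum_fun_upd_Suc by (rule s)+
    qed
    then have "\<forall>l. \<exists>c. l \<noteq> j \<longrightarrow> (\<forall>z\<in>sphere 0 1. zmon (\<alpha>'(l := Suc (\<alpha>' l))) (\<beta>'(l := Suc (\<beta>' l))) z = (\<Sum>k\<in>reduced_index N j. c k * zmon (fst k) (snd k) z))"
      by blast
    from choice[OF this] obtain C where C: "\<And>l z. l \<noteq> j \<Longrightarrow> z \<in> sphere 0 1 \<Longrightarrow>
        zmon (\<alpha>'(l := Suc (\<alpha>' l))) (\<beta>'(l := Suc (\<beta>' l))) z = (\<Sum>k\<in>reduced_index N j. C l k * zmon (fst k) (snd k) z)"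
      by blast
    show ?thesis
    proof (intro exI[of _ "\<lambda>k. c0 k - (\<Sum>l\<in>UNIV - {j}. C l k)"] ballI)
      fix z :: "complex ^ 'd" assume z: "z \<in> sphere 0 1"
      have "zmon \<alpha> \<beta> z = zmon (\<alpha>'(j := Suc (\<alpha>' j))) (\<beta>'(j := Suc (\<beta>' j))) z"
        using eq by (rule arg_cong2[where f = "\<lambda>a b. zmon a b z"])
      also have "\<dots> = zmon \<alpha>' \<beta>' z - (\<Sum>l\<in>UNIV - {j}. zmon (\<alpha>'(l := Suc (\<alpha>' l))) (\<beta>'(l := Suc (\<beta>' l))) z)"
        by (rule zmon_reduce[OF z])
      also have "(\<Sum>l\<in>UNIV - {j}. zmon (\<alpha>'(l := Suc (\<alpha>' l))) (\<beta>'(l := Suc (\<beta>' l))) z)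
         = (\<Sum>l\<in>UNIV - {j}. \<Sum>k\<in>reduced_index N j. C l k * zmon (fst k) (snd k) z)"
        by (intro sum.cong refl C z) auto
      also have "\<dots> = (\<Sum>k\<in>reduced_index N j. (\<Sum>l\<in>UNIV - {j}. C l k) * zmon (fst k) (snd k) z)"
        unfolding sum_distrib_right by (rule sum.swap)
      finally show "zmon \<alpha> \<beta> z = (\<Sum>k\<in>reduced_index N j. (c0 k - (\<Sum>l\<in>UNIV - {j}. C l k)) * zmon (fst k) (snd k) z)"
        by (simp add: c0[OF z] left_diff_distrib sum_subtractf)
    qed
  qed
qed

lemma bihom_reduced_span:
  fixes f :: "complex ^ 'd::finite \<Rightarrow> complex"
  assumes f: "bihom m n f" and mn: "m \<le> N" "n \<le> N"
  shows "\<exists>c. \<forall>z\<in>sphere 0 1. f z = (\<Sum>k\<in>reduced_index N j. c k * zmon (fst k) (snd k) z)"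
proof -
  let ?I = "{\<alpha> :: 'd \<Rightarrow> nat. sum \<alpha> UNIV = m} \<times> {\<beta> :: 'd \<Rightarrow> nat. sum \<beta> UNIV = n}"
  obtain c where c: "\<And>z. z \<in> sphere 0 1 \<Longrightarrow> f z = (\<Sum>k\<in>?I. c k * zmon (fst k) (snd k) z)"
    using bihom_span_zmon[OF f] by blast
  have "\<forall>i. \<exists>C. i \<in> ?I \<longrightarrow> (\<forall>z\<in>sphere 0 1. zmon (fst i) (snd i) z = (\<Sum>k\<in>reduced_index N j. C k * zmon (fst k) (snd k) z))"
    using zmon_reduced_span[of _ N _ j] mn by force
  from choice[OF this] obtain C where C: "\<And>i z. i \<in> ?I \<Longrightarrow> z \<in> sphere 0 1 \<Longrightarrow> zmon (fst i) (snd i) z = (\<Sum>k\<in>reduced_index N j. C i k * zmon (fst k) (snd k) z)"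
    by blast
  show ?thesis
  proof (intro exI[of _ "\<lambda>k. \<Sum>i\<in>?I. c i * C i k"] ballI)
    fix z :: "complex ^ 'd" assume z: "z \<in> sphere 0 1"
    have "f z = (\<Sum>i\<in>?I. c i * (\<Sum>k\<in>reduced_index N j. C i k * zmon (fst k) (snd k) z))"
      unfolding c[OF z] by (intro sum.cong refl arg_cong2[where f = "(*)"] C z)
    also have "\<dots> = (\<Sum>k\<in>reduced_index N j. (\<Sum>i\<in>?I. c i * C i k) * zmon (fst k) (snd k) z)"
      unfolding sum_distrib_left sum_distrib_right by (subst sum.swap) (simp only: mult.assoc)
    finally show "f z = (\<Sum>k\<in>reduced_index N j. (\<Sum>i\<in>?I. c i * C i k) * zmon (fst k) (snd k) z)" .
  qed
qed

lemma card_graded_basis: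
  "card (graded_basis N :: (complex ^ 'd::finite \<Rightarrow> complex) set) \<le> 2 * (N + 1) ^ (2 * CARD('d) - 1)"
proof -
  let ?j = "undefined :: 'd"
  have "card (graded_basis N :: (complex ^ 'd \<Rightarrow> complex) set) \<le> card (reduced_index N ?j)"
  proof (rule orthonormal_card_le[OF orthonormal_graded_basis reduced_index_card(1)])
    show "sphere_cont (zmon (fst k) (snd k))" for k :: "('d \<Rightarrow> nat) \<times> ('d \<Rightarrow> nat)" by (rule zmon_continuous)
    fix v :: "complex ^ 'd \<Rightarrow> complex" assume "v \<in> graded_basis N"
    then obtain m n where "m \<le> N" "n \<le> N" "bihom m n v" using graded_basis_bihom by blast
    then show "\<exists>c. \<forall>z\<in>sphere 0 1. v z = (\<Sum>k\<in>reduced_index N ?j. c k * zmon (fst k) (snd k) z)"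
      using bihom_reduced_span by blast
  qed
  then show ?thesis using reduced_index_card(2)[of N ?j] by (rule order_trans)
qed

section \<open>Algebra of the spans and sup norm bounds\<close>

lemma in_span_mono: "N \<le> M \<Longrightarrow> in_span N f \<Longrightarrow> in_span M f"
proof -
  assume NM: "N \<le> M" and f: "in_span N f"
  have sub: "graded_basis N \<subseteq> graded_basis M" using NM unfolding graded_basis_def by fastforce
  have fin: "finite (graded_basis M :: (complex ^ 'a \<Rightarrow> complex) set)" using orthonormal_graded_basis by (auto simp: orthonormal_def)
  show "in_span M f"
  proof (rule in_spanI[where c = "\<lambda>u. if u \<in> graded_basis N then ip f u else 0"])
    fix z :: "complex ^ 'a" assume z: "z \<in> sphere 0 1"
    have "(\<Sum>u\<in>graded_basis M. (if u \<in> graded_basis N then ip f u else 0) * u z) = (\<Sum>u\<in>graded_basis N. ip f u * u z)"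
      by (rule sum.mono_neutral_cong_right[OF fin sub]) auto
    then show "f z = (\<Sum>u\<in>graded_basis M. (if u \<in> graded_basis N then ip f u else 0) * u z)"
      using f z by (simp add: in_span_def)
  qed
qed

lemma in_span_zero: "in_span N (\<lambda>_. 0)"
  by (rule in_spanI[where c = "\<lambda>_. 0"]) simp

lemma in_span_scale: "in_span N f \<Longrightarrow> in_span N (\<lambda>z. c * f z)"
  by (rule in_spanI[where c = "\<lambda>u. c * ip f u"]) (simp add: in_span_def sum_distrib_left mult.assoc)

lemma in_span_sum: "(\<And>k. k \<in> A \<Longrightarrow> in_span N (f k)) \<Longrightarrow> in_span N (\<lambda>z. \<Sum>k\<in>A. f k z)"
  by (induction A rule: infinite_finite_induct) (auto intro: in_span_zero in_span_add)

text \<open>Products of polynomials are polynomials, and these are restored to the span by Fischer decomposition.\<close>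

lemma in_span_mult:
  fixes f g :: "complex ^ 'd::finite \<Rightarrow> complex"
  assumes f: "in_span N f" and g: "in_span M g"
  shows "in_span (N + M) (\<lambda>z. f z * g z)"
proof -
  have "in_span (N + M) (\<lambda>z. u z * v z)" if u: "u \<in> graded_basis N" and v: "v \<in> graded_basis M"
    for u v :: "complex ^ 'd \<Rightarrow> complex"
  proof -
    obtain m n m' n' where "m \<le> N" "n \<le> N" "bihom m n u" "m' \<le> M" "n' \<le> M" "bihom m' n' v"
      using graded_basis_bihom[OF u] graded_basis_bihom[OF v] by blast
    then show ?thesis using bihom_in_span[OF bihom_mult[of m n u m' n' v], of "N + M"] by simp
  qed
  then have "in_span (N + M) (\<lambda>z. \<Sum>u\<in>graded_basis N. \<Sum>v\<in>graded_basis M. (ip f u * ip g v) * (u z * v z))"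
    by (intro in_span_sum in_span_scale)
  then show ?thesis
    by (rule in_span_cong) (use f g in \<open>simp add: in_span_def sum_product mult_ac\<close>)
qed

lemma in_span_const: "in_span N (\<lambda>_. c)"
  by (rule bihom_in_span[OF bihom_const]) auto

lemma in_span_power: "in_span N f \<Longrightarrow> in_span (h * N) (\<lambda>z. f z ^ h)"
proof (induction h)
  case 0
  then show ?case using in_span_const[of 0 1] by simp
next
  case (Suc h)
  from in_span_mult[OF Suc.prems Suc.IH[OF Suc.prems]] show ?case by simp
qed

lemma in_span_continuous:
  fixes f :: "complex ^ 'd::finite \<Rightarrow> complex"
  assumes f: "in_span N f" shows "sphere_cont f"
proof -
  have "sphere_cont (\<lambda>z. \<Sum>u\<in>graded_basis N. ip f u * u z)"
    using orthonormal_graded_basis[of N] by (intro continuous_intros) (auto simp: orthonormal_def)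
  then show ?thesis
    by (rule continuous_on_eq) (use f in \<open>simp add: in_span_def\<close>)
qed

definition kernel_const :: "'d::finite itself \<Rightarrow> real" where
  "kernel_const _ = 2 / sphere_area TYPE('d)"

lemma kernel_const_pos: "kernel_const TYPE('d::finite) > 0"
  using sphere_area_pos[where 'd = 'd] by (simp add: kernel_const_def)

lemma kernel_bound:
  fixes w :: "complex ^ 'd::finite"
  assumes "w \<in> sphere 0 1"
  shows "(\<Sum>u\<in>graded_basis N. (norm (u w))\<^sup>2) \<le> kernel_const TYPE('d) * (real N + 1) ^ (2 * CARD('d) - 1)"
proof -
  have "(\<Sum>u\<in>graded_basis N. (norm (u w))\<^sup>2) * sphere_area TYPE('d) = real (card (graded_basis N :: (complex ^ 'd \<Rightarrow> complex) set))"
    by (rule kernel_diag_eq[OF assms])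
  also have "\<dots> \<le> real (2 * (N + 1) ^ (2 * CARD('d) - 1))"
    by (rule of_nat_mono[OF card_graded_basis])
  finally show ?thesis
    using sphere_area_pos[where 'd = 'd] by (simp add: kernel_const_def pos_le_divide_eq add.commute)
qed

lemma cauchy_schwarz_complex_sum:
  "(norm (\<Sum>i\<in>A. a i * b i :: complex))\<^sup>2 \<le> (\<Sum>i\<in>A. (norm (a i))\<^sup>2) * (\<Sum>i\<in>A. (norm (b i))\<^sup>2)"
proof -
  have "norm (\<Sum>i\<in>A. a i * b i) \<le> (\<Sum>i\<in>A. norm (a i) * norm (b i))"
    by (rule order_trans[OF norm_sum]) (simp add: norm_mult)
  then have "(norm (\<Sum>i\<in>A. a i * b i))\<^sup>2 \<le> (\<Sum>i\<in>A. norm (a i) * norm (b i))\<^sup>2"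
    by (intro power_mono) auto
  also have "\<dots> \<le> (\<Sum>i\<in>A. (norm (a i))\<^sup>2) * (\<Sum>i\<in>A. (norm (b i))\<^sup>2)"
    by (rule Cauchy_Schwarz_ineq_sum)
  finally show ?thesis .
qed

lemma in_span_sup_bound:
  fixes w :: "complex ^ 'd::finite"
  assumes f: "in_span N f" and w: "w \<in> sphere 0 1"
  shows "(norm (f w))\<^sup>2 \<le> kernel_const TYPE('d) * (real N + 1) ^ (2 * CARD('d) - 1) * (LINT z|surface_measure. (norm (f z))\<^sup>2)"
proof -
  have "(norm (f w))\<^sup>2 = (norm (\<Sum>u\<in>graded_basis N. ip f u * u w))\<^sup>2"
    using f w by (simp add: in_span_def)
  also have "\<dots> \<le> (\<Sum>u\<in>graded_basis N. (norm (ip f u))\<^sup>2) * (\<Sum>u\<in>graded_basis N. (norm (u w))\<^sup>2)"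
    by (rule cauchy_schwarz_complex_sum)
  also have "\<dots> \<le> (LINT z|surface_measure. (norm (f z))\<^sup>2) * (kernel_const TYPE('d) * (real N + 1) ^ (2 * CARD('d) - 1))"
    by (intro mult_mono bessel orthonormal_graded_basis in_span_continuous[OF f] kernel_bound[OF w] sum_nonneg)
       (auto simp: integral_nonneg_AE)
  finally show ?thesis by (simp add: mult.commute)
qed

text \<open>The reproducing-kernel bound is applied to the \<open>h\<close>-th power of \<open>f\<close>, which lies in the span of degree \<open>h * N\<close>. For large
  \<open>h\<close> the sup norm is thus controlled by the \<open>L\<^bsup>2h\<^esup>\<close> norm up to the \<open>2h\<close>-th root of a dimension.\<close>

lemma in_span_power_bound:
  fixes w :: "complex ^ 'd::finite"
  assumes f: "in_span N f" and w: "w \<in> sphere 0 1"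
  shows "norm (f w) ^ (2 * h) \<le> kernel_const TYPE('d) * (real (h * N) + 1) ^ (2 * CARD('d) - 1) * (LINT z|surface_measure. norm (f z) ^ (2 * h))"
proof -
  have *: "(norm (x ^ h))\<^sup>2 = norm x ^ (2 * h)" for x :: complex
    by (simp add: norm_power power_mult[symmetric] mult.commute)
  show ?thesis
    using in_span_sup_bound[OF in_span_power[OF f, of h] w] unfolding * .
qed

section \<open>Projections and completeness\<close>

lemma integrable_mult_continuous:
  fixes \<phi> :: "'a::euclidean_space \<Rightarrow> complex"
  assumes \<phi>: "integrable surface_measure \<phi>" and g: "sphere_cont g"
  shows "integrable surface_measure (\<lambda>z. \<phi> z * g z)"
proof -
  have "bounded (g ` sphere 0 1)"
    using compact_continuous_image[OF g] by (simp add: compact_imp_bounded)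
  then obtain C where C: "\<forall>x\<in>sphere 0 1. norm (g x) \<le> C" unfolding bounded_iff by blast
  show ?thesis
  proof (rule Bochner_Integration.integrable_bound[of _ "\<lambda>z. C *\<^sub>R \<phi> z"])
    show "integrable surface_measure (\<lambda>z. C *\<^sub>R \<phi> z)" using \<phi> by simp
    show "(\<lambda>z. \<phi> z * g z) \<in> borel_measurable surface_measure"
      using \<phi> continuous_borel_measurable_surface[OF g] by measurable
    show "AE z in surface_measure. norm (\<phi> z * g z) \<le> norm (C *\<^sub>R \<phi> z)"
    proof (rule AE_I2)
      fix z :: 'a assume "z \<in> space surface_measure"
      then have "norm (g z) \<le> C" using C by simp
      then have "norm (g z) \<le> \<bar>C\<bar>" by simp
      then show "norm (\<phi> z * g z) \<le> norm (C *\<^sub>R \<phi> z)"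
        using mult_left_mono[of "norm (g z)" "\<bar>C\<bar>" "norm (\<phi> z)"] by (simp add: norm_mult mult.commute)
    qed
  qed
qed

text \<open>The kernel of the definition is unique, and on the sphere it has the usual expression by an orthonormal basis.\<close>

lemma repr_kernel_eq:
  fixes w :: "complex ^ 'd::finite"
  assumes w: "w \<in> sphere 0 1" and z: "z \<in> sphere 0 1"
  shows "repr_kernel m n w z = (\<Sum>u\<in>hbasis m n. cnj (u w) * u z)"
proof -
  define k where "k = (\<lambda>z. \<Sum>u\<in>hbasis m n. cnj (u w) * u z)"
  define r where "r f = (\<lambda>z. if z \<in> sphere 0 1 then f z else 0)" for f :: "complex ^ 'd \<Rightarrow> complex"
  have B: "finite (hbasis m n :: (complex ^ 'd \<Rightarrow> complex) set)" "\<And>u. u \<in> hbasis m n \<Longrightarrow> sphere_cont u"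
    using hbasis(1)[of m n] by (auto simp: orthonormal_def)
  have kh: "harmonic_poly m n k"
    unfolding k_def by (rule function_space_lincomb[OF harm_function_space(1)]) (rule hbasis(2))
  have cont: "sphere_cont f" if "harmonic_poly m n f" for f
    using that by (auto simp: harmonic_poly_def intro: bihom_continuous)
  have repr: "f w = ip f k" if f: "harmonic_poly m n f" for f
  proof -
    have "cnj (ip f k) = (\<Sum>v\<in>hbasis m n. cnj (v w) * ip v f)"
      unfolding ip_cnj k_def using B cont[OF f] by (intro ip_lincomb_left) auto
    also have "\<dots> = cnj (\<Sum>v\<in>hbasis m n. ip f v * v w)"
      by (simp add: ip_cnj mult.commute)
    also have "(\<Sum>v\<in>hbasis m n. ip f v * v w) = f w" using hbasis(3)[OF f w] by simp
    finally show ?thesis by simp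
  qed
  have ip_r: "ip (r f) (r g) = ip f g" for f g by (intro ip_cong) (auto simp: r_def)
  have hs: "harmonic_space m n = {r f | f. harmonic_poly m n f}" unfolding harmonic_space_eq r_def ..
  have "repr_kernel m n w = r k"
    unfolding repr_kernel_def
  proof (rule the_equality)
    show "r k \<in> harmonic_space m n \<and> (\<forall>f\<in>harmonic_space m n. f w = (LINT z|surface_measure. f z * cnj (r k z)))"
      using kh repr ip_r w unfolding hs ip_def[symmetric] by (auto simp: r_def)
    fix k' assume k': "k' \<in> harmonic_space m n \<and> (\<forall>f\<in>harmonic_space m n. f w = (LINT z|surface_measure. f z * cnj (k' z)))"
    then obtain g where g: "k' = r g" "harmonic_poly m n g" unfolding hs by blast
    have gk: "ip f g = ip f k" if f: "harmonic_poly m n f" for f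
    proof -
      have "r f \<in> harmonic_space m n" unfolding hs using f by blast
      then have "r f w = ip (r f) k'" using k' unfolding ip_def by blast
      then have "f w = ip f g" using w unfolding g(1) ip_r by (simp add: r_def)
      then show ?thesis using repr[OF f] by simp
    qed
    define d where "d z = g z + (-1) * k z" for z
    have d: "harmonic_poly m n d"
      unfolding d_def[abs_def] using harm_function_space(1)[of m n] g(2) kh unfolding function_space_def by blast
    have d': "d = (\<lambda>z. g z - k z)" by (simp add: d_def fun_eq_iff)
    have "ip d d = ip d g - ip d k"
    proof -
      have "ip d d = ip g d - ip k d"
        by (subst (1) d') (rule ip_diff_left[OF cont[OF g(2)] cont[OF kh] cont[OF d]])
      from arg_cong[OF this, of cnj] show ?thesis by (simp only: complex_cnj_diff ip_cnj)
    qed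
    then have "ip d d = 0" using gk[OF d] by simp
    then have "d z = 0" if "z \<in> sphere 0 1" for z by (rule ip_self_zero[OF cont[OF d] _ that])
    then show "k' = r k" by (auto simp: g(1) r_def d' fun_eq_iff)
  qed
  then show ?thesis using z by (simp add: r_def k_def)
qed

lemma harmonic_proj_eq:
  fixes \<phi> :: "complex ^ 'd::finite \<Rightarrow> complex"
  assumes \<phi>: "integrable surface_measure \<phi>" and w: "w \<in> sphere 0 1"
  shows "harmonic_proj m n \<phi> w = (\<Sum>u\<in>hbasis m n. ip \<phi> u * u w)"
proof -
  have B: "\<And>u. u \<in> hbasis m n \<Longrightarrow> sphere_cont u"
    using hbasis(1)[of m n] by (auto simp: orthonormal_def)
  have "harmonic_proj m n \<phi> w = (LINT z|surface_measure. (\<Sum>u\<in>hbasis m n. (\<phi> z * cnj (u z)) * u w))"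
    unfolding harmonic_proj_def
    by (intro Bochner_Integration.integral_cong refl) (auto simp: repr_kernel_eq[OF w] sum_distrib_left mult_ac)
  also have "\<dots> = (\<Sum>u\<in>hbasis m n. LINT z|surface_measure. (\<phi> z * cnj (u z)) * u w)"
    using B by (intro Bochner_Integration.integral_sum integrable_mult_left integrable_mult_continuous \<phi> continuous_intros) auto
  also have "\<dots> = (\<Sum>u\<in>hbasis m n. ip \<phi> u * u w)" by (simp add: ip_def)
  finally show ?thesis .
qed

text \<open>The components of a function in one harmonic space are compared coefficientwise: the basis functions are
  linearly independent on the sphere.\<close>

lemma expansion_coefficients:
  fixes \<phi> \<psi> :: "complex ^ 'd::finite \<Rightarrow> complex"
  assumes "integrable surface_measure \<phi>" "integrable surface_measure \<psi>"
  shows "(\<forall>w\<in>sphere 0 1. harmonic_proj m n \<psi> w = l * harmonic_proj m n \<phi> w) \<longleftrightarrow> (\<forall>u\<in>hbasis m n. ip \<psi> u = l * ip \<phi> u)"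
    (is "?L \<longleftrightarrow> ?R")
proof
  assume ?R
  then show ?L by (simp add: harmonic_proj_eq[OF assms(1)] harmonic_proj_eq[OF assms(2)] sum_distrib_left mult.assoc)
next
  assume L: ?L
  define f where "f z = (\<Sum>u\<in>hbasis m n. ip \<psi> u * u z)" for z :: "complex ^ 'd"
  have f: "f z = (\<Sum>u\<in>hbasis m n. (l * ip \<phi> u) * u z)" if "z \<in> sphere 0 1" for z
    using L that by (simp add: f_def harmonic_proj_eq[OF assms(1)] harmonic_proj_eq[OF assms(2)] sum_distrib_left mult.assoc)
  show ?R
  proof
    fix u :: "complex ^ 'd \<Rightarrow> complex" assume u: "u \<in> hbasis m n"
    have "ip f u = ip \<psi> u" by (rule orthonormal_coefficients[OF hbasis(1) f_def u])
    moreover have "ip f u = l * ip \<phi> u" by (rule orthonormal_coefficients[OF hbasis(1) f u])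
    ultimately show "ip \<psi> u = l * ip \<phi> u" by simp
  qed
qed

lemma re_im_split:
  "complex_of_real (Re w * p + Im w * q) = (of_real p - \<i> * of_real q) / 2 * w + (of_real p + \<i> * of_real q) / 2 * cnj w"
  by (simp add: complex_eq_iff) (simp add: field_simps)

lemma real_polynomial_in_span:
  fixes g :: "complex ^ 'd::finite \<Rightarrow> real"
  assumes "real_polynomial_function g"
  shows "\<exists>N. in_span N (\<lambda>z. complex_of_real (g z))"
  using assms
proof (induction rule: real_polynomial_function.induct)
  case (linear f)
  then have lin: "linear f" by (rule bounded_linear.linear)
  have fz: "f z = (\<Sum>j\<in>UNIV. Re (z $ j) * f (axis j 1) + Im (z $ j) * f (axis j \<i>))" for z
  proof -
    have "z = (\<Sum>j\<in>UNIV. Re (z $ j) *\<^sub>R axis j 1 + Im (z $ j) *\<^sub>R axis j \<i>)"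
    proof (rule vec_eq_iff[THEN iffD2], rule allI)
      fix i
      have "(\<Sum>j\<in>UNIV. Re (z $ j) *\<^sub>R axis j 1 + Im (z $ j) *\<^sub>R axis j \<i>) $ i = (\<Sum>j\<in>UNIV. if j = i then z $ i else 0)"
        unfolding sum_component by (intro sum.cong refl) (auto simp: axis_def complex_eq_iff)
      then show "z $ i = (\<Sum>j\<in>UNIV. Re (z $ j) *\<^sub>R axis j 1 + Im (z $ j) *\<^sub>R axis j \<i>) $ i" by simp
    qed
    then have "f z = f (\<Sum>j\<in>UNIV. Re (z $ j) *\<^sub>R axis j 1 + Im (z $ j) *\<^sub>R axis j \<i>)" by simp
    also have "\<dots> = (\<Sum>j\<in>UNIV. Re (z $ j) * f (axis j 1) + Im (z $ j) * f (axis j \<i>))"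
      by (simp add: linear_sum[OF lin] linear_add[OF lin] linear_scale[OF lin])
    finally show ?thesis .
  qed
  have eq: "(\<lambda>z. complex_of_real (f z)) = (\<lambda>z. \<Sum>j\<in>UNIV. (of_real (f (axis j 1)) - \<i> * of_real (f (axis j \<i>))) / 2 * z $ j
      + (of_real (f (axis j 1)) + \<i> * of_real (f (axis j \<i>))) / 2 * cnj (z $ j))"
  proof
    fix z
    have "complex_of_real (f z) = of_real (\<Sum>j\<in>UNIV. Re (z $ j) * f (axis j 1) + Im (z $ j) * f (axis j \<i>))"
      by (rule arg_cong[OF fz])
    also have "\<dots> = (\<Sum>j\<in>UNIV. (of_real (f (axis j 1)) - \<i> * of_real (f (axis j \<i>))) / 2 * z $ j
      + (of_real (f (axis j 1)) + \<i> * of_real (f (axis j \<i>))) / 2 * cnj (z $ j))"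
      by (simp only: of_real_sum re_im_split)
    finally show "complex_of_real (f z) = (\<Sum>j\<in>UNIV. (of_real (f (axis j 1)) - \<i> * of_real (f (axis j \<i>))) / 2 * z $ j
      + (of_real (f (axis j 1)) + \<i> * of_real (f (axis j \<i>))) / 2 * cnj (z $ j))" .
  qed
  have "in_span 1 (\<lambda>z. complex_of_real (f z))"
    unfolding eq by (intro in_span_sum in_span_add in_span_scale bihom_in_span[OF bihom_coord(1)] bihom_in_span[OF bihom_coord(2)]) auto
  then show ?case ..
next
  case (const c)
  then show ?case using in_span_const by blast
next
  case (add f g)
  then obtain N M where "in_span N (\<lambda>z. complex_of_real (f z))" "in_span M (\<lambda>z. complex_of_real (g z))" by blast
  then have "in_span (N + M) (\<lambda>z. complex_of_real (f z) + complex_of_real (g z))"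
    by (intro in_span_add) (auto intro: in_span_mono[of N "N + M"] in_span_mono[of M "N + M"])
  then show ?case by auto
next
  case (mult f g)
  then obtain N M where "in_span N (\<lambda>z. complex_of_real (f z))" "in_span M (\<lambda>z. complex_of_real (g z))" by blast
  then have "in_span (N + M) (\<lambda>z. complex_of_real (f z) * complex_of_real (g z))" by (rule in_span_mult)
  then show ?case by auto
qed

text \<open>By the Stone-Weierstrass theorem a continuous function on the sphere is a uniform limit of real polynomials, and these lie
  in the span of the basis.\<close>

lemma integral_against_continuous_zero:
  fixes \<psi> :: "complex ^ 'd::finite \<Rightarrow> complex"
  assumes \<psi>: "integrable surface_measure \<psi>" and zero: "\<And>N u. u \<in> graded_basis N \<Longrightarrow> ip \<psi> u = 0"
    and h: "continuous_on (sphere 0 1) (h :: complex ^ 'd \<Rightarrow> real)"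
  shows "(LINT z|surface_measure. \<psi> z * of_real (h z)) = 0"
proof -
  have poly: "(LINT z|surface_measure. \<psi> z * cnj (f z)) = 0" if f: "in_span N f" for f N
  proof -
    have "(LINT z|surface_measure. \<psi> z * cnj (f z)) = (LINT z|surface_measure. (\<Sum>u\<in>graded_basis N. cnj (ip f u) * (\<psi> z * cnj (u z))))"
      using f by (intro Bochner_Integration.integral_cong refl) (simp add: in_span_def sum_distrib_left mult_ac)
    also have "\<dots> = (\<Sum>u\<in>graded_basis N. LINT z|surface_measure. cnj (ip f u) * (\<psi> z * cnj (u z)))"
      using orthonormal_graded_basis[of N]
      by (intro Bochner_Integration.integral_sum integrable_mult_right integrable_mult_continuous \<psi> continuous_intros)
         (auto simp: orthonormal_def)
    also have "\<dots> = 0" using zero by (intro sum.neutral) (auto simp: ip_def[symmetric])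
    finally show ?thesis .
  qed
  define T where "T = (LINT z|surface_measure. norm (\<psi> z))"
  have T: "T \<ge> 0" by (simp add: T_def integral_nonneg_AE)
  have "norm (LINT z|surface_measure. \<psi> z * of_real (h z)) \<le> \<epsilon> * T" if e: "\<epsilon> > 0" for \<epsilon>
  proof -
    obtain g where g: "real_polynomial_function g" "\<And>x. x \<in> sphere 0 1 \<Longrightarrow> \<bar>h x - g x\<bar> < \<epsilon>"
      using Stone_Weierstrass_real_polynomial_function[OF compact_sphere h e] by blast
    obtain N where N: "in_span N (\<lambda>z. complex_of_real (g z))" using real_polynomial_in_span[OF g(1)] by blast
    have ih: "integrable surface_measure (\<lambda>z. \<psi> z * of_real (h z))"
      by (intro integrable_mult_continuous \<psi> continuous_intros h)
    have ig: "integrable surface_measure (\<lambda>z. \<psi> z * of_real (g z))"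
      by (rule integrable_mult_continuous[OF \<psi> in_span_continuous[OF N]])
    have "(LINT z|surface_measure. \<psi> z * of_real (g z)) = 0" using poly[OF N] by simp
    then have "(LINT z|surface_measure. \<psi> z * of_real (h z)) = (LINT z|surface_measure. \<psi> z * of_real (h z) - \<psi> z * of_real (g z))"
      using ih ig by simp
    also have "norm \<dots> \<le> (LINT z|surface_measure. \<epsilon> * norm (\<psi> z))"
    proof (rule Bochner_Integration.integral_norm_bound_integral)
      show "integrable surface_measure (\<lambda>z. \<psi> z * of_real (h z) - \<psi> z * of_real (g z))" using ih ig by simp
      show "integrable surface_measure (\<lambda>z. \<epsilon> * norm (\<psi> z))" using \<psi> by simp
      fix z :: "complex ^ 'd" assume "z \<in> space surface_measure"
      then have "\<bar>h z - g z\<bar> \<le> \<epsilon>" using g(2)[of z] by simp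
      moreover have "\<psi> z * of_real (h z) - \<psi> z * of_real (g z) = \<psi> z * of_real (h z - g z)"
        by (simp add: right_diff_distrib)
      ultimately show "norm (\<psi> z * of_real (h z) - \<psi> z * of_real (g z)) \<le> \<epsilon> * norm (\<psi> z)"
        using mult_left_mono[of "\<bar>h z - g z\<bar>" \<epsilon> "norm (\<psi> z)"] by (simp add: norm_mult mult.commute del: of_real_diff)
    qed
    finally show ?thesis by (simp add: T_def)
  qed
  then have small: "norm (LINT z|surface_measure. \<psi> z * of_real (h z)) \<le> \<epsilon>" if "\<epsilon> > 0" for \<epsilon>
  proof -
    have "norm (LINT z|surface_measure. \<psi> z * of_real (h z)) \<le> \<epsilon> / (T + 1) * T"
      using T that \<open>\<And>\<epsilon>. \<epsilon> > 0 \<Longrightarrow> norm (LINT z|surface_measure. \<psi> z * of_real (h z)) \<le> \<epsilon> * T\<close>[of "\<epsilon> / (T + 1)"] by simp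
    also have "\<dots> \<le> \<epsilon>" using T that by (simp add: field_simps)
    finally show ?thesis .
  qed
  have "norm (LINT z|surface_measure. \<psi> z * of_real (h z)) \<le> 0"
    by (rule field_le_epsilon) (unfold add_0, rule small)
  then show ?thesis by simp
qed

text \<open>The positive and the negative part of \<open>r\<close> are densities of two finite Borel measures that integrate continuous functions
  to the same values. Indicators of closed sets are limits of continuous functions, so the two measures coincide.\<close>

lemma AE_zero_of_continuous_integrals:
  fixes r :: "complex ^ 'd::finite \<Rightarrow> real"
  assumes r: "integrable surface_measure r"
    and zero: "\<And>h. continuous_on (sphere 0 1) h \<Longrightarrow> (LINT z|surface_measure. r z * h z) = 0"
  shows "AE z in surface_measure. r z = 0"
proof -
  interpret finite_measure "surface_measure :: (complex ^ 'd) measure" by (rule finite_measure_surface_measure)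
  have [measurable]: "r \<in> borel_measurable surface_measure" using r by simp
  define rp rm where "rp z = max (r z) 0" and "rm z = max (- r z) 0" for z
  have rpm: "r z = rp z - rm z" "rp z \<ge> 0" "rm z \<ge> 0" for z by (auto simp: rp_def rm_def)
  have [measurable]: "rp \<in> borel_measurable surface_measure" "rm \<in> borel_measurable surface_measure"
    unfolding rp_def[abs_def] rm_def[abs_def] by measurable
  have int: "integrable surface_measure rp" "integrable surface_measure rm"
    unfolding rp_def[abs_def] rm_def[abs_def] using r by auto
  have idm: "(\<lambda>x. x) \<in> surface_measure \<rightarrow>\<^sub>M (borel :: (complex ^ 'd) measure)"
    by (rule continuous_borel_measurable_surface) (intro continuous_intros)
  define \<mu> where "\<mu> f = distr (density surface_measure (\<lambda>z. ennreal (f z))) (borel :: (complex ^ 'd) measure) (\<lambda>x. x)" for f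
  have em: "emeasure (\<mu> f) A = ennreal (LINT z|surface_measure. f z * indicator A z)"
    if f: "integrable surface_measure f" "\<And>z. f z \<ge> 0" and A: "A \<in> sets borel" for f A
  proof -
    have [measurable]: "f \<in> borel_measurable surface_measure" using f by simp
    have A': "A \<inter> sphere 0 1 \<in> sets surface_measure"
      using measurable_sets[OF idm A] by simp
    have i: "integrable surface_measure (\<lambda>z. f z * indicator A z)"
    proof -
      have "integrable surface_measure (\<lambda>z. f z * indicator (A \<inter> sphere 0 1) z)"
        using integrable_real_mult_indicator[OF A' f(1)] by (simp add: mult.commute)
      then show ?thesis
        by (rule Bochner_Integration.integrable_cong[THEN iffD1, rotated 2]) (auto simp: indicator_def)
    qed
    have "emeasure (\<mu> f) A = emeasure (density surface_measure (\<lambda>z. ennreal (f z))) (A \<inter> sphere 0 1)"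
      unfolding \<mu>_def using idm A by (subst emeasure_distr) auto
    also have "\<dots> = (\<integral>\<^sup>+z. ennreal (f z) * indicator (A \<inter> sphere 0 1) z \<partial>surface_measure)"
      using A' by (subst emeasure_density) auto
    also have "\<dots> = (\<integral>\<^sup>+z. ennreal (f z * indicator A z) \<partial>surface_measure)"
      by (intro nn_integral_cong) (auto simp: indicator_def)
    also have "\<dots> = ennreal (LINT z|surface_measure. f z * indicator A z)"
      using f by (intro nn_integral_eq_integral i) auto
    finally show ?thesis .
  qed
  have closed_eq: "(LINT z|surface_measure. rp z * indicator C z) = (LINT z|surface_measure. rm z * indicator C z)"
    if C: "closed C" for C
  proof (cases "C = {}")
    case True
    then show ?thesis by simp
  next
    case False
    define h where "h n z = max 0 (1 - real n * infdist z C)" for n z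
    have hc: "continuous_on (sphere 0 1) (h n)" for n
      unfolding h_def by (intro continuous_intros)
    have hb: "0 \<le> h n z" "h n z \<le> 1" for n z by (auto simp: h_def infdist_nonneg)
    have hlim: "(\<lambda>n. h n z) \<longlonglongrightarrow> indicator C z" for z
    proof (cases "z \<in> C")
      case True
      then show ?thesis by (simp add: h_def)
    next
      case z: False
      then have pos: "infdist z C > 0"
        using in_closed_iff_infdist_zero[OF C False, of z] infdist_nonneg[of z C] by (auto simp: less_le)
      obtain k where k: "real k * infdist z C > 1" using pos reals_Archimedean3 by blast
      have "h n z = 0" if "n \<ge> k" for n
      proof -
        have "real k * infdist z C \<le> real n * infdist z C" using that pos by (intro mult_right_mono) auto
        then show ?thesis using k by (simp add: h_def)
      qed
      then have "eventually (\<lambda>n. h n z = 0) sequentially" by (auto simp: eventually_sequentially)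
      then show ?thesis using z by (simp add: tendsto_eventually)
    qed
    have lim: "(\<lambda>n. LINT z|surface_measure. f z * h n z) \<longlonglongrightarrow> (LINT z|surface_measure. f z * indicator C z)"
      if f: "integrable surface_measure f" "\<And>z. f z \<ge> 0" for f
    proof (rule integral_dominated_convergence[where w = f])
      have [measurable]: "f \<in> borel_measurable surface_measure" using f by simp
      have [measurable]: "h n \<in> borel_measurable surface_measure" for n
        by (rule continuous_borel_measurable_surface[OF hc])
      show m: "(\<lambda>z. f z * h n z) \<in> borel_measurable surface_measure" for n by measurable
      show "(\<lambda>z. f z * indicator C z) \<in> borel_measurable surface_measure"
        by (rule borel_measurable_LIMSEQ_real[OF _ m]) (rule tendsto_mult[OF tendsto_const hlim])
      show "integrable surface_measure f" by (rule f)
      show "AE z in surface_measure. (\<lambda>n. f z * h n z) \<longlonglongrightarrow> f z * indicator C z"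
        by (rule AE_I2) (rule tendsto_mult[OF tendsto_const hlim])
      show "AE z in surface_measure. norm (f z * h n z) \<le> f z" for n
        using hb f by (auto simp: abs_mult mult_left_le)
    qed
    have ihp: "integrable surface_measure (\<lambda>z. f z * h n z)" if "integrable surface_measure f" for f n
    proof (rule Bochner_Integration.integrable_bound[OF that])
      show "(\<lambda>z. f z * h n z) \<in> borel_measurable surface_measure"
        using that continuous_borel_measurable_surface[OF hc, of n] by measurable
      show "AE z in surface_measure. norm (f z * h n z) \<le> norm (f z)"
        using hb by (auto simp: abs_mult mult_left_le)
    qed
    have "(LINT z|surface_measure. rp z * h n z) = (LINT z|surface_measure. rm z * h n z)" for n
    proof -
      have "(LINT z|surface_measure. rp z * h n z) - (LINT z|surface_measure. rm z * h n z) = (LINT z|surface_measure. r z * h n z)"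
        using ihp int by (simp add: rpm(1) left_diff_distrib)
      then show ?thesis using zero[OF hc] by simp
    qed
    then show ?thesis
      using lim[OF int(1) rpm(2)] lim[OF int(2) rpm(3)] by (simp add: LIMSEQ_unique)
  qed
  have eq: "\<mu> rp = \<mu> rm"
  proof (rule measure_eqI_generator_eq[where E = "Collect closed" and \<Omega> = UNIV and A = "\<lambda>_. UNIV"])
    show "Int_stable (Collect closed :: (complex ^ 'd) set set)" by (auto simp: Int_stable_def)
    show "emeasure (\<mu> rp) X = emeasure (\<mu> rm) X" if "X \<in> Collect closed" for X
      using that by (simp add: em int rpm closed_eq)
    show "sets (\<mu> rp) = sigma_sets UNIV (Collect closed)" "sets (\<mu> rm) = sigma_sets UNIV (Collect closed)"
      by (simp_all add: \<mu>_def borel_eq_closed)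
    show "emeasure (\<mu> rp) UNIV \<noteq> \<infinity>" for i :: nat by (simp add: em int rpm)
  qed auto
  have "density surface_measure (\<lambda>z. ennreal (rp z)) = density surface_measure (\<lambda>z. ennreal (rm z))"
  proof (rule measure_eqI)
    fix A assume "A \<in> sets (density surface_measure (\<lambda>z. ennreal (rp z)))"
    then have "A \<in> sets (restrict_space borel (sphere 0 1))" by (simp add: sets_surface_measure)
    then obtain A' where A': "A' \<in> sets borel" "A = A' \<inter> sphere 0 1"
      by (auto simp: sets_restrict_space)
    have "emeasure (density surface_measure (\<lambda>z. ennreal (f z))) A = emeasure (\<mu> f) A'"
      if "f \<in> borel_measurable surface_measure" for f
      unfolding \<mu>_def A'(2) using idm A' by (subst emeasure_distr) auto
    then show "emeasure (density surface_measure (\<lambda>z. ennreal (rp z))) A = emeasure (density surface_measure (\<lambda>z. ennreal (rm z))) A"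
      using eq by simp
  qed simp
  then have "AE z in surface_measure. ennreal (rp z) = ennreal (rm z)"
    by (intro density_unique) auto
  then show ?thesis
    using rpm by (auto simp: ennreal_inj)
qed

text \<open>The Fourier coefficients determine an integrable function, which need not be square integrable.\<close>

lemma completeness:
  fixes \<psi> :: "complex ^ 'd::finite \<Rightarrow> complex"
  assumes \<psi>: "integrable surface_measure \<psi>" and zero: "\<And>N u. u \<in> graded_basis N \<Longrightarrow> ip \<psi> u = 0"
  shows "AE z in surface_measure. \<psi> z = 0"
proof -
  have "AE z in surface_measure. Re (\<psi> z) = 0"
  proof (rule AE_zero_of_continuous_integrals)
    show "integrable surface_measure (\<lambda>z. Re (\<psi> z))" using \<psi> by simp
    fix h :: "complex ^ 'd \<Rightarrow> real" assume h: "continuous_on (sphere 0 1) h"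
    have i: "integrable surface_measure (\<lambda>z. \<psi> z * of_real (h z))"
      by (intro integrable_mult_continuous \<psi> continuous_intros h)
    have "Re (LINT z|surface_measure. \<psi> z * of_real (h z)) = (LINT z|surface_measure. Re (\<psi> z) * h z)"
      using integral_Re[OF i] by simp
    then show "(LINT z|surface_measure. Re (\<psi> z) * h z) = 0"
      using integral_against_continuous_zero[OF \<psi> zero h] by simp
  qed
  moreover have "AE z in surface_measure. Im (\<psi> z) = 0"
  proof (rule AE_zero_of_continuous_integrals)
    show "integrable surface_measure (\<lambda>z. Im (\<psi> z))" using \<psi> by simp
    fix h :: "complex ^ 'd \<Rightarrow> real" assume h: "continuous_on (sphere 0 1) h"
    have i: "integrable surface_measure (\<lambda>z. \<psi> z * of_real (h z))"
      by (intro integrable_mult_continuous \<psi> continuous_intros h)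
    have "Im (LINT z|surface_measure. \<psi> z * of_real (h z)) = (LINT z|surface_measure. Im (\<psi> z) * h z)"
      using integral_Im[OF i] by simp
    then show "(LINT z|surface_measure. Im (\<psi> z) * h z) = 0"
      using integral_against_continuous_zero[OF \<psi> zero h] by simp
  qed
  ultimately show ?thesis by (auto simp: complex_eq_iff)
qed

section \<open>Bounded functions and even moments\<close>

definition bounded_fun :: "'a measure \<Rightarrow> ('a \<Rightarrow> complex) \<Rightarrow> bool" where
  "bounded_fun M f \<longleftrightarrow> f \<in> borel_measurable M \<and> (\<exists>B. \<forall>w\<in>space M. norm (f w) \<le> B)"

text \<open>The norm of \<open>L\<^bsup>2h\<^esup>\<close>. Even exponents suffice, because \<open>q\<close> may be rounded up to one, and they make moments accessible to the
  subgaussian bound.\<close>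

definition even_norm :: "'a measure \<Rightarrow> nat \<Rightarrow> ('a \<Rightarrow> complex) \<Rightarrow> real" where
  "even_norm M h f = root (2 * h) (LINT w|M. norm (f w) ^ (2 * h))"

lemma bounded_fun_lincomb:
  assumes "finite A" "\<And>i. i \<in> A \<Longrightarrow> bounded_fun M (f i)"
  shows "bounded_fun M (\<lambda>w. \<Sum>i\<in>A. c i * f i w)"
proof -
  have "\<forall>i. \<exists>B. i \<in> A \<longrightarrow> (\<forall>w\<in>space M. norm (f i w) \<le> B)" using assms(2) by (auto simp: bounded_fun_def)
  from choice[OF this] obtain B where B: "\<And>i w. i \<in> A \<Longrightarrow> w \<in> space M \<Longrightarrow> norm (f i w) \<le> B i" by blast
  have "norm (\<Sum>i\<in>A. c i * f i w) \<le> (\<Sum>i\<in>A. norm (c i) * B i)" if "w \<in> space M" for w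
    by (rule order_trans[OF norm_sum]) (auto simp: norm_mult intro!: sum_mono mult_left_mono B that)
  moreover have "(\<lambda>w. \<Sum>i\<in>A. c i * f i w) \<in> borel_measurable M"
    using assms by (intro borel_measurable_sum borel_measurable_times) (auto simp: bounded_fun_def)
  ultimately show ?thesis unfolding bounded_fun_def by blast
qed

lemma bounded_fun_add: "bounded_fun M f \<Longrightarrow> bounded_fun M g \<Longrightarrow> bounded_fun M (\<lambda>w. f w + g w)"
  using bounded_fun_lincomb[of "{True, False}" M "\<lambda>b. if b then f else g" "\<lambda>_. 1"] by simp

lemma bounded_fun_scale: "bounded_fun M f \<Longrightarrow> bounded_fun M (\<lambda>w. c * f w)"
  using bounded_fun_lincomb[of "{True}" M "\<lambda>_. f" "\<lambda>_. c"] by simp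

context finite_measure
begin

lemma bounded_fun_integrable_power:
  assumes "bounded_fun M f" shows "integrable M (\<lambda>w. norm (f w) ^ n)"
proof -
  obtain B where B: "\<forall>w\<in>space M. norm (f w) \<le> B" and [measurable]: "f \<in> borel_measurable M"
    using assms by (auto simp: bounded_fun_def)
  show ?thesis
    by (rule integrable_const_bound[where B = "B ^ n"]) (use B in \<open>auto intro!: AE_I2 power_mono\<close>)
qed

lemma bounded_fun_integrable: "bounded_fun M f \<Longrightarrow> integrable M f"
proof -
  assume f: "bounded_fun M f"
  then obtain B where B: "\<forall>w\<in>space M. norm (f w) \<le> B" and [measurable]: "f \<in> borel_measurable M"
    by (auto simp: bounded_fun_def)
  show ?thesis
    by (rule integrable_const_bound[where B = B]) (use B in auto)
qed

lemma even_norm_power: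
  assumes "h \<ge> 1" 
  shows "even_norm M h f ^ (2 * h) = (LINT w|M. norm (f w) ^ (2 * h))" "even_norm M h f \<ge> 0"
  using assms by (auto simp: even_norm_def real_root_pow_pos2 integral_nonneg_AE)

lemma even_norm_scale:
  assumes "h \<ge> 1" shows "even_norm M h (\<lambda>w. c * f w) = norm c * even_norm M h f"
proof -
  have "(LINT w|M. norm (c * f w) ^ (2 * h)) = norm c ^ (2 * h) * (LINT w|M. norm (f w) ^ (2 * h))"
    by (simp add: norm_mult power_mult_distrib)
  then show ?thesis
    using assms by (simp add: even_norm_def real_root_mult real_root_power_cancel)
qed

lemma even_norm_le:
  assumes "h \<ge> 1" "s \<ge> 0" "(LINT w|M. norm (f w) ^ (2 * h)) \<le> s ^ (2 * h)"
  shows "even_norm M h f \<le> s"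
  using assms real_root_le_mono[of "2 * h" _ "s ^ (2 * h)"] by (simp add: even_norm_def real_root_power_cancel)

lemma even_norm_triangle:
  assumes h: "h \<ge> 1" and f: "bounded_fun M f" and g: "bounded_fun M g"
  shows "even_norm M h (\<lambda>w. f w + g w) \<le> even_norm M h f + even_norm M h g"
proof (rule field_le_epsilon)
  fix e :: real assume e: "e > 0"
  define s t where "s = even_norm M h f + e / 2" and "t = even_norm M h g + e / 2"
  have st: "s > 0" "t > 0" using e even_norm_power(2)[OF h, of f] even_norm_power(2)[OF h, of g] by (auto simp: s_def t_def)
  have fs: "(LINT w|M. norm (f w) ^ (2 * h)) \<le> s ^ (2 * h)" "(LINT w|M. norm (g w) ^ (2 * h)) \<le> t ^ (2 * h)"
    unfolding even_norm_power(1)[OF h, symmetric] s_def t_def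
    using e even_norm_power(2)[OF h] by (auto intro!: power_mono)
  define \<theta> where "\<theta> = s / (s + t)"
  have \<theta>: "0 \<le> \<theta>" "\<theta> \<le> 1" "1 - \<theta> = t / (s + t)" using st by (auto simp: \<theta>_def field_simps)
  have conv: "convex_on UNIV (\<lambda>x::real. x ^ (2 * h))" by (rule convex_power_even) simp
  have pw: "norm (f w + g w) ^ (2 * h) \<le> (s + t) ^ (2 * h) * (\<theta> * (norm (f w) ^ (2*h) / s ^ (2*h)) + (1 - \<theta>) * (norm (g w) ^ (2*h) / t ^ (2*h)))" for w
  proof -
    have "norm (f w + g w) \<le> (s + t) * ((1 - (1 - \<theta>)) * (norm (f w) / s) + (1 - \<theta>) * (norm (g w) / t))"
    proof -
      have "(s + t) * (\<theta> * (norm (f w) / s)) = norm (f w)" using st by (simp add: \<theta>_def)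
      moreover have "(s + t) * ((1 - \<theta>) * (norm (g w) / t)) = norm (g w)" unfolding \<theta>(3) using st by simp
      ultimately show ?thesis using norm_triangle_ineq[of "f w" "g w"] by (simp add: distrib_left)
    qed
    then have "norm (f w + g w) ^ (2*h) \<le> ((s + t) * ((1 - (1 - \<theta>)) * (norm (f w) / s) + (1 - \<theta>) * (norm (g w) / t))) ^ (2*h)"
      by (intro power_mono) auto
    also have "\<dots> = (s + t) ^ (2*h) * ((1 - (1 - \<theta>)) * (norm (f w) / s) + (1 - \<theta>) * (norm (g w) / t)) ^ (2*h)"
      by (rule power_mult_distrib)
    also have "((1 - (1 - \<theta>)) * (norm (f w) / s) + (1 - \<theta>) * (norm (g w) / t)) ^ (2*h)
       \<le> (1 - (1 - \<theta>)) * (norm (f w) / s) ^ (2*h) + (1 - \<theta>) * (norm (g w) / t) ^ (2*h)"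
      using convex_onD[OF conv, of "1 - \<theta>" "norm (f w) / s" "norm (g w) / t"] \<theta> by simp
    finally show ?thesis using st by (simp add: power_divide)
  qed
  have if_: "integrable M (\<lambda>w. norm (f w) ^ (2*h))" "integrable M (\<lambda>w. norm (g w) ^ (2*h))"
    by (rule bounded_fun_integrable_power[OF f] bounded_fun_integrable_power[OF g])+
  have "(LINT w|M. norm (f w + g w) ^ (2*h)) \<le> (LINT w|M. (s + t) ^ (2 * h) * (\<theta> * (norm (f w) ^ (2*h) / s ^ (2*h)) + (1 - \<theta>) * (norm (g w) ^ (2*h) / t ^ (2*h))))"
    using if_ by (intro integral_mono pw bounded_fun_integrable_power bounded_fun_add f g) auto
  also have "\<dots> = (s + t) ^ (2 * h) * (\<theta> * ((LINT w|M. norm (f w) ^ (2*h)) / s ^ (2*h)) + (1 - \<theta>) * ((LINT w|M. norm (g w) ^ (2*h)) / t ^ (2*h)))"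
    using if_ by simp
  also have "\<dots> \<le> (s + t) ^ (2 * h) * (\<theta> * 1 + (1 - \<theta>) * 1)"
    using st fs \<theta> by (intro mult_left_mono add_mono) (auto simp: divide_le_eq_1)
  finally have "(LINT w|M. norm (f w + g w) ^ (2*h)) \<le> (s + t) ^ (2 * h)" by simp
  then have "even_norm M h (\<lambda>w. f w + g w) \<le> s + t" using st by (intro even_norm_le h) auto
  then show "even_norm M h (\<lambda>w. f w + g w) \<le> even_norm M h f + even_norm M h g + e"
    by (simp add: s_def t_def)
qed

text \<open>For a fixed point \<open>w\<close> the random sum is subgaussian with variance at most \<open>card S * \<kappa>\<close>, so its \<open>2h\<close>-th moment is bounded;
  integration over \<open>w\<close> and interchange with the average over the signs give the bound on the norm. The real and the imaginary
  parts of the functions are treated separately.\<close>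

lemma khintchine_even_norm:
  fixes f :: "'i \<Rightarrow> 'a \<Rightarrow> complex"
  assumes I: "finite I" and S: "finite S" "S \<noteq> {}" and h: "h \<ge> 1" and \<kappa>: "\<kappa> > 0"
    and f: "\<And>i. i \<in> I \<Longrightarrow> bounded_fun M (f i)"
    and sq: "\<And>w. w \<in> space M \<Longrightarrow> (\<Sum>i\<in>I. (norm (f i w))\<^sup>2) \<le> \<kappa>"
  shows "avg (PiE S (\<lambda>_. signs I)) (\<lambda>g. even_norm M h (\<lambda>w. \<Sum>i\<in>I. of_real (\<Sum>s\<in>S. g s i) * f i w))
     \<le> 2 * ((measure M (space M) + 1) * sqrt (48 * real h * (real (card S) * \<kappa>)))"
proof -
  define V where "V = measure M (space M)"
  define b where "b = real (card S) * \<kappa>"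
  define P where "P = PiE S (\<lambda>_. signs I)"
  have V: "V \<ge> 0" by (simp add: V_def)
  have b: "b > 0" using S \<kappa> by (simp add: b_def card_gt_0_iff)
  have P: "finite P" "P \<noteq> {}" using S I by (auto simp: P_def finite_PiE signs_finite PiE_eq_empty_iff signs_nonempty)
  define G where "G g w = (\<Sum>i\<in>I. of_real (\<Sum>s\<in>S. g s i) * f i w)" for g w
  have real_moment: "avg P (\<lambda>g. (\<Sum>i\<in>I. (\<Sum>s\<in>S. g s i) * a i) ^ (2*h)) \<le> (12 * real h * b) ^ h"
    if a: "(\<Sum>i\<in>I. (a i)\<^sup>2) \<le> \<kappa>" for a
  proof (rule subgaussian_moment[OF b h])
    fix t :: real
    have "(\<Sum>i\<in>I. (\<Sum>s\<in>S. g s i) * a i) = (\<Sum>s\<in>S. \<Sum>i\<in>I. a i * g s i)" for g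
      unfolding sum_distrib_right by (subst sum.swap) (simp add: mult.commute)
    then have "avg P (\<lambda>g. exp (t * (\<Sum>i\<in>I. (\<Sum>s\<in>S. g s i) * a i))) = avg P (\<lambda>g. exp (\<Sum>s\<in>S. t * (\<Sum>i\<in>I. a i * g s i)))"
      by (simp add: sum_distrib_left)
    also have "\<dots> \<le> exp (\<Sum>s\<in>S. t\<^sup>2 * (\<Sum>i\<in>I. (a i)\<^sup>2) / 2)"
      unfolding P_def using S(1) avg_signs_exp[OF I] by (intro avg_PiE_exp[where f = "\<lambda>s \<epsilon>. t * (\<Sum>i\<in>I. a i * \<epsilon> i)"])
    also have "\<dots> \<le> exp (t\<^sup>2 * b / 2)"
    proof -
      have "t\<^sup>2 * (\<Sum>i\<in>I. (a i)\<^sup>2) * real (card S) \<le> t\<^sup>2 * \<kappa> * real (card S)"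
        by (intro mult_right_mono mult_left_mono a) auto
      then show ?thesis by (simp add: b_def mult_ac)
    qed
    finally show "avg P (\<lambda>g. exp (t * (\<Sum>i\<in>I. (\<Sum>s\<in>S. g s i) * a i))) \<le> exp (t\<^sup>2 * b / 2)" .
  qed
  have pw: "avg P (\<lambda>g. norm (G g w) ^ (2*h)) \<le> (48 * real h * b) ^ h" if w: "w \<in> space M" for w
  proof -
    have re: "Re (G g w) = (\<Sum>i\<in>I. (\<Sum>s\<in>S. g s i) * Re (f i w))" and im: "Im (G g w) = (\<Sum>i\<in>I. (\<Sum>s\<in>S. g s i) * Im (f i w))" for g
      by (simp_all add: G_def)
    have split: "norm z ^ (2*h) \<le> 2 ^ h * (Re z ^ (2*h) + Im z ^ (2*h))" for z :: complex
    proof -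
      have "norm z ^ (2*h) = ((Re z)\<^sup>2 + (Im z)\<^sup>2) ^ h" by (simp add: power_mult cmod_power2)
      also have "\<dots> \<le> (2 * max ((Re z)\<^sup>2) ((Im z)\<^sup>2)) ^ h" by (intro power_mono) auto
      also have "\<dots> = 2 ^ h * max ((Re z)\<^sup>2) ((Im z)\<^sup>2) ^ h" by (rule power_mult_distrib)
      also have "max ((Re z)\<^sup>2) ((Im z)\<^sup>2) ^ h \<le> ((Re z)\<^sup>2) ^ h + ((Im z)\<^sup>2) ^ h" by (auto simp: max_def)
      finally show ?thesis by (simp add: power_mult)
    qed
    have sqre: "(\<Sum>i\<in>I. (Re (f i w))\<^sup>2) \<le> \<kappa>" "(\<Sum>i\<in>I. (Im (f i w))\<^sup>2) \<le> \<kappa>"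
      by (rule order_trans[OF sum_mono sq[OF w]], simp add: cmod_power2)+
    have "avg P (\<lambda>g. norm (G g w) ^ (2*h)) \<le> avg P (\<lambda>g. 2 ^ h * (Re (G g w) ^ (2*h) + Im (G g w) ^ (2*h)))"
      by (intro avg_mono split)
    also have "\<dots> = 2 ^ h * (avg P (\<lambda>g. Re (G g w) ^ (2*h)) + avg P (\<lambda>g. Im (G g w) ^ (2*h)))"
      by (simp add: avg_cmult avg_add)
    also have "\<dots> \<le> 2 ^ h * ((12 * real h * b) ^ h + (12 * real h * b) ^ h)"
      unfolding re im by (intro mult_left_mono add_mono real_moment sqre) auto
    also have "\<dots> \<le> 2 ^ h * (2 ^ h * (12 * real h * b) ^ h)"
      using b h self_le_power[of "2::real" h] by (intro mult_left_mono) (auto simp: mult_2[symmetric] intro!: mult_right_mono)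
    also have "\<dots> = (2 * (2 * (12 * real h * b))) ^ h" by (simp only: power_mult_distrib)
    also have "\<dots> = (48 * real h * b) ^ h" by (simp add: mult.assoc)
    finally show ?thesis .
  qed
  have bG: "bounded_fun M (G g)" for g
    unfolding G_def[abs_def] by (rule bounded_fun_lincomb[OF I f])
  define \<rho> where "\<rho> = (V + 1) * sqrt (48 * real h * b)"
  have \<rho>: "\<rho> > 0" using V b h by (simp add: \<rho>_def)
  have "avg P (\<lambda>g. LINT w|M. norm (G g w) ^ (2*h)) = (LINT w|M. avg P (\<lambda>g. norm (G g w) ^ (2*h)))"
    unfolding avg_def using bounded_fun_integrable_power[OF bG] by simp
  also have "\<dots> \<le> (LINT w|M. (48 * real h * b) ^ h)"
    using bounded_fun_integrable_power[OF bG] pw unfolding avg_def by (intro integral_mono) auto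
  also have "\<dots> = V * (48 * real h * b) ^ h" by (simp add: V_def)
  also have "\<dots> \<le> (V + 1) ^ (2*h) * (48 * real h * b) ^ h"
    using V h b self_le_power[of "V + 1" "2*h"] by (intro mult_right_mono) auto
  also have "\<dots> = \<rho> ^ (2*h)"
    using b unfolding \<rho>_def power_mult_distrib[of _ "sqrt _"] power_mult[of "sqrt _"] by simp
  finally have int: "avg P (\<lambda>g. LINT w|M. norm (G g w) ^ (2*h)) \<le> \<rho> ^ (2*h)" .
  have root_le: "y \<le> \<rho> + \<rho> * (y ^ (2*h) / \<rho> ^ (2*h))" if y: "y \<ge> 0" for y :: real
  proof (cases "y \<le> \<rho>")
    case True
    have "0 \<le> \<rho> * (y ^ (2*h) / \<rho> ^ (2*h))" using \<rho> by simp
    then show ?thesis using True by linarith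
  next
    case False
    then have "y / \<rho> \<le> (y / \<rho>) ^ (2*h)" using \<rho> h by (intro self_le_power) auto
    then have "\<rho> * (y / \<rho>) \<le> \<rho> * (y ^ (2*h) / \<rho> ^ (2*h))" using \<rho> by (intro mult_left_mono) (auto simp: power_divide)
    then show ?thesis using \<rho> by simp
  qed
  have "avg P (\<lambda>g. even_norm M h (G g)) \<le> avg P (\<lambda>g. \<rho> + (\<rho> / \<rho> ^ (2*h)) * (LINT w|M. norm (G g w) ^ (2*h)))"
    using root_le[OF even_norm_power(2)[OF h]] by (intro avg_mono) (simp add: even_norm_power(1)[OF h])
  also have "\<dots> = \<rho> + (\<rho> / \<rho> ^ (2*h)) * avg P (\<lambda>g. LINT w|M. norm (G g w) ^ (2*h))"
    by (simp only: avg_add avg_const[OF P] avg_cmult)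
  also have "\<dots> \<le> \<rho> + (\<rho> / \<rho> ^ (2*h)) * \<rho> ^ (2*h)"
    using \<rho> by (intro add_left_mono mult_left_mono int) auto
  also have "\<dots> = 2 * \<rho>" using \<rho> by simp
  finally show ?thesis by (simp add: P_def G_def[abs_def] \<rho>_def V_def b_def)
qed

text \<open>The random subspace theorem for the norm of \<open>L\<^bsup>2h\<^esup>\<close> on the span of the \<open>f i\<close>. Its average \<open>R\<close> is of order
  \<open>(h * \<kappa> * k)\<^bsup>1/2\<^esup>\<close>. The coefficients of the random vectors are real; the real and the imaginary part of \<open>x\<close> are approximated
  separately by the same vectors, which doubles \<open>68 * 2 * 7\<close> to \<open>1904\<close>.\<close>

theorem random_approximation:
  fixes f :: "'i \<Rightarrow> 'a \<Rightarrow> complex"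
  assumes I: "finite I" and k: "k \<ge> 1" and h: "h \<ge> 1" and \<kappa>: "\<kappa> > 0"
    and f: "\<And>i. i \<in> I \<Longrightarrow> bounded_fun M (f i)"
    and sq: "\<And>w. w \<in> space M \<Longrightarrow> (\<Sum>i\<in>I. (norm (f i w))\<^sup>2) \<le> \<kappa>"
  shows "\<exists>g :: nat \<Rightarrow> 'i \<Rightarrow> real. \<forall>x :: 'i \<Rightarrow> complex. \<forall>\<rho> \<eta>. (\<Sum>i\<in>I. (norm (x i))\<^sup>2) \<le> \<rho>\<^sup>2 \<longrightarrow> \<rho> \<ge> 0 \<longrightarrow> \<eta> > 0 \<longrightarrow>
    (\<exists>a :: nat \<Rightarrow> complex. even_norm M h (\<lambda>w. (\<Sum>i\<in>I. x i * f i w) - (\<Sum>s<k. a s * (\<Sum>i\<in>I. of_real (g s i) * f i w)))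
      \<le> 1904 * (measure M (space M) + 1) * sqrt (real h * \<kappa> / real k) * \<rho> + \<eta>)"
proof -
  define N where "N c = even_norm M h (\<lambda>w. \<Sum>i\<in>I. of_real (c i) * f i w)" for c :: "'i \<Rightarrow> real"
  have bf: "bounded_fun M (\<lambda>w. \<Sum>i\<in>I. c i * f i w)" for c
    by (rule bounded_fun_lincomb[OF I f])
  define R where "R = avg (PiE {..<k} (\<lambda>_. signs I)) (\<lambda>g. N (\<lambda>i. \<Sum>s\<in>{..<k}. g s i))"
  define V where "V = measure M (space M)"
  have V: "V \<ge> 0" by (simp add: V_def)
  have "\<exists>g. \<forall>x \<eta>. \<eta> > 0 \<longrightarrow> (\<exists>a. N (\<lambda>i. x i - (\<Sum>s\<in>{..<k}. a s * g s i))
            < 68 / real (card {..<k}) * R * sqrt (\<Sum>i\<in>I. (x i)\<^sup>2) + \<eta>)"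
    unfolding R_def
  proof (rule random_subspace_approximation[OF I])
    show "finite {..<k}" "{..<k} \<noteq> {}" using k by (auto simp: lessThan_empty_iff)
    show "N (\<lambda>i. x i + y i) \<le> N x + N y" for x y
      using even_norm_triangle[OF h bf bf, of "\<lambda>i. of_real (x i)" "\<lambda>i. of_real (y i)"]
      by (simp add: N_def distrib_right sum.distrib)
    show "N (\<lambda>i. c * x i) = \<bar>c\<bar> * N x" for c x
      using even_norm_scale[OF h, of "of_real c" "\<lambda>w. \<Sum>i\<in>I. of_real (x i) * f i w"]
      by (simp add: N_def sum_distrib_left mult.assoc)
    show "N x = N y" if "\<And>i. i \<in> I \<Longrightarrow> x i = y i" for x y
      using that by (simp add: N_def)
  qed
  then obtain g where g: "\<And>x \<eta>. \<eta> > 0 \<Longrightarrow> \<exists>a. N (\<lambda>i. x i - (\<Sum>s\<in>{..<k}. a s * g s i)) < 68 / real k * R * sqrt (\<Sum>i\<in>I. (x i)\<^sup>2) + \<eta>"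
    by auto
  have "R \<le> 2 * ((V + 1) * sqrt (48 * real h * (real k * \<kappa>)))"
    using khintchine_even_norm[OF I _ _ h \<kappa> f sq, of "{..<k}"] k
    by (simp add: R_def N_def V_def lessThan_empty_iff)
  also have "\<dots> \<le> 2 * ((V + 1) * (7 * (real k * sqrt (real h * \<kappa> / real k))))"
  proof (intro mult_left_mono)
    have "sqrt (48 * real h * (real k * \<kappa>)) \<le> sqrt ((7 * real k)\<^sup>2 * (real h * \<kappa> / real k))"
      using k h \<kappa> by (intro real_sqrt_le_mono) (simp add: power2_eq_square)
    also have "\<dots> = 7 * (real k * sqrt (real h * \<kappa> / real k))"
      unfolding real_sqrt_mult real_sqrt_abs by simp
    finally show "sqrt (48 * real h * (real k * \<kappa>)) \<le> 7 * (real k * sqrt (real h * \<kappa> / real k))" .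
  qed (use V in auto)
  finally have "68 / real k * R \<le> 68 / real k * (2 * ((V + 1) * (7 * (real k * sqrt (real h * \<kappa> / real k)))))"
    by (intro mult_left_mono) auto
  also have "\<dots> = 952 * (V + 1) * sqrt (real h * \<kappa> / real k)" using k by simp
  finally have Rk: "68 / real k * R \<le> 952 * (V + 1) * sqrt (real h * \<kappa> / real k)" .
  have real_case: "\<exists>a. N (\<lambda>i. x i - (\<Sum>s<k. a s * g s i)) \<le> 952 * (V + 1) * sqrt (real h * \<kappa> / real k) * \<rho> + \<eta> / 2"
    if x: "(\<Sum>i\<in>I. (x i)\<^sup>2) \<le> \<rho>\<^sup>2" "\<rho> \<ge> 0" and \<eta>: "\<eta> > 0" for x \<rho> \<eta>
  proof -
    obtain a where a: "N (\<lambda>i. x i - (\<Sum>s\<in>{..<k}. a s * g s i)) < 68 / real k * R * sqrt (\<Sum>i\<in>I. (x i)\<^sup>2) + \<eta> / 2"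
      using g[of "\<eta> / 2" x] \<eta> by auto
    have "sqrt (\<Sum>i\<in>I. (x i)\<^sup>2) \<le> \<rho>" using x by (metis real_sqrt_le_mono real_sqrt_abs abs_of_nonneg)
    then have "952 * (V + 1) * sqrt (real h * \<kappa> / real k) * sqrt (\<Sum>i\<in>I. (x i)\<^sup>2) \<le> 952 * (V + 1) * sqrt (real h * \<kappa> / real k) * \<rho>"
      using V \<kappa> by (intro mult_left_mono) auto
    moreover have "68 / real k * R * sqrt (\<Sum>i\<in>I. (x i)\<^sup>2) \<le> 952 * (V + 1) * sqrt (real h * \<kappa> / real k) * sqrt (\<Sum>i\<in>I. (x i)\<^sup>2)"
      by (intro mult_right_mono Rk) (simp add: sum_nonneg)
    ultimately have "68 / real k * R * sqrt (\<Sum>i\<in>I. (x i)\<^sup>2) \<le> 952 * (V + 1) * sqrt (real h * \<kappa> / real k) * \<rho>" by (rule order_trans[rotated])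
    then show ?thesis using a by (intro exI[of _ a]) linarith
  qed
  show ?thesis
  proof (intro exI[of _ g] allI impI)
    fix x :: "'i \<Rightarrow> complex" and \<rho> \<eta> :: real
    assume x: "(\<Sum>i\<in>I. (norm (x i))\<^sup>2) \<le> \<rho>\<^sup>2" and \<rho>: "\<rho> \<ge> 0" and \<eta>: "\<eta> > 0"
    have xr: "(\<Sum>i\<in>I. (Re (x i))\<^sup>2) \<le> \<rho>\<^sup>2" "(\<Sum>i\<in>I. (Im (x i))\<^sup>2) \<le> \<rho>\<^sup>2"
      by (rule order_trans[OF sum_mono x], simp add: cmod_power2)+
    obtain a b where a: "N (\<lambda>i. Re (x i) - (\<Sum>s<k. a s * g s i)) \<le> 952 * (V + 1) * sqrt (real h * \<kappa> / real k) * \<rho> + \<eta> / 2"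
      and b: "N (\<lambda>i. Im (x i) - (\<Sum>s<k. b s * g s i)) \<le> 952 * (V + 1) * sqrt (real h * \<kappa> / real k) * \<rho> + \<eta> / 2"
      using real_case[OF xr(1) \<rho> \<eta>] real_case[OF xr(2) \<rho> \<eta>] by blast
    define c where "c s = Complex (a s) (b s)" for s
    define y where "y i = complex_of_real (Re (x i) - (\<Sum>s<k. a s * g s i))" for i
    define y' where "y' i = complex_of_real (Im (x i) - (\<Sum>s<k. b s * g s i))" for i
    have xy: "x i - (\<Sum>s<k. c s * of_real (g s i)) = y i + \<i> * y' i" for i
      by (simp add: y_def y'_def c_def complex_eq_iff)
    have "(\<Sum>i\<in>I. x i * f i w) - (\<Sum>s<k. c s * (\<Sum>i\<in>I. of_real (g s i) * f i w)) = (\<Sum>i\<in>I. y i * f i w) + \<i> * (\<Sum>i\<in>I. y' i * f i w)" for w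
    proof -
      have "(\<Sum>s<k. c s * (\<Sum>i\<in>I. of_real (g s i) * f i w)) = (\<Sum>i\<in>I. (\<Sum>s<k. c s * of_real (g s i)) * f i w)"
        unfolding sum_distrib_left sum_distrib_right by (subst sum.swap) (simp add: mult.assoc)
      then have "(\<Sum>i\<in>I. x i * f i w) - (\<Sum>s<k. c s * (\<Sum>i\<in>I. of_real (g s i) * f i w)) = (\<Sum>i\<in>I. (x i - (\<Sum>s<k. c s * of_real (g s i))) * f i w)"
        by (simp add: left_diff_distrib sum_subtractf)
      then show ?thesis unfolding xy by (simp add: distrib_right sum.distrib sum_distrib_left mult.assoc)
    qed
    then have "even_norm M h (\<lambda>w. (\<Sum>i\<in>I. x i * f i w) - (\<Sum>s<k. c s * (\<Sum>i\<in>I. of_real (g s i) * f i w)))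
       \<le> even_norm M h (\<lambda>w. \<Sum>i\<in>I. y i * f i w) + even_norm M h (\<lambda>w. \<i> * (\<Sum>i\<in>I. y' i * f i w))"
      using even_norm_triangle[OF h bf bounded_fun_scale[OF bf], of y \<i> y'] by simp
    also have "\<dots> = N (\<lambda>i. Re (x i) - (\<Sum>s<k. a s * g s i)) + N (\<lambda>i. Im (x i) - (\<Sum>s<k. b s * g s i))"
      unfolding even_norm_scale[OF h] N_def y_def y'_def by simp
    also have "\<dots> \<le> 1904 * (V + 1) * sqrt (real h * \<kappa> / real k) * \<rho> + \<eta>"
      using a b by (simp add: algebra_simps)
    finally show "\<exists>a. even_norm M h (\<lambda>w. (\<Sum>i\<in>I. x i * f i w) - (\<Sum>s<k. a s * (\<Sum>i\<in>I. of_real (g s i) * f i w)))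
      \<le> 1904 * (measure M (space M) + 1) * sqrt (real h * \<kappa> / real k) * \<rho> + \<eta>"
      unfolding V_def by blast
  qed
qed

section \<open>Lp norms\<close>

text \<open>On a finite measure space the unit ball of \<open>L\<^sup>p\<close> is bounded in \<open>L\<^sup>2\<close> when \<open>p \<ge> 2\<close>, so only exponents \<open>r \<le> 2\<close> are
  considered later. The bound is that of the integral of \<open>1 + x\<^sup>p\<close>, which dominates \<open>x\<^sup>2\<close>.\<close>

lemma Lp_ball_moment:
  assumes p: "1 \<le> p" and \<phi>: "\<phi> \<in> Lp_ball p M"
  defines "r \<equiv> (if p \<le> 2 then enn2real p else 2)"
  shows "1 \<le> r" "r \<le> 2" "\<phi> \<in> borel_measurable M" "integrable M (\<lambda>w. norm (\<phi> w) powr r)"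
    "(LINT w|M. norm (\<phi> w) powr r) \<le> measure M (space M) + 1" "integrable M \<phi>"
proof -
  have m[measurable]: "\<phi> \<in> borel_measurable M" and N: "Lp_norm p M \<phi> \<le> 1"
    using \<phi> by (auto simp: Lp_ball_def Lp_space_def)
  show "\<phi> \<in> borel_measurable M" by (rule m)
  have pr: "p \<le> 2 \<Longrightarrow> 1 \<le> enn2real p \<and> enn2real p \<le> 2"
    using p by (cases p) (auto simp: ennreal_le_iff top_unique simp flip: ennreal_1 ennreal_numeral)
  then show r: "1 \<le> r" "r \<le> 2" by (auto simp: r_def)
  have "\<exists>F. integrable M F \<and> (LINT w|M. F w) \<le> measure M (space M) + 1 \<and> (AE w in M. norm (\<phi> w) powr r \<le> F w)"
  proof (cases "p = \<infinity>")
    case True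
    then have ess: "esssup M (\<lambda>x. ennreal (norm (\<phi> x))) \<le> 1" using N by (simp add: Lp_norm_def)
    from esssup_AE[of "\<lambda>x. ennreal (norm (\<phi> x))" M] have "AE w in M. ennreal (norm (\<phi> w)) \<le> 1"
      by (rule eventually_mono) (rule order_trans[OF _ ess])
    then have "AE w in M. norm (\<phi> w) powr r \<le> 1"
      by (rule eventually_mono) (use r in \<open>auto intro!: powr_le1\<close>)
    then show ?thesis by (intro exI[of _ "\<lambda>_. 1"]) auto
  next
    case False
    define p' where "p' = enn2real p"
    have p': "p' \<ge> 1" "p = ennreal p'" using p False by (cases p; simp add: p'_def ennreal_le_iff flip: ennreal_1)+
    define J where "J = (\<integral>\<^sup>+ x. ennreal (norm (\<phi> x) powr p') \<partial>M)"
    have "(if J = \<infinity> then \<infinity> else ennreal (enn2real J powr (1 / p'))) \<le> 1"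
      using N False unfolding Lp_norm_def Let_def J_def p'_def by simp
    then have J: "J \<noteq> \<infinity>" "enn2real J powr (1 / p') \<le> 1" by (auto simp: top_unique split: if_splits)
    have "enn2real J \<le> 1"
    proof (rule ccontr)
      assume "\<not> ?thesis"
      then have "1 < enn2real J powr (1 / p')" using p'(1) by (intro gr_one_powr) auto
      then show False using J(2) by simp
    qed
    then have J1: "J \<le> 1" using J(1) by (cases J) (auto simp flip: ennreal_1)
    have ip': "integrable M (\<lambda>w. norm (\<phi> w) powr p')"
      using J1 unfolding J_def by (intro integrableI_nonneg) (auto simp: top_unique intro: le_less_trans)
    have "ennreal (LINT w|M. norm (\<phi> w) powr p') \<le> 1"
      using J1 ip' unfolding J_def by (subst (asm) nn_integral_eq_integral) auto
    then have i1: "(LINT w|M. norm (\<phi> w) powr p') \<le> 1" by simp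
    have "norm (\<phi> w) powr r \<le> 1 + norm (\<phi> w) powr p'" for w
    proof (cases "norm (\<phi> w) \<le> 1")
      case True
      then have "norm (\<phi> w) powr r \<le> 1" using r by (intro powr_le1) auto
      then show ?thesis by (simp add: add_increasing2)
    next
      case f: False
      have "r \<le> p'"
        using p'(2) pr by (auto simp: r_def p'_def) (metis ennreal_le_iff ennreal_numeral enn2real_nonneg linear p'(2) p'_def)
      then have "norm (\<phi> w) powr r \<le> norm (\<phi> w) powr p'" using f by (intro powr_mono) auto
      then show ?thesis by simp
    qed
    then show ?thesis
      using ip' i1 by (intro exI[of _ "\<lambda>w. 1 + norm (\<phi> w) powr p'"]) auto
  qed
  then obtain F where F: "integrable M F" "(LINT w|M. F w) \<le> measure M (space M) + 1" "AE w in M. norm (\<phi> w) powr r \<le> F w" by blast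
  show i: "integrable M (\<lambda>w. norm (\<phi> w) powr r)"
    by (rule Bochner_Integration.integrable_bound[OF F(1)]) (use F(3) in \<open>auto elim!: eventually_mono\<close>)
  show "(LINT w|M. norm (\<phi> w) powr r) \<le> measure M (space M) + 1"
    by (rule order_trans[OF integral_mono_AE[OF i F(1) F(3)] F(2)])
  show "integrable M \<phi>"
  proof (rule Bochner_Integration.integrable_bound[of _ "\<lambda>w. 1 + norm (\<phi> w) powr r"])
    show "integrable M (\<lambda>w. 1 + norm (\<phi> w) powr r)" using i by simp
    have "x \<le> 1 + x powr r" if x: "x \<ge> 0" for x :: real
    proof (cases "x \<le> 1")
      case False
      then have "x powr 1 \<le> x powr r" using r by (intro powr_mono) auto
      then show ?thesis using False by simp
    qed (simp add: add_increasing2)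
    then show "AE w in M. norm (\<phi> w) \<le> norm (1 + norm (\<phi> w) powr r)" by (auto simp: abs_of_nonneg add_nonneg_nonneg)
  qed (rule m)
qed

lemma Lp_norm_le_of_even_norm:
  assumes F: "F \<in> borel_measurable M" and G: "bounded_fun M G"
    and FG: "AE w in M. norm (F w) \<le> norm (G w) + \<eta>" and \<eta>: "0 \<le> \<eta>" "\<eta> \<le> s" and s: "s > 0"
    and Gs: "even_norm M h G \<le> s" and h: "h \<ge> 1" and q: "2 \<le> q" "q < \<infinity>" "enn2real q \<le> 2 * real h"
  shows "Lp_norm q M F \<le> ennreal (2 * (measure M (space M) + 1) * s)"
proof -
  define V where "V = measure M (space M)"
  define q' where "q' = enn2real q"
  have V: "V \<ge> 0" by (simp add: V_def)
  have q': "q' \<ge> 2" using q by (cases q) (auto simp: q'_def ennreal_le_iff simp flip: ennreal_numeral)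
  have Gi: "(LINT w|M. norm (G w) ^ (2*h)) \<le> s ^ (2*h)"
    unfolding even_norm_power(1)[OF h, symmetric] by (intro power_mono Gs even_norm_power(2) h)
  have gi: "integrable M (\<lambda>w. norm (G w) ^ (2*h))" by (rule bounded_fun_integrable_power[OF G])
  define B where "B w = (2 * s) powr q' * (1 + norm (G w) ^ (2*h) / s ^ (2*h))" for w
  have Bi: "integrable M B" unfolding B_def using gi by simp
  have B0: "B w \<ge> 0" for w unfolding B_def using s by simp
  have pw: "x powr q' \<le> (2 * s) powr q' * (1 + y ^ (2*h) / s ^ (2*h))" if xy: "0 \<le> x" "0 \<le> y" "x \<le> y + \<eta>" for x y
  proof (cases "y \<le> s")
    case True
    then have "x powr q' \<le> (2 * s) powr q'" using xy \<eta> q' by (intro powr_mono2) auto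
    also have "\<dots> \<le> (2 * s) powr q' * (1 + y ^ (2*h) / s ^ (2*h))" using s xy by simp
    finally show ?thesis .
  next
    case False
    have "x powr q' \<le> (2 * y) powr q'" using xy \<eta> q' False by (intro powr_mono2) auto
    also have "\<dots> = (2 * s) powr q' * (y / s) powr q'" using s False by (subst powr_mult[symmetric]) auto
    also have "\<dots> \<le> (2 * s) powr q' * (1 + y ^ (2*h) / s ^ (2*h))"
    proof (rule mult_left_mono)
      have "(y / s) powr q' \<le> (y / s) powr real (2 * h)"
        using False s q(3) by (intro powr_mono) (auto simp: q'_def)
      also have "(y / s) powr real (2 * h) = y ^ (2*h) / s ^ (2*h)"
        using False s by (subst powr_realpow) (auto simp: power_divide)
      finally show "(y / s) powr q' \<le> 1 + y ^ (2*h) / s ^ (2*h)" by simp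
    qed simp
    finally show ?thesis .
  qed
  define J where "J = (\<integral>\<^sup>+ x. ennreal (norm (F x) powr q') \<partial>M)"
  have "J \<le> (\<integral>\<^sup>+ x. ennreal (B x) \<partial>M)"
    unfolding J_def B_def using FG
    by (intro nn_integral_mono_AE) (auto elim!: eventually_mono intro!: ennreal_leI pw)
  also have "\<dots> = ennreal (LINT w|M. B w)"
    using Bi B0 by (intro nn_integral_eq_integral) auto
  also have "(LINT w|M. B w) = (2 * s) powr q' * (V + (LINT w|M. norm (G w) ^ (2*h)) / s ^ (2*h))"
    unfolding B_def V_def using gi by simp
  also have "ennreal \<dots> \<le> ennreal ((2 * s) powr q' * (V + 1))"
    using Gi s by (intro ennreal_leI mult_left_mono add_left_mono) (auto simp: divide_le_eq_1)
  finally have J: "J \<le> ennreal ((2 * s) powr q' * (V + 1))" .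
  then have Jf: "J \<noteq> \<infinity>" by (auto simp: top_unique)
  have "enn2real J \<le> (2 * s) powr q' * (V + 1)"
    using J V by (metis enn2real_mono enn2real_ennreal ennreal_less_top mult_nonneg_nonneg powr_ge_zero add_nonneg_nonneg zero_le_one)
  then have "enn2real J powr (1 / q') \<le> ((2 * s) powr q' * (V + 1)) powr (1 / q')"
    using q' by (intro powr_mono2) auto
  also have "\<dots> = (2 * s) * (V + 1) powr (1 / q')"
    using s V q' by (simp add: powr_mult powr_powr)
  also have "\<dots> \<le> (2 * s) * (V + 1)"
  proof -
    have "(V + 1) powr (1 / q') \<le> (V + 1) powr 1" using V q' by (intro powr_mono) auto
    then show ?thesis using s V by (intro mult_left_mono) auto
  qed
  finally have "ennreal (enn2real J powr (1 / q')) \<le> ennreal (2 * (V + 1) * s)"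
    by (intro ennreal_leI) (simp add: mult_ac)
  moreover have "q \<noteq> \<infinity>" using q(2) by auto
  ultimately show ?thesis
    using Jf by (simp only: Lp_norm_def q'_def[symmetric] J_def[symmetric] Let_def V_def[symmetric] if_False)
qed

end

lemma Lp_norm_infinity_le:
  assumes F: "F \<in> borel_measurable M" and "AE w in M. norm (F w) \<le> c"
  shows "Lp_norm \<infinity> M F \<le> ennreal c"
  using assms unfolding Lp_norm_def
  by (auto intro!: esssup_I elim!: eventually_mono ennreal_leI)

section \<open>Graded orthonormal systems\<close>

text \<open>A pointwise substitute for Hoelder's inequality combined with interpolation of \<open>u\<close> between \<open>L\<^sup>2\<close> and
  \<open>L\<^sup>\<infinity>\<close>. Either \<open>u \<le> x\<^bsup>r-1\<^esup>\<close> and the first term suffices, or \<open>x\<close> is at most \<open>u\<^bsup>1/(r-1)\<^esup>\<close> and the surplus power of \<open>u\<close>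
  is absorbed by its upper bound.\<close>

lemma crude_young:
  fixes x u r K :: real
  assumes x: "x \<ge> 0" and u: "u \<ge> 0" "u \<le> K powr (1 - 1 / r)" and r: "1 \<le> r" "r \<le> 2" and K: "K > 0"
  shows "x * u \<le> x powr r + u\<^sup>2 * K powr (2 / r - 1)"
proof (cases "x = 0 \<or> u \<le> x powr (r - 1)")
  case True
  have "x * u \<le> x powr r"
  proof (cases "x = 0")
    case False
    then have "x * u \<le> x * x powr (r - 1)" using True x by (intro mult_left_mono) auto
    also have "\<dots> = x powr r" using False x by (simp add: powr_mult_base)
    finally show ?thesis .
  qed simp
  moreover have "0 \<le> u\<^sup>2 * K powr (2 / r - 1)" by simp
  ultimately show ?thesis by linarith
next
  case False
  then have x0: "x > 0" and xu: "x powr (r - 1) < u" using x by auto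
  have u0: "u > 0" using xu by (metis less_le_trans not_le powr_ge_zero less_imp_le order.strict_trans1)
  have r1: "r > 1"
  proof (rule ccontr)
    assume "\<not> ?thesis"
    then have "r = 1" using r by simp
    then show False using xu x0 u K by simp
  qed
  have "x = (x powr (r - 1)) powr (1 / (r - 1))" using x0 r1 by (simp add: powr_powr)
  also have "\<dots> \<le> u powr (1 / (r - 1))" using xu r1 by (intro powr_mono2) auto
  finally have "x * u \<le> u powr (1 / (r - 1)) * u" using u0 by (intro mult_right_mono) auto
  also have "\<dots> = u\<^sup>2 * u powr ((2 - r) / (r - 1))"
  proof -
    have "1 / (r - 1) + 1 = 2 + (2 - r) / (r - 1)" using r1 by (simp add: field_simps)
    moreover have "u powr (1 / (r - 1)) * u = u powr (1 / (r - 1) + 1)" using u0 by (simp add: powr_add)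
    moreover have "u\<^sup>2 = u powr 2" using u0 by simp
    ultimately show ?thesis by (simp only: powr_add)
  qed
  also have "\<dots> \<le> u\<^sup>2 * (K powr (1 - 1 / r)) powr ((2 - r) / (r - 1))"
    using u u0 r r1 by (intro mult_left_mono powr_mono2) auto
  also have "(K powr (1 - 1 / r)) powr ((2 - r) / (r - 1)) = K powr (2 / r - 1)"
  proof -
    have "(1 - 1 / r) * ((2 - r) / (r - 1)) = 2 / r - 1" using r1 by (simp add: field_simps)
    then show ?thesis by (simp add: powr_powr)
  qed
  finally show ?thesis by (simp add: add_increasing)
qed

lemma sum_norm_square_cauchy:
  "norm (\<Sum>i\<in>A. a i * b i :: complex) \<le> sqrt (\<Sum>i\<in>A. (norm (a i))\<^sup>2) * sqrt (\<Sum>i\<in>A. (norm (b i))\<^sup>2)"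
proof -
  have "norm (\<Sum>i\<in>A. a i * b i) \<le> (\<Sum>i\<in>A. norm (a i) * norm (b i))"
    by (rule order_trans[OF norm_sum]) (simp add: norm_mult)
  also have "\<dots> \<le> sqrt ((\<Sum>i\<in>A. (norm (a i))\<^sup>2) * (\<Sum>i\<in>A. (norm (b i))\<^sup>2))"
    by (intro real_le_rsqrt Cauchy_Schwarz_ineq_sum)
  finally show ?thesis by (simp only: real_sqrt_mult)
qed

text \<open>The properties of spherical harmonics that the approximation argument uses: an orthonormal system whose reproducing kernel
  grows on the diagonal like a power \<open>D\<close> of the degree, together with the comparison of sup norms and \<open>L\<^bsup>2h\<^esup>\<close> norms. The factor
  \<open>h * N\<close> is the degree of an \<open>h\<close>-th power.\<close>

locale graded_system = finite_measure M for M :: "'a measure" +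
  fixes I :: "'i set" and e :: "'i \<Rightarrow> 'a \<Rightarrow> complex" and deg :: "'i \<Rightarrow> nat" and B :: real and D :: nat
  assumes B_pos: "B > 0" and D_pos: "D \<ge> 1"
    and e_measurable: "\<And>i. i \<in> I \<Longrightarrow> e i \<in> borel_measurable M"
    and finite_deg: "\<And>N. finite {i \<in> I. deg i \<le> N}"
    and kernel: "\<And>N w. w \<in> space M \<Longrightarrow> (\<Sum>i\<in>{i \<in> I. deg i \<le> N}. (norm (e i w))\<^sup>2) \<le> B * (real N + 1) ^ D"
    and orth: "\<And>i j. i \<in> I \<Longrightarrow> j \<in> I \<Longrightarrow> (LINT w|M. e i w * cnj (e j w)) = (if i = j then 1 else 0)"
    and power_bound: "\<And>h N c w. w \<in> space M \<Longrightarrow> norm (\<Sum>i\<in>{i \<in> I. deg i \<le> N}. c i * e i w) ^ (2 * h)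
      \<le> B * (real (h * N) + 1) ^ D * (LINT w|M. norm (\<Sum>i\<in>{i \<in> I. deg i \<le> N}. c i * e i w) ^ (2 * h))"
begin

definition coef :: "('a \<Rightarrow> complex) \<Rightarrow> 'i \<Rightarrow> complex" where
  "coef \<phi> i = (LINT w|M. \<phi> w * cnj (e i w))"

text \<open>A bounded \<open>r\<close>-th moment replaces membership in a ball of \<open>L\<^sup>p\<close>.\<close>

definition admissible :: "real \<Rightarrow> real \<Rightarrow> ('a \<Rightarrow> complex) \<Rightarrow> bool" where
  "admissible r A \<phi> \<longleftrightarrow> \<phi> \<in> borel_measurable M \<and> integrable M \<phi> \<and> integrable M (\<lambda>w. norm (\<phi> w) powr r)
     \<and> (LINT w|M. norm (\<phi> w) powr r) \<le> A"

lemma e_bounded: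
  assumes i: "i \<in> I" shows "bounded_fun M (e i)"
proof -
  have "norm (e i w) \<le> sqrt (B * (real (deg i) + 1) ^ D)" if w: "w \<in> space M" for w
  proof (rule real_le_rsqrt)
    have "(norm (e i w))\<^sup>2 \<le> (\<Sum>i\<in>{j \<in> I. deg j \<le> deg i}. (norm (e i w))\<^sup>2)"
      using i finite_deg by (intro member_le_sum[where f = "\<lambda>i. (norm (e i w))\<^sup>2"]) auto
    then show "(norm (e i w))\<^sup>2 \<le> B * (real (deg i) + 1) ^ D" using kernel[OF w] by (rule order_trans)
  qed
  then show ?thesis using e_measurable[OF i] unfolding bounded_fun_def by blast
qed

lemma integrable_mult_bounded:
  assumes \<phi>: "integrable M \<phi>" and g: "bounded_fun M g"
  shows "integrable M (\<lambda>w. \<phi> w * g w)" "integrable M (\<lambda>w. \<phi> w * cnj (g w))"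
proof -
  obtain C where C: "\<forall>w\<in>space M. norm (g w) \<le> C" and [measurable]: "g \<in> borel_measurable M"
    using g by (auto simp: bounded_fun_def)
  have [measurable]: "\<phi> \<in> borel_measurable M" using \<phi> by simp
  have i: "integrable M (\<lambda>w. \<bar>C\<bar> * norm (\<phi> w))" using \<phi> by simp
  have b: "norm (\<phi> w) * norm (g w) \<le> \<bar>C\<bar> * norm (\<phi> w)" if "w \<in> space M" for w
  proof -
    have "norm (g w) \<le> \<bar>C\<bar>" using C that by force
    then show ?thesis using mult_left_mono[of "norm (g w)" "\<bar>C\<bar>" "norm (\<phi> w)"] by (simp add: mult.commute)
  qed
  have [measurable]: "(\<lambda>w. cnj (g w)) \<in> borel_measurable M"
    by (rule measurable_compose[of g M borel cnj borel]) (auto intro!: borel_measurable_continuous_onI continuous_intros)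
  show "integrable M (\<lambda>w. \<phi> w * g w)" "integrable M (\<lambda>w. \<phi> w * cnj (g w))"
    using b by (auto intro!: Bochner_Integration.integrable_bound[OF i] AE_I2 simp: norm_mult abs_mult)
qed

text \<open>Let \<open>s\<close> be the Euclidean norm of the coefficients and \<open>g\<close> the corresponding partial sum, so that the pairing of \<open>\<phi>\<close> with
  \<open>g\<close> is \<open>s\<^sup>2\<close>. The function \<open>u = \<bar>g\<bar> * K\<^bsup>1/2-1/r\<^esup> / s\<close> is at most \<open>K\<^bsup>1-1/r\<^esup>\<close> by the kernel bound, and the square integral of
  \<open>g / s\<close> is \<open>1\<close>. Hence \<open>crude_young\<close> bounds the pairing of \<open>\<bar>\<phi>\<bar>\<close> with \<open>u\<close> by \<open>A + 1\<close>.\<close>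

lemma coef_square_sum:
  assumes F: "F \<subseteq> {i \<in> I. deg i \<le> N}" and r: "1 \<le> r" "r \<le> 2" and \<phi>: "admissible r A \<phi>"
  defines "K \<equiv> B * (real N + 1) ^ D"
  shows "sqrt (\<Sum>i\<in>F. (norm (coef \<phi> i))\<^sup>2) \<le> (A + 1) * K powr (1 / r - 1 / 2)"
proof -
  have fin: "finite F" using F finite_deg finite_subset by blast
  have FI: "\<And>i. i \<in> F \<Longrightarrow> i \<in> I" using F by auto
  have K: "K > 0" using B_pos by (simp add: K_def)
  have "0 \<le> (LINT w|M. norm (\<phi> w) powr r)" by (intro integral_nonneg_AE AE_I2) simp
  moreover have "(LINT w|M. norm (\<phi> w) powr r) \<le> A" using \<phi> by (auto simp: admissible_def)
  ultimately have A: "A \<ge> 0" by (rule order_trans)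
  define s where "s = sqrt (\<Sum>i\<in>F. (norm (coef \<phi> i))\<^sup>2)"
  define g where "g w = (\<Sum>i\<in>F. coef \<phi> i * e i w)" for w
  have bg: "bounded_fun M g" unfolding g_def[abs_def] by (rule bounded_fun_lincomb[OF fin e_bounded]) (rule FI)
  have ss: "s\<^sup>2 = (\<Sum>i\<in>F. (norm (coef \<phi> i))\<^sup>2)" "s \<ge> 0" by (simp_all add: s_def sum_nonneg)
  have ig: "integrable M (\<lambda>w. (norm (g w))\<^sup>2)" by (rule bounded_fun_integrable_power[OF bg])
  have inner: "(LINT w|M. \<phi>' w * cnj (g w)) = (\<Sum>i\<in>F. cnj (coef \<phi> i) * coef \<phi>' i)" if "integrable M \<phi>'" for \<phi>'
  proof -
    have "(LINT w|M. \<phi>' w * cnj (g w)) = (LINT w|M. (\<Sum>i\<in>F. cnj (coef \<phi> i) * (\<phi>' w * cnj (e i w))))"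
      by (simp add: g_def sum_distrib_left mult_ac)
    also have "\<dots> = (\<Sum>i\<in>F. LINT w|M. cnj (coef \<phi> i) * (\<phi>' w * cnj (e i w)))"
      by (intro Bochner_Integration.integral_sum integrable_mult_right integrable_mult_bounded that e_bounded FI)
    finally show ?thesis by (simp add: coef_def)
  qed
  have coefg: "coef g i = coef \<phi> i" if "i \<in> F" for i
  proof -
    have "coef g i = (LINT w|M. (\<Sum>j\<in>F. coef \<phi> j * (e j w * cnj (e i w))))"
      by (simp add: coef_def g_def sum_distrib_right mult.assoc)
    also have "\<dots> = (\<Sum>j\<in>F. LINT w|M. coef \<phi> j * (e j w * cnj (e i w)))"
      using that by (intro Bochner_Integration.integral_sum integrable_mult_right integrable_mult_bounded bounded_fun_integrable e_bounded FI)
    also have "\<dots> = (\<Sum>j\<in>F. if j = i then coef \<phi> i else 0)"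
      using that FI by (intro sum.cong) (auto simp: orth)
    finally show ?thesis using that fin by simp
  qed
  have cc: "(\<Sum>i\<in>F. cnj (coef \<phi> i) * coef \<phi> i) = of_real (s\<^sup>2)"
    unfolding ss(1) of_real_sum by (intro sum.cong refl) (simp only: complex_norm_square mult.commute)
  have gg: "(LINT w|M. (norm (g w))\<^sup>2) = s\<^sup>2"
  proof -
    have "complex_of_real (LINT w|M. (norm (g w))\<^sup>2) = (LINT w|M. complex_of_real ((norm (g w))\<^sup>2))"
      by (rule integral_complex_of_real[symmetric])
    also have "\<dots> = (LINT w|M. g w * cnj (g w))" by (simp only: complex_norm_square)
    also have "\<dots> = (\<Sum>i\<in>F. cnj (coef \<phi> i) * coef g i)" by (rule inner[OF bounded_fun_integrable[OF bg]])
    also have "\<dots> = (\<Sum>i\<in>F. cnj (coef \<phi> i) * coef \<phi> i)" by (intro sum.cong refl) (simp add: coefg)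
    finally show ?thesis unfolding cc using of_real_eq_iff by blast
  qed
  show ?thesis
  proof (cases "s = 0")
    case True
    then show ?thesis using A by (simp add: s_def[symmetric])
  next
    case False
    then have s0: "s > 0" using ss(2) by simp
    define \<kappa> where "\<kappa> = K powr (1 / r - 1 / 2)"
    have \<kappa>: "\<kappa> > 0" using K by (simp add: \<kappa>_def)
    have \<kappa>2: "\<kappa>\<^sup>2 = K powr (2 / r - 1)"
      using K by (simp add: \<kappa>_def power2_eq_square powr_add[symmetric])
    have \<phi>i: "integrable M \<phi>" "integrable M (\<lambda>w. norm (\<phi> w) powr r)" "(LINT w|M. norm (\<phi> w) powr r) \<le> A"
      using \<phi> by (auto simp: admissible_def)
    have pw: "norm (\<phi> w * cnj (g w)) \<le> (\<kappa> * s) * (norm (\<phi> w) powr r + ((norm (g w))\<^sup>2 / (\<kappa>\<^sup>2 * s\<^sup>2)) * \<kappa>\<^sup>2)" if w: "w \<in> space M" for w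
    proof -
      have "norm (g w) \<le> s * sqrt (\<Sum>i\<in>F. (norm (e i w))\<^sup>2)"
        unfolding g_def s_def by (rule sum_norm_square_cauchy)
      also have "\<dots> \<le> s * sqrt K"
      proof (intro mult_left_mono real_sqrt_le_mono)
        have "(\<Sum>i\<in>F. (norm (e i w))\<^sup>2) \<le> (\<Sum>i\<in>{i \<in> I. deg i \<le> N}. (norm (e i w))\<^sup>2)"
          by (intro sum_mono2 finite_deg F) auto
        then show "(\<Sum>i\<in>F. (norm (e i w))\<^sup>2) \<le> K" using kernel[OF w, of N] by (simp add: K_def)
      qed (use ss in auto)
      finally have "norm (g w) / (\<kappa> * s) \<le> sqrt K / \<kappa>" using s0 \<kappa> by (simp add: field_simps)
      also have "sqrt K / \<kappa> = K powr (1 / 2) / K powr (1 / r - 1 / 2)" using K by (simp add: \<kappa>_def powr_half_sqrt)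
      also have "\<dots> = K powr (1 - 1 / r)" by (simp add: powr_diff[symmetric])
      finally have u: "norm (g w) / (\<kappa> * s) \<le> K powr (1 - 1 / r)" .
      have "norm (\<phi> w) * (norm (g w) / (\<kappa> * s)) \<le> norm (\<phi> w) powr r + (norm (g w) / (\<kappa> * s))\<^sup>2 * \<kappa>\<^sup>2"
        unfolding \<kappa>2 using \<kappa> s0 by (intro crude_young u r K) auto
      then have "(\<kappa> * s) * (norm (\<phi> w) * (norm (g w) / (\<kappa> * s))) \<le> (\<kappa> * s) * (norm (\<phi> w) powr r + (norm (g w) / (\<kappa> * s))\<^sup>2 * \<kappa>\<^sup>2)"
        using \<kappa> s0 by (intro mult_left_mono) auto
      then show ?thesis using \<kappa> s0 by (simp add: norm_mult power_divide power_mult_distrib)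
    qed
    have "s\<^sup>2 = norm (LINT w|M. \<phi> w * cnj (g w))"
      unfolding inner[OF \<phi>i(1)] cc by (simp only: norm_of_real) simp
    also have "\<dots> \<le> (LINT w|M. (\<kappa> * s) * (norm (\<phi> w) powr r + ((norm (g w))\<^sup>2 / (\<kappa>\<^sup>2 * s\<^sup>2)) * \<kappa>\<^sup>2))"
      using \<phi>i(2) ig
      by (intro order_trans[OF integral_norm_bound] integral_mono integrable_norm integrable_mult_bounded \<phi>i(1) bg pw) auto
    also have "\<dots> = (\<kappa> * s) * ((LINT w|M. norm (\<phi> w) powr r) + (s\<^sup>2 / (\<kappa>\<^sup>2 * s\<^sup>2)) * \<kappa>\<^sup>2)"
      using \<phi>i(2) ig by (simp add: gg)
    also have "\<dots> \<le> (\<kappa> * s) * (A + 1)"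
      using \<phi>i(3) \<kappa> s0 by (intro mult_left_mono add_mono) auto
    finally have "s * s \<le> s * (\<kappa> * (A + 1))" by (simp add: power2_eq_square mult_ac)
    then have "s \<le> \<kappa> * (A + 1)" using s0 by (simp only: mult_le_cancel_left_pos)
    then show ?thesis by (simp add: s_def \<kappa>_def mult.commute)
  qed
qed

definition block :: "nat \<Rightarrow> 'i set" where
  "block j = {i \<in> I. 2 ^ j \<le> deg i \<and> deg i < 2 ^ (j + 1)}"

lemma block_subset: "block j \<subseteq> {i \<in> I. deg i \<le> 2 ^ (j + 1) - 1}"
  by (auto simp: block_def)

lemma block_finite: "finite (block j)"
  using finite_subset[OF block_subset finite_deg] .

lemma block_I: "i \<in> block j \<Longrightarrow> i \<in> I"
  by (simp add: block_def)

lemma block_disjoint: "i \<in> block j \<Longrightarrow> i \<in> block j' \<Longrightarrow> j = j'"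
proof (induction j j' rule: linorder_wlog)
  case (le a b)
  show ?case
  proof (rule ccontr)
    assume "a \<noteq> b"
    then have "(2::nat) ^ (a + 1) \<le> 2 ^ b" using le by (intro power_increasing) auto
    then show False using le by (auto simp: block_def)
  qed
qed simp

text \<open>The kernel bound on the \<open>j\<close>-th dyadic block.\<close>

definition KB :: "nat \<Rightarrow> real" where
  "KB j = B * 2 ^ D * 2 powr (real j * real D)"

lemma KB_pos: "KB j > 0"
  using B_pos by (simp add: KB_def)

lemma KB_eq: "B * (real (2 ^ (j + 1) - 1) + 1) ^ D = KB j"
proof -
  have "real (2 ^ (j + 1) - 1) + 1 = 2 ^ (j + 1)" by (simp add: of_nat_diff)
  then have "B * (real (2 ^ (j + 1) - 1) + 1) ^ D = B * (2 ^ (j + 1)) ^ D" by (simp only:)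
  also have "(2 ^ (j + 1) :: real) ^ D = 2 ^ D * 2 ^ (j * D)" by (simp add: power_mult power_mult_distrib)
  also have "(2::real) ^ (j * D) = 2 powr (real j * real D)" by (subst powr_realpow[symmetric]) auto
  finally show ?thesis by (simp add: KB_def)
qed

lemma block_kernel:
  assumes w: "w \<in> space M" shows "(\<Sum>i\<in>block j. (norm (e i w))\<^sup>2) \<le> KB j"
proof -
  have "(\<Sum>i\<in>block j. (norm (e i w))\<^sup>2) \<le> (\<Sum>i\<in>{i \<in> I. deg i \<le> 2 ^ (j + 1) - 1}. (norm (e i w))\<^sup>2)"
    by (intro sum_mono2 finite_deg block_subset) auto
  also have "\<dots> \<le> KB j" unfolding KB_eq[symmetric] by (rule kernel[OF w])
  finally show ?thesis .
qed

text \<open>The number of basis functions is the integral of the diagonal of the kernel.\<close>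

lemma card_deg_le: "real (card {i \<in> I. deg i \<le> N}) \<le> measure M (space M) * B * (real N + 1) ^ D"
proof -
  let ?J = "{i \<in> I. deg i \<le> N}"
  have i: "integrable M (\<lambda>w. (norm (e i w))\<^sup>2)" if "i \<in> ?J" for i
    using that by (intro bounded_fun_integrable_power e_bounded) auto
  have "(LINT w|M. (norm (e i w))\<^sup>2) = 1" if "i \<in> ?J" for i
  proof -
    have "complex_of_real (LINT w|M. (norm (e i w))\<^sup>2) = (LINT w|M. complex_of_real ((norm (e i w))\<^sup>2))"
      by (rule integral_complex_of_real[symmetric])
    also have "\<dots> = of_real 1" unfolding complex_norm_square using that orth by simp
    finally show ?thesis using of_real_eq_iff by blast
  qed
  then have "real (card ?J) = (\<Sum>i\<in>?J. LINT w|M. (norm (e i w))\<^sup>2)" by simp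
  also have "\<dots> = (LINT w|M. (\<Sum>i\<in>?J. (norm (e i w))\<^sup>2))"
    by (rule Bochner_Integration.integral_sum[symmetric]) (rule i)
  also have "\<dots> \<le> (LINT w|M. B * (real N + 1) ^ D)"
    using i by (intro integral_mono kernel) auto
  finally show ?thesis by (simp add: mult_ac)
qed

end

section \<open>Convergence of the multiplier series\<close>

text \<open>On a dyadic block both factors of the multiplier are bounded by their values at \<open>2\<^sup>j\<close>. The maximum with \<open>1\<close> handles
  the block \<open>j = 0\<close>, which consists of degree \<open>1\<close> only, where the multiplier vanishes.\<close>

lemma lambda1_dyadic_bound:
  assumes n: "2 ^ j \<le> n" "n < 2 ^ (j + 1)" and \<gamma>: "\<gamma> > 0" and \<xi>: "\<xi> \<ge> 0"
  shows "\<bar>lambda1 \<gamma> \<xi> (real n)\<bar> \<le> ln 2 powr (- \<xi>) * 2 powr (- real j * \<gamma>) * real (max 1 j) powr (- \<xi>)"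
proof (cases "j = 0")
  case True
  then have "n = 1" using n by simp
  then show ?thesis by (simp add: lambda1_def)
next
  case False
  have n2: "(2::real) ^ j \<le> real n" using n(1) by (metis of_nat_le_iff of_nat_numeral of_nat_power)
  have "(2::real) ^ 1 \<le> 2 ^ j" using False by (intro power_increasing) auto
  then have n1: "real n > 1" using n2 unfolding power_one_right by linarith
  have a: "real n powr (- \<gamma>) \<le> 2 powr (- real j * \<gamma>)"
  proof -
    have "real n powr (- \<gamma>) \<le> (2 ^ j) powr (- \<gamma>)" using n2 \<gamma> by (intro powr_mono2') auto
    also have "(2 ^ j :: real) = 2 powr real j" by (simp add: powr_realpow)
    finally show ?thesis by (simp add: powr_powr)
  qed
  have "real j * ln 2 \<le> ln (real n)"
    using n2 n1 by (subst ln_realpow[symmetric]) auto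
  then have "ln (real n) powr (- \<xi>) \<le> (real j * ln 2) powr (- \<xi>)"
    using False \<xi> by (intro powr_mono2') auto
  also have "\<dots> = ln 2 powr (- \<xi>) * real (max 1 j) powr (- \<xi>)"
    using False by (simp add: powr_mult max_def mult.commute)
  finally have "real n powr (- \<gamma>) * ln (real n) powr (- \<xi>) \<le> 2 powr (- real j * \<gamma>) * (ln 2 powr (- \<xi>) * real (max 1 j) powr (- \<xi>))"
    using a by (intro mult_mono) auto
  then show ?thesis using n1 by (simp add: lambda1_def mult_ac)
qed

text \<open>The decay exponent exceeds \<open>D / r\<close>. This makes the multiplier series converge uniformly, block by block, with geometric
  ratio \<open>2\<^bsup>-\<delta>\<^esup>\<close>.\<close>

locale multiplier_system = graded_system M I e deg B D
  for M :: "'a measure" and I :: "'i set" and e deg B D +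
  fixes \<gamma> \<xi> r A :: real
  assumes r: "1 \<le> r" "r \<le> 2" and \<gamma>_gt: "\<gamma> > real D / r" and \<xi>_nonneg: "\<xi> \<ge> 0" and A_nonneg: "A \<ge> 0"
begin

definition \<delta> :: real where "\<delta> = \<gamma> - real D / r"
definition lam :: "'i \<Rightarrow> real" where "lam i = lambda1 \<gamma> \<xi> (real (deg i))"
definition lam_bound :: "nat \<Rightarrow> real" where
  "lam_bound j = ln 2 powr (- \<xi>) * 2 powr (- real j * \<gamma>) * real (max 1 j) powr (- \<xi>)"
definition block_sum :: "('a \<Rightarrow> complex) \<Rightarrow> nat \<Rightarrow> 'a \<Rightarrow> complex" where
  "block_sum \<phi> j w = (\<Sum>i\<in>block j. of_real (lam i) * coef \<phi> i * e i w)"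
definition series :: "('a \<Rightarrow> complex) \<Rightarrow> 'a \<Rightarrow> complex" where
  "series \<phi> w = (\<Sum>j. block_sum \<phi> j w)"
definition C_block :: real where "C_block = ln 2 powr (- \<xi>) * (A + 1) * (B * 2 ^ D) powr (1 / r)"
definition \<Gamma> :: real where "\<Gamma> = 1 / (1 - 2 powr (- \<delta>))"

lemma \<delta>_pos: "\<delta> > 0" using \<gamma>_gt by (simp add: \<delta>_def)

lemma \<gamma>_pos: "\<gamma> > 0"
proof -
  have "real D / r \<ge> 0" using r by simp
  then show ?thesis using \<gamma>_gt by linarith
qed

lemma ratio: "0 < (2::real) powr (- \<delta>)" "(2::real) powr (- \<delta>) < 1"
  using \<delta>_pos by (auto simp: powr_less_one)

lemma \<Gamma>_pos: "\<Gamma> > 0" using ratio by (simp add: \<Gamma>_def)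

lemma C_block_pos: "C_block > 0"
  using A_nonneg B_pos by (simp add: C_block_def)

lemma ratio_power: "(2::real) powr (- real j * \<delta>) = (2 powr (- \<delta>)) ^ j"
  by (simp add: powr_realpow[symmetric] powr_powr mult.commute)

lemma geometric: "summable (\<lambda>j. ((2::real) powr (- \<delta>)) ^ j)" "(\<Sum>j. ((2::real) powr (- \<delta>)) ^ j) = \<Gamma>"
  using ratio by (auto simp: \<Gamma>_def suminf_geometric)

lemma geometric_partial: "(\<Sum>j<n. ((2::real) powr (- \<delta>)) ^ j) \<le> \<Gamma>"
  unfolding geometric(2)[symmetric] using ratio by (intro sum_le_suminf geometric(1)) auto

lemma lam_block: "i \<in> block j \<Longrightarrow> \<bar>lam i\<bar> \<le> lam_bound j"
  unfolding lam_def lam_bound_def block_def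
  by (intro lambda1_dyadic_bound \<gamma>_pos \<xi>_nonneg) auto

lemma lam_bound_nonneg: "lam_bound j \<ge> 0" by (simp add: lam_bound_def)

lemma coef_block:
  assumes "admissible r A \<phi>"
  shows "sqrt (\<Sum>i\<in>block j. (norm (coef \<phi> i))\<^sup>2) \<le> (A + 1) * KB j powr (1 / r - 1 / 2)"
  using coef_square_sum[OF block_subset r assms, of j] unfolding KB_eq .

lemma lam_coef_block:
  assumes "admissible r A \<phi>"
  shows "sqrt (\<Sum>i\<in>block j. (norm (of_real (lam i) * coef \<phi> i))\<^sup>2) \<le> lam_bound j * ((A + 1) * KB j powr (1 / r - 1 / 2))"
proof -
  have "(\<Sum>i\<in>block j. (norm (of_real (lam i) * coef \<phi> i))\<^sup>2) \<le> (\<Sum>i\<in>block j. (lam_bound j)\<^sup>2 * (norm (coef \<phi> i))\<^sup>2)"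
  proof (rule sum_mono)
    fix i assume "i \<in> block j"
    then have "(norm (complex_of_real (lam i)))\<^sup>2 \<le> (lam_bound j)\<^sup>2"
      using power_mono[OF lam_block abs_ge_zero, of i j 2] by simp
    then show "(norm (of_real (lam i) * coef \<phi> i))\<^sup>2 \<le> (lam_bound j)\<^sup>2 * (norm (coef \<phi> i))\<^sup>2"
      unfolding norm_mult power_mult_distrib by (intro mult_right_mono) auto
  qed
  then have "sqrt (\<Sum>i\<in>block j. (norm (of_real (lam i) * coef \<phi> i))\<^sup>2) \<le> sqrt ((lam_bound j)\<^sup>2 * (\<Sum>i\<in>block j. (norm (coef \<phi> i))\<^sup>2))"
    by (intro real_sqrt_le_mono) (simp add: sum_distrib_left)
  also have "\<dots> = lam_bound j * sqrt (\<Sum>i\<in>block j. (norm (coef \<phi> i))\<^sup>2)"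
    using lam_bound_nonneg by (simp add: real_sqrt_mult)
  also have "\<dots> \<le> lam_bound j * ((A + 1) * KB j powr (1 / r - 1 / 2))"
    by (intro mult_left_mono coef_block assms lam_bound_nonneg)
  finally show ?thesis .
qed

lemma lam_bound_simple: "lam_bound j \<le> ln 2 powr (- \<xi>) * 2 powr (- real j * \<gamma>)"
proof -
  have "real (max 1 j) powr (- \<xi>) \<le> 1 powr (- \<xi>)" using \<xi>_nonneg by (intro powr_mono2') auto
  then have "real (max 1 j) powr (- \<xi>) \<le> 1" by simp
  then show ?thesis unfolding lam_bound_def by (intro mult_left_le) auto
qed

text \<open>By Cauchy-Schwarz: the coefficients contribute \<open>KB j\<close> to the power \<open>1/r - 1/2\<close> and the kernel the power \<open>1/2\<close>.\<close>

lemma block_sum_bound: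
  assumes \<phi>: "admissible r A \<phi>" and w: "w \<in> space M"
  shows "norm (block_sum \<phi> j w) \<le> C_block * (2 powr (- \<delta>)) ^ j"
proof -
  have "norm (block_sum \<phi> j w) \<le> sqrt (\<Sum>i\<in>block j. (norm (of_real (lam i) * coef \<phi> i))\<^sup>2) * sqrt (\<Sum>i\<in>block j. (norm (e i w))\<^sup>2)"
    unfolding block_sum_def by (rule sum_norm_square_cauchy)
  also have "\<dots> \<le> (ln 2 powr (- \<xi>) * 2 powr (- real j * \<gamma>) * ((A + 1) * KB j powr (1 / r - 1 / 2))) * sqrt (KB j)"
  proof (rule mult_mono)
    show "sqrt (\<Sum>i\<in>block j. (norm (of_real (lam i) * coef \<phi> i))\<^sup>2) \<le> ln 2 powr (- \<xi>) * 2 powr (- real j * \<gamma>) * ((A + 1) * KB j powr (1 / r - 1 / 2))"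
      using A_nonneg by (intro order_trans[OF lam_coef_block[OF \<phi>] mult_right_mono[OF lam_bound_simple]]) simp
    show "sqrt (\<Sum>i\<in>block j. (norm (e i w))\<^sup>2) \<le> sqrt (KB j)" by (intro real_sqrt_le_mono block_kernel w)
  qed (use A_nonneg in \<open>auto intro!: mult_nonneg_nonneg sum_nonneg\<close>)
  also have "\<dots> = ln 2 powr (- \<xi>) * (A + 1) * (2 powr (- real j * \<gamma>) * (KB j powr (1 / r - 1 / 2) * KB j powr (1 / 2)))"
    using KB_pos[of j] by (simp add: powr_half_sqrt mult_ac)
  also have "KB j powr (1 / r - 1 / 2) * KB j powr (1 / 2) = KB j powr (1 / r)"
    by (simp add: powr_add[symmetric])
  also have "KB j powr (1 / r) = (B * 2 ^ D) powr (1 / r) * 2 powr (real j * real D / r)"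
    using B_pos unfolding KB_def by (simp add: powr_mult powr_powr)
  also have "ln 2 powr (- \<xi>) * (A + 1) * (2 powr (- real j * \<gamma>) * ((B * 2 ^ D) powr (1 / r) * 2 powr (real j * real D / r)))
     = C_block * (2 powr (- real j * \<gamma>) * 2 powr (real j * real D / r))"
    by (simp add: C_block_def mult_ac)
  also have "2 powr (- real j * \<gamma>) * 2 powr (real j * real D / r) = (2::real) powr (- real j * \<delta>)"
    by (simp add: powr_add[symmetric] \<delta>_def algebra_simps)
  finally show ?thesis by (simp only: ratio_power)
qed

lemma block_sum_summable:
  assumes \<phi>: "admissible r A \<phi>" and w: "w \<in> space M"
  shows "summable (\<lambda>j. norm (block_sum \<phi> j w))" "summable (\<lambda>j. block_sum \<phi> j w)"
proof -
  have "summable (\<lambda>j. C_block * (2 powr (- \<delta>)) ^ j)" by (intro summable_mult geometric)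
  then show "summable (\<lambda>j. norm (block_sum \<phi> j w))"
    by (rule summable_comparison_test'[where N = 0]) (use block_sum_bound[OF \<phi> w] in simp)
  then show "summable (\<lambda>j. block_sum \<phi> j w)" by (rule summable_norm_cancel)
qed

lemma series_tail:
  assumes \<phi>: "admissible r A \<phi>" and w: "w \<in> space M"
  shows "norm (series \<phi> w - (\<Sum>j<n. block_sum \<phi> j w)) \<le> C_block * \<Gamma> * (2 powr (- \<delta>)) ^ n"
proof -
  have "series \<phi> w - (\<Sum>j<n. block_sum \<phi> j w) = (\<Sum>j. block_sum \<phi> (j + n) w)"
    unfolding series_def by (simp add: suminf_minus_initial_segment[OF block_sum_summable(2)[OF \<phi> w]])
  also have "norm \<dots> \<le> (\<Sum>j. C_block * (2 powr (- \<delta>)) ^ n * (2 powr (- \<delta>)) ^ j)"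
  proof (rule norm_suminf_le)
    show "summable (\<lambda>j. C_block * (2 powr (- \<delta>)) ^ n * (2 powr (- \<delta>)) ^ j)"
      by (intro summable_mult geometric)
    show "norm (block_sum \<phi> (j + n) w) \<le> C_block * (2 powr (- \<delta>)) ^ n * (2 powr (- \<delta>)) ^ j" for j
      using block_sum_bound[OF \<phi> w, of "j + n"] by (simp add: power_add mult_ac)
  qed
  also have "\<dots> = C_block * (2 powr (- \<delta>)) ^ n * \<Gamma>"
    by (subst suminf_mult[OF geometric(1)]) (simp only: geometric(2))
  finally show ?thesis by (simp add: mult_ac)
qed

lemma block_sum_bounded_fun: "bounded_fun M (block_sum \<phi> j)"
  unfolding block_sum_def[abs_def] by (rule bounded_fun_lincomb[OF block_finite e_bounded]) (rule block_I)

lemma series_bounded_fun: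
  assumes \<phi>: "admissible r A \<phi>" shows "bounded_fun M (series \<phi>)"
proof -
  have "series \<phi> \<in> borel_measurable M"
    unfolding series_def[abs_def] using block_sum_bounded_fun by (intro borel_measurable_suminf) (auto simp: bounded_fun_def)
  moreover have "norm (series \<phi> w) \<le> C_block * \<Gamma>" if "w \<in> space M" for w
    using series_tail[OF \<phi> that, of 0] by simp
  ultimately show ?thesis unfolding bounded_fun_def by blast
qed

lemma coef_lincomb:
  assumes "finite F" "F \<subseteq> I" "i \<in> I"
  shows "coef (\<lambda>w. \<Sum>j\<in>F. c j * e j w) i = (if i \<in> F then c i else 0)"
proof -
  have "coef (\<lambda>w. \<Sum>j\<in>F. c j * e j w) i = (LINT w|M. (\<Sum>j\<in>F. c j * (e j w * cnj (e i w))))"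
    by (simp add: coef_def sum_distrib_right mult.assoc)
  also have "\<dots> = (\<Sum>j\<in>F. LINT w|M. c j * (e j w * cnj (e i w)))"
    using assms by (intro Bochner_Integration.integral_sum integrable_mult_right integrable_mult_bounded bounded_fun_integrable e_bounded) auto
  also have "\<dots> = (\<Sum>j\<in>F. if j = i then c i else 0)"
    using assms by (intro sum.cong) (auto simp: orth)
  finally show ?thesis using assms by simp
qed

lemma deg_in_block: "i \<in> I \<Longrightarrow> deg i \<ge> 1 \<Longrightarrow> \<exists>j. i \<in> block j"
proof -
  assume i: "i \<in> I" "deg i \<ge> 1"
  define j where "j = (LEAST j. deg i < 2 ^ (j + 1))"
  have "deg i < 2 ^ deg i" by (rule less_exp)
  also have "\<dots> < 2 ^ (deg i + 1)" by simp
  finally have ex: "deg i < 2 ^ (deg i + 1)" .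
  have a: "deg i < 2 ^ (j + 1)" unfolding j_def by (rule LeastI[of "\<lambda>j. deg i < 2 ^ (j + 1)", OF ex])
  have "2 ^ j \<le> deg i"
  proof (cases j)
    case 0
    then show ?thesis using i by simp
  next
    case (Suc k)
    then have "k < j" by simp
    then have "\<not> deg i < 2 ^ (k + 1)" unfolding j_def by (rule not_less_Least)
    then show ?thesis using Suc by simp
  qed
  then show "\<exists>j. i \<in> block j" using a i by (auto simp: block_def)
qed

text \<open>Uniform convergence permits integration term by term.\<close>

lemma coef_series:
  assumes \<phi>: "admissible r A \<phi>" and i: "i \<in> I"
  shows "coef (series \<phi>) i = of_real (lam i) * coef \<phi> i"
proof -
  obtain C where C: "\<forall>w\<in>space M. norm (e i w) \<le> C" using e_bounded[OF i] by (auto simp: bounded_fun_def)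
  have C': "norm (e i w) \<le> \<bar>C\<bar>" if "w \<in> space M" for w using C that by force
  have int: "integrable M (\<lambda>w. block_sum \<phi> j w * cnj (e i w))" for j
    by (intro integrable_mult_bounded bounded_fun_integrable block_sum_bounded_fun e_bounded i)
  have nb: "norm (block_sum \<phi> j w * cnj (e i w)) \<le> C_block * \<bar>C\<bar> * (2 powr (- \<delta>)) ^ j" if w: "w \<in> space M" for j w
  proof -
    have "norm (block_sum \<phi> j w) * norm (e i w) \<le> (C_block * (2 powr (- \<delta>)) ^ j) * \<bar>C\<bar>"
      using C_block_pos ratio by (intro mult_mono block_sum_bound[OF \<phi> w] C'[OF w]) auto
    then show ?thesis by (simp add: norm_mult mult_ac)
  qed
  have sm: "summable (\<lambda>j. C_block * \<bar>C\<bar> * (2 powr (- \<delta>)) ^ j)" by (intro summable_mult geometric)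
  have "coef (series \<phi>) i = (LINT w|M. (\<Sum>j. block_sum \<phi> j w * cnj (e i w)))"
    unfolding coef_def series_def
    by (intro Bochner_Integration.integral_cong refl) (simp add: suminf_mult2[OF block_sum_summable(2)[OF \<phi>]])
  also have "\<dots> = (\<Sum>j. LINT w|M. block_sum \<phi> j w * cnj (e i w))"
  proof (rule integral_suminf[OF int])
    show "AE w in M. summable (\<lambda>j. norm (block_sum \<phi> j w * cnj (e i w)))"
    proof (rule AE_I2)
      fix w assume w: "w \<in> space M"
      show "summable (\<lambda>j. norm (block_sum \<phi> j w * cnj (e i w)))"
        by (rule summable_comparison_test'[OF sm, where N = 0]) (use nb[OF w] in simp)
    qed
    have "(LINT w|M. norm (block_sum \<phi> j w * cnj (e i w))) \<le> measure M (space M) * (C_block * \<bar>C\<bar> * (2 powr (- \<delta>)) ^ j)" for j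
    proof -
      have "(LINT w|M. norm (block_sum \<phi> j w * cnj (e i w))) \<le> (LINT w|M. C_block * \<bar>C\<bar> * (2 powr (- \<delta>)) ^ j)"
        by (intro integral_mono integrable_norm int nb) auto
      then show ?thesis by simp
    qed
    then show "summable (\<lambda>j. LINT w|M. norm (block_sum \<phi> j w * cnj (e i w)))"
      by (intro summable_comparison_test'[OF summable_mult[OF sm, of "measure M (space M)"], where N = 0])
         (simp add: abs_of_nonneg integral_nonneg_AE)
  qed
  also have "(\<lambda>j. LINT w|M. block_sum \<phi> j w * cnj (e i w)) = (\<lambda>j. if i \<in> block j then of_real (lam i) * coef \<phi> i else 0)"
    using coef_lincomb[OF block_finite _ i] block_I unfolding coef_def[symmetric] block_sum_def[abs_def] by (auto simp: fun_eq_iff subset_iff)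
  also have "(\<Sum>j. if i \<in> block j then of_real (lam i) * coef \<phi> i else 0) = of_real (lam i) * coef \<phi> i"
  proof (cases "deg i \<ge> 1")
    case True
    then obtain j where j: "i \<in> block j" using deg_in_block i by blast
    then have "(\<lambda>j'. if i \<in> block j' then of_real (lam i) * coef \<phi> i else 0) = (\<lambda>j'. if j' = j then of_real (lam i) * coef \<phi> i else 0)"
      using block_disjoint by (auto simp: fun_eq_iff)
    moreover have "(\<lambda>j'. if j' = j then of_real (lam i) * coef \<phi> i else 0) sums (of_real (lam i) * coef \<phi> i)" by (rule sums_single)
    ultimately show ?thesis by (simp add: sums_iff)
  next
    case False
    then have "lam i = 0" by (simp add: lam_def lambda1_def)
    then show ?thesis by (simp cong: if_cong)
  qed
  finally show ?thesis .
qed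

section \<open>Approximation of a window of blocks\<close>

definition level :: "'i \<Rightarrow> nat" where "level i = (THE j. i \<in> block j)"

lemma level_block: "i \<in> block j \<Longrightarrow> level i = j"
  unfolding level_def using block_disjoint by (intro the_equality) auto

definition window :: "nat \<Rightarrow> nat \<Rightarrow> 'i set" where "window J J' = (\<Union>j\<in>{J..<J'}. block j)"

lemma window_finite: "finite (window J J')"
  unfolding window_def using block_finite by auto

lemma window_I: "window J J' \<subseteq> I"
  unfolding window_def using block_I by auto

lemma window_deg: "i \<in> window J J' \<Longrightarrow> 1 \<le> deg i \<and> deg i \<le> 2 ^ J'"
proof -
  assume "i \<in> window J J'"
  then obtain j where j: "J \<le> j" "j < J'" "2 ^ j \<le> deg i" "deg i < 2 ^ (j + 1)" by (auto simp: window_def block_def)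
  have "(2::nat) ^ (j + 1) \<le> 2 ^ J'" using j by (intro power_increasing) auto
  moreover have "(1::nat) \<le> 2 ^ j" by simp
  ultimately show ?thesis using j by linarith
qed

lemma sum_window:
  "(\<Sum>i\<in>window J J'. F i) = (\<Sum>j=J..<J'. \<Sum>i\<in>block j. F i)" for F :: "'i \<Rightarrow> 'b::comm_monoid_add"
  unfolding window_def using block_finite block_disjoint by (subst sum.UNION_disjoint) auto

lemma sum_shift_geometric:
  "(\<Sum>j=J..<J'. c * (2 powr (- \<delta>)) ^ (j - J)) \<le> c * \<Gamma>" if "c \<ge> 0" for c :: real
proof -
  have "(\<Sum>j=J..<J'. c * (2 powr (- \<delta>)) ^ (j - J)) = (\<Sum>l<J' - J. c * (2 powr (- \<delta>)) ^ l)"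
    by (rule sum.reindex_bij_witness[where i = "\<lambda>l. l + J" and j = "\<lambda>j. j - J"]) auto
  also have "\<dots> = c * (\<Sum>l<J' - J. (2 powr (- \<delta>)) ^ l)" by (simp add: sum_distrib_left)
  also have "\<dots> \<le> c * \<Gamma>" using that by (intro mult_left_mono geometric_partial)
  finally show ?thesis .
qed

text \<open>Weights that split the geometric decay beyond level \<open>J\<close> evenly: both the squared weighted basis functions and the squared
  coefficients divided by the weights decay over the blocks with ratio \<open>2\<^bsup>-\<delta>\<^esup>\<close>.\<close>

definition weight :: "nat \<Rightarrow> nat \<Rightarrow> real" where
  "weight J j = 2 powr (- (real j - real J) * (real D + \<delta>) / 2)"

lemma weight_pos: "weight J j > 0" by (simp add: weight_def)

text \<open>The order of the error when the blocks below level \<open>J\<close> are reproduced exactly.\<close>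

definition rate :: "nat \<Rightarrow> real" where
  "rate J = real (max 1 J) powr (- \<xi>) * 2 powr (- real J * (\<gamma> - real D * (1 / r - 1 / 2)))"

lemma rate_pos: "rate J > 0"
  by (simp add: rate_def)

definition C_coef :: real where
  "C_coef = ln 2 powr (- \<xi>) * (A + 1) * (B * 2 ^ D) powr (1 / r - 1 / 2)"

lemma C_coef_pos: "C_coef > 0"
  using A_nonneg B_pos by (simp add: C_coef_def)

lemma weighted_functions_bound:
  assumes w: "w \<in> space M"
  shows "(\<Sum>i\<in>window J J'. (norm (of_real (weight J (level i)) * e i w))\<^sup>2) \<le> B * 2 ^ D * \<Gamma> * 2 powr (real J * real D)"
proof -
  have "(\<Sum>i\<in>window J J'. (norm (of_real (weight J (level i)) * e i w))\<^sup>2)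
     = (\<Sum>j=J..<J'. \<Sum>i\<in>block j. (weight J j)\<^sup>2 * (norm (e i w))\<^sup>2)"
    unfolding sum_window by (intro sum.cong refl) (auto simp: level_block norm_mult power_mult_distrib)
  also have "\<dots> \<le> (\<Sum>j=J..<J'. (B * 2 ^ D * 2 powr (real J * real D)) * (2 powr (- \<delta>)) ^ (j - J))"
  proof (rule sum_mono)
    fix j assume "j \<in> {J..<J'}"
    then have j: "J \<le> j" by simp
    have "(\<Sum>i\<in>block j. (weight J j)\<^sup>2 * (norm (e i w))\<^sup>2) = (weight J j)\<^sup>2 * (\<Sum>i\<in>block j. (norm (e i w))\<^sup>2)"
      by (simp add: sum_distrib_left)
    also have "\<dots> \<le> (weight J j)\<^sup>2 * KB j" by (intro mult_left_mono block_kernel w) simp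
    also have "\<dots> = B * 2 ^ D * (2 powr (- (real j - real J) * (real D + \<delta>)) * 2 powr (real j * real D))"
      by (simp add: weight_def KB_def power2_eq_square powr_add[symmetric] mult_ac)
    also have "2 powr (- (real j - real J) * (real D + \<delta>)) * 2 powr (real j * real D) = 2 powr (real J * real D) * (2::real) powr (- real (j - J) * \<delta>)"
      using j by (simp add: powr_add[symmetric] of_nat_diff algebra_simps)
    finally show "(\<Sum>i\<in>block j. (weight J j)\<^sup>2 * (norm (e i w))\<^sup>2) \<le> (B * 2 ^ D * 2 powr (real J * real D)) * (2 powr (- \<delta>)) ^ (j - J)"
      by (simp only: ratio_power mult.assoc)
  qed
  also have "\<dots> \<le> (B * 2 ^ D * 2 powr (real J * real D)) * \<Gamma>"
    using B_pos by (intro sum_shift_geometric) simp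
  finally show ?thesis by (simp add: mult_ac)
qed

lemma weighted_coefficients_bound:
  assumes \<phi>: "admissible r A \<phi>"
  shows "(\<Sum>i\<in>window J J'. (norm (of_real (lam i) * coef \<phi> i / of_real (weight J (level i))))\<^sup>2) \<le> (C_coef * sqrt \<Gamma> * rate J)\<^sup>2"
proof -
  define c where "c = (C_coef * rate J)\<^sup>2"
  have "(\<Sum>i\<in>window J J'. (norm (of_real (lam i) * coef \<phi> i / of_real (weight J (level i))))\<^sup>2)
     = (\<Sum>j=J..<J'. \<Sum>i\<in>block j. (norm (of_real (lam i) * coef \<phi> i))\<^sup>2 / (weight J j)\<^sup>2)"
    unfolding sum_window by (intro sum.cong refl) (auto simp: level_block norm_divide power_divide)
  also have "\<dots> \<le> (\<Sum>j=J..<J'. c * (2 powr (- \<delta>)) ^ (j - J))"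
  proof (rule sum_mono)
    fix j assume "j \<in> {J..<J'}"
    then have j: "J \<le> j" by simp
    define s where "s = (\<Sum>i\<in>block j. (norm (of_real (lam i) * coef \<phi> i))\<^sup>2)"
    have KBj: "KB j powr (1 / r - 1 / 2) = (B * 2 ^ D) powr (1 / r - 1 / 2) * 2 powr (real j * real D * (1 / r - 1 / 2))"
      using B_pos unfolding KB_def by (simp add: powr_mult powr_powr)
    have mx: "real (max 1 j) powr (- \<xi>) \<le> real (max 1 J) powr (- \<xi>)"
      using j \<xi>_nonneg by (intro powr_mono2') auto
    have "sqrt s \<le> lam_bound j * ((A + 1) * KB j powr (1 / r - 1 / 2))"
      unfolding s_def by (rule lam_coef_block[OF \<phi>])
    also have "\<dots> = C_coef * (real (max 1 j) powr (- \<xi>) * (2 powr (- real j * \<gamma>) * 2 powr (real j * real D * (1 / r - 1 / 2))))"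
      unfolding lam_bound_def KBj C_coef_def by (simp add: mult_ac)
    also have "\<dots> \<le> C_coef * (real (max 1 J) powr (- \<xi>) * (2 powr (- real j * \<gamma>) * 2 powr (real j * real D * (1 / r - 1 / 2))))"
      using C_coef_pos by (intro mult_left_mono mult_right_mono mx) auto
    also have "2 powr (- real j * \<gamma>) * 2 powr (real j * real D * (1 / r - 1 / 2))
      = 2 powr (- real J * (\<gamma> - real D * (1 / r - 1 / 2))) * (2::real) powr (- (real j - real J) * (\<delta> + real D / 2))"
    proof -
      have "- real j * \<gamma> + real j * real D * (1 / r - 1 / 2) = - real J * (\<gamma> - real D * (1 / r - 1 / 2)) + - (real j - real J) * (\<delta> + real D / 2)"
      proof -
        define a where "a = real D / r"
        define b where "b = real D / 2"
        have ab: "real D * (1 / r - 1 / 2) = a - b" by (simp add: a_def b_def right_diff_distrib)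
        show ?thesis unfolding mult.assoc ab \<delta>_def a_def[symmetric] b_def[symmetric] by (simp add: algebra_simps)
      qed
      then show ?thesis by (simp only: powr_add[symmetric])
    qed
    finally have "sqrt s \<le> C_coef * rate J * 2 powr (- (real j - real J) * (\<delta> + real D / 2))"
      by (simp add: rate_def mult_ac)
    then have "(sqrt s)\<^sup>2 \<le> (C_coef * rate J * 2 powr (- (real j - real J) * (\<delta> + real D / 2)))\<^sup>2"
      by (intro power_mono) (auto simp: s_def sum_nonneg)
    then have "s \<le> c * (2 powr (- (real j - real J) * (\<delta> + real D / 2)))\<^sup>2"
      by (simp add: c_def power_mult_distrib s_def sum_nonneg)
    then have "s / (weight J j)\<^sup>2 \<le> c * (2 powr (- (real j - real J) * (\<delta> + real D / 2)))\<^sup>2 / (weight J j)\<^sup>2"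
      by (intro divide_right_mono) auto
    also have "\<dots> = c * ((2 powr (- (real j - real J) * (\<delta> + real D / 2)))\<^sup>2 / (weight J j)\<^sup>2)" by simp
    also have "(2 powr (- (real j - real J) * (\<delta> + real D / 2)))\<^sup>2 / (weight J j)\<^sup>2 = (2::real) powr (- real (j - J) * \<delta>)"
    proof -
      define x where "x = real j - real J"
      have sq: "(2 powr t)\<^sup>2 = (2::real) powr (2 * t)" for t by (simp add: power2_eq_square powr_add[symmetric])
      have "- x * (\<delta> + real D / 2) = - (x * \<delta>) - x * real D / 2" by (simp add: distrib_left)
      moreover have "- x * (real D + \<delta>) / 2 = - (x * real D) / 2 - x * \<delta> / 2" by (simp add: distrib_left diff_divide_distrib add_divide_distrib)
      ultimately have "2 * (- x * (\<delta> + real D / 2)) - 2 * (- x * (real D + \<delta>) / 2) = - x * \<delta>" by linarith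
      moreover have "x = real (j - J)" using j by (simp add: x_def of_nat_diff)
      ultimately show ?thesis unfolding weight_def x_def[symmetric] sq by (simp add: powr_diff[symmetric])
    qed
    finally have "s / (weight J j)\<^sup>2 \<le> c * (2 powr (- \<delta>)) ^ (j - J)" by (simp only: ratio_power)
    then show "(\<Sum>i\<in>block j. (norm (of_real (lam i) * coef \<phi> i))\<^sup>2 / (weight J j)\<^sup>2) \<le> c * (2 powr (- \<delta>)) ^ (j - J)"
      by (simp add: s_def sum_divide_distrib)
  qed
  also have "\<dots> \<le> c * \<Gamma>" by (intro sum_shift_geometric) (simp add: c_def)
  also have "\<dots> = (C_coef * sqrt \<Gamma> * rate J)\<^sup>2"
    using \<Gamma>_pos by (simp add: c_def power_mult_distrib)
  finally show ?thesis .
qed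

text \<open>All blocks from \<open>J\<close> to \<open>J'\<close> are approximated by one random subspace. Its dimension \<open>k\<close> need only be comparable with the size
  of block \<open>J\<close>, because the weights make the variance of the weighted system of that order.\<close>

lemma window_approximation:
  assumes k: "k \<ge> 1" and h: "h \<ge> 1" and Jk: "2 powr (real J * real D) \<le> 3 * real k"
  shows "\<exists>g :: nat \<Rightarrow> 'i \<Rightarrow> complex. \<forall>\<phi>. admissible r A \<phi> \<longrightarrow> (\<exists>a :: nat \<Rightarrow> complex.
     even_norm M h (\<lambda>w. (\<Sum>i\<in>window J J'. of_real (lam i) * coef \<phi> i * e i w) - (\<Sum>s<k. a s * (\<Sum>i\<in>window J J'. g s i * e i w)))
     \<le> (1904 * (measure M (space M) + 1) * sqrt (3 * (B * 2 ^ D * \<Gamma>)) * (C_coef * sqrt \<Gamma>) + 1) * sqrt (real h) * rate J)"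
proof -
  define \<kappa> where "\<kappa> = B * 2 ^ D * \<Gamma> * 2 powr (real J * real D)"
  have \<kappa>: "\<kappa> > 0" using B_pos \<Gamma>_pos by (simp add: \<kappa>_def)
  define f where "f i w = of_real (weight J (level i)) * e i w" for i w
  have bf: "bounded_fun M (f i)" if "i \<in> window J J'" for i
    unfolding f_def[abs_def] using that window_I by (intro bounded_fun_scale e_bounded) auto
  have sqf: "(\<Sum>i\<in>window J J'. (norm (f i w))\<^sup>2) \<le> \<kappa>" if "w \<in> space M" for w
    unfolding f_def \<kappa>_def by (rule weighted_functions_bound[OF that])
  obtain g :: "nat \<Rightarrow> 'i \<Rightarrow> real" where g: "\<And>x \<rho> \<eta>. (\<Sum>i\<in>window J J'. (norm (x i))\<^sup>2) \<le> \<rho>\<^sup>2 \<Longrightarrow> \<rho> \<ge> 0 \<Longrightarrow> \<eta> > 0 \<Longrightarrow>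
    (\<exists>a :: nat \<Rightarrow> complex. even_norm M h (\<lambda>w. (\<Sum>i\<in>window J J'. x i * f i w) - (\<Sum>s<k. a s * (\<Sum>i\<in>window J J'. of_real (g s i) * f i w)))
      \<le> 1904 * (measure M (space M) + 1) * sqrt (real h * \<kappa> / real k) * \<rho> + \<eta>)"
    using random_approximation[where f = f and I = "window J J'", OF window_finite k h \<kappa> bf sqf] by blast
  have sq: "sqrt (real h * \<kappa> / real k) \<le> sqrt (real h) * sqrt (3 * (B * 2 ^ D * \<Gamma>))"
  proof -
    have "\<kappa> / real k \<le> 3 * (B * 2 ^ D * \<Gamma>)"
    proof -
      have "\<kappa> \<le> (B * 2 ^ D * \<Gamma>) * (3 * real k)"
        unfolding \<kappa>_def using B_pos \<Gamma>_pos by (intro mult_left_mono Jk) auto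
      then show ?thesis using k by (simp add: divide_le_eq mult_ac)
    qed
    then have "real h * (\<kappa> / real k) \<le> real h * (3 * (B * 2 ^ D * \<Gamma>))" by (intro mult_left_mono) auto
    then show ?thesis unfolding real_sqrt_mult[symmetric] by (intro real_sqrt_le_mono) simp
  qed
  show ?thesis
  proof (intro exI[of _ "\<lambda>s i. of_real (g s i * weight J (level i))"] allI impI)
    fix \<phi> assume \<phi>: "admissible r A \<phi>"
    define x where "x i = of_real (lam i) * coef \<phi> i / of_real (weight J (level i))" for i
    define \<rho> where "\<rho> = C_coef * sqrt \<Gamma> * rate J"
    have \<rho>: "\<rho> > 0" using C_coef_pos \<Gamma>_pos rate_pos by (simp add: \<rho>_def)
    obtain a :: "nat \<Rightarrow> complex" where a: "even_norm M h (\<lambda>w. (\<Sum>i\<in>window J J'. x i * f i w) - (\<Sum>s<k. a s * (\<Sum>i\<in>window J J'. of_real (g s i) * f i w)))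
      \<le> 1904 * (measure M (space M) + 1) * sqrt (real h * \<kappa> / real k) * \<rho> + rate J"
      using g[of x \<rho> "rate J"] weighted_coefficients_bound[OF \<phi>, of J J'] rate_pos \<rho> unfolding x_def \<rho>_def by auto
    have "(\<Sum>i\<in>window J J'. x i * f i w) = (\<Sum>i\<in>window J J'. of_real (lam i) * coef \<phi> i * e i w)" for w
      using weight_pos[of J] by (intro sum.cong refl) (simp add: x_def f_def less_imp_neq[symmetric])
    moreover have "(\<Sum>i\<in>window J J'. of_real (g s i) * f i w) = (\<Sum>i\<in>window J J'. of_real (g s i * weight J (level i)) * e i w)" for s w
      by (simp add: f_def mult.assoc)
    ultimately have "even_norm M h (\<lambda>w. (\<Sum>i\<in>window J J'. of_real (lam i) * coef \<phi> i * e i w) - (\<Sum>s<k. a s * (\<Sum>i\<in>window J J'. of_real (g s i * weight J (level i)) * e i w)))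
      \<le> 1904 * (measure M (space M) + 1) * sqrt (real h * \<kappa> / real k) * \<rho> + rate J"
      using a by simp
    also have "\<dots> \<le> 1904 * (measure M (space M) + 1) * (sqrt (real h) * sqrt (3 * (B * 2 ^ D * \<Gamma>))) * \<rho> + sqrt (real h) * rate J"
    proof (rule add_mono)
      show "1904 * (measure M (space M) + 1) * sqrt (real h * \<kappa> / real k) * \<rho> \<le> 1904 * (measure M (space M) + 1) * (sqrt (real h) * sqrt (3 * (B * 2 ^ D * \<Gamma>))) * \<rho>"
        using \<rho> by (intro mult_right_mono mult_left_mono sq) (auto simp: add_nonneg_nonneg)
      have "1 \<le> sqrt (real h)" using h by simp
      then show "rate J \<le> sqrt (real h) * rate J" using rate_pos[of J] by simp
    qed
    also have "\<dots> = (1904 * (measure M (space M) + 1) * sqrt (3 * (B * 2 ^ D * \<Gamma>)) * (C_coef * sqrt \<Gamma>) + 1) * sqrt (real h) * rate J"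
      by (simp add: \<rho>_def algebra_simps)
    finally show "\<exists>a. even_norm M h (\<lambda>w. (\<Sum>i\<in>window J J'. of_real (lam i) * coef \<phi> i * e i w) - (\<Sum>s<k. a s * (\<Sum>i\<in>window J J'. of_real (g s i * weight J (level i)) * e i w)))
     \<le> (1904 * (measure M (space M) + 1) * sqrt (3 * (B * 2 ^ D * \<Gamma>)) * (C_coef * sqrt \<Gamma>) + 1) * sqrt (real h) * rate J"
      by blast
  qed
qed

section \<open>The rate of approximation\<close>

text \<open>The largest level for which the basis functions of lower degree fill at most half of the allowed dimension.\<close>

lemma dyadic_cutoff:
  fixes m :: nat
  assumes m: "m \<ge> 2"
  defines "C0 \<equiv> max (measure M (space M) * B) 1"
  shows "\<exists>J. real m / 2 < C0 * 2 ^ ((J + 1) * D) \<and> (J = 0 \<or> C0 * 2 ^ (J * D) \<le> real m / 2)"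
proof -
  have C0: "C0 \<ge> 1" by (simp add: C0_def)
  let ?P = "\<lambda>J. real m / 2 < C0 * 2 ^ ((J + 1) * D)"
  have "?P m"
  proof -
    have "real m < 2 ^ m" by (rule of_nat_less_two_power)
    also have "(2::real) ^ m \<le> 2 ^ ((m + 1) * D)" using D_pos by (intro power_increasing) (auto simp: Suc_leI trans_le_add2)
    also have "\<dots> \<le> C0 * 2 ^ ((m + 1) * D)" using C0 by simp
    finally show ?thesis using m by linarith
  qed
  then have L: "?P (LEAST J. ?P J)" by (rule LeastI)
  define J where "J = (LEAST J. ?P J)"
  have "J = 0 \<or> C0 * 2 ^ (J * D) \<le> real m / 2"
  proof (cases J)
    case (Suc k)
    then have "\<not> ?P k" using not_less_Least[of k ?P] by (simp add: J_def)
    then show ?thesis using Suc by (simp add: not_less)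
  qed simp
  then show ?thesis using L unfolding J_def by blast
qed

text \<open>At the cutoff level \<open>2\<^bsup>J * D\<^esup>\<close> is at least a multiple of \<open>m\<close>, so \<open>J\<close> is at least a multiple of \<open>ln m\<close>.\<close>

lemma rate_le:
  assumes m: "m \<ge> (2::nat)" and J: "real m / 2 < C0 * 2 ^ ((J + 1) * D)" and C0: "C0 \<ge> 1"
  defines "\<alpha> \<equiv> \<gamma> / real D - (1 / r - 1 / 2)"
  defines "c1 \<equiv> ln (2 * C0 * 2 ^ D) + real D * ln 2"
  shows "rate J \<le> c1 powr \<xi> * (2 * C0 * 2 ^ D) powr \<alpha> * (real m powr (- \<alpha>) * ln (real m) powr (- \<xi>))" 
proof -
  have D: "real D > 0" using D_pos by simp
  have \<alpha>: "\<alpha> > 0"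
  proof -
    have "\<gamma> / real D > 1 / r" using \<gamma>_gt D r by (simp add: field_simps)
    then show ?thesis by (simp add: \<alpha>_def)
  qed
  have pw: "(2::real) ^ (J * D) = 2 powr (real J * real D)" by (subst powr_realpow[symmetric]) auto
  have mJ: "real m < (2 * C0 * 2 ^ D) * 2 powr (real J * real D)"
  proof -
    have "(2::real) ^ ((J + 1) * D) = 2 ^ D * 2 ^ (J * D)" by (simp add: power_add[symmetric] add.commute)
    then show ?thesis using J unfolding pw[symmetric] by simp
  qed
  define c0 where "c0 = 2 * C0 * 2 ^ D"
  have c0: "c0 > 1"
  proof -
    have "(1::real) \<le> 2 ^ D" by simp
    then have "1 * 1 \<le> C0 * 2 ^ D" using C0 by (intro mult_mono) auto
    then show ?thesis by (simp add: c0_def)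
  qed
  have m0: "real m > 1" using m by simp
  have "2 powr (- real J * (\<gamma> - real D * (1 / r - 1 / 2))) = (2 powr (real J * real D)) powr (- \<alpha>)"
  proof -
    define x where "x = 1 / r - 1 / 2"
    define y where "y = \<gamma> / real D"
    have \<gamma>: "\<gamma> = real D * y" using D by (simp add: y_def)
    show ?thesis unfolding \<alpha>_def x_def[symmetric] y_def[symmetric] powr_powr by (subst \<gamma>) (simp add: algebra_simps)
  qed
  also have "\<dots> \<le> (real m / c0) powr (- \<alpha>)"
  proof -
    have "real m / c0 \<le> 2 powr (real J * real D)"
      using mJ c0 unfolding c0_def[symmetric] by (simp add: divide_le_eq mult.commute)
    then show ?thesis using c0 \<alpha> m0 by (intro powr_mono2') auto
  qed
  also have "\<dots> = c0 powr \<alpha> * real m powr (- \<alpha>)"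
    using c0 m0 by (simp add: powr_divide powr_minus_divide)
  finally have a: "2 powr (- real J * (\<gamma> - real D * (1 / r - 1 / 2))) \<le> c0 powr \<alpha> * real m powr (- \<alpha>)" .
  have c1: "c1 > 0" using c0 D unfolding c1_def c0_def[symmetric] by (simp add: add_pos_pos)
  have "ln (real m) \<le> ln (c0 * 2 powr (real J * real D))"
    using mJ m0 c0 by (subst ln_le_cancel_iff) (auto simp: c0_def[symmetric])
  also have "\<dots> = ln c0 + real J * (real D * ln 2)"
    using c0 by (subst ln_mult) (auto simp: ln_powr)
  also have "\<dots> \<le> ln c0 * real (max 1 J) + real (max 1 J) * (real D * ln 2)"
  proof (intro add_mono mult_right_mono)
    have "ln c0 * 1 \<le> ln c0 * real (max 1 J)" using c0 by (intro mult_left_mono) auto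
    then show "ln c0 \<le> ln c0 * real (max 1 J)" by simp
  qed (use D in auto)
  finally have "ln (real m) \<le> c1 * real (max 1 J)" by (simp add: c1_def c0_def algebra_simps)
  then have "ln (real m) / c1 \<le> real (max 1 J)" using c1 by (simp add: divide_le_eq mult.commute)
  then have "real (max 1 J) powr (- \<xi>) \<le> (ln (real m) / c1) powr (- \<xi>)"
    using c1 m0 \<xi>_nonneg by (intro powr_mono2') auto
  also have "\<dots> = c1 powr \<xi> * ln (real m) powr (- \<xi>)"
    using c1 m0 by (simp add: powr_divide powr_minus_divide)
  finally have b: "real (max 1 J) powr (- \<xi>) \<le> c1 powr \<xi> * ln (real m) powr (- \<xi>)" .
  have "rate J \<le> (c1 powr \<xi> * ln (real m) powr (- \<xi>)) * (c0 powr \<alpha> * real m powr (- \<alpha>))"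
    unfolding rate_def by (intro mult_mono a b) auto
  then show ?thesis by (simp add: c0_def mult_ac)
qed

text \<open>A window of \<open>R0 * (J + 1)\<close> blocks is long enough for the tail of the series to be negligible. The bound
  \<open>max 1 J \<le> 2\<^sup>J\<close> disposes of the logarithmic factor.\<close>

lemma tail_le_rate:
  assumes "real R0 * \<delta> \<ge> \<gamma> + \<xi>"
  shows "(2 powr (- \<delta>)) ^ (R0 * (J + 1)) \<le> rate J"
proof -
  have "(2 powr (- \<delta>)) ^ (R0 * (J + 1)) = (2::real) powr (- (real R0 * \<delta>) * (real J + 1))"
    unfolding ratio_power[symmetric] by (simp add: algebra_simps)
  also have "\<dots> \<le> 2 powr (- (\<gamma> + \<xi>) * real J)"
  proof (rule powr_mono)
    have "(\<gamma> + \<xi>) * real J \<le> (real R0 * \<delta>) * (real J + 1)"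
      using assms \<gamma>_pos \<xi>_nonneg by (intro mult_mono) auto
    then show "- (real R0 * \<delta>) * (real J + 1) \<le> - (\<gamma> + \<xi>) * real J"
      unfolding mult_minus_left by (rule le_imp_neg_le)
  qed simp
  also have "\<dots> = 2 powr (- \<xi> * real J) * 2 powr (- \<gamma> * real J)" by (simp add: powr_add[symmetric] algebra_simps)
  also have "\<dots> \<le> real (max 1 J) powr (- \<xi>) * 2 powr (- real J * (\<gamma> - real D * (1 / r - 1 / 2)))"
  proof (rule mult_mono)
    have "real (max 1 J) \<le> 2 powr real J"
    proof -
      have "real J \<le> 2 ^ J" using of_nat_less_two_power[of J] by (simp add: less_imp_le)
      moreover have "(1::real) \<le> 2 ^ J" by simp
      ultimately have "real (max 1 J) \<le> 2 ^ J" by (auto simp: max_def)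
      then show ?thesis by (simp add: powr_realpow)
    qed
    then have "(2 powr real J) powr (- \<xi>) \<le> real (max 1 J) powr (- \<xi>)" using \<xi>_nonneg by (intro powr_mono2') auto
    then show "2 powr (- \<xi> * real J) \<le> real (max 1 J) powr (- \<xi>)" by (simp add: powr_powr mult.commute)
    have "1 / r - 1 / 2 \<ge> 0" using r by (simp add: field_simps)
    then have "real J * (real D * (1 / r - 1 / 2)) \<ge> 0" by simp
    then show "2 powr (- \<gamma> * real J) \<le> (2::real) powr (- real J * (\<gamma> - real D * (1 / r - 1 / 2)))"
      by (intro powr_mono) (simp_all add: algebra_simps)
  qed auto
  finally show ?thesis by (simp add: rate_def)
qed

text \<open>The degrees are at most \<open>2\<^bsup>R0 * h\<^esup>\<close>, so the dimension factor of \<open>power_bound\<close> is exponential in \<open>h\<close> and its \<open>2h\<close>-th root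
  is bounded. Thus \<open>q = \<infinity>\<close> is treated with \<open>h\<close> of order \<open>J\<close>, that is, of order \<open>ln m\<close>.\<close>

lemma sup_norm_power_bound:
  assumes w: "w \<in> space M" and h: "h = J + 1"
    and G: "even_norm M h (\<lambda>w. \<Sum>i\<in>window J (R0 * h). c i * e i w) \<le> s" and s: "s \<ge> 0"
  shows "norm (\<Sum>i\<in>window J (R0 * h). c i * e i w) \<le> max B 1 * 2 ^ ((R0 + 1) * D) * s"
proof -
  let ?N = "2 ^ (R0 * h) :: nat"
  let ?G = "\<lambda>w. \<Sum>i\<in>window J (R0 * h). c i * e i w"
  have h1: "h \<ge> 1" using h by simp
  have eq: "?G w = (\<Sum>i\<in>{i \<in> I. deg i \<le> ?N}. (if i \<in> window J (R0 * h) then c i else 0) * e i w)" for w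
    using window_deg window_I by (intro sum.mono_neutral_cong_left finite_deg) (auto simp: subset_iff)
  have "norm (?G w) ^ (2 * h) \<le> B * (real (h * ?N) + 1) ^ D * (LINT w|M. norm (?G w) ^ (2 * h))"
    unfolding eq by (rule power_bound[OF w])
  also have "(LINT w|M. norm (?G w) ^ (2 * h)) = even_norm M h ?G ^ (2 * h)"
    by (rule even_norm_power(1)[OF h1, symmetric])
  also have "B * (real (h * ?N) + 1) ^ D * even_norm M h ?G ^ (2 * h) \<le> (max B 1 * 2 ^ ((R0 + 1) * D)) ^ (2 * h) * s ^ (2 * h)"
  proof (rule mult_mono)
    show "even_norm M h ?G ^ (2 * h) \<le> s ^ (2 * h)" by (intro power_mono G even_norm_power(2) h1)
    have "real (h * ?N) + 1 \<le> 2 ^ ((R0 + 1) * h)"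
    proof -
      have "(1::nat) \<le> ?N" by simp
      then have "h * ?N + 1 \<le> (h + 1) * ?N" by (simp add: algebra_simps)
      also have "h + 1 \<le> 2 ^ h" using less_exp[of h] by (simp only: Suc_eq_plus1[symmetric] Suc_le_eq)
      then have "(h + 1) * ?N \<le> 2 ^ h * ?N" by (intro mult_right_mono) auto
      also have "2 ^ h * ?N = 2 ^ ((R0 + 1) * h)" by (simp add: power_add[symmetric] algebra_simps)
      finally have "real (h * ?N + 1) \<le> real (2 ^ ((R0 + 1) * h))" by (rule of_nat_mono)
      then show ?thesis by simp
    qed
    then have "(real (h * ?N) + 1) ^ D \<le> (2 ^ ((R0 + 1) * h)) ^ D" by (intro power_mono) auto
    also have "\<dots> = (2 ^ ((R0 + 1) * D)) ^ h" by (simp add: power_mult[symmetric] algebra_simps)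
    also have "\<dots> \<le> (2 ^ ((R0 + 1) * D)) ^ (2 * h)" by (intro power_increasing) auto
    finally have 1: "(real (h * ?N) + 1) ^ D \<le> (2 ^ ((R0 + 1) * D)) ^ (2 * h)" .
    have 2: "B \<le> max B 1 ^ (2 * h)"
    proof -
      have "max B 1 ^ 1 \<le> max B 1 ^ (2 * h)" using h1 by (intro power_increasing) auto
      then show ?thesis by simp
    qed
    show "B * (real (h * ?N) + 1) ^ D \<le> (max B 1 * 2 ^ ((R0 + 1) * D)) ^ (2 * h)"
      unfolding power_mult_distrib by (intro mult_mono 1 2) (use B_pos in auto)
  qed (use B_pos s in \<open>auto intro!: integral_nonneg_AE\<close>)
  also have "\<dots> = (max B 1 * 2 ^ ((R0 + 1) * D) * s) ^ (2 * h)" by (rule power_mult_distrib[symmetric])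
  finally show ?thesis
    using h1 s B_pos by (subst (asm) power_mono_iff) auto
qed

text \<open>The subspace is spanned by the basis functions of degree less than \<open>2\<^sup>J\<close> and by \<open>m div 2\<close> random combinations of those
  of the window that follows; the former are indexed by \<open>Inl\<close> and the latter by \<open>Inr\<close>. What remains of the series is
  uniformly small.\<close>

theorem width_approximation:
  "\<exists>C>0. \<forall>q::ennreal. 2 \<le> q \<longrightarrow> (\<forall>m::nat. 2 \<le> m \<longrightarrow> (\<exists>(T :: ('i + nat) set) b. finite T \<and> card T \<le> m
     \<and> (\<forall>t\<in>T. \<exists>F c. finite F \<and> F \<subseteq> I \<and> b t = (\<lambda>w. \<Sum>i\<in>F. c i * e i w))
     \<and> (\<forall>\<phi> \<psi>. admissible r A \<phi> \<longrightarrow> \<psi> \<in> borel_measurable M \<longrightarrow> (AE w in M. \<psi> w = series \<phi> w) \<longrightarrow>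
        (\<exists>a. Lp_norm q M (\<lambda>w. \<psi> w - (\<Sum>t\<in>T. a t * b t w)) \<le>
          ennreal (C * real m powr (- \<gamma> / real D + (1 / r - 1 / 2)) * ln (real m) powr (- \<xi>)
            * (if q < \<infinity> then enn2real q powr (1 / 2) else ln (real m) powr (1 / 2)))))))"
proof -
  define V where "V = measure M (space M)"
  define C0 where "C0 = max (V * B) 1"
  define \<alpha> where "\<alpha> = \<gamma> / real D - (1 / r - 1 / 2)"
  define c1 where "c1 = ln (2 * C0 * 2 ^ D) + real D * ln 2"
  define C1 where "C1 = c1 powr \<xi> * (2 * C0 * 2 ^ D) powr \<alpha>"
  define C2 where "C2 = 1904 * (V + 1) * sqrt (3 * (B * 2 ^ D * \<Gamma>)) * (C_coef * sqrt \<Gamma>) + 1 + C_block * \<Gamma>"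
  obtain R1 :: nat where R1: "real R1 * \<delta> \<ge> \<gamma> + \<xi>" using \<delta>_pos reals_Archimedean3 by (meson less_imp_le)
  \<comment> \<open>At least one block is needed, so that the window begins no later than it ends.\<close>
  define R0 where "R0 = R1 + 1"
  have R0: "real R0 * \<delta> \<ge> \<gamma> + \<xi>" using R1 \<delta>_pos by (simp add: R0_def distrib_right)
  define C3 where "C3 = 2 * (V + 1) + (max B 1 * 2 ^ ((R0 + 1) * D) + 1) * sqrt (2 / ln 2)"
  define C where "C = C3 * C2 * C1 + 1"
  have V: "V \<ge> 0" by (simp add: V_def)
  have C0: "C0 \<ge> 1" by (simp add: C0_def)
  have C2: "C2 > 0" using V B_pos \<Gamma>_pos C_coef_pos C_block_pos by (auto simp: C2_def intro!: add_nonneg_pos mult_nonneg_nonneg)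
  have C1: "C1 \<ge> 0" by (simp add: C1_def)
  have C3: "C3 \<ge> 0" using V by (simp add: C3_def)
  have C: "C > 0" using C1 C2 C3 by (simp add: C_def add_nonneg_pos)
  have main: "\<exists>(T :: ('i + nat) set) b. finite T \<and> card T \<le> m
     \<and> (\<forall>t\<in>T. \<exists>F c. finite F \<and> F \<subseteq> I \<and> b t = (\<lambda>w. \<Sum>i\<in>F. c i * e i w))
     \<and> (\<forall>\<phi> \<psi>. admissible r A \<phi> \<longrightarrow> \<psi> \<in> borel_measurable M \<longrightarrow> (AE w in M. \<psi> w = series \<phi> w) \<longrightarrow>
        (\<exists>a. Lp_norm q M (\<lambda>w. \<psi> w - (\<Sum>t\<in>T. a t * b t w)) \<le>
          ennreal (C * real m powr (- \<gamma> / real D + (1 / r - 1 / 2)) * ln (real m) powr (- \<xi>)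
            * (if q < \<infinity> then enn2real q powr (1 / 2) else ln (real m) powr (1 / 2)))))"
    if q: "2 \<le> q" and m: "2 \<le> m" for q :: ennreal and m :: nat
  proof -
    obtain J where J: "real m / 2 < C0 * 2 ^ ((J + 1) * D)" "J = 0 \<or> C0 * 2 ^ (J * D) \<le> real m / 2"
      using dyadic_cutoff[OF m] unfolding C0_def V_def by blast
    define k where "k = m div 2"
    have "m \<le> 3 * k" "k \<ge> 1" using m unfolding k_def by presburger+
    then have k: "k \<ge> 1" "real m \<le> 3 * real k" by linarith+
    have pw: "(2::real) ^ (J * D) = 2 powr (real J * real D)" by (subst powr_realpow[symmetric]) auto
    have JDm: "(2::real) ^ (J * D) \<le> real m"
    proof (cases "J = 0")
      case False
      then have "C0 * 2 ^ (J * D) \<le> real m" using J(2) by simp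
      moreover have "1 * 2 ^ (J * D) \<le> C0 * 2 ^ (J * D)" using C0 by (intro mult_right_mono) auto
      ultimately show ?thesis by linarith
    qed (use m in simp)
    have Jk: "2 powr (real J * real D) \<le> 3 * real k" using JDm k(2) unfolding pw by linarith
    \<comment> \<open>The square root of \<open>h\<close> is the factor \<open>q\<^bsup>1/2\<^esup>\<close> or \<open>(ln m)\<^bsup>1/2\<^esup>\<close> of the estimate.\<close>
    define h where "h = (if q < \<infinity> then nat \<lceil>enn2real q / 2\<rceil> else J + 1)"
    have q2: "enn2real q \<ge> 2" if "q < \<infinity>"
      using q that by (cases q) (auto simp: ennreal_le_iff simp flip: ennreal_numeral)
    have h: "h \<ge> 1" using q2 by (auto simp: h_def) linarith
    define J' where "J' = R0 * (J + 1)"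
    have JJ': "J \<le> J'" by (simp add: J'_def R0_def)
    obtain g :: "nat \<Rightarrow> 'i \<Rightarrow> complex" where g: "\<And>\<phi>. admissible r A \<phi> \<Longrightarrow> \<exists>a :: nat \<Rightarrow> complex.
      even_norm M h (\<lambda>w. (\<Sum>i\<in>window J J'. of_real (lam i) * coef \<phi> i * e i w) - (\<Sum>s<k. a s * (\<Sum>i\<in>window J J'. g s i * e i w)))
      \<le> (1904 * (V + 1) * sqrt (3 * (B * 2 ^ D * \<Gamma>)) * (C_coef * sqrt \<Gamma>) + 1) * sqrt (real h) * rate J"
      using window_approximation[OF k(1) h Jk, of J'] unfolding V_def by blast
    define T where "T = window 0 J <+> {..<k}"
    define b where "b t = (case t of Inl i \<Rightarrow> e i | Inr s \<Rightarrow> (\<lambda>w. \<Sum>i\<in>window J J'. g s i * e i w))" for t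
    have finT: "finite T" by (simp add: T_def window_finite)
    have cardT: "card T \<le> m"
    proof -
      have "card (window 0 J) \<le> m div 2"
      proof (cases "J = 0")
        case True
        then show ?thesis by (simp add: window_def)
      next
        case False
        have "window 0 J \<subseteq> {i \<in> I. deg i \<le> 2 ^ J - 1}"
        proof
          fix i assume i: "i \<in> window 0 J"
          then obtain j where j: "j < J" "i \<in> block j" by (auto simp: window_def)
          have "(2::nat) ^ (j + 1) \<le> 2 ^ J" using j by (intro power_increasing) auto
          then show "i \<in> {i \<in> I. deg i \<le> 2 ^ J - 1}" using j(2) by (auto simp: block_def)
        qed
        then have "real (card (window 0 J)) \<le> real (card {i \<in> I. deg i \<le> 2 ^ J - 1})"
          by (intro of_nat_mono card_mono finite_deg)
        also have "\<dots> \<le> V * B * (real (2 ^ J - 1) + 1) ^ D" unfolding V_def by (rule card_deg_le)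
        also have "real (2 ^ J - 1) + 1 = 2 ^ J" by (simp add: of_nat_diff)
        also have "V * B * (2 ^ J) ^ D \<le> C0 * 2 ^ (J * D)"
          unfolding power_mult[symmetric] by (intro mult_right_mono) (auto simp: C0_def)
        also have "\<dots> \<le> real m / 2" using J(2) False by simp
        finally have "2 * card (window 0 J) \<le> m" by linarith
        then show ?thesis by simp
      qed
      then show ?thesis by (simp add: T_def card_Plus window_finite k_def)
    qed
    have bT: "\<exists>F c. finite F \<and> F \<subseteq> I \<and> b t = (\<lambda>w. \<Sum>i\<in>F. c i * e i w)" if t: "t \<in> T" for t
    proof (cases t)
      case (Inl i)
      then have "i \<in> I" using t window_I by (auto simp: T_def)
      then show ?thesis by (intro exI[of _ "{i}"] exI[of _ "\<lambda>_. 1"]) (simp add: b_def Inl)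
    next
      case (Inr s)
      then show ?thesis
        by (intro exI[of _ "window J J'"] exI[of _ "g s"]) (simp add: b_def window_finite window_I)
    qed
    define s where "s = C2 * (sqrt (real h) * rate J)"
    have hr: "rate J \<le> sqrt (real h) * rate J" "0 < sqrt (real h) * rate J"
    proof -
      have "1 \<le> sqrt (real h)" using h by simp
      then show "rate J \<le> sqrt (real h) * rate J" "0 < sqrt (real h) * rate J" using rate_pos[of J] by auto
    qed
    have s0: "s > 0" using C2 hr by (simp add: s_def)
    have approx: "\<exists>a. Lp_norm q M (\<lambda>w. \<psi> w - (\<Sum>t\<in>T. a t * b t w)) \<le>
       ennreal ((if q < \<infinity> then 2 * (V + 1) else max B 1 * 2 ^ ((R0 + 1) * D) + 1) * s)"
      if \<phi>: "admissible r A \<phi>" and \<psi>: "\<psi> \<in> borel_measurable M" and ae: "AE w in M. \<psi> w = series \<phi> w" for \<phi> \<psi>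
    proof -
      obtain a :: "nat \<Rightarrow> complex" where a: "even_norm M h (\<lambda>w. (\<Sum>i\<in>window J J'. of_real (lam i) * coef \<phi> i * e i w) - (\<Sum>s<k. a s * (\<Sum>i\<in>window J J'. g s i * e i w)))
        \<le> (1904 * (V + 1) * sqrt (3 * (B * 2 ^ D * \<Gamma>)) * (C_coef * sqrt \<Gamma>) + 1) * sqrt (real h) * rate J"
        using g[OF \<phi>] by blast
      define c where "c i = of_real (lam i) * coef \<phi> i - (\<Sum>s<k. a s * g s i)" for i
      define G where "G w = (\<Sum>i\<in>window J J'. c i * e i w)" for w
      have Geq: "G = (\<lambda>w. (\<Sum>i\<in>window J J'. of_real (lam i) * coef \<phi> i * e i w) - (\<Sum>s<k. a s * (\<Sum>i\<in>window J J'. g s i * e i w)))"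
      proof
        fix w
        have "(\<Sum>s<k. a s * (\<Sum>i\<in>window J J'. g s i * e i w)) = (\<Sum>i\<in>window J J'. (\<Sum>s<k. a s * g s i) * e i w)"
          unfolding sum_distrib_left sum_distrib_right by (subst sum.swap) (simp add: mult.assoc)
        then show "G w = (\<Sum>i\<in>window J J'. of_real (lam i) * coef \<phi> i * e i w) - (\<Sum>s<k. a s * (\<Sum>i\<in>window J J'. g s i * e i w))"
          by (simp add: G_def c_def left_diff_distrib sum_subtractf)
      qed
      have bG: "bounded_fun M G"
        unfolding G_def[abs_def] using window_I by (intro bounded_fun_lincomb window_finite e_bounded) auto
      have Gs: "even_norm M h G \<le> s"
      proof -
        have "even_norm M h G \<le> (1904 * (V + 1) * sqrt (3 * (B * 2 ^ D * \<Gamma>)) * (C_coef * sqrt \<Gamma>) + 1) * sqrt (real h) * rate J"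
          unfolding Geq by (rule a)
        also have "\<dots> \<le> C2 * (sqrt (real h) * rate J)"
          unfolding mult.assoc[of _ "sqrt (real h)"] using C_block_pos \<Gamma>_pos hr by (intro mult_right_mono) (auto simp: C2_def)
        finally show ?thesis by (simp add: s_def)
      qed
      define a' where "a' t = (case t of Inl i \<Rightarrow> of_real (lam i) * coef \<phi> i | Inr s \<Rightarrow> a s)" for t
      define F where "F w = \<psi> w - (\<Sum>t\<in>T. a' t * b t w)" for w
      have sumT: "(\<Sum>t\<in>T. a' t * b t w) = (\<Sum>i\<in>window 0 J. of_real (lam i) * coef \<phi> i * e i w) + (\<Sum>s<k. a s * (\<Sum>i\<in>window J J'. g s i * e i w))" for w
        unfolding T_def by (subst sum.Plus) (auto simp: window_finite a'_def b_def)
      have part: "(\<Sum>j<J'. block_sum \<phi> j w) = (\<Sum>i\<in>window 0 J. of_real (lam i) * coef \<phi> i * e i w) + (\<Sum>i\<in>window J J'. of_real (lam i) * coef \<phi> i * e i w)" for w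
        unfolding sum_window block_sum_def[symmetric] atLeast0LessThan[symmetric] using JJ' by (simp add: sum.atLeastLessThan_concat)
      define \<eta> where "\<eta> = C_block * \<Gamma> * rate J"
      have \<eta>: "0 \<le> \<eta>" "\<eta> \<le> s"
      proof -
        show "0 \<le> \<eta>" using C_block_pos \<Gamma>_pos rate_pos[of J] by (simp add: \<eta>_def)
        have "\<eta> \<le> C_block * \<Gamma> * (sqrt (real h) * rate J)"
          unfolding \<eta>_def using C_block_pos \<Gamma>_pos hr by (intro mult_left_mono) auto
        also have "\<dots> \<le> C2 * (sqrt (real h) * rate J)"
          using hr V B_pos \<Gamma>_pos C_coef_pos C_block_pos by (intro mult_right_mono) (auto simp: C2_def intro!: add_nonneg_nonneg mult_nonneg_nonneg)
        finally show "\<eta> \<le> s" by (simp add: s_def)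
      qed
      have FG: "AE w in M. norm (F w) \<le> norm (G w) + \<eta>"
        using ae
      proof (rule AE_mp, intro AE_I2 impI)
        fix w assume w: "w \<in> space M" and eq: "\<psi> w = series \<phi> w"
        have "F w = (series \<phi> w - (\<Sum>j<J'. block_sum \<phi> j w)) + G w"
          by (simp add: F_def eq sumT part Geq)
        then have "norm (F w) \<le> norm (series \<phi> w - (\<Sum>j<J'. block_sum \<phi> j w)) + norm (G w)"
          by (simp only: norm_triangle_ineq)
        moreover have "norm (series \<phi> w - (\<Sum>j<J'. block_sum \<phi> j w)) \<le> C_block * \<Gamma> * (2 powr (- \<delta>)) ^ J'"
          by (rule series_tail[OF \<phi> w])
        moreover have "C_block * \<Gamma> * (2 powr (- \<delta>)) ^ J' \<le> \<eta>"
          unfolding \<eta>_def J'_def using C_block_pos \<Gamma>_pos by (intro mult_left_mono tail_le_rate R0) auto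
        ultimately show "norm (F w) \<le> norm (G w) + \<eta>" by linarith
      qed
      have bm: "b t \<in> borel_measurable M" if t: "t \<in> T" for t
      proof -
        obtain F c where Fc: "finite F" "F \<subseteq> I" "b t = (\<lambda>w. \<Sum>i\<in>F. c i * e i w)" using bT[OF t] by blast
        have "bounded_fun M (b t)" unfolding Fc(3) using Fc by (intro bounded_fun_lincomb e_bounded) auto
        then show ?thesis by (simp add: bounded_fun_def)
      qed
      have Fm: "F \<in> borel_measurable M"
        unfolding F_def[abs_def] using bm \<psi> by (intro borel_measurable_diff borel_measurable_sum borel_measurable_times) auto
      have "Lp_norm q M F \<le> ennreal ((if q < \<infinity> then 2 * (V + 1) else max B 1 * 2 ^ ((R0 + 1) * D) + 1) * s)"
      proof (cases "q < \<infinity>")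
        case True
        have "real h = of_int \<lceil>enn2real q / 2\<rceil>" using True q2[OF True] by (simp add: h_def)
        then have "enn2real q \<le> 2 * real h" using le_of_int_ceiling[of "enn2real q / 2"] by linarith
        then show ?thesis
          using Lp_norm_le_of_even_norm[OF Fm bG FG \<eta> s0 Gs h q True] True by (simp add: V_def)
      next
        case False
        then have qi: "q = \<infinity>" by (simp add: not_less top_unique)
        have hJ: "h = J + 1" using False by (simp add: h_def)
        have "AE w in M. norm (F w) \<le> (max B 1 * 2 ^ ((R0 + 1) * D) + 1) * s"
          using FG
        proof (rule AE_mp, intro AE_I2 impI)
          fix w assume w: "w \<in> space M" and le: "norm (F w) \<le> norm (G w) + \<eta>"
          have "norm (G w) \<le> max B 1 * 2 ^ ((R0 + 1) * D) * s"
            using sup_norm_power_bound[OF w hJ, where c = c and s = s] Gs s0 hJ unfolding G_def[abs_def] J'_def by simp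
          then show "norm (F w) \<le> (max B 1 * 2 ^ ((R0 + 1) * D) + 1) * s"
            using le \<eta> by (simp add: distrib_right)
        qed
        from Lp_norm_infinity_le[OF Fm this] show ?thesis using qi by simp
      qed
      then show ?thesis unfolding F_def[abs_def] by blast
    qed
    have bound: "(if q < \<infinity> then 2 * (V + 1) else max B 1 * 2 ^ ((R0 + 1) * D) + 1) * s
      \<le> C * real m powr (- \<gamma> / real D + (1 / r - 1 / 2)) * ln (real m) powr (- \<xi>)
            * (if q < \<infinity> then enn2real q powr (1 / 2) else ln (real m) powr (1 / 2))" (is "?K * s \<le> C * ?a * ?b * ?Q")
    proof -
      have lnm: "ln (real m) > 0" using m by simp
      have hQ: "?K * sqrt (real h) \<le> C3 * ?Q"
      proof (cases "q < \<infinity>")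
        case True
        have "real h \<le> enn2real q" using q2[OF True] True by (simp add: h_def) linarith
        then have "sqrt (real h) \<le> enn2real q powr (1 / 2)" by (simp add: powr_half_sqrt)
        then have "2 * (V + 1) * sqrt (real h) \<le> 2 * (V + 1) * enn2real q powr (1 / 2)" using V by (intro mult_left_mono) auto
        also have "\<dots> \<le> C3 * enn2real q powr (1 / 2)"
          by (intro mult_right_mono) (auto simp: C3_def)
        finally show ?thesis using True by simp
      next
        case False
        have "real (J + 1) \<le> 2 / ln 2 * ln (real m)"
        proof (cases "J = 0")
          case True
          have "ln 2 \<le> ln (real m)" using m by simp
          then have "ln 2 \<le> 2 * ln (real m)" using lnm by linarith
          then show ?thesis using True by (simp add: field_simps)
        next
          case J0: False
          have "(2::real) ^ (J * 1) \<le> 2 ^ (J * D)" using D_pos by (intro power_increasing mult_le_mono2) auto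
          then have "(2::real) ^ (J * 1) \<le> real m" using JDm by (rule order_trans)
          then have "(2::real) ^ J \<le> real m" by simp
          then have "ln ((2::real) ^ J) \<le> ln (real m)" using m by (subst ln_le_cancel_iff) auto
          then have "real J * ln 2 \<le> ln (real m)" by (simp add: ln_realpow)
          moreover have "real (J + 1) \<le> 2 * real J" using J0 by simp
          then have "real (J + 1) * ln 2 \<le> 2 * real J * ln 2" by (intro mult_right_mono) auto
          ultimately have "real (J + 1) * ln 2 \<le> 2 * ln (real m)" by linarith
          then have "real (J + 1) \<le> 2 * ln (real m) / ln 2" by (subst pos_le_divide_eq) auto
          then show ?thesis by simp
        qed
        then have "sqrt (real h) \<le> sqrt (2 / ln 2 * ln (real m))" using False by (simp add: h_def)
        also have "\<dots> = sqrt (2 / ln 2) * ln (real m) powr (1 / 2)" unfolding real_sqrt_mult using lnm by (simp add: powr_half_sqrt)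
        finally have "(max B 1 * 2 ^ ((R0 + 1) * D) + 1) * sqrt (real h) \<le> (max B 1 * 2 ^ ((R0 + 1) * D) + 1) * (sqrt (2 / ln 2) * ln (real m) powr (1 / 2))"
          by (intro mult_left_mono) auto
        also have "\<dots> \<le> C3 * ln (real m) powr (1 / 2)"
          unfolding mult.assoc[symmetric] using V by (intro mult_right_mono) (auto simp: C3_def)
        finally show ?thesis using False by simp
      qed
      have rt: "rate J \<le> C1 * (?a * ?b)"
        using rate_le[OF m J(1) C0] unfolding C1_def c1_def \<alpha>_def by (simp add: algebra_simps)
      have Q0: "?Q \<ge> 0" by simp
      have "?K * s = C2 * ((?K * sqrt (real h)) * rate J)" by (simp add: s_def mult_ac)
      also have "\<dots> \<le> C2 * ((C3 * ?Q) * (C1 * (?a * ?b)))"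
        using C2 C3 rate_pos[of J] by (intro mult_left_mono mult_mono hQ rt mult_nonneg_nonneg Q0) auto
      also have "\<dots> = (C3 * C2 * C1) * (?a * ?b * ?Q)" by (simp add: mult_ac)
      also have "\<dots> \<le> C * (?a * ?b * ?Q)"
        by (intro mult_right_mono mult_nonneg_nonneg Q0) (auto simp: C_def)
      finally show ?thesis by (simp only: mult.assoc)
    qed
    show ?thesis
    proof (intro exI[of _ T] exI[of _ b] conjI ballI allI impI)
      fix \<phi> \<psi> assume "admissible r A \<phi>" "\<psi> \<in> borel_measurable M" "AE w in M. \<psi> w = series \<phi> w"
      from approx[OF this] obtain a where "Lp_norm q M (\<lambda>w. \<psi> w - (\<Sum>t\<in>T. a t * b t w)) \<le>
        ennreal ((if q < \<infinity> then 2 * (V + 1) else max B 1 * 2 ^ ((R0 + 1) * D) + 1) * s)" by blast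
      also note ennreal_leI[OF bound]
      finally show "\<exists>a. Lp_norm q M (\<lambda>w. \<psi> w - (\<Sum>t\<in>T. a t * b t w)) \<le>
        ennreal (C * real m powr (- \<gamma> / real D + (1 / r - 1 / 2)) * ln (real m) powr (- \<xi>)
            * (if q < \<infinity> then enn2real q powr (1 / 2) else ln (real m) powr (1 / 2)))" by blast
    qed (fact finT cardT bT)+
  qed
  show ?thesis
    using C main by (intro exI[of _ C]) blast
qed

end

section \<open>Orthonormal bases of subspaces of the required dimension\<close>

lemma graded_basis_mono: "N \<le> N' \<Longrightarrow> graded_basis N \<subseteq> graded_basis N'"
  by (auto simp: graded_basis_def) (meson atMost_iff order_trans)

text \<open>The power \<open>z\<^sub>j\<^sup>a\<close> is harmonic and does not vanish at the unit vector of the coordinate \<open>j\<close>.\<close>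

lemma hbasis_nonempty: "(hbasis a 0 :: (complex ^ 'd::finite \<Rightarrow> complex) set) \<noteq> {}"
proof
  fix j :: 'd
  define f where "f = (zmon ((\<lambda>_. 0)(j := a)) (\<lambda>_. 0) :: complex ^ 'd \<Rightarrow> complex)"
  assume e: "(hbasis a 0 :: (complex ^ 'd \<Rightarrow> complex) set) = {}"
  have "bihom (sum ((\<lambda>_. 0)(j := a)) UNIV) (sum (\<lambda>_. 0) (UNIV :: 'd set)) f"
    unfolding f_def by (rule bihom_zmon)
  then have "bihom a 0 f" by (simp add: sum.remove[of UNIV j])
  then have "harmonic_poly a 0 f" by (intro harm_of_zero_degree) auto
  then have "f (axis j 1) = (\<Sum>u\<in>hbasis a 0. ip f u * u (axis j 1))"
    by (rule hbasis(3)) (simp add: norm_axis_complex)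
  moreover have "f (axis j 1) = 1"
    unfolding f_def zmon_def by (simp add: axis_def) (intro prod.neutral, auto)
  ultimately show False using e by simp
qed

lemma graded_basis_large: "card (graded_basis N :: (complex ^ 'd::finite \<Rightarrow> complex) set) > N"
proof -
  define f where "f a = (SOME u :: complex ^ 'd \<Rightarrow> complex. u \<in> hbasis a 0)" for a
  have f: "f a \<in> hbasis a 0" for a
  proof -
    obtain u :: "complex ^ 'd \<Rightarrow> complex" where "u \<in> hbasis a 0" using hbasis_nonempty[of a, where 'd = 'd] by blast
    then show ?thesis unfolding f_def by (rule someI[of "\<lambda>u. u \<in> hbasis a 0"])
  qed
  have "inj_on f {..N}"
  proof (rule inj_onI)
    fix a b assume "f a = f b"
    then have "f a \<in> hbasis b 0" using f[of b] by simp
    then show "a = b" using hbasis_disjoint[OF f[of a]] by blast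
  qed
  moreover have "f ` {..N} \<subseteq> graded_basis N"
    using f by (auto simp: graded_basis_def)
  moreover have "finite (graded_basis N :: (complex ^ 'd \<Rightarrow> complex) set)"
    using orthonormal_graded_basis by (auto simp: orthonormal_def)
  ultimately have "card {..N} \<le> card (graded_basis N :: (complex ^ 'd \<Rightarrow> complex) set)"
    by (rule card_inj_on_le)
  then show ?thesis by simp
qed

text \<open>A Kolmogorov width of order \<open>m\<close> refers to subspaces of dimension exactly \<open>m\<close>, so smaller subspaces have to be
  enlarged. Spaces of polynomials of high degree supply new directions.\<close>

lemma orthonormal_extend:
  fixes U :: "(complex ^ 'd::finite \<Rightarrow> complex) set"
  assumes U: "orthonormal U" and m: "card U \<le> m"
  shows "\<exists>V. U \<subseteq> V \<and> orthonormal V \<and> card V = m"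
  using m
proof (induction rule: dec_induct)
  case base
  then show ?case using U by blast
next
  case (step k)
  then obtain V where V: "U \<subseteq> V" "orthonormal V" "card V = k" by blast
  have fin: "finite V" and cont: "\<And>v. v \<in> V \<Longrightarrow> sphere_cont v" using V(2) by (auto simp: orthonormal_def)
  have "\<exists>f w. f \<in> graded_basis k \<and> w \<in> sphere 0 1 \<and> f w \<noteq> (\<Sum>u\<in>V. ip f u * u w)"
  proof (rule ccontr)
    assume "\<not> ?thesis"
    then have s: "f w = (\<Sum>u\<in>V. ip f u * u w)" if "f \<in> graded_basis k" "w \<in> sphere 0 1" for f w
      using that by blast
    have "card (graded_basis k :: (complex ^ 'd \<Rightarrow> complex) set) \<le> card V"
    proof (rule orthonormal_card_le[OF orthonormal_graded_basis fin, where g = "\<lambda>u. u"])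
      show "\<exists>c. \<forall>z\<in>sphere 0 1. v z = (\<Sum>k\<in>V. c k * k z)" if "v \<in> graded_basis k" for v
        using s[OF that] by (intro exI[of _ "ip v"]) auto
    qed (rule cont)
    then show False using graded_basis_large[of k, where 'd = 'd] V(3) by simp
  qed
  then obtain f w where f: "f \<in> graded_basis k" and w: "w \<in> sphere 0 1" "f w \<noteq> (\<Sum>u\<in>V. ip f u * u w)" by blast
  have "sphere_cont f" using f orthonormal_graded_basis by (auto simp: orthonormal_def)
  from orthonormal_insert_residual[OF V(2) this w] obtain g where "g \<notin> V" "orthonormal (insert g V)" by blast
  then show ?case using V fin by (intro exI[of _ "insert g V"]) auto
qed

section \<open>From approximation to Kolmogorov widths\<close>

lemma Lp_norm_eq_on_space:
  assumes "\<And>x. x \<in> space M \<Longrightarrow> f x = g x" and [measurable]: "f \<in> borel_measurable M" "g \<in> borel_measurable M"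
  shows "Lp_norm q M f = Lp_norm q M g"
proof -
  have "esssup M (\<lambda>x. ennreal (norm (f x))) = esssup M (\<lambda>x. ennreal (norm (g x)))"
    using assms by (intro esssup_AE_cong AE_I2) auto
  moreover have "(\<integral>\<^sup>+ x. ennreal (norm (f x) powr enn2real q) \<partial>M) = (\<integral>\<^sup>+ x. ennreal (norm (g x) powr enn2real q) \<partial>M)"
    using assms by (intro nn_integral_cong) auto
  ultimately show ?thesis by (simp add: Lp_norm_def)
qed

lemma sphere_cont_Lp_space:
  fixes f :: "complex ^ 'd::finite \<Rightarrow> complex"
  assumes f: "sphere_cont f"
  shows "f \<in> Lp_space q surface_measure"
proof -
  interpret finite_measure "surface_measure :: (complex ^ 'd) measure" by (rule finite_measure_surface_measure)
  have m[measurable]: "f \<in> borel_measurable surface_measure" by (rule continuous_borel_measurable_surface[OF f])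
  have "compact (f ` sphere 0 1)" by (intro compact_continuous_image f) simp
  then have "bounded (f ` sphere 0 1)" by (rule compact_imp_bounded)
  then obtain C where C: "\<And>x. x \<in> sphere 0 1 \<Longrightarrow> norm (f x) \<le> C" unfolding bounded_iff by blast
  have "Lp_norm q surface_measure f < \<infinity>"
  proof (cases "q = \<infinity>")
    case True
    have "Lp_norm \<infinity> surface_measure f \<le> ennreal C" using C by (intro Lp_norm_infinity_le m AE_I2) auto
    then show ?thesis using True by (auto simp: le_less_trans)
  next
    case False
    have "(\<integral>\<^sup>+ x. ennreal (norm (f x) powr enn2real q) \<partial>surface_measure) \<le> (\<integral>\<^sup>+ x. ennreal (C powr enn2real q) \<partial>(surface_measure :: (complex ^ 'd) measure))"
      using C by (intro nn_integral_mono ennreal_leI powr_mono2) auto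
    also have "\<dots> < \<infinity>" by (simp add: ennreal_mult_eq_top_iff less_top[symmetric])
    finally show ?thesis using False by (simp add: Lp_norm_def Let_def)
  qed
  then show ?thesis by (simp add: Lp_space_def)
qed

lemma Lp_norm_zero_sphere_cont:
  fixes f :: "complex ^ 'd::finite \<Rightarrow> complex"
  assumes f: "sphere_cont f" and q: "1 \<le> q" and z: "Lp_norm q surface_measure f = 0" and w: "w \<in> sphere 0 1"
  shows "f w = 0"
proof -
  have m[measurable]: "f \<in> borel_measurable surface_measure" by (rule continuous_borel_measurable_surface[OF f])
  have "AE x in surface_measure. f x = 0"
  proof (cases "q = \<infinity>")
    case True
    then have "esssup surface_measure (\<lambda>x. ennreal (norm (f x))) = 0" using z by (simp add: Lp_norm_def)
    then show ?thesis using esssup_AE[of "\<lambda>x. ennreal (norm (f x))" surface_measure] by simp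
  next
    case False
    let ?I = "\<integral>\<^sup>+ x. ennreal (norm (f x) powr enn2real q) \<partial>surface_measure"
    have I: "?I \<noteq> \<infinity>" "enn2real ?I powr (1 / enn2real q) = 0"
      using z False by (auto simp: Lp_norm_def Let_def split: if_splits)
    then have "?I = 0" by (simp add: enn2real_eq_0_iff)
    then have "AE x in surface_measure. ennreal (norm (f x) powr enn2real q) = 0"
      by (subst (asm) nn_integral_0_iff_AE) auto
    then show ?thesis by eventually_elim (auto simp: ennreal_eq_0_iff)
  qed
  then show ?thesis using f w by (intro continuous_AE_zero_surface[where f = f])
qed

text \<open>An orthonormal family is independent modulo null functions, since the functions are continuous.\<close>

lemma Lp_width_le:
  fixes V :: "(complex ^ 'd::finite \<Rightarrow> complex) set"
  assumes V: "orthonormal V" "card V = m" and q: "1 \<le> q"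
    and A: "\<And>f. f \<in> A \<Longrightarrow> \<exists>c. Lp_norm q surface_measure (\<lambda>z. f z - (\<Sum>v\<in>V. c v * v z)) \<le> K"
  shows "Lp_width m A q surface_measure \<le> K"
proof -
  have fin: "finite V" and cont: "\<And>v. v \<in> V \<Longrightarrow> sphere_cont v" using V(1) by (auto simp: orthonormal_def)
  obtain b where b: "bij_betw b {..<m} V"
    using ex_bij_betw_nat_finite[OF fin] V(2) by (auto simp: atLeast0LessThan)
  have bV: "b i \<in> V" if "i < m" for i using b that by (auto simp: bij_betw_def)
  have b_inj: "b i = b j \<longleftrightarrow> i = j" if "i < m" "j < m" for i j
    using b that by (auto simp: bij_betw_def inj_on_def)
  let ?W = "range (\<lambda>c :: nat \<Rightarrow> complex. \<lambda>x. \<Sum>i<m. c i * b i x)"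
  have "?W \<in> subspaces_of_dim (Lp_space q surface_measure) (Lp_norm q surface_measure) m"
    unfolding subspaces_of_dim_def
  proof (intro CollectI exI[of _ b] conjI allI impI)
    show "b i \<in> Lp_space q surface_measure" if "i < m" for i
      using bV[OF that] cont by (intro sphere_cont_Lp_space)
  next
    fix c :: "nat \<Rightarrow> complex" and i assume z: "Lp_norm q surface_measure (\<lambda>x. \<Sum>i<m. c i * b i x) = 0" and i: "i < m"
    have "sphere_cont (\<lambda>x. \<Sum>i<m. c i * b i x)" using cont bV by (intro continuous_intros) auto
    from Lp_norm_zero_sphere_cont[OF this q z]
    have "ip (\<lambda>x. \<Sum>i<m. c i * b i x) (b i) = ip (\<lambda>x. 0) (b i)" by (intro ip_cong) auto
    also have "\<dots> = 0" by (simp add: ip_def)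
    also have "ip (\<lambda>x. \<Sum>i<m. c i * b i x) (b i) = (\<Sum>k<m. c k * ip (b k) (b i))"
      using cont bV i by (intro ip_lincomb_left) auto
    also have "\<dots> = (\<Sum>k<m. if k = i then c k else 0)"
      using V(1) bV i b_inj by (intro sum.cong refl) (auto simp: orthonormal_def)
    also have "\<dots> = c i" using i by simp
    finally show "c i = 0" .
  qed simp
  then show ?thesis
    unfolding kolmogorov_width_def
  proof (rule INF_lower2, intro SUP_least)
    fix f assume "f \<in> A"
    then obtain c where c: "Lp_norm q surface_measure (\<lambda>z. f z - (\<Sum>v\<in>V. c v * v z)) \<le> K" using A by blast
    have "(\<Sum>v\<in>V. c v * v z) = (\<Sum>i<m. c (b i) * b i z)" for z
      using sum.reindex_bij_betw[OF b, of "\<lambda>v. c v * v z"] by simp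
    then have "Lp_norm q surface_measure (\<lambda>z. f z - (\<lambda>x. \<Sum>i<m. c (b i) * b i x) z) \<le> K" using c by simp
    then show "(INF g\<in>?W. Lp_norm q surface_measure (\<lambda>x. f x - g x)) \<le> K"
      by (intro INF_lower2[where i = "\<lambda>x. \<Sum>i<m. c (b i) * b i x"] rangeI)
  qed
qed

lemma Lp_width_le_of_family:
  fixes b :: "'k \<Rightarrow> complex ^ 'd::finite \<Rightarrow> complex"
  assumes T: "finite T" "card T \<le> m" and b: "\<And>t. t \<in> T \<Longrightarrow> sphere_cont (b t)" and q: "1 \<le> q"
    and Am: "\<And>f. f \<in> A \<Longrightarrow> f \<in> borel_measurable surface_measure"
    and A: "\<And>f. f \<in> A \<Longrightarrow> \<exists>a. Lp_norm q surface_measure (\<lambda>z. f z - (\<Sum>t\<in>T. a t * b t z)) \<le> K"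
  shows "Lp_width m A q surface_measure \<le> K"
proof -
  obtain U where U: "orthonormal U" "card U \<le> card T" "\<And>t z. t \<in> T \<Longrightarrow> z \<in> sphere 0 1 \<Longrightarrow> b t z = (\<Sum>u\<in>U. ip (b t) u * u z)"
    using gram_schmidt[of T b] T(1) b by blast
  obtain V where V: "U \<subseteq> V" "orthonormal V" "card V = m"
    using orthonormal_extend[OF U(1), of m] U(2) T(2) by auto
  have fin: "finite V" and cont: "\<And>v. v \<in> V \<Longrightarrow> sphere_cont v" using V(2) by (auto simp: orthonormal_def)
  show ?thesis
  proof (rule Lp_width_le[OF V(2,3) q])
    fix f assume f: "f \<in> A"
    then obtain a where a: "Lp_norm q surface_measure (\<lambda>z. f z - (\<Sum>t\<in>T. a t * b t z)) \<le> K" using A by blast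
    define c where "c v = (if v \<in> U then \<Sum>t\<in>T. a t * ip (b t) v else 0)" for v
    have eq: "(\<Sum>v\<in>V. c v * v z) = (\<Sum>t\<in>T. a t * b t z)" if z: "z \<in> sphere 0 1" for z
    proof -
      have "(\<Sum>v\<in>V. c v * v z) = (\<Sum>v\<in>U. (\<Sum>t\<in>T. a t * ip (b t) v) * v z)"
        using V(1) fin by (intro sum.mono_neutral_cong_right) (auto simp: c_def)
      also have "\<dots> = (\<Sum>t\<in>T. a t * (\<Sum>v\<in>U. ip (b t) v * v z))"
        unfolding sum_distrib_left sum_distrib_right by (subst sum.swap) (simp add: mult.assoc)
      also have "\<dots> = (\<Sum>t\<in>T. a t * b t z)" using U(3)[OF _ z] by (intro sum.cong refl) simp
      finally show ?thesis .
    qed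
    have "(\<lambda>z. f z - (\<Sum>v\<in>V. c v * v z)) \<in> borel_measurable surface_measure"
      using cont by (intro borel_measurable_diff[OF Am[OF f]] continuous_borel_measurable_surface continuous_intros) auto
    moreover have "(\<lambda>z. f z - (\<Sum>t\<in>T. a t * b t z)) \<in> borel_measurable surface_measure"
      using b by (intro borel_measurable_diff[OF Am[OF f]] continuous_borel_measurable_surface continuous_intros) auto
    ultimately have "Lp_norm q surface_measure (\<lambda>z. f z - (\<Sum>v\<in>V. c v * v z)) = Lp_norm q surface_measure (\<lambda>z. f z - (\<Sum>t\<in>T. a t * b t z))"
      using eq by (intro Lp_norm_eq_on_space) auto
    then show "\<exists>c. Lp_norm q surface_measure (\<lambda>z. f z - (\<Sum>v\<in>V. c v * v z)) \<le> K" using a by (intro exI[of _ c]) simp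
  qed
qed

section \<open>The spherical harmonics as a graded system\<close>

definition full_basis :: "(complex ^ 'd::finite \<Rightarrow> complex) set" where
  "full_basis = (\<Union>N. graded_basis N)"

text \<open>The larger of the two degrees of a basis element, read off from the spans to which it belongs.\<close>

definition degree_of :: "(complex ^ 'd::finite \<Rightarrow> complex) \<Rightarrow> nat" where
  "degree_of u = (LEAST N. u \<in> graded_basis N)"

lemma degree_of_le: "u \<in> full_basis \<Longrightarrow> degree_of u \<le> N \<longleftrightarrow> u \<in> graded_basis N"
proof
  assume "u \<in> full_basis" "degree_of u \<le> N"
  then obtain N' where "u \<in> graded_basis N'" by (auto simp: full_basis_def)
  then have "u \<in> graded_basis (degree_of u)" unfolding degree_of_def by (rule LeastI)
  then show "u \<in> graded_basis N" using graded_basis_mono \<open>degree_of u \<le> N\<close> by blast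
qed (simp add: degree_of_def Least_le)

lemma graded_basis_eq: "{u \<in> full_basis. degree_of u \<le> N} = graded_basis N"
proof (intro equalityI subsetI)
  fix u assume u: "u \<in> graded_basis N"
  then have "u \<in> full_basis" unfolding full_basis_def by blast
  then show "u \<in> {u \<in> full_basis. degree_of u \<le> N}" using u degree_of_le by blast
qed (use degree_of_le in blast)

lemma hbasis_degree_of:
  assumes u: "u \<in> hbasis m n" shows "u \<in> full_basis" "degree_of u = max m n"
proof -
  have g: "u \<in> graded_basis N \<longleftrightarrow> max m n \<le> N" for N
  proof
    assume "u \<in> graded_basis N"
    then obtain m' n' where "m' \<le> N" "n' \<le> N" "u \<in> hbasis m' n'" unfolding graded_basis_def by blast
    then show "max m n \<le> N" using hbasis_disjoint[OF u, of m' n'] by simp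
  next
    assume "max m n \<le> N"
    then show "u \<in> graded_basis N" unfolding graded_basis_def using u by (intro UN_I[of m] UN_I[of n]) auto
  qed
  have "u \<in> graded_basis (max m n)" unfolding g ..
  then show "u \<in> full_basis" unfolding full_basis_def by (rule UN_I[OF UNIV_I])
  show "degree_of u = max m n" unfolding degree_of_def g by (rule Least_equality) auto
qed

lemma graded_system_sphere:
  "graded_system (surface_measure :: (complex ^ 'd::finite) measure) full_basis (\<lambda>u. u) degree_of (kernel_const TYPE('d)) (2 * CARD('d) - 1)"
proof -
  interpret finite_measure "surface_measure :: (complex ^ 'd) measure" by (rule finite_measure_surface_measure)
  show ?thesis
  proof
    show "kernel_const TYPE('d) > 0" by (rule kernel_const_pos)
    have "CARD('d) \<ge> 1" by (simp add: Suc_leI)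
    then show "1 \<le> 2 * CARD('d) - 1" by linarith
    show "u \<in> borel_measurable surface_measure" if "u \<in> full_basis" for u :: "complex ^ 'd \<Rightarrow> complex"
      using that orthonormal_graded_basis by (intro continuous_borel_measurable_surface) (auto simp: full_basis_def orthonormal_def)
    show "finite {u :: complex ^ 'd \<Rightarrow> complex. u \<in> full_basis \<and> degree_of u \<le> N}" for N
      using orthonormal_graded_basis[of N] unfolding graded_basis_eq orthonormal_def by blast
    show "(\<Sum>u\<in>{u \<in> full_basis. degree_of u \<le> N}. (norm (u w))\<^sup>2) \<le> kernel_const TYPE('d) * (real N + 1) ^ (2 * CARD('d) - 1)"
      if "w \<in> space surface_measure" for N and w :: "complex ^ 'd"
      using that unfolding graded_basis_eq space_surface_measure by (rule kernel_bound)
    show "(LINT w|surface_measure. u w * cnj (v w)) = (if u = v then 1 else 0)"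
      if u: "u \<in> full_basis" and v: "v \<in> full_basis" for u v :: "complex ^ 'd \<Rightarrow> complex"
    proof -
      obtain N N' where "u \<in> graded_basis N" "v \<in> graded_basis N'" using u v by (auto simp: full_basis_def)
      then have "u \<in> graded_basis (max N N')" "v \<in> graded_basis (max N N')"
        using graded_basis_mono[of N "max N N'"] graded_basis_mono[of N' "max N N'"] by auto
      moreover have "orthonormal (graded_basis (max N N') :: (complex ^ 'd \<Rightarrow> complex) set)" by (rule orthonormal_graded_basis)
      ultimately show ?thesis by (simp add: orthonormal_def ip_def)
    qed
    show "norm (\<Sum>u\<in>{u \<in> full_basis. degree_of u \<le> N}. c u * u w) ^ (2 * h)
      \<le> kernel_const TYPE('d) * (real (h * N) + 1) ^ (2 * CARD('d) - 1) * (LINT w|surface_measure. norm (\<Sum>u\<in>{u \<in> full_basis. degree_of u \<le> N}. c u * u w) ^ (2 * h))"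
      if "w \<in> space surface_measure" for h N and c :: "(complex ^ 'd \<Rightarrow> complex) \<Rightarrow> complex" and w :: "complex ^ 'd"
      using that unfolding graded_basis_eq space_surface_measure by (intro in_span_power_bound in_spanI[where c = c]) auto
  qed
qed

section \<open>The multiplier operator and its widths\<close>

lemma Lp_space_1_iff: "f \<in> Lp_space 1 M \<longleftrightarrow> integrable M f"
  by (auto simp: Lp_space_def Lp_norm_def Let_def integrable_iff_bounded less_top)

text \<open>The operator is specified by its expansion up to null sets only. Any integrable function with the prescribed coefficients
  shows that the specification can be met and, by completeness, agrees with the chosen value almost everywhere.\<close>

lemma Lambda1_AE_eq:
  fixes \<phi> s :: "complex ^ 'd::finite \<Rightarrow> complex"
  assumes \<phi>i: "integrable surface_measure \<phi>" and si: "integrable surface_measure s"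
    and cs: "\<And>m n u. u \<in> hbasis m n \<Longrightarrow> ip s u = of_real (lambda1 \<gamma> \<xi> (real (max m n))) * ip \<phi> u"
  shows "Lambda1 \<gamma> \<xi> \<phi> \<in> borel_measurable surface_measure" "AE w in surface_measure. Lambda1 \<gamma> \<xi> \<phi> w = s w"
proof -
  let ?l = "\<lambda>m n. of_real (lambda1 \<gamma> \<xi> (real (max m n))) :: complex"
  have "has_multiplier_expansion ?l \<phi> s"
    unfolding has_multiplier_expansion_def Lp_space_1_iff using si cs by (auto simp: expansion_coefficients[OF \<phi>i si])
  then have "has_multiplier_expansion ?l \<phi> (Lambda1 \<gamma> \<xi> \<phi>)"
    unfolding Lambda1_def multiplier_op_def by (rule someI[where P = "has_multiplier_expansion ?l \<phi>"])
  then have Li: "integrable surface_measure (Lambda1 \<gamma> \<xi> \<phi>)"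
    and "\<And>m n. \<forall>w\<in>sphere 0 1. harmonic_proj m n (Lambda1 \<gamma> \<xi> \<phi>) w = ?l m n * harmonic_proj m n \<phi> w"
    unfolding has_multiplier_expansion_def Lp_space_1_iff by blast+
  then have cL: "ip (Lambda1 \<gamma> \<xi> \<phi>) u = ?l m n * ip \<phi> u" if "u \<in> hbasis m n" for m n u
    using that unfolding expansion_coefficients[OF \<phi>i Li] by blast
  have "AE w in surface_measure. Lambda1 \<gamma> \<xi> \<phi> w - s w = 0"
  proof (rule completeness)
    show "integrable surface_measure (\<lambda>w. Lambda1 \<gamma> \<xi> \<phi> w - s w)" using Li si by simp
    fix N and u :: "complex ^ 'd \<Rightarrow> complex" assume u: "u \<in> graded_basis N"
    then obtain m n where mn: "u \<in> hbasis m n" by (auto simp: graded_basis_def)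
    have b: "sphere_cont u" using hbasis(1)[of m n] mn by (auto simp: orthonormal_def)
    have "ip (\<lambda>w. Lambda1 \<gamma> \<xi> \<phi> w - s w) u = ip (Lambda1 \<gamma> \<xi> \<phi>) u - ip s u"
      unfolding ip_def left_diff_distrib using integrable_mult_continuous[OF Li continuous_on_cnj[OF b]] integrable_mult_continuous[OF si continuous_on_cnj[OF b]]
      by (rule Bochner_Integration.integral_diff)
    then show "ip (\<lambda>w. Lambda1 \<gamma> \<xi> \<phi> w - s w) u = 0" using cs[OF mn] cL[OF mn] by simp
  qed
  then show "AE w in surface_measure. Lambda1 \<gamma> \<xi> \<phi> w = s w" by eventually_elim simp
  show "Lambda1 \<gamma> \<xi> \<phi> \<in> borel_measurable surface_measure" using Li by simp
qed

theorem theorem6p2: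
  fixes \<gamma> \<xi> :: real and p :: ennreal
  assumes "CARD('d::finite) \<ge> 2"
    and "\<gamma> > 0" and "\<xi> \<ge> 0"
    and "1 \<le> p"
    and "p \<le> 2 \<Longrightarrow> \<gamma> > (2 * real CARD('d) - 1) / enn2real p"
    and "p \<ge> 2 \<Longrightarrow> \<gamma> > (2 * real CARD('d) - 1) / 2"
  shows "\<exists>C>0. \<forall>q::ennreal. 2 \<le> q \<longrightarrow> (\<forall>m::nat. 2 \<le> m \<longrightarrow>
           Lp_width m
             (Lambda1 \<gamma> \<xi> ` Lp_ball p (surface_measure :: (complex ^ 'd) measure))
             q surface_measure
           \<le> ennreal (C * real m powr (- \<gamma> / (2 * real CARD('d) - 1) + max 0 (enn2real (1 / p) - 1 / 2))
                * ln (real m) powr (- \<xi>)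
                * (if q < \<infinity> then enn2real q powr (1 / 2) else ln (real m) powr (1 / 2))))"
proof -
  let ?M = "surface_measure :: (complex ^ 'd) measure"
  define r where "r = (if p \<le> 2 then enn2real p else 2)"
  define A where "A = measure ?M (space ?M) + 1"
  interpret M: finite_measure ?M by (rule finite_measure_surface_measure)
  have D: "real (2 * CARD('d) - 1) = 2 * real CARD('d) - 1"
    using assms(1) by (simp add: of_nat_diff)
  have p2: "1 \<le> enn2real p \<and> enn2real p \<le> 2 \<and> enn2real (1 / p) = 1 / enn2real p" if p: "p \<le> 2"
  proof (cases p)
    case (real x)
    then have "1 \<le> x" using assms(4) by (simp add: ennreal_le_iff flip: ennreal_1)
    moreover from this have "x \<le> 2" using real p by (simp add: ennreal_le_iff flip: ennreal_numeral)
    moreover from calculation have "1 / p = ennreal (1 / x)"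
      using divide_ennreal[of 1 x] real by simp
    ultimately show ?thesis using real by simp
  next
    case top
    then show ?thesis using p by (simp add: top_unique)
  qed
  have r: "1 \<le> r" "r \<le> 2" using p2 by (auto simp: r_def)
  interpret multiplier_system ?M full_basis "\<lambda>u. u" degree_of "kernel_const TYPE('d)" "2 * CARD('d) - 1" \<gamma> \<xi> r A
  proof (intro multiplier_system.intro multiplier_system_axioms.intro graded_system_sphere r)
    show "real (2 * CARD('d) - 1) / r < \<gamma>" using assms(5,6) unfolding D r_def by (auto simp: not_le)
  qed (auto simp: A_def assms)
  have series: "Lambda1 \<gamma> \<xi> \<phi> \<in> borel_measurable ?M" "AE w in ?M. Lambda1 \<gamma> \<xi> \<phi> w = series \<phi> w"
    if \<phi>: "admissible r A \<phi>" for \<phi>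
  proof -
    have coef_ip: "coef = ip" by (intro ext) (simp add: coef_def ip_def)
    have \<phi>i: "integrable ?M \<phi>" using \<phi> by (simp add: admissible_def)
    have si: "integrable ?M (series \<phi>)" by (rule M.bounded_fun_integrable[OF series_bounded_fun[OF \<phi>]])
    have "ip (series \<phi>) u = of_real (lambda1 \<gamma> \<xi> (real (max m n))) * ip \<phi> u" if u: "u \<in> hbasis m n" for m n u
      using coef_series[OF \<phi> hbasis_degree_of(1)[OF u]] by (simp add: coef_ip lam_def hbasis_degree_of(2)[OF u])
    then show "Lambda1 \<gamma> \<xi> \<phi> \<in> borel_measurable ?M" "AE w in ?M. Lambda1 \<gamma> \<xi> \<phi> w = series \<phi> w"
      using Lambda1_AE_eq[OF \<phi>i si] by blast+
  qed
  \<comment> \<open>For \<open>p > 2\<close> both sides vanish; this covers \<open>p = \<infinity>\<close> as well.\<close>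
  have exponent: "max 0 (enn2real (1 / p) - 1 / 2) = 1 / r - 1 / 2"
  proof (cases "p \<le> 2")
    case True
    then show ?thesis using p2 by (auto simp: r_def field_simps)
  next
    case False
    have "enn2real (1 / p) \<le> 1 / 2"
    proof (cases p)
      case (real x)
      then have x: "x > 2" using False by (simp add: not_le flip: ennreal_numeral) 
      then have "1 / p = ennreal (1 / x)" using divide_ennreal[of 1 x] real by simp
      then show ?thesis using x by simp
    next
      case top
      then show ?thesis by simp
    qed
    then show ?thesis using False by (simp add: r_def)
  qed
  obtain C where C: "C > 0" and W: "\<And>q m. 2 \<le> q \<Longrightarrow> 2 \<le> m \<Longrightarrow> \<exists>(T :: ((complex ^ 'd \<Rightarrow> complex) + nat) set) b. finite T \<and> card T \<le> m
     \<and> (\<forall>t\<in>T. \<exists>F c. finite F \<and> F \<subseteq> full_basis \<and> b t = (\<lambda>w. \<Sum>u\<in>F. c u * u w))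
     \<and> (\<forall>\<phi> \<psi>. admissible r A \<phi> \<longrightarrow> \<psi> \<in> borel_measurable ?M \<longrightarrow> (AE w in ?M. \<psi> w = series \<phi> w) \<longrightarrow>
        (\<exists>a. Lp_norm q ?M (\<lambda>w. \<psi> w - (\<Sum>t\<in>T. a t * b t w)) \<le>
          ennreal (C * real m powr (- \<gamma> / real (2 * CARD('d) - 1) + (1 / r - 1 / 2)) * ln (real m) powr (- \<xi>)
            * (if q < \<infinity> then enn2real q powr (1 / 2) else ln (real m) powr (1 / 2)))))"
    using width_approximation by blast
  show ?thesis
  proof (intro exI[of _ C] conjI C allI impI)
    fix q :: ennreal and m :: nat assume q: "2 \<le> q" and m: "2 \<le> m"
    let ?K = "ennreal (C * real m powr (- \<gamma> / (2 * real CARD('d) - 1) + max 0 (enn2real (1 / p) - 1 / 2))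
                * ln (real m) powr (- \<xi>)
                * (if q < \<infinity> then enn2real q powr (1 / 2) else ln (real m) powr (1 / 2)))"
    obtain T :: "((complex ^ 'd \<Rightarrow> complex) + nat) set" and b where T: "finite T" "card T \<le> m"
      and b: "\<And>t. t \<in> T \<Longrightarrow> \<exists>F c. finite F \<and> F \<subseteq> full_basis \<and> b t = (\<lambda>w. \<Sum>u\<in>F. c u * u w)"
      and a: "\<And>\<phi> \<psi>. admissible r A \<phi> \<Longrightarrow> \<psi> \<in> borel_measurable ?M \<Longrightarrow> (AE w in ?M. \<psi> w = series \<phi> w) \<Longrightarrow>
        (\<exists>a. Lp_norm q ?M (\<lambda>w. \<psi> w - (\<Sum>t\<in>T. a t * b t w)) \<le> ?K)"
      using W[OF q m] unfolding D exponent by blast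
    have q1: "1 \<le> q" using q by (rule order_trans[rotated]) simp
    have adm: "admissible r A \<phi>" if "\<phi> \<in> Lp_ball p ?M" for \<phi>
      using M.Lp_ball_moment[OF assms(4) that] by (simp add: admissible_def A_def r_def)
    have cont: "sphere_cont (b t)" if t: "t \<in> T" for t
    proof -
      obtain F c where F: "finite F" "F \<subseteq> full_basis" "b t = (\<lambda>w. \<Sum>u\<in>F. c u * u w)" using b[OF t] by blast
      have "sphere_cont u" if "u \<in> F" for u
        using that F(2) orthonormal_graded_basis by (auto simp: full_basis_def orthonormal_def)
      then show ?thesis unfolding F(3) by (intro continuous_intros)
    qed
    show "Lp_width m (Lambda1 \<gamma> \<xi> ` Lp_ball p ?M) q ?M \<le> ?K"
    proof (rule Lp_width_le_of_family[OF T cont q1])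
      fix f assume "f \<in> Lambda1 \<gamma> \<xi> ` Lp_ball p ?M"
      then obtain \<phi> where f: "f = Lambda1 \<gamma> \<xi> \<phi>" and \<phi>: "admissible r A \<phi>" using adm by blast
      show "f \<in> borel_measurable ?M" unfolding f by (rule series(1)[OF \<phi>])
      show "\<exists>a. Lp_norm q ?M (\<lambda>z. f z - (\<Sum>t\<in>T. a t * b t z)) \<le> ?K"
        unfolding f by (rule a[OF \<phi> series[OF \<phi>]])
    qed
  qed
qed

end
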